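(* Let $\mathcal C$ be a constraint that is admissible for $[0,1]$, let $l\ge i_k$ (with $l\ge1$), and for each large enough $n$ let $(m_1^{(n)},\dots,m_n^{(n)})$ be drawn from the uniform distribution on $\mathcal M_n^{\mathcal C}([0,1])$. Let $(a_n)_n$ be a sequence with $a_n\to\infty$ and $a_n=o(n^{1/2})$ as $n\to\infty$. Then the sequence $$a_n\Big((m_1^{(n)},\dots,m_l^{(n)})-\big(m_1(\mu^{\mathcal C}),\dots,m_l(\mu^{\mathcal C})\big)\Big)$$ satisfies a large deviations principle on $\mathbb R^l$ with speed $\frac{n}{a_n^2}$ and good rate function $$I(x):=\begin{cases}\frac12\,x^t\,\Sigma_l^{+}\,x,& x_{i_1}=\dots=x_{i_k}=0,\\ \infty,&\text{else},\end{cases}$$ where $\Sigma_l$ is the covariance matrix of the limiting centered normal distribution of $\sqrt n\big((m_1^{(n)},\dots,m_l^{(n)})-(m_1(\mu^{\mathcal C}),\dots,m_l(\mu^{\mathcal C}))\big)$ and $\Sigma_l^{+}$ is its Moore--Penrose inverse.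
   Context: For a Borel set $E\subset\mathbb R$, $\mathcal P(E)$ is the set of Borel probability measures on $E$ possessing moments of all orders, $m_j(\mu):=\int x^j\,d\mu(x)$, and $\mathcal M_n(E):=\{(m_1(\mu),\dots,m_n(\mu)):\mu\in\mathcal P(E)\}$. A constraint $\mathcal C=\{m_{i_1}=c_{i_1},\dots,m_{i_k}=c_{i_k}\}$ consists of finitely many integers $1\le i_1<\dots<i_k$ and real values $c_{i_1},\dots,c_{i_k}$; $k=0$ (no constraint) is allowed, with $i_k:=0$. Put $\mathcal P^{\mathcal C}(E):=\{\mu\in\mathcal P(E): m_{i_j}(\mu)=c_{i_j},\ 1\le j\le k\}$ and $\mathcal M^{\mathcal C}_n(E):=\{(m_1(\mu),\dots,m_n(\mu)):\mu\in\mathcal P^{\mathcal C}(E)\}$. $\mathcal C$ is admissible for $E$ if $\mathcal M^{\mathcal C}_{i_k}(E)\cap\operatorname{Int}\mathcal M_{i_k}(E)\neq\emptyset$ (automatic if $k=0$). Uniform distribution: for $n\ge i_k$, $\mathcal M_n^{\mathcal C}([0,1])$ is identified with its projection to the $n-k$ unconstrained coordinates $(m_j,\ 1\le j\le n,\ j\ne i_1,\dots,i_k)$, a compact convex subset of $[0,1]^{n-k}$ of positive Lebesgue measure; the uniform distribution on $\mathcal M_n^{\mathcal C}([0,1])$ is the push-forward, under this identification, of normalized $(n-k)$-dimensional Lebesgue measure on the projection. $\mu^0(dx):=\frac{1}{\pi\sqrt{x(1-x)}}dx$ on $[0,1]$ is the arcsine distribution; $\mathcal K(\mu^0|\mu):=\int\log\frac{d\mu^0}{d\mu}\,d\mu^0$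 if $\mu^0\ll\mu$ and $\infty$ otherwise; $\mu^{\mathcal C}$ is the unique minimizer of $\mu\mapsto\mathcal K(\mu^0|\mu)$ over $\mathcal P^{\mathcal C}([0,1])$. The sequence $\sqrt n\big((m_1^{(n)},\dots,m_l^{(n)})-(m_1(\mu^{\mathcal C}),\dots,m_l(\mu^{\mathcal C}))\big)$ converges in distribution to $\mathcal N(0,\Sigma_l)$ for an $l\times l$ covariance matrix $\Sigma_l$ of rank $l-k$ whose rows and columns $i_1,\dots,i_k$ are zero; this defines $\Sigma_l$. A sequence of laws $\mathbb P_n$ on a topological space $\mathcal X$ (with Borel $\sigma$-field) satisfies a large deviations principle (LDP) with speed $b_n\to\infty$ and rate function $I:\mathcal X\to[0,\infty]$ if $I$ is lower semicontinuous and for all measurable $\Gamma$: $-\inf_{\operatorname{Int}\Gamma}I\le\liminf_n\frac1{b_n}\log\mathbb P_n(\Gamma)\le\limsup_n\frac1{b_n}\log\mathbb P_n(\Gamma)\le-\inf_{\overline\Gamma}I$. $I$ is good if $I^{-1}((-\infty,\alpha])$ is compact for all $\alpha\ge0$. Random variables satisfy an LDP if their laws do. *)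

theory Defs
  imports "HOL-Probability.Probability" "HOL-Library.Landau_Symbols" "Jordan_Normal_Form.Matrix"
begin

definition borel_of :: "'a topology \<Rightarrow> 'a measure" where
  "borel_of X = sigma (topspace X) {U. openin X U}"

definition weakly_converges :: "'a topology \<Rightarrow> (nat \<Rightarrow> 'a measure) \<Rightarrow> 'a measure \<Rightarrow> bool" where
  "weakly_converges X P Q \<longleftrightarrow>
     (\<forall>f. continuous_map X euclideanreal f \<and> bounded (f ` topspace X)
        \<longrightarrow> (\<lambda>n. \<integral>x. f x \<partial>P n) \<longlonglongrightarrow> (\<integral>x. f x \<partial>Q))"

definition ln_ext :: "real \<Rightarrow> ereal" where
  "ln_ext p = (if p = 0 then - \<infinity> else ereal (ln p))"

text \<open>The sequence of laws only has to consist of probability measures for large \<open>n\<close>.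
  The infimum over the empty set is \<open>\<infinity>\<close> in \<^typ>\<open>ereal\<close>.\<close>

definition satisfies_LDP ::
    "'a topology \<Rightarrow> (nat \<Rightarrow> 'a measure) \<Rightarrow> (nat \<Rightarrow> real) \<Rightarrow> ('a \<Rightarrow> ereal) \<Rightarrow> bool" where
  "satisfies_LDP X P b I \<longleftrightarrow>
     (\<forall>n. sets (P n) = sets (borel_of X)) \<and> (\<forall>\<^sub>F n in sequentially. prob_space (P n)) \<and>
     filterlim b at_top sequentially \<and>
     (\<forall>x\<in>topspace X. 0 \<le> I x) \<and>
     (\<forall>\<alpha>::real. closedin X {x \<in> topspace X. I x \<le> ereal \<alpha>}) \<and>
     (\<forall>\<Gamma>\<in>sets (borel_of X).
        - (INF x\<in>X interior_of \<Gamma>. I x) \<le> liminf (\<lambda>n. ereal (1 / b n) * ln_ext (measure (P n) \<Gamma>)) \<and>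
        limsup (\<lambda>n. ereal (1 / b n) * ln_ext (measure (P n) \<Gamma>)) \<le> - (INF x\<in>X closure_of \<Gamma>. I x))"

definition good_rate_function :: "'a topology \<Rightarrow> ('a \<Rightarrow> ereal) \<Rightarrow> bool" where
  "good_rate_function X I \<longleftrightarrow> (\<forall>\<alpha>\<ge>0::real. compactin X {x \<in> topspace X. I x \<le> ereal \<alpha>})"

text \<open>A point of \<open>\<real>\<^sup>n\<close> is an extensional function on the index set \<open>{1..n}\<close>,
  so that the coordinate \<open>j\<close> of a moment vector is the moment of order \<open>j\<close>.\<close>

abbreviation Rspace :: "nat \<Rightarrow> (nat \<Rightarrow> real) topology" where
  "Rspace n \<equiv> powertop_real {1..n}"

definition prob_measures :: "real set \<Rightarrow> real measure set" where
  "prob_measures E = {\<mu>. prob_space \<mu> \<and> sets \<mu> = sets borel \<and> emeasure \<mu> E = 1 \<and>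
                         (\<forall>j::nat. integrable \<mu> (\<lambda>x. x ^ j))}"

definition moment :: "nat \<Rightarrow> real measure \<Rightarrow> real" where
  "moment j \<mu> = (\<integral>x. x ^ j \<partial>\<mu>)"

definition moment_vec :: "nat \<Rightarrow> real measure \<Rightarrow> nat \<Rightarrow> real" where
  "moment_vec n \<mu> = (\<lambda>j\<in>{1..n}. moment j \<mu>)"

definition moment_space :: "real set \<Rightarrow> nat \<Rightarrow> (nat \<Rightarrow> real) set" where
  "moment_space E n = moment_vec n ` prob_measures E"

text \<open>A constraint \<open>{m\<^bsub>i\<^sub>1\<^esub> = c\<^bsub>i\<^sub>1\<^esub>, \<dots>, m\<^bsub>i\<^sub>k\<^esub> = c\<^bsub>i\<^sub>k\<^esub>}\<close> is the finite
  partial map sending each \<open>i\<^sub>j\<close> to \<open>c\<^bsub>i\<^sub>j\<^esub>\<close>; \<open>top_index C\<close> is \<open>i\<^sub>k\<close>, and \<open>0\<close> if there is no constraint.\<close>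

type_synonym moment_constraint = "nat \<rightharpoonup> real"

definition is_constraint :: "moment_constraint \<Rightarrow> bool" where
  "is_constraint C \<longleftrightarrow> finite (dom C) \<and> 0 \<notin> dom C"

definition top_index :: "moment_constraint \<Rightarrow> nat" where
  "top_index C = Max (insert 0 (dom C))"

definition constr_measures :: "moment_constraint \<Rightarrow> real set \<Rightarrow> real measure set" where
  "constr_measures C E = {\<mu> \<in> prob_measures E. \<forall>i c. C i = Some c \<longrightarrow> moment i \<mu> = c}"

definition constr_moment_space :: "moment_constraint \<Rightarrow> real set \<Rightarrow> nat \<Rightarrow> (nat \<Rightarrow> real) set" where
  "constr_moment_space C E n = moment_vec n ` constr_measures C E"

definition admissible :: "moment_constraint \<Rightarrow> real set \<Rightarrow> bool" where
  "admissible C E \<longleftrightarrow>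
     constr_moment_space C E (top_index C)
       \<inter> (Rspace (top_index C) interior_of moment_space E (top_index C)) \<noteq> {}"

definition free_indices :: "moment_constraint \<Rightarrow> nat \<Rightarrow> nat set" where
  "free_indices C n = {1..n} - dom C"

definition free_moment_space :: "moment_constraint \<Rightarrow> nat \<Rightarrow> (nat \<Rightarrow> real) set" where
  "free_moment_space C n = (\<lambda>m. restrict m (free_indices C n)) ` constr_moment_space C {0..1} n"

definition fill_in :: "moment_constraint \<Rightarrow> nat \<Rightarrow> (nat \<Rightarrow> real) \<Rightarrow> nat \<Rightarrow> real" where
  "fill_in C n y = (\<lambda>j\<in>{1..n}. case C j of Some c \<Rightarrow> c | None \<Rightarrow> y j)"

definition uniform_moments :: "moment_constraint \<Rightarrow> nat \<Rightarrow> (nat \<Rightarrow> real) measure" where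
  "uniform_moments C n =
     distr (uniform_measure (PiM (free_indices C n) (\<lambda>_. lborel)) (free_moment_space C n))
       (borel_of (Rspace n)) (fill_in C n)"

definition arcsine :: "real measure" where
  "arcsine = density lborel
     (\<lambda>x. ennreal (indicator {0<..<1} x * (1 / (pi * sqrt (x * (1 - x))))))"

text \<open>\<open>rel_entropy \<nu> \<mu>\<close> is \<open>\<K>(\<nu>|\<mu>)\<close>. For probability measures the negative part of
  \<open>ln (d\<nu>/d\<mu>)\<close> is always \<open>\<nu>\<close>-integrable, so the integral is \<open>\<infinity>\<close> when the integrand is not integrable.\<close>

definition rel_entropy :: "real measure \<Rightarrow> real measure \<Rightarrow> ereal" where
  "rel_entropy \<nu> \<mu> =
     (if absolutely_continuous \<mu> \<nu> \<and> integrable \<nu> (\<lambda>x. ln (enn2real (RN_deriv \<mu> \<nu> x)))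
      then ereal (\<integral>x. ln (enn2real (RN_deriv \<mu> \<nu> x)) \<partial>\<nu>) else \<infinity>)"

definition min_measure :: "moment_constraint \<Rightarrow> real measure" where
  "min_measure C = (THE \<mu>. \<mu> \<in> constr_measures C {0..1} \<and>
     (\<forall>\<nu>\<in>constr_measures C {0..1}. rel_entropy arcsine \<mu> \<le> rel_entropy arcsine \<nu>))"

definition scaled_law :: "moment_constraint \<Rightarrow> nat \<Rightarrow> (nat \<Rightarrow> real) \<Rightarrow> nat \<Rightarrow> (nat \<Rightarrow> real) measure" where
  "scaled_law C l s n =
     distr (uniform_moments C n) (borel_of (Rspace l))
       (\<lambda>m. \<lambda>j\<in>{1..l}. s n * (m j - moment j (min_measure C)))"

text \<open>Vectors of the matrix library are indexed from \<open>0\<close>.\<close>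

definition to_vec :: "nat \<Rightarrow> (nat \<Rightarrow> real) \<Rightarrow> real vec" where
  "to_vec l x = vec l (\<lambda>i. x (Suc i))"

definition cov_matrix :: "nat \<Rightarrow> real mat \<Rightarrow> bool" where
  "cov_matrix l S \<longleftrightarrow> S \<in> carrier_mat l l \<and> transpose_mat S = S \<and>
     (\<forall>t\<in>carrier_vec l. 0 \<le> scalar_prod t (S *\<^sub>v t))"

definition centered_normal :: "real \<Rightarrow> real measure" where
  "centered_normal v =
     (if v = 0 then return borel 0 else density lborel (normal_density 0 (sqrt v)))"

text \<open>\<open>Q\<close> is \<open>\<N>(0, S)\<close>, possibly degenerate: each linear functional \<open>t\<close> has law \<open>\<N>(0, t\<^sup>T S t)\<close>.\<close>

definition is_normal_law :: "nat \<Rightarrow> real mat \<Rightarrow> (nat \<Rightarrow> real) measure \<Rightarrow> bool" where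
  "is_normal_law l S Q \<longleftrightarrow> cov_matrix l S \<and> prob_space Q \<and> sets Q = sets (borel_of (Rspace l)) \<and>
     (\<forall>t\<in>carrier_vec l. distr Q borel (\<lambda>x. scalar_prod t (to_vec l x))
                         = centered_normal (scalar_prod t (S *\<^sub>v t)))"

definition limit_cov :: "moment_constraint \<Rightarrow> nat \<Rightarrow> real mat" where
  "limit_cov C l = (THE S. \<exists>Q. is_normal_law l S Q \<and>
     weakly_converges (Rspace l) (scaled_law C l (\<lambda>n. sqrt (real n))) Q)"

definition moore_penrose :: "real mat \<Rightarrow> real mat" where
  "moore_penrose A = (THE X. X \<in> carrier_mat (dim_col A) (dim_row A) \<and>
     A * X * A = A \<and> X * A * X = X \<and>
     transpose_mat (A * X) = A * X \<and> transpose_mat (X * A) = X * A)"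

definition mdp_rate :: "moment_constraint \<Rightarrow> nat \<Rightarrow> (nat \<Rightarrow> real) \<Rightarrow> ereal" where
  "mdp_rate C l x =
     (if \<forall>i\<in>dom C. x i = 0
      then ereal (1 / 2 * scalar_prod (to_vec l x) (moore_penrose (limit_cov C l) *\<^sub>v to_vec l x))
      else \<infinity>)"

end

(* Writing x = (1 + cos t) / 2 turns the moments of a measure on [0,1] into trigonometric moments
   c_k, and the Szego recursion turns these into prediction errors eps_n = eps_{n-1} (1 - alpha^2).
   The set of admissible m_{n+1} over a given interior point (m_1, ..., m_n) is an interval of length
   proportional to eps_n, so integrating out the coordinates above l one at a time shows that the
   first l moments have a density proportional to eps_l ^ (n - l) on the free coordinates.
   This power concentrates at the maximizer of the concave function eps_l on the constrained slice,
   whose Bernstein-Szego measure is the entropy minimizer: at the critical point the reciprocal of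
   its density involves constrained monomials only, which gives optimality by Jensen's inequality.
   In triangular coordinates z around the maximizer, eps_l is 1 - |z|^2 / 2 + O(|z|^3) up to a
   constant, concavity controls the tails, and Laplace's argument yields both the Gaussian limit
   with covariance B B^T and the moderate deviations with rate |z|^2 / 2 at x = B z; the
   pseudo-inverse of B B^T is the Hessian of - ln eps_l, padded with zeros. *)

theory Submission
  imports Defs "HOL-Complex_Analysis.Complex_Analysis"
begin

section \<open>Toeplitz forms and the Szego recursion\<close>

text \<open>One variational fact carries most of the analysis: \<open>eps c n\<close> is the minimum
  of the Toeplitz form of \<open>c\<close> over vectors v with v_n = 1, attained at
  \<open>phi c n\<close>. As a minimum of functions linear in \<open>c\<close> it is concave;
  testing with fixed vectors lets lower bounds pass to limits, which yields the maximizer;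
  perturbing the minimizer yields the expansion to second order. The obstacle is the boundary of the
  moment space, where the recursion divides by zero. Hence statements are phrased through
  \<open>szego_pos\<close>, boundary points are reached by contraction towards the arcsine moments,
  and the boundary is shown to be a null set. Normalizing constants are never evaluated: for every
  scaling s the law of the rescaled moments has, in the coordinates u = s z, a density proportional
  to R(u / s) ^ (n - l), where R is the prediction error divided by its maximum, and the constants
  of the fibres and of the change of variables cancel. The scalings sqrt n and a_n then give the
  limit theorem and the moderate deviations; the exponent n - l is harmless because (n - l) / n
  tends to 1.\<close>

definition toep :: "(nat \<Rightarrow> real) \<Rightarrow> nat \<Rightarrow> (nat \<Rightarrow> real) \<Rightarrow> nat \<Rightarrow> real" where
  "toep c n u k = (\<Sum>j\<le>n. u j * c (j - k + (k - j)))"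

text \<open>Truncated subtraction makes \<open>j - k + (k - j)\<close> in \<open>toep\<close> the
  distance |j - k|, so this is the bilinear form of the symmetric Toeplitz matrix of order n + 1;
  coefficients above n are ignored.\<close>

definition form :: "(nat \<Rightarrow> real) \<Rightarrow> nat \<Rightarrow> (nat \<Rightarrow> real) \<Rightarrow> (nat \<Rightarrow> real) \<Rightarrow> real" where
  "form c n u v = (\<Sum>i\<le>n. u i * toep c n v i)"

text \<open>The pair consists of the coefficients of the monic orthogonal polynomial \<open>\<Phi>\<^sub>n\<close> and the
  prediction error \<open>eps c n\<close>. If some \<open>eps c j\<close> vanishes, division by zero makes all later
  values meaningless, so statements are restricted to \<open>szego_pos\<close>.\<close>

primrec szego :: "(nat \<Rightarrow> real) \<Rightarrow> nat \<Rightarrow> (nat \<Rightarrow> real) \<times> real" where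
  "szego c 0 = ((\<lambda>k. if k = 0 then 1 else 0), c 0)"
| "szego c (Suc n) =
     (let p = fst (szego c n); e = snd (szego c n); a = (\<Sum>j\<le>n. p j * c (Suc j)) / e
      in ((\<lambda>k. (if k = 0 then 0 else p (k - 1)) - a * (if k \<le> n then p (n - k) else 0)), e * (1 - a\<^sup>2)))"

definition phi :: "(nat \<Rightarrow> real) \<Rightarrow> nat \<Rightarrow> nat \<Rightarrow> real" where "phi c n = fst (szego c n)"
definition eps :: "(nat \<Rightarrow> real) \<Rightarrow> nat \<Rightarrow> real" where "eps c n = snd (szego c n)"
text \<open>The Verblunsky (reflection) coefficient, here real. It is the place where
  \<open>c (Suc n)\<close> enters the recursion, and it enters affinely with slope 1 /
  \<open>eps c n\<close> because \<open>phi c n\<close> is monic.\<close>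

definition alpha :: "(nat \<Rightarrow> real) \<Rightarrow> nat \<Rightarrow> real" where
  "alpha c n = (\<Sum>j\<le>n. phi c n j * c (Suc j)) / eps c n"

text \<open>Positive definiteness of the Toeplitz form (compare \<open>szego_pos_psd\<close>,
  \<open>form_coercive\<close>, \<open>szego_posI\<close>), encoded through the prediction errors so
  that the denominators of the recursion are nonzero by definition.\<close>

definition szego_pos :: "(nat \<Rightarrow> real) \<Rightarrow> nat \<Rightarrow> bool" where
  "szego_pos c n \<longleftrightarrow> (\<forall>j\<le>n. 0 < eps c j)"

definition toep_psd :: "(nat \<Rightarrow> real) \<Rightarrow> nat \<Rightarrow> bool" where
  "toep_psd c n \<longleftrightarrow> (\<forall>v. 0 \<le> form c n v v)"

lemma phi_0: "phi c 0 k = (if k = 0 then 1 else 0)" by (simp add: phi_def)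
lemma eps_0: "eps c 0 = c 0" by (simp add: eps_def)
lemma phi_Suc: "phi c (Suc n) k =
    (if k = 0 then 0 else phi c n (k - 1)) - alpha c n * (if k \<le> n then phi c n (n - k) else 0)"
  by (simp add: phi_def eps_def alpha_def Let_def)
lemma eps_Suc: "eps c (Suc n) = eps c n * (1 - (alpha c n)\<^sup>2)"
  by (simp add: phi_def eps_def alpha_def Let_def)

lemma phi_above: "n < k \<Longrightarrow> phi c n k = 0"
  by (induction n arbitrary: k) (auto simp: phi_0 phi_Suc)

lemma phi_monic: "phi c n n = 1"
  by (induction n) (auto simp: phi_0 phi_Suc phi_above)

lemma szego_cong:
  "(\<And>k. k \<le> n \<Longrightarrow> c k = d k) \<Longrightarrow> szego c n = szego d n"
proof (induction n)
  case (Suc n)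
  then have "szego c n = szego d n" by simp
  moreover have "\<And>p. (\<Sum>j\<le>n. p j * c (Suc j)) = (\<Sum>j\<le>n. p j * d (Suc j))"
    using Suc.prems by (intro sum.cong) auto
  ultimately show ?case by (simp only: szego.simps)
qed simp

lemma phi_cong: "(\<And>k. k \<le> n \<Longrightarrow> c k = d k) \<Longrightarrow> phi c n = phi d n"
  and eps_cong: "(\<And>k. k \<le> n \<Longrightarrow> c k = d k) \<Longrightarrow> eps c n = eps d n"
  unfolding phi_def eps_def using szego_cong[of n c d] by auto

lemma szego_pos_cong: "(\<And>k. k \<le> n \<Longrightarrow> c k = d k) \<Longrightarrow> szego_pos c n = szego_pos d n"
  unfolding szego_pos_def using eps_cong[of _ c d] by (metis le_trans)

lemma szego_pos_mono: "szego_pos c n \<Longrightarrow> m \<le> n \<Longrightarrow> szego_pos c m"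
  unfolding szego_pos_def by auto

lemma szego_pos_eps: "szego_pos c n \<Longrightarrow> j \<le> n \<Longrightarrow> 0 < eps c j"
  unfolding szego_pos_def by auto

lemma szego_pos_nonzero: "szego_pos c n \<Longrightarrow> j < n \<Longrightarrow> eps c j \<noteq> 0"
  unfolding szego_pos_def by (metis less_imp_le_nat order_less_irrefl)

lemma szego_pos_Suc: "szego_pos c (Suc n) \<longleftrightarrow> szego_pos c n \<and> 0 < eps c (Suc n)"
  unfolding szego_pos_def by (auto simp: le_Suc_eq)

lemma toep_lin: "toep c n (\<lambda>i. a * u i + b * v i) k = a * toep c n u k + b * toep c n v k"
  unfolding toep_def by (simp add: algebra_simps sum.distrib sum_distrib_left)

lemma toep_lin_seq: "toep (\<lambda>k. a * c k + b * d k) n u k = a * toep c n u k + b * toep d n u k"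
  unfolding toep_def by (simp add: algebra_simps sum.distrib sum_distrib_left)

lemma form_lin_left: "form c n (\<lambda>i. a * u i + b * v i) w = a * form c n u w + b * form c n v w"
  unfolding form_def by (simp add: algebra_simps sum.distrib sum_distrib_left)

lemma form_lin_right: "form c n w (\<lambda>i. a * u i + b * v i) = a * form c n w u + b * form c n w v"
  unfolding form_def toep_lin by (simp add: algebra_simps sum.distrib sum_distrib_left)

lemma form_lin_seq: "form (\<lambda>k. a * c k + b * d k) n u v = a * form c n u v + b * form d n u v"
  unfolding form_def toep_lin_seq by (simp add: algebra_simps sum.distrib sum_distrib_left)

lemma form_sum: "form c n u v = (\<Sum>i\<le>n. \<Sum>j\<le>n. u i * v j * c (i - j + (j - i)))"
  unfolding form_def toep_def by (simp add: sum_distrib_left add.commute mult.assoc)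

lemma form_sym: "form c n u v = form c n v u"
  unfolding form_sum by (subst sum.swap) (intro sum.cong refl, simp add: add.commute mult.commute)

lemma form_square: "form c n (\<lambda>i. a * u i + b * v i) (\<lambda>i. a * u i + b * v i) =
    a\<^sup>2 * form c n u u + 2 * a * b * form c n u v + b\<^sup>2 * form c n v v"
  unfolding form_lin_left form_lin_right using form_sym[of c n v u]
  by (simp add: algebra_simps power2_eq_square)

lemma toep_supp:
  assumes "m \<le> n" "\<And>i. m < i \<Longrightarrow> u i = 0"
  shows "toep c n u k = toep c m u k"
  unfolding toep_def by (rule sum.mono_neutral_right) (use assms in auto)

lemma form_supp:
  assumes "m \<le> n" "\<And>i. m < i \<Longrightarrow> u i = 0" "\<And>i. m < i \<Longrightarrow> v i = 0"
  shows "form c n u v = form c m u v"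
proof -
  have "form c n u v = (\<Sum>i\<le>n. u i * toep c m v i)"
    unfolding form_def using toep_supp[OF assms(1,3)] by simp
  also have "\<dots> = form c m u v"
    unfolding form_def by (rule sum.mono_neutral_right) (use assms in auto)
  finally show ?thesis .
qed

lemma form_cong_seq: "(\<And>k. k \<le> n \<Longrightarrow> c k = d k) \<Longrightarrow> form c n u v = form d n u v"
  unfolding form_sum by (intro sum.cong refl) (auto intro!: arg_cong2[of _ _ _ _ "(*)"])

lemma toep_psd_mono: "toep_psd c n \<Longrightarrow> m \<le> n \<Longrightarrow> toep_psd c m"
  unfolding toep_psd_def
proof
  fix v :: "nat \<Rightarrow> real" assume *: "\<forall>v. 0 \<le> form c n v v" "m \<le> n"
  let ?w = "\<lambda>i. if i \<le> m then v i else (0::real)"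
  have "form c n ?w ?w = form c m ?w ?w" by (rule form_supp) (use * in auto)
  also have "\<dots> = form c m v v" unfolding form_sum by (intro sum.cong refl) auto
  finally show "0 \<le> form c m v v" using * by metis
qed

section \<open>Reversal, shift and orthogonality\<close>

lemma toep_rev:
  assumes "k \<le> n" shows "toep c n (\<lambda>j. u (n - j)) k = toep c n u (n - k)"
proof -
  have "toep c n (\<lambda>j. u (n - j)) k = (\<Sum>j\<le>n. u (n - (n - j)) * c ((n - j) - k + (k - (n - j))))"
    unfolding toep_def
    by (rule sum.reindex_bij_witness[where i="\<lambda>j. n - j" and j="\<lambda>j. n - j"]) auto
  also have "\<dots> = toep c n u (n - k)"
    unfolding toep_def using assms by (intro sum.cong refl arg_cong2[of _ _ _ _ "(*)"] arg_cong[of _ _ c] arg_cong[of _ _ u]) auto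
  finally show ?thesis .
qed

definition shift_up :: "(nat \<Rightarrow> real) \<Rightarrow> nat \<Rightarrow> real" where
  "shift_up u k = (if k = 0 then 0 else u (k - 1))"

lemma toep_shift_Suc: "toep c (Suc n) (shift_up u) (Suc k) = toep c n u k"
  unfolding toep_def by (subst sum.atMost_Suc_shift) (simp add: shift_up_def)

lemma toep_shift_0: "toep c (Suc n) (shift_up u) 0 = (\<Sum>j\<le>n. u j * c (Suc j))"
  unfolding toep_def by (subst sum.atMost_Suc_shift) (simp add: shift_up_def)

definition rev_phi :: "(nat \<Rightarrow> real) \<Rightarrow> nat \<Rightarrow> nat \<Rightarrow> real" where
  "rev_phi c n k = (if k \<le> n then phi c n (n - k) else 0)"

lemma phi_Suc_fun: "phi c (Suc n) = (\<lambda>k. 1 * shift_up (phi c n) k + (- alpha c n) * rev_phi c n k)"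
  by (rule ext) (auto simp: phi_Suc shift_up_def rev_phi_def)

lemma toep_rev_phi: "k \<le> n \<Longrightarrow> toep c n (rev_phi d n) k = toep c n (phi d n) (n - k)"
proof -
  assume "k \<le> n"
  moreover have "toep c n (rev_phi d n) k = toep c n (\<lambda>j. phi d n (n - j)) k"
    unfolding toep_def rev_phi_def by (intro sum.cong) auto
  ultimately show ?thesis using toep_rev by metis
qed

text \<open>Orthogonality of the monic polynomial to all lower powers. In the induction the shift
  preserves the previous identity one row further down, and subtracting \<open>alpha\<close> times
  the reversed polynomial kills row 0, where the reversal has its only nonzero value among rows 0 to
  n. Assuming nonvanishing rather than positive errors keeps the identity available up to the first
  index where \<open>eps\<close> is zero.\<close>

lemma toep_phi:
  assumes "\<And>j. j < n \<Longrightarrow> eps c j \<noteq> 0" "k \<le> n"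
  shows "toep c n (phi c n) k = (if k = n then eps c n else 0)"
  using assms
proof (induction n arbitrary: k)
  case 0 then show ?case by (simp add: toep_def phi_0 eps_0)
next
  case (Suc n)
  have IH: "\<And>k. k \<le> n \<Longrightarrow> toep c n (phi c n) k = (if k = n then eps c n else 0)"
    using Suc by auto
  define b where "b = (\<Sum>j\<le>n. phi c n j * c (Suc j))"
  have E: "eps c n \<noteq> 0" using Suc by auto
  have b: "b = alpha c n * eps c n" unfolding alpha_def b_def using E by simp
  have S: "toep c (Suc n) (phi c (Suc n)) k
     = toep c (Suc n) (shift_up (phi c n)) k - alpha c n * toep c (Suc n) (rev_phi c n) k" for k
    unfolding phi_Suc_fun toep_lin by simp
  have sup: "toep c (Suc n) (rev_phi c n) k = toep c n (rev_phi c n) k" for k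
    by (rule toep_supp) (auto simp: rev_phi_def)
  have r1: "k \<le> n \<Longrightarrow> toep c (Suc n) (rev_phi c n) k = (if k = 0 then eps c n else 0)" for k
    unfolding sup by (subst toep_rev_phi) (auto simp: IH)
  \<comment> \<open>Row n + 1 of the reversed polynomial is the same sum as row 0 of the shifted
    one; this coincidence produces the factor 1 - alpha^2.\<close>
  have "toep c (Suc n) (rev_phi c n) (Suc n) = (\<Sum>j\<le>n. phi c n (n - j) * c (Suc n - j))"
    unfolding sup unfolding toep_def rev_phi_def by (intro sum.cong refl) simp
  also have "\<dots> = (\<Sum>j\<le>n. phi c n j * c (Suc j))"
    by (rule sum.reindex_bij_witness[where i="\<lambda>j. n - j" and j="\<lambda>j. n - j"]) (auto simp: Suc_diff_le)
  finally have r2: "toep c (Suc n) (rev_phi c n) (Suc n) = b" by (simp add: b_def)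
  show ?case
  proof (cases k)
    case 0
    then show ?thesis using S[of 0] r1[of 0] by (simp add: toep_shift_0 b_def[symmetric] b)
  next
    case (Suc m)
    show ?thesis
    proof (cases "m = n")
      case True
      then show ?thesis using S[of k] r2 Suc IH[of n]
        by (simp add: toep_shift_Suc b eps_Suc algebra_simps power2_eq_square)
    next
      case False
      then show ?thesis using S[of k] r1[of k] Suc IH[of m] Suc.prems by (simp add: toep_shift_Suc)
    qed
  qed
qed

lemma form_phi_right:
  assumes "\<And>j. j < n \<Longrightarrow> eps c j \<noteq> 0"
  shows "form c n v (phi c n) = v n * eps c n"
proof -
  have "form c n v (phi c n) = (\<Sum>i\<le>n. v i * (if i = n then eps c n else 0))"
    unfolding form_def by (intro sum.cong refl) (simp add: toep_phi assms)
  then show ?thesis by (simp add: if_distrib cong: if_cong)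
qed

lemma form_phi_phi:
  assumes "\<And>j. j < n \<Longrightarrow> eps c j \<noteq> 0"
  shows "form c n (phi c n) (phi c n) = eps c n"
  using form_phi_right[OF assms] by (simp add: phi_monic)

text \<open>Subtracting \<open>v (Suc n)\<close> times the orthogonal polynomial removes the top
  coefficient, and the two pieces are orthogonal: one step of the diagonalization of the
  form.\<close>

lemma form_Suc_decomp:
  assumes "\<And>j. j < Suc n \<Longrightarrow> eps c j \<noteq> 0"
  shows "form c (Suc n) v v = (v (Suc n))\<^sup>2 * eps c (Suc n)
     + form c n (\<lambda>i. v i - v (Suc n) * phi c (Suc n) i) (\<lambda>i. v i - v (Suc n) * phi c (Suc n) i)"
proof -
  let ?p = "phi c (Suc n)"
  let ?w = "\<lambda>i. if i \<le> n then v i - v (Suc n) * ?p i else (0::real)"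
  have "form c (Suc n) v v = form c (Suc n) (\<lambda>i. v (Suc n) * ?p i + 1 * ?w i) (\<lambda>i. v (Suc n) * ?p i + 1 * ?w i)"
    unfolding form_sum by (intro sum.cong refl) (auto simp: phi_monic le_Suc_eq)
  also have "\<dots> = (v (Suc n))\<^sup>2 * eps c (Suc n) + form c (Suc n) ?w ?w"
    unfolding form_square using form_phi_right[of "Suc n" c ?w] form_sym[of c "Suc n" ?p ?w] assms
    by (simp add: form_phi_phi)
  also have "form c (Suc n) ?w ?w = form c n ?w ?w" by (rule form_supp) auto
  also have "form c n ?w ?w = form c n (\<lambda>i. v i - v (Suc n) * ?p i) (\<lambda>i. v i - v (Suc n) * ?p i)"
    unfolding form_sum by (intro sum.cong refl) auto
  finally show ?thesis .
qed

text \<open>Together with \<open>form_phi_phi\<close> this identifies \<open>eps c n\<close> as the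
  minimum of the form over the vectors with \<open>v n = 1\<close>.\<close>

lemma form_lower:
  assumes "szego_pos c n" shows "(v n)\<^sup>2 * eps c n \<le> form c n v v"
  using assms
proof (induction n arbitrary: v)
  case 0 then show ?case by (simp add: form_def toep_def eps_0 power2_eq_square)
next
  case (Suc n)
  have "0 \<le> (w n)\<^sup>2 * eps c n" for w using Suc.prems szego_pos_eps[of c "Suc n" n] by simp
  then have "0 \<le> form c n w w" for w using Suc.IH[of w] Suc.prems
    by (meson szego_pos_Suc order_trans)
  moreover have "j < Suc n \<Longrightarrow> eps c j \<noteq> 0" for j using szego_pos_eps[OF Suc.prems, of j] by auto
  ultimately show ?case using form_Suc_decomp[of n c v] by simp
qed

lemma szego_pos_psd: "szego_pos c n \<Longrightarrow> toep_psd c n"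
  unfolding toep_psd_def using form_lower szego_pos_eps
  by (metis less_eq_real_def mult_nonneg_nonneg order_trans zero_le_power2 order_refl)

text \<open>The decisive test vector is \<open>phi c j\<close> itself: it is monic of degree j, and
  its form equals \<open>eps c j\<close> as soon as the earlier errors are nonzero.\<close>

lemma szego_posI:
  assumes "\<And>j v. \<lbrakk>j \<le> n; v j = 1; \<And>i. i > j \<Longrightarrow> v i = 0\<rbrakk> \<Longrightarrow> 0 < form c n v v"
  shows "szego_pos c n"
proof -
  have "j \<le> n \<Longrightarrow> 0 < eps c j" for j
  proof (induction j rule: less_induct)
    case (less j)
    then have "\<And>i. i < j \<Longrightarrow> eps c i \<noteq> 0" by (metis less_imp_le_nat order_less_irrefl order_trans)
    then have "eps c j = form c j (phi c j) (phi c j)" by (simp add: form_phi_phi)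
    also have "\<dots> = form c n (phi c j) (phi c j)"
      by (rule form_supp[symmetric]) (use less phi_above in auto)
    finally show ?case using assms[of j "phi c j"] less by (simp add: phi_monic phi_above)
  qed
  then show ?thesis by (simp add: szego_pos_def)
qed

lemma form_coercive:
  assumes "szego_pos c n" shows "\<exists>\<kappa>>0. \<forall>v. \<kappa> * (\<Sum>i\<le>n. (v i)\<^sup>2) \<le> form c n v v"
  using assms
proof (induction n)
  case 0 then show ?case
    by (intro exI[of _ "eps c 0"]) (simp add: form_def toep_def eps_0 power2_eq_square szego_pos_def)
next
  case (Suc n)
  then obtain k where k: "k > 0" "\<And>v. k * (\<Sum>i\<le>n. (v i)\<^sup>2) \<le> form c n v v"
    by (auto simp: szego_pos_Suc)
  let ?p = "phi c (Suc n)"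
  define P where "P = (\<Sum>i\<le>Suc n. (?p i)\<^sup>2)"
  define E where "E = eps c (Suc n)"
  have E: "E > 0" using Suc.prems by (simp add: E_def szego_pos_Suc)
  have P: "P \<ge> 0" unfolding P_def by (intro sum_nonneg) auto
  \<comment> \<open>The two parts of the decomposition are paid for separately: 2P / E bounds the
    multiple of \<open>phi\<close> through s^2 E, and 2 / k bounds the remainder through the
    induction hypothesis. The 1 keeps \<open>D\<close> positive.\<close>
  define D where "D = 2 * P / E + 2 / k + 1"
  have D: "D > 0" unfolding D_def using k E P by (simp add: add_nonneg_pos)
  show ?case
  proof (intro exI conjI allI)
    show "1 / D > 0" using D by simp
    fix v
    let ?w = "\<lambda>i. v i - v (Suc n) * ?p i"
    define s where "s = v (Suc n)"
    define W where "W = (\<Sum>i\<le>n. (?w i)\<^sup>2)"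
    define F where "F = form c n ?w ?w"
    have W: "W \<ge> 0" unfolding W_def by (intro sum_nonneg) auto
    have dec: "form c (Suc n) v v = s\<^sup>2 * E + F"
      unfolding E_def F_def s_def by (rule form_Suc_decomp) (rule szego_pos_nonzero[OF Suc.prems])
    have kF: "k * W \<le> F" using k(2)[of ?w] by (simp add: F_def W_def)
    have "(v i)\<^sup>2 \<le> 2 * (?w i)\<^sup>2 + 2 * (s\<^sup>2 * (?p i)\<^sup>2)" for i
      using zero_le_power2[of "?w i - s * ?p i"] by (simp add: s_def power2_eq_square algebra_simps)
    then have "(\<Sum>i\<le>Suc n. (v i)\<^sup>2) \<le> (\<Sum>i\<le>Suc n. 2 * (?w i)\<^sup>2 + 2 * (s\<^sup>2 * (?p i)\<^sup>2))"
      by (intro sum_mono) auto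
    also have "\<dots> = 2 * (\<Sum>i\<le>Suc n. (?w i)\<^sup>2) + 2 * (s\<^sup>2 * P)"
      by (simp only: P_def sum.distrib sum_distrib_left)
    also have "(\<Sum>i\<le>Suc n. (?w i)\<^sup>2) = W" by (simp add: W_def phi_monic)
    finally have *: "(\<Sum>i\<le>Suc n. (v i)\<^sup>2) \<le> 2 * W + 2 * (s\<^sup>2 * P)" .
    have F0: "F \<ge> 0" using kF W k by (meson mult_nonneg_nonneg less_imp_le order_trans)
    have a: "W \<le> F / k" using kF k by (simp add: field_simps)
    have "2 * (s\<^sup>2 * P) = (2 * P / E) * (s\<^sup>2 * E)" using E by simp
    also have "\<dots> \<le> (2 * P / E) * (s\<^sup>2 * E + F)" using E P F0 by (intro mult_left_mono) auto
    finally have b: "2 * (s\<^sup>2 * P) \<le> (2 * P / E) * (s\<^sup>2 * E + F)" .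
    have "F \<le> s\<^sup>2 * E + F" using E by simp
    then have "(2 / k) * F \<le> (2 / k) * (s\<^sup>2 * E + F)" using k by (intro mult_left_mono) auto
    then have "2 * W \<le> (2 / k) * (s\<^sup>2 * E + F)" using a by simp
    with * b have "(\<Sum>i\<le>Suc n. (v i)\<^sup>2) \<le> (2 * P / E + 2 / k) * (s\<^sup>2 * E + F)"
      by (simp only: distrib_right)
    also have "\<dots> \<le> D * (s\<^sup>2 * E + F)" unfolding D_def using E F0 by (intro mult_right_mono) auto
    finally show "1 / D * (\<Sum>i\<le>Suc n. (v i)\<^sup>2) \<le> form c (Suc n) v v" unfolding dec using D by (simp add: field_simps)
  qed
qed

lemma szego_pos_blend:
  assumes "toep_psd c n" "szego_pos d n" "0 < t" "t \<le> 1"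
  shows "szego_pos (\<lambda>k. (1 - t) * c k + t * d k) n"
proof (rule szego_posI)
  fix j v assume v: "j \<le> n" "v j = (1::real)" "\<And>i. i > j \<Longrightarrow> v i = 0"
  have "form d n v v = form d j v v" by (rule form_supp) (use v in auto)
  also have "\<dots> > 0" using form_lower[of d j v] v assms(2) szego_pos_eps[of d n j]
    by (simp add: szego_pos_mono)
  finally have "0 < t * form d n v v" using assms by simp
  moreover have "0 \<le> (1 - t) * form c n v v" using assms by (simp add: toep_psd_def)
  ultimately show "0 < form (\<lambda>k. (1 - t) * c k + t * d k) n v v" unfolding form_lin_seq by simp
qed

text \<open>The minimizer of the mixed sequence is a competitor for both \<open>c\<close> and
  \<open>d\<close>, and the form is linear in the sequence.\<close>

lemma eps_concave:
  assumes "szego_pos c n" "szego_pos d n" "0 \<le> t" "t \<le> 1"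
  shows "szego_pos (\<lambda>k. (1 - t) * c k + t * d k) n"
    "(1 - t) * eps c n + t * eps d n \<le> eps (\<lambda>k. (1 - t) * c k + t * d k) n"
proof -
  let ?e = "\<lambda>k. (1 - t) * c k + t * d k"
  show e: "szego_pos ?e n"
    using szego_pos_blend[OF szego_pos_psd[OF assms(1)] assms(2)] assms by (cases "t = 0") auto
  let ?p = "phi ?e n"
  have "eps ?e n = form ?e n ?p ?p" by (rule form_phi_phi[symmetric]) (rule szego_pos_nonzero[OF e])
  also have "\<dots> = (1 - t) * form c n ?p ?p + t * form d n ?p ?p" by (rule form_lin_seq)
  also have "\<dots> \<ge> (1 - t) * eps c n + t * eps d n"
    using form_lower[OF assms(1), of ?p] form_lower[OF assms(2), of ?p] assms
    by (intro add_mono mult_left_mono) (auto simp: phi_monic)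
  finally show "(1 - t) * eps c n + t * eps d n \<le> eps ?e n" .
qed

lemma eps_antimono:
  assumes "szego_pos c n" "j \<le> n" shows "eps c n \<le> eps c j"
  using assms(2,1)
proof (induction rule: dec_induct)
  case (step m)
  have "eps c (Suc m) \<le> eps c m"
    using step.prems szego_pos_eps[of c "Suc m" m] unfolding eps_Suc
    by (simp add: mult_left_le)
  then show ?case using step by (simp add: szego_pos_Suc)
qed simp

section \<open>Degenerate positive semidefinite forms\<close>

lemma toep_psd_kernel:
  assumes "toep_psd c n" "form c n v v = 0" "k \<le> n" shows "toep c n v k = 0"
proof (rule ccontr)
  define b where "b = toep c n v k"
  let ?e = "\<lambda>i. if i = k then 1 else (0::real)"
  have ev: "form c n ?e w = toep c n w k" for w
  proof -
    have "form c n ?e w = (\<Sum>i\<le>n. if k = i then toep c n w i else 0)"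
      unfolding form_def by (intro sum.cong) auto
    then show ?thesis using assms(3) by simp
  qed
  define a where "a = form c n ?e ?e"
  have *: "0 \<le> t\<^sup>2 * a + 2 * t * b" for t
    using assms(1)[unfolded toep_psd_def, rule_format, of "\<lambda>i. t * ?e i + 1 * v i"]
    unfolding form_square assms(2) ev[of v] a_def b_def by simp
  assume "toep c n v k \<noteq> 0" then have b: "b \<noteq> 0" by (simp add: b_def)
  have a: "a \<ge> 0" using assms(1) by (simp add: a_def toep_psd_def)
  \<comment> \<open>The minimizing step would be -b / a; the denominator a + 1 also covers a = 0,
    and the quadratic is still negative there unless b = 0.\<close>
  have "0 \<le> (- b / (a + 1))\<^sup>2 * a + 2 * (- b / (a + 1)) * b" by (rule *)
  also have "\<dots> = (b / (a + 1))\<^sup>2 * (a - 2 * (a + 1))"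
    using a by (simp add: divide_simps) (simp add: algebra_simps power2_eq_square)
  also have "\<dots> < 0" using a b by (intro mult_pos_neg) auto
  finally show False by simp
qed

lemma form_phi_psd_nonneg:
  assumes "toep_psd c n" "j \<le> n" "\<And>i. i < j \<Longrightarrow> eps c i \<noteq> 0"
  shows "0 \<le> eps c j"
  using toep_psd_mono[OF assms(1,2)] form_phi_phi[of j c] assms(3) by (metis toep_psd_def)

text \<open>At the first index j with vanishing error, \<open>phi c j\<close> is a null vector, and
  its shifts stay null vectors of every positive semidefinite extension, hence lie in the kernel.
  Row 0 of the kernel relation is a linear recurrence with leading coefficient 1, which fixes the
  next entry.\<close>

lemma singular_extension_unique:
  assumes psd: "toep_psd c (Suc n)" "toep_psd d (Suc n)" and eq: "\<And>k. k \<le> n \<Longrightarrow> c k = d k"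
    and sing: "\<not> szego_pos c n"
  shows "c (Suc n) = d (Suc n)"
proof -
  define j where "j = (LEAST j. \<not> 0 < eps c j)"
  obtain j0 where j0: "j0 \<le> n" "\<not> 0 < eps c j0" using sing by (auto simp: szego_pos_def)
  have j: "\<not> 0 < eps c j" "j \<le> n" unfolding j_def using LeastI[of "\<lambda>j. \<not> 0 < eps c j"] j0 Least_le[of "\<lambda>j. \<not> 0 < eps c j" j0] by auto
  have less: "i < j \<Longrightarrow> 0 < eps c i" for i unfolding j_def using not_less_Least by blast
  have less': "i < j \<Longrightarrow> eps c i \<noteq> 0" for i using less[of i] by simp
  have "0 \<le> eps c j" by (rule form_phi_psd_nonneg[OF psd(1)]) (use j less' in auto)
  then have E0: "eps c j = 0" using j by simp
  \<comment> \<open>This shift moves the leading coefficient of \<open>phi c j\<close> to index n +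
    1, so that row 0 reaches \<open>c (Suc n)\<close>.\<close>
  define s where "s = Suc n - j"
  let ?p = "phi c j"
  let ?v = "\<lambda>i. if s \<le> i then ?p (i - s) else 0"
  have S: "(\<Sum>i\<le>Suc n. (if s \<le> i then ?p (i - s) else 0) * g i) = (\<Sum>i\<le>j. ?p i * g (i + s))" for g
  proof -
    have "(\<Sum>i\<le>Suc n. (if s \<le> i then ?p (i - s) else 0) * g i) = (\<Sum>i=s..Suc n. ?p (i - s) * g i)"
      by (rule sum.mono_neutral_cong_right) auto
    also have "\<dots> = (\<Sum>i\<le>j. ?p i * g (i + s))"
      by (rule sum.reindex_bij_witness[where i="\<lambda>i. i + s" and j="\<lambda>i. i - s"]) (use j in \<open>auto simp: s_def\<close>)
    finally show ?thesis .
  qed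
  have key: "(\<Sum>i\<le>j. ?p i * e (i + s)) = 0" if e: "toep_psd e (Suc n)" "\<And>k. k \<le> n \<Longrightarrow> c k = e k" for e
  proof -
    have "form e (Suc n) ?v ?v = (\<Sum>i\<le>j. ?p i * toep e (Suc n) ?v (i + s))"
      unfolding form_def by (rule S)
    also have TE: "\<dots> = (\<Sum>i\<le>j. ?p i * toep e j ?p i)"
    proof -
      have "toep e (Suc n) ?v (i + s) = toep e j ?p i" for i
      unfolding toep_def S by (intro sum.cong refl) simp
      then show ?thesis by simp
    qed
    also have "(\<Sum>i\<le>j. ?p i * toep e j ?p i) = form c j ?p ?p"
      unfolding form_def[symmetric] using e(2) j(2) by (intro form_cong_seq) auto
    also have "\<dots> = 0" using form_phi_phi[OF less'] E0 by simp
    finally have "toep e (Suc n) ?v 0 = 0" by (intro toep_psd_kernel[OF e(1)]) auto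
    then show ?thesis unfolding toep_def S by simp
  qed
  have split: "(\<Sum>i\<le>j. ?p i * e (i + s)) = (\<Sum>i<j. ?p i * e (i + s)) + e (Suc n)" for e
    using j by (simp add: lessThan_Suc_atMost[symmetric] phi_monic s_def)
  have "(\<Sum>i<j. ?p i * c (i + s)) = (\<Sum>i<j. ?p i * d (i + s))"
    using eq j by (intro sum.cong refl) (auto simp: s_def)
  then show ?thesis using key[OF psd(1)] key[OF psd(2) eq] split[of c] split[of d] by simp
qed

text \<open>A sequence is determined by the action of its Toeplitz matrix on the single vector
  \<open>phi c n\<close>. Since 1 - alpha^2 is nonzero, the recursion can be inverted: the shift of
  \<open>phi c n\<close> is a combination of \<open>phi c (Suc n)\<close> and its reversal, so the
  hypothesis descends to degree n, and row 0 gives the last entry. This identifies the moments of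
  Bernstein-Szego measures and makes the second variation definite.\<close>

lemma toep_phi_zero_imp:
  assumes "szego_pos c n" "\<And>k. k \<le> n \<Longrightarrow> toep h n (phi c n) k = 0" "k \<le> n"
  shows "h k = 0"
  using assms
proof (induction n arbitrary: k)
  case 0 then show ?case by (simp add: toep_def phi_0)
next
  case (Suc n)
  let ?a = "alpha c n"
  have a: "1 - ?a\<^sup>2 \<noteq> 0" using Suc.prems(1) szego_pos_eps[of c "Suc n" "Suc n"] by (auto simp: eps_Suc)
  have sh: "shift_up (phi c n) = (\<lambda>k. 1 / (1 - ?a\<^sup>2) * phi c (Suc n) k + ?a / (1 - ?a\<^sup>2) * rev_phi c (Suc n) k)"
  proof
    fix k
    have "(1 - ?a\<^sup>2) * shift_up (phi c n) k = phi c (Suc n) k + ?a * rev_phi c (Suc n) k"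
    proof (cases k)
      case 0
      then show ?thesis by (simp add: shift_up_def rev_phi_def phi_Suc phi_monic phi_above)
    next
      case (Suc m)
      consider "m < n" | "m = n" | "n < m" by linarith
      then show ?thesis
      proof cases
        case 1
        then have [simp]: "Suc n - k = Suc (n - k)" "n - Suc (n - k) = m" using Suc by auto
        then have r: "rev_phi c (Suc n) k = phi c n (n - k) - ?a * phi c n m"
          using 1 Suc by (simp add: rev_phi_def phi_Suc del: diff_Suc_Suc)
        have p: "phi c (Suc n) k = phi c n m - ?a * phi c n (n - k)"
          using 1 Suc by (simp add: phi_Suc)
        show ?thesis unfolding r p using Suc by (simp add: shift_up_def algebra_simps power2_eq_square)
      qed (use Suc in \<open>simp_all add: shift_up_def rev_phi_def phi_Suc phi_monic phi_above power2_eq_square\<close>)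
    qed
    then have "shift_up (phi c n) k = (phi c (Suc n) k + ?a * rev_phi c (Suc n) k) / (1 - ?a\<^sup>2)"
      using a by (metis nonzero_mult_div_cancel_left)
    then show "shift_up (phi c n) k = 1 / (1 - ?a\<^sup>2) * phi c (Suc n) k + ?a / (1 - ?a\<^sup>2) * rev_phi c (Suc n) k"
      by (simp add: add_divide_distrib)
  qed
  have T: "toep h (Suc n) (shift_up (phi c n)) k = 0" if "k \<le> Suc n" for k
    unfolding sh toep_lin using that Suc.prems(2) by (simp add: toep_rev_phi)
  have "toep h n (phi c n) k = 0" if "k \<le> n" for k
    using T[of "Suc k"] that by (simp add: toep_shift_Suc)
  then have IH: "k \<le> n \<Longrightarrow> h k = 0" for k using Suc.IH Suc.prems(1) szego_pos_Suc by blast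
  have "0 = (\<Sum>j\<le>n. phi c n j * h (Suc j))" using T[of 0] by (simp add: toep_shift_0)
  also have "\<dots> = (\<Sum>j<n. phi c n j * h (Suc j)) + h (Suc n)"
    by (simp add: lessThan_Suc_atMost[symmetric] phi_monic)
  also have "(\<Sum>j<n. phi c n j * h (Suc j)) = 0" using IH by (intro sum.neutral) auto
  finally have "h (Suc n) = 0" by simp
  then show ?case using IH Suc.prems(3) by (auto simp: le_Suc_eq)
qed

section \<open>Second-order expansion of the prediction error\<close>

definition seq_norm :: "(nat \<Rightarrow> real) \<Rightarrow> nat \<Rightarrow> real" where
  "seq_norm e n = (\<Sum>k\<le>n. \<bar>e k\<bar>)"

lemma seq_norm_nonneg: "0 \<le> seq_norm e n"
  unfolding seq_norm_def by (intro sum_nonneg) auto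

lemma seq_norm_ge: "k \<le> n \<Longrightarrow> \<bar>e k\<bar> \<le> seq_norm e n"
  unfolding seq_norm_def by (rule member_le_sum) auto

lemma form_bound: "\<bar>form e n u v\<bar> \<le> seq_norm e n * ((\<Sum>i\<le>n. \<bar>u i\<bar>) * (\<Sum>i\<le>n. \<bar>v i\<bar>))"
proof -
  have "\<bar>form e n u v\<bar> \<le> (\<Sum>i\<le>n. \<Sum>j\<le>n. \<bar>u i * v j * e (i - j + (j - i))\<bar>)"
    unfolding form_sum by (rule order_trans[OF sum_abs sum_mono]) (rule sum_abs)
  also have "\<dots> \<le> (\<Sum>i\<le>n. \<Sum>j\<le>n. seq_norm e n * (\<bar>u i\<bar> * \<bar>v j\<bar>))"
  proof (intro sum_mono)
    fix i j assume "i \<in> {..n}" "j \<in> {..n}"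
    then have "\<bar>e (i - j + (j - i))\<bar> \<le> seq_norm e n" by (intro seq_norm_ge) auto
    then have "\<bar>e (i - j + (j - i))\<bar> * (\<bar>u i\<bar> * \<bar>v j\<bar>) \<le> seq_norm e n * (\<bar>u i\<bar> * \<bar>v j\<bar>)"
      by (intro mult_right_mono) auto
    then show "\<bar>u i * v j * e (i - j + (j - i))\<bar> \<le> seq_norm e n * (\<bar>u i\<bar> * \<bar>v j\<bar>)"
      by (simp add: abs_mult mult.commute)
  qed
  also have "\<dots> = seq_norm e n * ((\<Sum>i\<le>n. \<bar>u i\<bar>) * (\<Sum>i\<le>n. \<bar>v i\<bar>))"
    by (simp add: sum_distrib_left[symmetric] sum_distrib_right[symmetric])
  finally show ?thesis .
qed

lemma form_bound_square: "\<bar>form e n v v\<bar> \<le> real (Suc n) * seq_norm e n * (\<Sum>i\<le>n. (v i)\<^sup>2)"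
proof -
  have "(\<Sum>i\<le>n. \<bar>v i\<bar>)\<^sup>2 \<le> (\<Sum>i\<le>n. (1::real)\<^sup>2) * (\<Sum>i\<le>n. \<bar>v i\<bar>\<^sup>2)"
    using Cauchy_Schwarz_ineq_sum[of "\<lambda>_. 1" "\<lambda>i. \<bar>v i\<bar>" "{..n}"] by simp
  then have "(\<Sum>i\<le>n. \<bar>v i\<bar>) * (\<Sum>i\<le>n. \<bar>v i\<bar>) \<le> real (Suc n) * (\<Sum>i\<le>n. (v i)\<^sup>2)"
    by (simp add: power2_eq_square)
  from mult_left_mono[OF this seq_norm_nonneg[of e n]] form_bound[of e n v v] show ?thesis
    by (simp add: mult.assoc mult.left_commute)
qed

lemma form_sum_left: "finite A \<Longrightarrow> form c n (\<lambda>i. \<Sum>j\<in>A. b j * u j i) v = (\<Sum>j\<in>A. b j * form c n (u j) v)"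
  unfolding form_def
  by (simp add: sum_distrib_left sum_distrib_right mult.assoc sum.swap[of _ A])

text \<open>The derivative of \<open>eps\<close> in direction \<open>e\<close>: to first order the
  minimizer may be held fixed.\<close>

definition first_var :: "(nat \<Rightarrow> real) \<Rightarrow> nat \<Rightarrow> (nat \<Rightarrow> real) \<Rightarrow> real" where
  "first_var c n e = form e n (phi c n) (phi c n)"

text \<open>Minus the quadratic term of \<open>eps\<close> along \<open>e\<close>. It is the squared
  dual norm of the functional v -> \<open>form e n v (phi c n)\<close> on degrees below n, written
  in the orthogonal basis \<open>phi c j\<close> with squared norms \<open>eps c j\<close>.\<close>

definition second_var :: "(nat \<Rightarrow> real) \<Rightarrow> nat \<Rightarrow> (nat \<Rightarrow> real) \<Rightarrow> real" where
  "second_var c n e = (\<Sum>j<n. (form e n (phi c j) (phi c n))\<^sup>2 / eps c j)"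

text \<open>For m = n the Riesz representer of that functional with respect to
  \<open>form c n\<close>, hence up to sign the first-order change of the minimizer. The cutoff m
  serves the induction in \<open>toep_riesz\<close>.\<close>

definition riesz :: "(nat \<Rightarrow> real) \<Rightarrow> nat \<Rightarrow> (nat \<Rightarrow> real) \<Rightarrow> nat \<Rightarrow> nat \<Rightarrow> real" where
  "riesz c n e m i = (\<Sum>j<m. form e n (phi c j) (phi c n) / eps c j * phi c j i)"

lemma riesz_above: "m \<le> i \<Longrightarrow> riesz c n e m i = 0"
  unfolding riesz_def by (intro sum.neutral) (auto simp: phi_above)

text \<open>Adding the term with \<open>phi c m\<close> changes no row below m, by orthogonality,
  and its coefficient is what row m requires; the latter follows because the lower sum pairs to zero
  with \<open>phi c m\<close>.\<close>

lemma toep_riesz: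
  assumes "szego_pos c n" "m \<le> n" "k < m"
  shows "toep c n (riesz c n e m) k = toep e n (phi c n) k"
  using assms(2,3)
proof (induction m arbitrary: k)
  case (Suc m)
  let ?b = "form e n (phi c m) (phi c n) / eps c m"
  have E: "eps c m > 0" using Suc.prems szego_pos_eps[OF assms(1), of m] by auto
  have ne: "j < m \<Longrightarrow> eps c j \<noteq> 0" for j using szego_pos_nonzero[OF assms(1), of j] Suc.prems by auto
  have "riesz c n e (Suc m) = (\<lambda>i. 1 * riesz c n e m i + ?b * phi c m i)"
    by (rule ext) (simp add: riesz_def)
  then have t: "toep c n (riesz c n e (Suc m)) k = toep c n (riesz c n e m) k + ?b * toep c n (phi c m) k" for k
    by (simp only: toep_lin)
  have tm: "toep c n (phi c m) k = (if k = m then eps c m else 0)" if "k \<le> m" for k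
    by (subst toep_supp[of m n]) (use Suc.prems ne that phi_above toep_phi in auto)
  show ?case
  proof (cases "k = m")
    case False
    then show ?thesis using Suc t[of k] tm[of k] by simp
  next
    case True
    have "0 = form c m (riesz c n e m) (phi c m)" using form_phi_right[of m c] ne riesz_above by simp
    also have "\<dots> = form c m (phi c m) (riesz c n e m)" by (rule form_sym)
    also have "\<dots> = form c n (phi c m) (riesz c n e m)"
      by (rule form_supp[symmetric]) (use Suc.prems in \<open>auto simp: phi_above riesz_above\<close>)
    also have "\<dots> = (\<Sum>i\<le>m. phi c m i * toep c n (riesz c n e m) i)"
      unfolding form_def by (rule sum.mono_neutral_right) (use Suc.prems in \<open>auto simp: phi_above\<close>)
    also have "\<dots> = (\<Sum>i<m. phi c m i * toep e n (phi c n) i) + toep c n (riesz c n e m) m"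
      using Suc by (simp add: lessThan_Suc_atMost[symmetric] phi_monic)
    finally have 1: "(\<Sum>i<m. phi c m i * toep e n (phi c n) i) = - toep c n (riesz c n e m) m" by simp
    have "form e n (phi c m) (phi c n) = (\<Sum>i\<le>m. phi c m i * toep e n (phi c n) i)"
      unfolding form_def by (rule sum.mono_neutral_right) (use Suc.prems in \<open>auto simp: phi_above\<close>)
    also have "\<dots> = - toep c n (riesz c n e m) m + toep e n (phi c n) m"
      using 1 by (simp add: lessThan_Suc_atMost[symmetric] phi_monic)
    finally show ?thesis using t[of m] tm[of m] True E by simp
  qed
qed simp

lemma form_riesz:
  assumes "szego_pos c n" "v n = 0"
  shows "form c n v (riesz c n e n) = form e n v (phi c n)"
  unfolding form_def
proof (rule sum.cong)
  fix i assume "i \<in> {..n}"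
  then show "v i * toep c n (riesz c n e n) i = v i * toep e n (phi c n) i"
    using assms toep_riesz[OF assms(1) order_refl, of i] by (cases "i = n") auto
qed simp

lemma form_riesz_riesz:
  assumes "szego_pos c n"
  shows "form c n (riesz c n e n) (riesz c n e n) = second_var c n e"
    "form e n (riesz c n e n) (phi c n) = second_var c n e"
proof -
  show 2: "form e n (riesz c n e n) (phi c n) = second_var c n e"
    unfolding riesz_def form_sum_left[OF finite_lessThan] second_var_def
    by (intro sum.cong) (auto simp: power2_eq_square)
  show "form c n (riesz c n e n) (riesz c n e n) = second_var c n e"
    using form_riesz[of c n "riesz c n e n" e] assms riesz_above[of n n c n e] 2 by simp
qed

lemma second_var_nonneg: "szego_pos c n \<Longrightarrow> 0 \<le> second_var c n e"
  unfolding second_var_def by (intro sum_nonneg divide_nonneg_pos) (auto intro: szego_pos_eps)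

lemma second_var_bound:
  assumes "szego_pos c n"
  shows "\<exists>K\<ge>0. \<forall>e. second_var c n e \<le> K * (seq_norm e n)\<^sup>2"
proof -
  define K where "K = (\<Sum>j<n. ((\<Sum>i\<le>n. \<bar>phi c j i\<bar>) * (\<Sum>i\<le>n. \<bar>phi c n i\<bar>))\<^sup>2 / eps c j)"
  have "K \<ge> 0" unfolding K_def by (intro sum_nonneg divide_nonneg_pos) (auto intro: szego_pos_eps assms)
  moreover have "second_var c n e \<le> K * (seq_norm e n)\<^sup>2" for e
  proof -
    have "second_var c n e \<le> (\<Sum>j<n. ((\<Sum>i\<le>n. \<bar>phi c j i\<bar>) * (\<Sum>i\<le>n. \<bar>phi c n i\<bar>))\<^sup>2 / eps c j * (seq_norm e n)\<^sup>2)"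
    unfolding second_var_def
  proof (rule sum_mono)
    fix j assume "j \<in> {..<n}"
    then have "eps c j > 0" by (auto intro: szego_pos_eps assms)
    moreover have "(form e n (phi c j) (phi c n))\<^sup>2 \<le>
        (seq_norm e n * ((\<Sum>i\<le>n. \<bar>phi c j i\<bar>) * (\<Sum>i\<le>n. \<bar>phi c n i\<bar>)))\<^sup>2"
      using form_bound[of e n "phi c j" "phi c n"] abs_le_square_iff abs_ge_self order_trans by blast
    ultimately show "(form e n (phi c j) (phi c n))\<^sup>2 / eps c j \<le>
        ((\<Sum>i\<le>n. \<bar>phi c j i\<bar>) * (\<Sum>i\<le>n. \<bar>phi c n i\<bar>))\<^sup>2 / eps c j * (seq_norm e n)\<^sup>2"
      by (simp add: divide_right_mono power_mult_distrib mult.commute)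
  qed
    also have "\<dots> = K * (seq_norm e n)\<^sup>2" unfolding K_def by (rule sum_distrib_right[symmetric])
    finally show ?thesis .
  qed
  ultimately show ?thesis by blast
qed

text \<open>All pairings of \<open>phi c n\<close> with the basis vanish, the one with
  \<open>phi c n\<close> itself by the assumption on the first variation. The basis is triangular,
  so the rows of \<open>toep e n (phi c n)\<close> vanish one after another and
  \<open>toep_phi_zero_imp\<close> applies.\<close>

lemma second_var_zero:
  assumes "szego_pos c n" "second_var c n e = 0" "first_var c n e = 0" "k \<le> n"
  shows "e k = 0"
proof -
  have "\<forall>j\<in>{..<n}. (form e n (phi c j) (phi c n))\<^sup>2 / eps c j = 0"
    using assms(2) unfolding second_var_def
    by (subst (asm) sum_nonneg_eq_0_iff) (auto intro!: divide_nonneg_pos szego_pos_eps assms)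
  then have z: "form e n (phi c j) (phi c n) = 0" if "j \<le> n" for j
    using that assms(3) szego_pos_eps[OF assms(1), of j] by (cases "j = n") (auto simp: first_var_def)
  have "toep e n (phi c n) j = 0" if "j \<le> n" for j
    using that
  proof (induction j rule: less_induct)
    case (less j)
    have "0 = form e n (phi c j) (phi c n)" using z less by simp
    also have "\<dots> = (\<Sum>i\<le>j. phi c j i * toep e n (phi c n) i)"
      unfolding form_def by (rule sum.mono_neutral_right) (use less in \<open>auto simp: phi_above\<close>)
    also have "\<dots> = toep e n (phi c n) j"
      using less by (simp add: lessThan_Suc_atMost[symmetric] phi_monic)
    finally show ?case by simp
  qed
  then show ?thesis using toep_phi_zero_imp[OF assms(1)] assms(4) by blast
qed

text \<open>Both bounds use the variational principle: \<open>phi c n\<close> minus the Riesz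
  representer is a competitor for the perturbed minimum, and at the true minimizer a completed
  square bounds the form from below. The perturbation is relatively bounded by \<theta> = O(|e|) and
  the second variation W is O(|e|^2), so errors of size \<theta> W are cubic.\<close>

lemma eps_expansion:
  assumes c: "szego_pos c n"
  shows "\<exists>\<delta>>0. \<exists>K\<ge>0. \<forall>e. seq_norm e n \<le> \<delta> \<longrightarrow> szego_pos (\<lambda>k. c k + e k) n \<and>
     \<bar>eps (\<lambda>k. c k + e k) n - (eps c n + first_var c n e - second_var c n e)\<bar> \<le> K * seq_norm e n ^ 3"
proof -
  obtain \<kappa> where \<kappa>: "\<kappa> > 0" "\<And>v. \<kappa> * (\<Sum>i\<le>n. (v i)\<^sup>2) \<le> form c n v v"
    using form_coercive[OF c] by blast
  obtain K1 where K1: "K1 \<ge> 0" "\<And>e. second_var c n e \<le> K1 * (seq_norm e n)\<^sup>2"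
    using second_var_bound[OF c] by blast
  define \<delta> where "\<delta> = \<kappa> / (2 * real (Suc n))"
  define K where "K = 2 * (real (Suc n) / \<kappa>) * K1"
  show ?thesis
  proof (intro exI conjI allI impI)
    show "\<delta> > 0" "K \<ge> 0" using \<kappa> K1 by (auto simp: \<delta>_def K_def)
    fix e assume le: "seq_norm e n \<le> \<delta>"
    \<comment> \<open>Relative bound of the form of \<open>e\<close> by the form of
      \<open>c\<close>. The choice of \<delta> keeps it at most 1/2, which preserves positivity and
      allows division by 1 - \<theta>.\<close>
    define \<theta> where "\<theta> = real (Suc n) * seq_norm e n / \<kappa>"
    have \<theta>: "0 \<le> \<theta>" "\<theta> \<le> 1 / 2"
      using le \<kappa> seq_norm_nonneg[of e n] by (auto simp: \<theta>_def \<delta>_def field_simps)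
    have He: "\<bar>form e n v v\<bar> \<le> \<theta> * form c n v v" for v
    proof -
      have "\<bar>form e n v v\<bar> \<le> \<theta> * (\<kappa> * (\<Sum>i\<le>n. (v i)\<^sup>2))"
        using form_bound_square[of e n v] \<kappa>(1) by (simp add: \<theta>_def)
      also have "\<dots> \<le> \<theta> * form c n v v" using \<kappa>(2) \<theta> by (intro mult_left_mono) auto
      finally show ?thesis .
    qed
    let ?d = "\<lambda>k. c k + e k"
    have d: "form ?d n u v = form c n u v + form e n u v" for u v
      using form_lin_seq[of 1 c 1 e n u v] by simp
    show pos: "szego_pos ?d n"
    proof (rule szego_posI)
      fix j and v :: "nat \<Rightarrow> real" assume v: "j \<le> n" "v j = 1"
      have "0 < (v j)\<^sup>2" using v by simp
      also have "\<dots> \<le> (\<Sum>i\<le>n. (v i)\<^sup>2)" by (rule member_le_sum) (use v in auto)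
      finally have "0 < form c n v v" using \<kappa> by (meson less_le_trans mult_pos_pos)
      then have "\<theta> * form c n v v < 1 * form c n v v" using \<theta> by (intro mult_strict_right_mono) auto
      then show "0 < form ?d n v v" unfolding d using He[of v] by linarith
    qed
    define u where "u = riesz c n e n"
    define W where "W = second_var c n e"
    define S where "S = seq_norm e n"
    have W: "W \<ge> 0" "W \<le> K1 * S\<^sup>2" using second_var_nonneg[OF c] K1 by (auto simp: W_def S_def)
    have uu: "form c n u u = W" "form e n u (phi c n) = W"
      unfolding u_def W_def by (rule form_riesz_riesz[OF c])+
    have un: "u n = 0" by (simp add: u_def riesz_above)
    have ne: "j < n \<Longrightarrow> eps c j \<noteq> 0" for j using szego_pos_nonzero[OF c] .
    have pp: "form c n (phi c n) (phi c n) = eps c n" by (rule form_phi_phi[OF ne])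
    have err: "2 * \<theta> * W \<le> K * S ^ 3"
    proof -
      have "2 * \<theta> * W \<le> 2 * \<theta> * (K1 * S\<^sup>2)" using W \<theta> by (intro mult_left_mono) auto
      also have "\<dots> = K * S ^ 3" by (simp add: \<theta>_def K_def S_def power2_eq_square power3_eq_cube)
      finally show ?thesis .
    qed
    have up: "eps ?d n \<le> eps c n + first_var c n e - W + \<theta> * W"
    proof -
      let ?v = "\<lambda>i. 1 * phi c n i + (- 1) * u i"
      have "eps ?d n \<le> form ?d n ?v ?v"
        using form_lower[OF pos, of ?v] by (simp add: phi_monic un)
      also have "\<dots> = eps c n + first_var c n e - W + form e n u u"
        unfolding d form_square pp form_sym[of _ _ "phi c n" u] uu first_var_def
        using form_phi_right[of n c u] ne un by simp
      also have "form e n u u \<le> \<theta> * W" using He[of u] uu by simp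
      finally show ?thesis by simp
    qed
    have lo: "eps c n + first_var c n e - W - 2 * \<theta> * W \<le> eps ?d n"
    proof -
      define p where "p = phi ?d n"
      define q where "q = (\<lambda>i. p i - phi c n i)"
      have qn: "q n = 0" by (simp add: q_def p_def phi_monic)
      have "eps ?d n = form ?d n p p"
        unfolding p_def by (rule form_phi_phi[symmetric]) (rule szego_pos_nonzero[OF pos])
      also have "p = (\<lambda>i. 1 * phi c n i + 1 * q i)" by (auto simp: q_def)
      finally have E: "eps ?d n = eps c n + first_var c n e + form c n q q + 2 * form c n q u + form e n q q"
        unfolding d form_square pp form_sym[of _ _ "phi c n" q] first_var_def
        using form_phi_right[of n c q] ne qn form_riesz[of c n q e] c qn by (simp add: u_def)
      define X where "X = form c n q q"
      define Y where "Y = form c n q u"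
      \<comment> \<open>The weight 1 - \<theta> on q is what the perturbation leaves of the form of
        \<open>c\<close> at q; after division by 1 - \<theta> the square costs W / (1 - \<theta>),
        which is at most (1 + 2 \<theta>) W.\<close>
      have "0 \<le> form c n (\<lambda>i. (1 - \<theta>) * q i + 1 * u i) (\<lambda>i. (1 - \<theta>) * q i + 1 * u i)"
        using szego_pos_psd[OF c] by (simp add: toep_psd_def)
      then have "0 \<le> (1 - \<theta>)\<^sup>2 * X + 2 * (1 - \<theta>) * Y + W"
        unfolding form_square uu X_def Y_def by simp
      then have "- W \<le> (1 - \<theta>) * ((1 - \<theta>) * X + 2 * Y)"
        by (simp add: power2_eq_square algebra_simps)
      then have "- W / (1 - \<theta>) \<le> (1 - \<theta>) * X + 2 * Y"
        using \<theta> by (subst pos_divide_le_eq) (simp_all add: mult.commute)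
      moreover have "W \<le> (1 - \<theta>) * (1 + 2 * \<theta>) * W"
      proof -
        have "0 \<le> \<theta> * (1 - 2 * \<theta>)" using \<theta> by simp
        then have "1 \<le> (1 - \<theta>) * (1 + 2 * \<theta>)" by (simp add: algebra_simps)
        then show ?thesis using W mult_right_mono[of 1 _ W] by simp
      qed
      then have "W / (1 - \<theta>) \<le> (1 + 2 * \<theta>) * W"
        using \<theta> by (simp add: divide_le_eq mult_ac)
      ultimately have "- W - 2 * \<theta> * W \<le> (1 - \<theta>) * X + 2 * Y"
        by (simp add: algebra_simps)
      moreover have "- (\<theta> * X) \<le> form e n q q" using He[of q] by (simp add: X_def)
      ultimately show ?thesis unfolding E X_def[symmetric] Y_def[symmetric] by (simp add: algebra_simps)
    qed
    have "\<theta> * W \<le> 2 * \<theta> * W" using \<theta> W by simp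
    then show "\<bar>eps ?d n - (eps c n + first_var c n e - second_var c n e)\<bar> \<le> K * seq_norm e n ^ 3"
      using up lo err unfolding W_def[symmetric] S_def[symmetric] by linarith
  qed
qed

section \<open>Trigonometric moments\<close>

text \<open>Chebyshev polynomials transported to [0,1]: \<open>cheb n\<close> is T_n(2x - 1), hence
  the factor 2(2x - 1) = 4x - 2 in the recurrence.\<close>

fun cheb :: "nat \<Rightarrow> real poly" where
  "cheb 0 = 1"
| "cheb (Suc 0) = [:-1, 2:]"
| "cheb (Suc (Suc n)) = [:-2, 4:] * cheb (Suc n) - cheb n"

lemma degree_cheb: "degree (cheb n) \<le> n"
proof (induction n rule: cheb.induct)
  case (3 n)
  have "degree ([:-2, 4:] * cheb (Suc n)) \<le> Suc (Suc n)"
    using degree_mult_le[of "[:-2, 4:]" "cheb (Suc n)"] 3 by simp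
  then show ?case using 3 by (auto intro: degree_diff_le)
qed auto

lemma coeff_cheb_pos: "coeff (cheb n) n > 0"
proof (induction n rule: cheb.induct)
  case (3 n)
  have "coeff (cheb (Suc n)) (Suc (Suc n)) = 0" "coeff (cheb n) (Suc (Suc n)) = 0"
    using degree_cheb[of "Suc n"] degree_cheb[of n] by (auto intro!: coeff_eq_0)
  then show ?case using 3 by simp
qed auto

lemma cheb_cos: "poly (cheb n) ((1 + cos t) / 2) = cos (real n * t)"
proof (induction n rule: cheb.induct)
  case (3 n)
  have "cos (real (Suc (Suc n)) * t) = 2 * cos t * cos (real (Suc n) * t) - cos (real n * t)"
    using cos_add[of "real (Suc n) * t" t] cos_diff[of "real (Suc n) * t" t]
    by (simp add: algebra_simps)
  moreover have "poly [:-2, 4:] ((1 + cos t) / 2) = 2 * cos t" by (simp add: field_simps)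
  ultimately show ?case using 3 by (simp only: cheb.simps poly_diff poly_mult)
qed (auto simp: field_simps)

text \<open>The trigonometric moments \<open>\<integral> cos (k t)\<close> with \<open>x = (1 + cos t) / 2\<close>; the moment of order 0 is
  fixed to 1, so that \<open>m\<close> may be undefined there.\<close>

definition trig :: "(nat \<Rightarrow> real) \<Rightarrow> nat \<Rightarrow> real" where
  "trig m k = (\<Sum>j\<le>k. coeff (cheb k) j * (if j = 0 then 1 else m j))"

definition dtrig :: "(nat \<Rightarrow> real) \<Rightarrow> nat \<Rightarrow> real" where
  "dtrig h k = (\<Sum>j\<in>{1..k}. coeff (cheb k) j * h j)"

lemma trig_eq_dtrig: "trig m k = coeff (cheb k) 0 + dtrig m k"
proof -
  have "{..k} = insert 0 {1..k}" by auto
  then have "trig m k = coeff (cheb k) 0 + (\<Sum>j\<in>{1..k}. coeff (cheb k) j * (if j = 0 then 1 else m j))"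
    unfolding trig_def by simp
  also have "(\<Sum>j\<in>{1..k}. coeff (cheb k) j * (if j = 0 then 1 else m j)) = dtrig m k"
    unfolding dtrig_def by (intro sum.cong) auto
  finally show ?thesis .
qed

lemma trig_0: "trig m 0 = 1" by (simp add: trig_def)

lemma dtrig_lin: "dtrig (\<lambda>j. a * x j + b * y j) k = a * dtrig x k + b * dtrig y k"
  unfolding dtrig_def by (simp add: algebra_simps sum.distrib sum_distrib_left)

lemma trig_add: "trig (\<lambda>j. m j + h j) k = trig m k + dtrig h k"
  using dtrig_lin[of 1 m 1 h k] by (simp add: trig_eq_dtrig)

lemma trig_blend: "trig (\<lambda>j. (1 - t) * x j + t * y j) = (\<lambda>k. (1 - t) * trig x k + t * trig y k)"
  unfolding trig_eq_dtrig dtrig_lin by (rule ext) (simp add: algebra_simps)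

lemma trig_cong: "(\<And>j. j \<in> {1..k} \<Longrightarrow> x j = y j) \<Longrightarrow> trig x k = trig y k"
  unfolding trig_eq_dtrig dtrig_def by (auto intro!: sum.cong)

text \<open>The passage from moments to trigonometric moments is triangular, with the nonzero
  diagonal of \<open>coeff_cheb_pos\<close>.\<close>

lemma dtrig_zero_imp:
  assumes "\<And>k. k \<le> n \<Longrightarrow> dtrig h k = 0" "j \<in> {1..n}" shows "h j = 0"
  using assms(2)
proof (induction j rule: less_induct)
  case (less j)
  have "0 = dtrig h j" using assms(1) less by simp
  also have "\<dots> = (\<Sum>i\<in>{1..j}. if i = j then coeff (cheb j) j * h j else 0)"
    unfolding dtrig_def using less by (intro sum.cong) auto
  also have "\<dots> = coeff (cheb j) j * h j" using less.prems by simp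
  finally show ?case using coeff_cheb_pos[of j] by simp
qed

lemma trig_inj:
  assumes "\<And>k. k \<le> n \<Longrightarrow> trig x k = trig y k" "j \<in> {1..n}" shows "x j = y j"
proof -
  have "dtrig (\<lambda>j. 1 * x j + (- 1) * y j) k = 0" if "k \<le> n" for k
    unfolding dtrig_lin using assms(1)[OF that] by (simp add: trig_eq_dtrig)
  from dtrig_zero_imp[OF this assms(2)] show ?thesis by simp
qed

section \<open>Moments of measures on the unit interval\<close>

lemma prob_measuresD:
  assumes "\<mu> \<in> prob_measures {0..1}"
  shows "prob_space \<mu>" "sets \<mu> = sets borel" "AE x in \<mu>. x \<in> {0..1}"
    "\<And>p. integrable \<mu> (\<lambda>x. poly p x)" "moment 0 \<mu> = 1"
proof -
  show p: "prob_space \<mu>" and s: "sets \<mu> = sets borel" using assms by (auto simp: prob_measures_def)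
  interpret prob_space \<mu> by fact
  have "emeasure \<mu> {0..1} = 1" using assms by (auto simp: prob_measures_def)
  then show "AE x in \<mu>. x \<in> {0..1}"
    by (subst AE_in_set_eq_1) (auto simp: s emeasure_eq_measure)
  show "integrable \<mu> (\<lambda>x. poly p x)" for p
    unfolding poly_altdef using assms by (auto simp: prob_measures_def)
  show "moment 0 \<mu> = 1" by (simp add: moment_def prob_space)
qed

lemma prob_measuresI:
  assumes "prob_space \<mu>" and [measurable_cong]: "sets \<mu> = sets borel" and ae: "AE x in \<mu>. x \<in> {0..1}"
  shows "\<mu> \<in> prob_measures {0..1}"
proof -
  interpret prob_space \<mu> by fact
  have "integrable \<mu> (\<lambda>x. x ^ j)" for j
  proof (rule integrable_const_bound[where B=1])
    show "AE x in \<mu>. norm (x ^ j) \<le> 1" using ae by eventually_elim (auto simp: power_le_one)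
  qed measurable
  moreover have "emeasure \<mu> {0..1} = 1"
    using ae by (subst (asm) AE_in_set_eq_1) (auto simp: assms(2) emeasure_eq_measure)
  ultimately show ?thesis using assms by (simp add: prob_measures_def)
qed

lemma integral_poly_moments:
  assumes "\<mu> \<in> prob_measures {0..1}" "degree p \<le> n"
  shows "(\<integral>x. poly p x \<partial>\<mu>) = coeff p 0 + (\<Sum>j\<in>{1..n}. coeff p j * moment j \<mu>)"
proof -
  have "(\<integral>x. poly p x \<partial>\<mu>) = (\<Sum>j\<le>degree p. coeff p j * moment j \<mu>)"
    unfolding poly_altdef moment_def using assms by (subst Bochner_Integration.integral_sum) (auto simp: prob_measures_def)
  also have "\<dots> = (\<Sum>j\<in>{..n}. coeff p j * moment j \<mu>)"
    by (rule sum.mono_neutral_left) (use assms in \<open>auto simp: coeff_eq_0\<close>)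
  also have "{..n} = insert 0 {1..n}" by auto
  finally show ?thesis using prob_measuresD(5)[OF assms(1)] by simp
qed

lemma trig_moment:
  assumes "\<mu> \<in> prob_measures {0..1}"
  shows "trig (\<lambda>j. moment j \<mu>) k = (\<integral>x. poly (cheb k) x \<partial>\<mu>)"
  using integral_poly_moments[OF assms degree_cheb[of k]] by (simp add: trig_eq_dtrig dtrig_def)

lemma trig_moment_vec: "k \<le> n \<Longrightarrow> trig (moment_vec n \<mu>) k = trig (\<lambda>j. moment j \<mu>) k"
  by (rule trig_cong) (auto simp: moment_vec_def)

lemma cos_dist_mult:
  "cos (real (i - j + (j - i)) * t) = cos (real i * t) * cos (real j * t) + sin (real i * t) * sin (real j * t)"
proof (cases "j \<le> i")
  case True
  then have "real (i - j + (j - i)) * t = real i * t - real j * t" by (simp add: of_nat_diff algebra_simps)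
  then show ?thesis by (simp add: cos_diff)
next
  case False
  then have "real (i - j + (j - i)) * t = real j * t - real i * t" by (simp add: of_nat_diff algebra_simps)
  then show ?thesis by (simp add: cos_diff mult.commute)
qed

lemma form_cos:
  "form (\<lambda>k. cos (real k * t)) n u v =
     (\<Sum>i\<le>n. u i * cos (real i * t)) * (\<Sum>i\<le>n. v i * cos (real i * t))
   + (\<Sum>i\<le>n. u i * sin (real i * t)) * (\<Sum>i\<le>n. v i * sin (real i * t))"
  unfolding form_sum sum_product cos_dist_mult by (simp add: sum.distrib[symmetric] algebra_simps)

definition form_poly :: "nat \<Rightarrow> (nat \<Rightarrow> real) \<Rightarrow> (nat \<Rightarrow> real) \<Rightarrow> real poly" where
  "form_poly n u v = (\<Sum>i\<le>n. \<Sum>j\<le>n. Polynomial.smult (u i * v j) (cheb (i - j + (j - i))))"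

lemma poly_form_poly: "poly (form_poly n u v) x = form (\<lambda>k. poly (cheb k) x) n u v"
  unfolding form_poly_def form_sum by (simp add: poly_sum)

lemma degree_form_poly: "degree (form_poly n u v) \<le> n"
  unfolding form_poly_def
proof (intro degree_sum_le finite_atMost)
  fix i j assume "i \<in> {..n}" "j \<in> {..n}"
  then have "i - j + (j - i) \<le> n" by auto
  then show "degree (Polynomial.smult (u i * v j) (cheb (i - j + (j - i)))) \<le> n"
    using degree_smult_le[of "u i * v j" "cheb (i - j + (j - i))"] degree_cheb[of "i - j + (j - i)"] by linarith
qed

text \<open>The coefficients of \<open>form_poly\<close> are the gradient of the form with respect
  to the ordinary moments; this translates a critical-point equation into vanishing polynomial
  coefficients.\<close>

lemma form_dtrig: "form (dtrig h) n u v = (\<Sum>j\<in>{1..n}. coeff (form_poly n u v) j * h j)"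
proof -
  have d: "dtrig h k = (\<Sum>j\<in>{1..n}. coeff (cheb k) j * h j)" if "k \<le> n" for k
    unfolding dtrig_def
    by (rule sum.mono_neutral_left) (use that degree_cheb[of k] in \<open>auto intro!: coeff_eq_0\<close>)
  have "form (dtrig h) n u v = (\<Sum>i\<le>n. \<Sum>k\<le>n. u i * v k * (\<Sum>j\<in>{1..n}. coeff (cheb (i - k + (k - i))) j * h j))"
    unfolding form_sum
  proof (intro sum.cong refl)
    fix i k assume "i \<in> {..n}" "k \<in> {..n}"
    then have "i - k + (k - i) \<le> n" by auto
    then show "u i * v k * dtrig h (i - k + (k - i)) = u i * v k * (\<Sum>j\<in>{1..n}. coeff (cheb (i - k + (k - i))) j * h j)"
      by (simp only: d)
  qed
  also have "\<dots> = (\<Sum>i\<le>n. \<Sum>k\<le>n. \<Sum>j\<in>{1..n}. u i * v k * (coeff (cheb (i - k + (k - i))) j * h j))"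
    by (simp add: sum_distrib_left)
  also have "\<dots> = (\<Sum>i\<le>n. \<Sum>j\<in>{1..n}. \<Sum>k\<le>n. u i * v k * (coeff (cheb (i - k + (k - i))) j * h j))"
    by (rule sum.cong[OF refl sum.swap])
  also have "\<dots> = (\<Sum>j\<in>{1..n}. \<Sum>i\<le>n. \<Sum>k\<le>n. u i * v k * (coeff (cheb (i - k + (k - i))) j * h j))"
    by (rule sum.swap)
  also have "\<dots> = (\<Sum>j\<in>{1..n}. coeff (form_poly n u v) j * h j)"
    by (simp add: form_poly_def coeff_sum sum_distrib_right mult.assoc)
  finally show ?thesis .
qed

lemma form_integral:
  assumes "\<mu> \<in> prob_measures {0..1}"
  shows "form (trig (\<lambda>j. moment j \<mu>)) n u v = (\<integral>x. form (\<lambda>k. poly (cheb k) x) n u v \<partial>\<mu>)"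
  unfolding form_sum trig_moment[OF assms] using prob_measuresD(4)[OF assms] by simp

lemma unit_interval_cos: "x \<in> {0..1} \<Longrightarrow> \<exists>t. x = (1 + cos t) / (2::real)"
  by (intro exI[of _ "arccos (2 * x - 1)"]) simp

text \<open>At x = (1 + cos t) / 2 the integrand is the squared modulus of the sum of v_k e^(ikt),
  by \<open>form_cos\<close>.\<close>

lemma toep_psd_moments:
  assumes "\<mu> \<in> prob_measures {0..1}" shows "toep_psd (trig (\<lambda>j. moment j \<mu>)) n"
  unfolding toep_psd_def
proof
  fix v
  have "AE x in \<mu>. 0 \<le> form (\<lambda>k. poly (cheb k) x) n v v"
    using prob_measuresD(3)[OF assms]
  proof eventually_elim
    case (elim x)
    then obtain t where t: "x = (1 + cos t) / 2" using unit_interval_cos by blast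
    show ?case unfolding t cheb_cos form_cos by simp
  qed
  then show "0 \<le> form (trig (\<lambda>j. moment j \<mu>)) n v v"
    unfolding form_integral[OF assms] by (rule integral_nonneg_AE)
qed

section \<open>Orthogonal polynomials on the unit circle as complex functions\<close>

definition cphi :: "(nat \<Rightarrow> real) \<Rightarrow> nat \<Rightarrow> complex \<Rightarrow> complex" where
  "cphi c n z = (\<Sum>k\<le>n. of_real (phi c n k) * z ^ k)"
text \<open>The reversed polynomial; no conjugation of coefficients occurs because they are
  real.\<close>

definition cstar :: "(nat \<Rightarrow> real) \<Rightarrow> nat \<Rightarrow> complex \<Rightarrow> complex" where
  "cstar c n z = (\<Sum>k\<le>n. of_real (rev_phi c n k) * z ^ k)"

lemma sum_power_diff:
  fixes z :: complex
  shows "(\<Sum>k\<le>m. of_real (a k - t * b k) * z ^ k)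
     = (\<Sum>k\<le>m. of_real (a k) * z ^ k) - of_real t * (\<Sum>k\<le>m. of_real (b k) * z ^ k)"
  by (simp add: sum_distrib_left sum_subtractf left_diff_distrib mult.assoc)

lemma sum_power_shift:
  fixes z :: complex
  shows "(\<Sum>k\<le>Suc n. of_real (shift_up u k) * z ^ k) = z * (\<Sum>k\<le>n. of_real (u k) * z ^ k)"
  by (subst sum.atMost_Suc_shift) (simp add: shift_up_def sum_distrib_left mult.left_commute)

lemma cphi_Suc: "cphi c (Suc n) z = z * cphi c n z - of_real (alpha c n) * cstar c n z"
proof -
  have "cphi c (Suc n) z = (\<Sum>k\<le>Suc n. of_real (shift_up (phi c n) k) * z ^ k)
      - of_real (alpha c n) * (\<Sum>k\<le>Suc n. of_real (rev_phi c n k) * z ^ k)"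
    unfolding cphi_def sum_power_diff[symmetric] by (simp add: phi_Suc_fun)
  also have "(\<Sum>k\<le>Suc n. of_real (shift_up (phi c n) k) * z ^ k) = z * cphi c n z"
    unfolding cphi_def by (rule sum_power_shift)
  also have "(\<Sum>k\<le>Suc n. of_real (rev_phi c n k) * z ^ k) = cstar c n z"
    unfolding cstar_def by (simp add: rev_phi_def)
  finally show ?thesis .
qed

lemma rev_phi_Suc: "k \<le> Suc n \<Longrightarrow> rev_phi c (Suc n) k = rev_phi c n k - alpha c n * shift_up (phi c n) k"
proof (cases k)
  case 0
  then show ?thesis by (simp add: shift_up_def rev_phi_def phi_monic)
next
  case (Suc m)
  assume k: "k \<le> Suc n"
  show ?thesis
  proof (cases "m = n")
    case True then show ?thesis using Suc by (simp add: shift_up_def rev_phi_def phi_Suc phi_monic)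
  next
    case False
    then have "Suc n - k = Suc (n - k)" "n - Suc (n - k) = m" "Suc (n - k) \<le> n" "k \<le> n"
      using Suc k by auto
    then have "rev_phi c (Suc n) k = phi c n (n - k) - alpha c n * phi c n m"
      using k by (simp only: rev_phi_def phi_Suc if_True nat.distinct diff_Suc_1 if_False)
    then show ?thesis using \<open>k \<le> n\<close> Suc by (simp only: rev_phi_def shift_up_def if_True nat.distinct diff_Suc_1 if_False)
  qed
qed

lemma cstar_Suc: "cstar c (Suc n) z = cstar c n z - of_real (alpha c n) * (z * cphi c n z)"
proof -
  have "cstar c (Suc n) z = (\<Sum>k\<le>Suc n. of_real (rev_phi c n k) * z ^ k)
     - of_real (alpha c n) * (\<Sum>k\<le>Suc n. of_real (shift_up (phi c n) k) * z ^ k)"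
    unfolding cstar_def sum_power_diff[symmetric] by (intro sum.cong refl) (simp add: rev_phi_Suc)
  also have "(\<Sum>k\<le>Suc n. of_real (shift_up (phi c n) k) * z ^ k) = z * cphi c n z"
    unfolding cphi_def by (rule sum_power_shift)
  also have "(\<Sum>k\<le>Suc n. of_real (rev_phi c n k) * z ^ k) = cstar c n z"
    unfolding cstar_def by (simp add: rev_phi_def)
  finally show ?thesis .
qed

lemma cstar_0: "cstar c n 0 = 1"
proof -
  have "cstar c n 0 = (\<Sum>k\<le>n. if k = 0 then of_real (rev_phi c n 0) else 0)"
    unfolding cstar_def by (intro sum.cong) auto
  then show ?thesis by (simp add: rev_phi_def phi_monic)
qed

text \<open>For real a with |a| < 1 one has |y - a x|^2 - |x - a y|^2 = (1 - a^2)(|y|^2 - |x|^2), so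
  the recursion preserves the inequality. The inequality is carried along to exclude zeros of
  \<open>cstar\<close> in the closed disc, which makes its reciprocal holomorphic there.\<close>

lemma cphi_le_cstar:
  assumes "szego_pos c n" "norm z \<le> 1"
  shows "norm (cphi c n z) \<le> norm (cstar c n z) \<and> cstar c n z \<noteq> 0"
  using assms(1)
proof (induction n)
  case 0 then show ?case by (simp add: cphi_def cstar_def phi_0 rev_phi_def)
next
  case (Suc n)
  let ?a = "alpha c n" and ?x = "z * cphi c n z" and ?y = "cstar c n z"
  have IH: "norm (cphi c n z) \<le> norm ?y" "?y \<noteq> 0" using Suc by (auto simp: szego_pos_Suc)
  have "0 < eps c n * (1 - ?a\<^sup>2)" using Suc.prems szego_pos_eps[of c "Suc n" "Suc n"] by (simp add: eps_Suc)
  moreover have "0 < eps c n" using Suc.prems szego_pos_eps[of c "Suc n" n] by simp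
  ultimately have a2: "?a\<^sup>2 < 1" by (simp add: zero_less_mult_iff)
  then have a1: "\<bar>?a\<bar> < 1" by (simp add: abs_square_less_1)
  have xy: "norm ?x \<le> norm ?y" using IH assms(2)
    by (metis mult_left_le_one_le norm_ge_zero norm_mult order_trans)
  have "norm (of_real ?a * ?x) \<le> \<bar>?a\<bar> * norm ?y" using xy by (simp add: norm_mult mult_left_mono)
  also have "\<dots> < norm ?y" using a1 IH by simp
  finally have ne: "?y - of_real ?a * ?x \<noteq> 0" by auto
  have sq: "(norm (p - of_real a * q))\<^sup>2 = (norm p)\<^sup>2 - 2 * a * (p \<bullet> q) + a\<^sup>2 * (norm q)\<^sup>2" for p q :: complex and a :: real
  proof -
    have "of_real a * q = a *\<^sub>R q" by (simp add: scaleR_conv_of_real)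
    then show ?thesis unfolding power2_norm_eq_inner
      by (simp add: inner_diff inner_commute power2_eq_square algebra_simps)
  qed
  have "(norm ?x)\<^sup>2 \<le> (norm ?y)\<^sup>2" using xy by (simp add: power_mono)
  then have "0 \<le> (1 - ?a\<^sup>2) * ((norm ?y)\<^sup>2 - (norm ?x)\<^sup>2)" using a2 by simp
  then have "(norm (?x - of_real ?a * ?y))\<^sup>2 \<le> (norm (?y - of_real ?a * ?x))\<^sup>2"
    unfolding sq inner_commute[of ?y ?x] by (simp add: algebra_simps)
  then have "norm (?x - of_real ?a * ?y) \<le> norm (?y - of_real ?a * ?x)"
    by (rule power2_le_imp_le) simp
  then show ?case using ne unfolding cphi_Suc cstar_Suc by simp
qed

lemma cphi_cstar_circle: "norm z = 1 \<Longrightarrow> cphi c n z = z ^ n * cnj (cstar c n z)"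
proof -
  assume "norm z = 1"
  then have zz: "z * cnj z = 1" by (simp add: complex_norm_square[symmetric])
  have "z ^ n * cnj (cstar c n z) = (\<Sum>k\<le>n. of_real (rev_phi c n k) * (z ^ n * cnj z ^ k))"
    unfolding cstar_def by (simp add: sum_distrib_left mult_ac)
  also have "\<dots> = (\<Sum>k\<le>n. of_real (phi c n (n - k)) * z ^ (n - k))"
  proof (intro sum.cong refl)
    fix k assume "k \<in> {..n}"
    then have zn: "z ^ n = z ^ (n - k) * z ^ k" using power_add[of z "n - k" k] by simp
    have "z ^ n * cnj z ^ k = z ^ (n - k) * (z * cnj z) ^ k"
      unfolding zn power_mult_distrib by (rule mult.assoc)
    then show "of_real (rev_phi c n k) * (z ^ n * cnj z ^ k) = of_real (phi c n (n - k)) * z ^ (n - k)"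
      using zz \<open>k \<in> {..n}\<close> by (simp add: rev_phi_def)
  qed
  also have "\<dots> = cphi c n z"
    unfolding cphi_def by (rule sum.reindex_bij_witness[where i="\<lambda>k. n - k" and j="\<lambda>k. n - k"]) auto
  finally show ?thesis by simp
qed

lemma cphi_cis: "cphi c n (cis t) = Complex (\<Sum>k\<le>n. phi c n k * cos (real k * t)) (\<Sum>k\<le>n. phi c n k * sin (real k * t))"
  unfolding cphi_def by (rule complex_eqI) (simp_all add: Complex.DeMoivre)

lemma form_cos_phi: "form (\<lambda>k. cos (real k * t)) n (phi c n) (phi c n) = (norm (cphi c n (cis t)))\<^sup>2"
  unfolding form_cos cphi_cis cmod_power2 by (simp add: power2_eq_square)

lemma toep_cos_phi:
  "toep (\<lambda>k. cos (real k * t)) n (phi c n) k = Re (cphi c n (cis t) * cnj (cis t ^ k))"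
  unfolding toep_def cphi_cis Complex.DeMoivre cos_dist_mult
  by (simp add: distrib_left sum.distrib sum_distrib_right mult.assoc)

text \<open>On the circle the squared modulus of \<open>cphi\<close> is \<open>cstar\<close> times
  its conjugate. The conjugate factor cancels, and what is left is the real part of a function
  holomorphic on the disc.\<close>

lemma toep_cos_quotient:
  assumes "szego_pos c n" "k \<le> n"
  shows "toep (\<lambda>k. cos (real k * t)) n (phi c n) k / (norm (cphi c n (cis t)))\<^sup>2
     = Re (cis t ^ (n - k) / cstar c n (cis t))"
proof -
  define z where "z = cis t"
  have nz: "norm z = 1" by (simp add: z_def)
  then have zz: "z * cnj z = 1" by (simp add: complex_norm_square[symmetric])
  have s: "cstar c n z \<noteq> 0" using cphi_le_cstar[OF assms(1), of z] nz by simp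
  have P: "cphi c n z = z ^ n * cnj (cstar c n z)" by (rule cphi_cstar_circle[OF nz])
  have "cphi c n z * cnj (z ^ k) / of_real ((norm (cphi c n z))\<^sup>2) = z ^ n * cnj z ^ k / cstar c n z"
  proof -
    have "of_real ((norm (cphi c n z))\<^sup>2) = cstar c n z * cnj (cstar c n z)"
      unfolding P norm_mult norm_power nz by (simp only: power_one mult_1 complex_mod_cnj complex_norm_square)
    then show ?thesis unfolding P using s by simp
  qed
  also have "z ^ n = z ^ (n - k) * z ^ k" using assms(2) power_add[of z "n - k" k] by simp
  also have "z ^ (n - k) * z ^ k * cnj z ^ k = z ^ (n - k) * (z * cnj z) ^ k"
    unfolding power_mult_distrib by (rule mult.assoc)
  finally have "cphi c n z * cnj (z ^ k) / of_real ((norm (cphi c n z))\<^sup>2) = z ^ (n - k) / cstar c n z"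
    by (simp add: zz)
  then have "Re (cphi c n z * cnj (z ^ k)) / (norm (cphi c n z))\<^sup>2 = Re (z ^ (n - k) / cstar c n z)"
    by (metis Re_divide_of_real)
  then show ?thesis unfolding toep_cos_phi z_def .
qed

section \<open>Bernstein-Szego measures\<close>

text \<open>Reflection in the real axis exchanges the two half circles and preserves the real part
  of F, so each half carries half of Cauchy's integral.\<close>

lemma mean_value_half_circle:
  assumes hol: "F holomorphic_on cball 0 1" and cnj: "\<And>z. norm z = 1 \<Longrightarrow> F (cnj z) = cnj (F z)"
  shows "((\<lambda>t. Re (F (cis t))) has_integral pi * Re (F 0)) {pi..2*pi}"
proof -
  define g where "g = (\<lambda>t. Re (F (cis t)))"
  have contF: "continuous_on (sphere 0 1) F"
    using holomorphic_on_imp_continuous_on[OF hol] by (rule continuous_on_subset) auto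
  have cg: "continuous_on A g" for A
    unfolding g_def
    by (intro continuous_on_Re continuous_on_compose2[OF contF] continuous_intros) auto
  have int: "g integrable_on {a..b}" for a b
    by (rule integrable_continuous_real[OF cg])
  have "((\<lambda>u. F u / (u - 0)) has_contour_integral (2 * of_real pi * \<i> * F 0)) (part_circlepath 0 1 0 (2 * pi))"
    using Cauchy_integral_circlepath_simple[OF hol, of 0] by (simp add: circlepath_def)
  then have "((\<lambda>t. F (cis t) / cis t * 1 * \<i> * cis t) has_integral (2 * of_real pi * \<i> * F 0)) {0..2 * pi}"
    by (subst (asm) has_contour_integral_part_circlepath_iff) auto
  then have "((\<lambda>t. - \<i> * (F (cis t) / cis t * 1 * \<i> * cis t)) has_integral - \<i> * (2 * of_real pi * \<i> * F 0)) {0..2 * pi}"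
    by (rule has_integral_mult_right)
  also have "(\<lambda>t. - \<i> * (F (cis t) / cis t * 1 * \<i> * cis t)) = (\<lambda>t. F (cis t))"
    by (rule ext) (simp add: field_simps)
  also have "- \<i> * (2 * of_real pi * \<i> * F 0) = 2 * of_real pi * F 0"
    by (simp add: field_simps)
  finally have "((\<lambda>t. F (cis t)) has_integral (2 * of_real pi * F 0)) {0..2 * pi}" .
  then have "(g has_integral Re (2 * of_real pi * F 0)) {0..2 * pi}"
    unfolding g_def by (rule has_integral_Re)
  then have tot: "integral {0..2 * pi} g = 2 * pi * Re (F 0)"
    by (simp add: integral_unique)
  have sym: "g (2 * pi - t) = g t" for t
  proof -
    have "cis (2 * pi - t) = cnj (cis t)" by (simp add: complex_eq_iff)
    then show ?thesis unfolding g_def using cnj[of "cis t"] by simp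
  qed
  have im: "(\<lambda>x. (1 / (- 1)) *\<^sub>R x + - ((1 / (- 1)) *\<^sub>R (2 * pi))) ` cbox 0 pi = {pi..2 * pi}"
  proof (intro equalityI subsetI)
    fix x assume "x \<in> {pi..2 * pi}"
    then show "x \<in> (\<lambda>x. (1 / (- 1)) *\<^sub>R x + - ((1 / (- 1)) *\<^sub>R (2 * pi))) ` cbox 0 pi"
      by (intro image_eqI[of _ _ "2 * pi - x"]) auto
  qed auto
  have "(g has_integral integral {0..pi} g) (cbox 0 pi)"
    using integrable_integral[OF int[of 0 pi]] by simp
  from has_integral_affinity[OF this, of "- 1" "2 * pi"]
  have "((\<lambda>x. g (2 * pi - x)) has_integral integral {0..pi} g) {pi..2 * pi}"
    unfolding im by simp
  then have "integral {0..pi} g = integral {pi..2 * pi} g"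
    unfolding sym by (simp add: integral_unique)
  moreover have "integral {0..pi} g + integral {pi..2 * pi} g = integral {0..2 * pi} g"
    by (rule Henstock_Kurzweil_Integration.integral_combine) (auto intro: int)
  ultimately have "integral {pi..2 * pi} g = pi * Re (F 0)" using tot by simp
  then show ?thesis using integrable_integral[OF int[of pi "2 * pi"]] by (simp add: g_def)
qed

text \<open>Uniform law on the lower half circle. The interval [pi, 2 pi] is preferred to [0, pi]
  because (1 + cos t) / 2 increases on it, as the substitution rule requires.\<close>

definition half_circle :: "real measure" where
  "half_circle = density lborel (\<lambda>t. ennreal (indicator {pi..2*pi} t / pi))"

lemma sets_half_circle [measurable_cong, simp]: "sets half_circle = sets borel"
  by (simp add: half_circle_def)

lemma sets_arcsine [measurable_cong, simp]: "sets arcsine = sets borel"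
  by (simp add: arcsine_def)

lemma space_arcsine: "space arcsine = UNIV"
  by (simp add: arcsine_def)

lemma half_cos_mem: "(1 + cos t) / 2 \<in> {0..1}" for t :: real
proof -
  have "- 1 \<le> cos t" "cos t \<le> 1" by simp_all
  then have "0 \<le> 1 + cos t" "1 + cos t \<le> 2" by linarith+
  then show ?thesis by simp
qed

lemma arcsine_distr: "arcsine = distr half_circle borel (\<lambda>t. (1 + cos t) / 2)"
proof (rule measure_eqI)
  fix A :: "real set" assume "A \<in> sets arcsine"
  then have A[measurable]: "A \<in> sets borel" by simp
  define f where "f x = indicator {0<..<1} x * (1 / (pi * sqrt (x * (1 - x)))) * indicator A x" for x :: real
  let ?g = "\<lambda>t::real. (1 + cos t) / 2" and ?g' = "\<lambda>t::real. - sin t / 2"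
  have "?g \<in> borel_measurable borel" by measurable
  then have gA: "?g -` A \<in> sets borel" using measurable_sets[of ?g borel borel A] A by simp
  have g01: "?g pi = 0" "?g (2 * pi) = 1" by auto
  have "emeasure arcsine A = (\<integral>\<^sup>+x. ennreal (f x) * indicator {?g pi..?g (2 * pi)} x \<partial>lborel)"
    unfolding arcsine_def g01 by (subst emeasure_density) (auto simp: f_def intro!: nn_integral_cong split: split_indicator)
  also have "\<dots> = (\<integral>\<^sup>+x. ennreal (f x * indicator {?g pi..?g (2 * pi)} x) \<partial>lborel)"
    by (intro nn_integral_cong) (auto split: split_indicator)
  also have "\<dots> = (\<integral>\<^sup>+t. ennreal (f (?g t) * ?g' t * indicator {pi..2*pi} t) \<partial>lborel)"
  proof (rule nn_integral_substitution)
    show "set_borel_measurable borel {?g pi..?g (2 * pi)} f"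
      unfolding f_def set_borel_measurable_def by measurable
    show "- sin t / 2 \<ge> 0" if "t \<in> {pi..2 * pi}" for t
    proof -
      have "sin t = - sin (t - pi)" by (simp add: sin_diff)
      moreover have "0 \<le> sin (t - pi)" using that by (intro sin_ge_zero) auto
      ultimately show ?thesis by simp
    qed
  qed (auto intro!: derivative_eq_intros continuous_intros)
  also have "\<dots> = (\<integral>\<^sup>+t. ennreal (indicator {pi..2*pi} t / pi) * indicator A (?g t) \<partial>lborel)"
  proof (rule nn_integral_cong_AE)
    \<comment> \<open>At the two endpoints the sine vanishes and the density formula degenerates;
      they form a null set.\<close>
    have "AE t in lborel. t \<noteq> pi \<and> t \<noteq> 2 * pi"
      using AE_lborel_singleton[of pi] AE_lborel_singleton[of "2 * pi"] by eventually_elim auto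
    then show "AE t in lborel. ennreal (f (?g t) * ?g' t * indicator {pi..2*pi} t)
        = ennreal (indicator {pi..2*pi} t / pi) * indicator A (?g t)"
    proof eventually_elim
      case (elim t)
      show ?case
      proof (cases "t \<in> {pi..2*pi}")
        case True
        then have "0 < sin (t - pi)" using elim by (intro sin_gt_zero) auto
        then have s: "sin t < 0" by (simp add: sin_diff)
        have "?g t * (1 - ?g t) = (1 - (cos t)\<^sup>2) / 4"
          by (simp add: power2_eq_square algebra_simps divide_simps)
        then have q: "?g t * (1 - ?g t) = (- sin t / 2)\<^sup>2"
          by (simp add: sin_squared_eq[symmetric] power_divide)
        have r: "sqrt (?g t * (1 - ?g t)) = - sin t / 2" unfolding q using s by (simp only: real_sqrt_abs)
        have "0 < ?g t * (1 - ?g t)" unfolding q using s by simp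
        moreover have "0 \<le> ?g t" "0 \<le> 1 - ?g t" using half_cos_mem[of t] unfolding atLeastAtMost_iff by linarith+
        ultimately have "?g t \<in> {0<..<1}" by (auto simp: zero_less_mult_iff)
        then have "f (?g t) * ?g' t = 1 / pi * indicator A (?g t)"
          unfolding f_def r using s by simp
        then show ?thesis using True by (simp split: split_indicator)
      qed simp
    qed
  qed
  also have "\<dots> = (\<integral>\<^sup>+t. ennreal (indicator {pi..2*pi} t / pi) * indicator (?g -` A) t \<partial>lborel)"
    by (intro nn_integral_cong) (simp split: split_indicator)
  also have "\<dots> = emeasure half_circle (?g -` A)"
    unfolding half_circle_def by (subst emeasure_density) (use gA in auto)
  also have "\<dots> = emeasure (distr half_circle borel ?g) A"
    by (subst emeasure_distr) (auto simp: half_circle_def)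
  finally show "emeasure arcsine A = emeasure (distr half_circle borel ?g) A" .
qed simp

lemma prob_space_half_circle: "prob_space half_circle"
proof
  have "emeasure half_circle (space half_circle) = (\<integral>\<^sup>+t. ennreal (1 / pi) * indicator {pi..2*pi} t \<partial>lborel)"
    unfolding half_circle_def by (subst emeasure_density) (auto intro!: nn_integral_cong split: split_indicator)
  also have "\<dots> = ennreal (1 / pi) * ennreal pi"
    by (subst nn_integral_cmult) auto
  also have "\<dots> = 1" by (simp flip: ennreal_mult)
  finally show "emeasure half_circle (space half_circle) = 1" .
qed

lemma arcsine_prob_measure: "arcsine \<in> prob_measures {0..1}"
proof (rule prob_measuresI)
  interpret prob_space half_circle by (rule prob_space_half_circle)
  show "prob_space arcsine" unfolding arcsine_distr by (rule prob_space_distr) measurable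
  show "AE x in arcsine. x \<in> {0..1}"
    unfolding arcsine_distr
    by (subst AE_distr_iff) (use half_cos_mem in \<open>auto intro!: AE_I2\<close>)
qed simp

lemma integral_arcsine:
  assumes "continuous_on {0..1} (f :: real \<Rightarrow> real)"
    and I: "((\<lambda>t. f ((1 + cos t) / 2)) has_integral I) {pi..2*pi}"
    and [measurable]: "f \<in> borel_measurable borel"
  shows "integrable arcsine f" "(\<integral>x. f x \<partial>arcsine) = I / pi"
proof -
  let ?h = "\<lambda>t::real. f ((1 + cos t) / 2)"
  have c: "continuous_on {pi..2*pi} ?h"
    by (rule continuous_on_compose2[OF assms(1)]) (use half_cos_mem in \<open>auto intro!: continuous_intros\<close>)
  have si: "set_integrable lborel {pi..2*pi} ?h"
    by (rule borel_integrable_compact[OF compact_Icc c, unfolded set_integrable_def[symmetric]])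
  have eq: "indicator {pi..2*pi} t / pi * ?h t = (indicator {pi..2*pi} t *\<^sub>R ?h t) / pi" for t
    by simp
  have hi: "integrable half_circle ?h"
    unfolding half_circle_def
    by (subst integrable_density) (use si in \<open>auto simp: set_integrable_def split: split_indicator\<close>)
  then show "integrable arcsine f" unfolding arcsine_distr
    by (subst integrable_distr_eq) auto
  have "(\<integral>x. f x \<partial>arcsine) = (\<integral>t. ?h t \<partial>half_circle)"
    unfolding arcsine_distr by (subst integral_distr) auto
  also have "\<dots> = (\<integral>t. (indicator {pi..2*pi} t / pi) *\<^sub>R ?h t \<partial>lborel)"
    unfolding half_circle_def by (subst integral_density) auto
  also have "\<dots> = (LBINT t:{pi..2*pi}. ?h t) / pi"
    unfolding set_lebesgue_integral_def by simp
  also have "(LBINT t:{pi..2*pi}. ?h t) = I"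
    using set_borel_integral_eq_integral[OF si] I by (simp add: integral_unique)
  finally show "(\<integral>x. f x \<partial>arcsine) = I / pi" .
qed

lemma integrable_arcsine:
  assumes "continuous_on {0..1} (f :: real \<Rightarrow> real)" "f \<in> borel_measurable borel"
  shows "integrable arcsine f"
proof -
  have "continuous_on {pi..2*pi} (\<lambda>t. f ((1 + cos t) / 2))"
    by (rule continuous_on_compose2[OF assms(1)]) (use half_cos_mem in \<open>auto intro!: continuous_intros\<close>)
  then show ?thesis
    using integral_arcsine(1)[OF assms(1) integrable_integral[OF integrable_continuous_real] assms(2)] by blast
qed

lemma borel_measurable_poly [measurable]: "poly (p :: real poly) \<in> borel_measurable borel"
  by (intro borel_measurable_continuous_onI continuous_on_poly continuous_on_id)

text \<open>At x = (1 + cos t) / 2 this is the squared modulus of \<open>cphi\<close> at e^(it), see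
  \<open>poly_weight_cos\<close>.\<close>

definition weight_poly :: "(nat \<Rightarrow> real) \<Rightarrow> nat \<Rightarrow> real poly" where
  "weight_poly c n = form_poly n (phi c n) (phi c n)"

definition bernstein_szego :: "(nat \<Rightarrow> real) \<Rightarrow> nat \<Rightarrow> real measure" where
  "bernstein_szego c n = density arcsine (\<lambda>x. ennreal (eps c n / poly (weight_poly c n) x))"

lemma poly_weight_cos: "poly (weight_poly c n) ((1 + cos t) / 2) = (norm (cphi c n (cis t)))\<^sup>2"
  unfolding weight_poly_def poly_form_poly cheb_cos form_cos_phi ..

lemma weight_poly_pos: "szego_pos c n \<Longrightarrow> x \<in> {0..1} \<Longrightarrow> 0 < poly (weight_poly c n) x"
proof -
  assume c: "szego_pos c n" and "x \<in> {0..1}"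
  then obtain t where t: "x = (1 + cos t) / 2" using unit_interval_cos by blast
  have "cphi c n (cis t) \<noteq> 0"
    using cphi_cstar_circle[of "cis t" c n] cphi_le_cstar[OF c, of "cis t"] by simp
  then show ?thesis unfolding t poly_weight_cos by simp
qed

lemma cstar_cnj: "cstar c n (cnj z) = cnj (cstar c n z)"
  unfolding cstar_def by simp

text \<open>By \<open>toep_cos_quotient\<close> the integral is the mean value of z^(n - k) /
  \<open>cstar c n z\<close>, that is, its value at 0; there \<open>cstar\<close> is 1 because
  \<open>phi\<close> is monic.\<close>

lemma bernstein_szego_toep:
  assumes c: "szego_pos c n" and "k \<le> n"
  shows "integrable arcsine (\<lambda>x. toep (\<lambda>k. poly (cheb k) x) n (phi c n) k / poly (weight_poly c n) x)"
    "(\<integral>x. toep (\<lambda>k. poly (cheb k) x) n (phi c n) k / poly (weight_poly c n) x \<partial>arcsine) = (if k = n then 1 else 0)"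
proof -
  let ?F = "\<lambda>z. z ^ (n - k) / cstar c n z"
  have "((\<lambda>t. Re (?F (cis t))) has_integral pi * Re (?F 0)) {pi..2*pi}"
  proof (rule mean_value_half_circle)
    show "?F holomorphic_on cball 0 1"
    proof (intro holomorphic_intros)
      show "cstar c n holomorphic_on cball 0 1" unfolding cstar_def by (intro holomorphic_intros)
      show "\<And>z. z \<in> cball 0 1 \<Longrightarrow> cstar c n z \<noteq> 0" using cphi_le_cstar[OF c] by auto
    qed
  qed (simp add: cstar_cnj)
  then have I: "((\<lambda>t. toep (\<lambda>k. poly (cheb k) ((1 + cos t) / 2)) n (phi c n) k / poly (weight_poly c n) ((1 + cos t) / 2))
      has_integral pi * Re (?F 0)) {pi..2*pi}"
    unfolding poly_weight_cos cheb_cos toep_cos_quotient[OF assms] .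
  have m: "(\<lambda>x. toep (\<lambda>k. poly (cheb k) x) n (phi c n) k / poly (weight_poly c n) x) \<in> borel_measurable borel"
    unfolding toep_def by measurable
  have co: "continuous_on {0..1} (\<lambda>x. toep (\<lambda>k. poly (cheb k) x) n (phi c n) k / poly (weight_poly c n) x)"
    unfolding toep_def by (intro continuous_intros) (use weight_poly_pos[OF c] in \<open>metis less_irrefl\<close>)
  note * = integral_arcsine[OF co I m]
  show "integrable arcsine (\<lambda>x. toep (\<lambda>k. poly (cheb k) x) n (phi c n) k / poly (weight_poly c n) x)" by (rule *)
  show "(\<integral>x. toep (\<lambda>k. poly (cheb k) x) n (phi c n) k / poly (weight_poly c n) x \<partial>arcsine) = (if k = n then 1 else 0)"
    unfolding *(2) using assms(2) by (simp add: cstar_0 power_0_left)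
qed


text \<open>The sequence \<open>d\<close> of trigonometric integrals against the new density acts on
  \<open>phi c n\<close> in the same way as \<open>c\<close>, and \<open>toep_phi_zero_imp\<close>
  says that this action determines the sequence. Total mass 1 is the entry k = 0.\<close>

lemma bernstein_szego:
  assumes c: "szego_pos c n" "c 0 = 1"
  shows "bernstein_szego c n \<in> prob_measures {0..1}"
    "\<And>k. k \<le> n \<Longrightarrow> trig (\<lambda>j. moment j (bernstein_szego c n)) k = c k"
proof -
  define w where "w = (\<lambda>x. eps c n / poly (weight_poly c n) x)"
  have wm [measurable]: "w \<in> borel_measurable borel" unfolding w_def by measurable
  have bw: "bernstein_szego c n = density arcsine (\<lambda>x. ennreal (w x))"
    by (simp add: bernstein_szego_def w_def)
  have E: "eps c n > 0" using szego_pos_eps[OF c(1)] by simp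
  have AE01: "AE x in arcsine. x \<in> {0..1}" using prob_measuresD(3)[OF arcsine_prob_measure] .
  have w: "AE x in arcsine. 0 < w x"
    using AE01 unfolding w_def by eventually_elim (use E weight_poly_pos[OF c(1)] in auto)
  then have w0: "AE x in arcsine. 0 \<le> w x" by eventually_elim simp
  have int: "integrable arcsine (\<lambda>x. poly p x * w x)" for p
    unfolding w_def
    by (rule integrable_arcsine, intro continuous_intros, insert weight_poly_pos[OF c(1)], force, measurable)
  define d where "d = (\<lambda>k. \<integral>x. poly (cheb k) x * w x \<partial>arcsine)"
  have td: "toep d n (phi c n) k = toep c n (phi c n) k" if k: "k \<le> n" for k
  proof -
    have "toep d n (phi c n) k = (\<integral>x. (\<Sum>j\<le>n. phi c n j * (poly (cheb (j - k + (k - j))) x * w x)) \<partial>arcsine)"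
      unfolding toep_def d_def using int by (subst Bochner_Integration.integral_sum) auto
    also have "\<dots> = (\<integral>x. eps c n * (toep (\<lambda>k. poly (cheb k) x) n (phi c n) k / poly (weight_poly c n) x) \<partial>arcsine)"
      unfolding toep_def w_def by (intro Bochner_Integration.integral_cong refl) (simp add: sum_distrib_left sum_divide_distrib mult_ac)
    also have "\<dots> = toep c n (phi c n) k"
      using bernstein_szego_toep[OF c(1) k] toep_phi[OF szego_pos_nonzero[OF c(1)] k]
      by (subst integral_mult_right_zero) simp
    finally show ?thesis .
  qed
  have dc: "d k = c k" if "k \<le> n" for k
  proof -
    have "toep (\<lambda>k. 1 * d k + (- 1) * c k) n (phi c n) j = 0" if "j \<le> n" for j
      unfolding toep_lin_seq td[OF that] by simp
    from toep_phi_zero_imp[OF c(1) this that] show ?thesis by simp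
  qed
  have "(\<integral>x. w x \<partial>arcsine) = 1" using dc[of 0] c(2) by (simp add: d_def)
  moreover have "integrable arcsine w" using int[of 1] by simp
  ultimately have "(\<integral>\<^sup>+x. ennreal (w x) \<partial>arcsine) = 1"
    using w0 by (subst nn_integral_eq_integral) auto
  then have "emeasure (density arcsine (\<lambda>x. ennreal (w x))) UNIV = 1"
    by (subst emeasure_density) auto
  then have "prob_space (bernstein_szego c n)"
    unfolding bw by (intro prob_spaceI) (simp add: space_arcsine)
  moreover have "AE x in bernstein_szego c n. x \<in> {0..1}"
    unfolding bw by (subst AE_density) (use AE01 in auto)
  ultimately show mem: "bernstein_szego c n \<in> prob_measures {0..1}"
    by (intro prob_measuresI) (auto simp: bernstein_szego_def)
  fix k assume "k \<le> n"
  have "trig (\<lambda>j. moment j (bernstein_szego c n)) k = (\<integral>x. w x *\<^sub>R poly (cheb k) x \<partial>arcsine)"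
    unfolding trig_moment[OF mem] unfolding bw by (subst integral_density) (use w0 in auto)
  also have "\<dots> = d k" unfolding d_def by (simp add: mult.commute)
  finally show "trig (\<lambda>j. moment j (bernstein_szego c n)) k = c k" using dc[OF \<open>k \<le> n\<close>] by simp
qed

lemma bernstein_szego_moment:
  assumes "szego_pos (trig m) n" "j \<in> {1..n}"
  shows "moment j (bernstein_szego (trig m) n) = m j"
  by (rule trig_inj[OF _ assms(2)]) (rule bernstein_szego(2)[OF assms(1) trig_0])

text \<open>Measures on [0,1] are tight, so a subsequence converges weakly; moments become integrals
  of bounded continuous functions once the powers are truncated outside [0,1].\<close>

lemma moments_closed:
  fixes \<mu> :: "nat \<Rightarrow> real measure"
  assumes \<mu>: "\<And>N. \<mu> N \<in> prob_measures {0..1}"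
    and lim: "\<And>j. j \<in> J \<Longrightarrow> (\<lambda>N. moment j (\<mu> N)) \<longlonglongrightarrow> m j"
  shows "\<exists>\<nu>\<in>prob_measures {0..1}. \<forall>j\<in>J. moment j \<nu> = m j"
proof -
  have rd: "real_distribution (\<mu> N)" for N
    using prob_measuresD(1,2)[OF \<mu>[of N]]
    by (simp add: real_distribution_def real_distribution_axioms_def)
  have "tight \<mu>"
    unfolding tight_def
  proof (intro conjI allI impI)
    fix e :: real assume "0 < e"
    have "1 - e < measure (\<mu> N) {-1<..1}" for N
    proof -
      interpret prob_space "\<mu> N" using prob_measuresD(1)[OF \<mu>] .
      have "AE x in \<mu> N. x \<in> {-1<..1}" using prob_measuresD(3)[OF \<mu>[of N]] by eventually_elim auto
      then have "measure (\<mu> N) {-1<..1} = 1"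
        by (subst (asm) AE_in_set_eq_1) (auto simp: prob_measuresD(2)[OF \<mu>])
      then show ?thesis using \<open>0 < e\<close> by simp
    qed
    then show "\<exists>a b. a < b \<and> (\<forall>N. 1 - e < measure (\<mu> N) {a<..b})"
      by (intro exI[of _ "-1"] exI[of _ 1]) auto
  qed (rule rd)
  moreover have "strict_mono (id :: nat \<Rightarrow> nat)" by (simp add: strict_mono_def)
  ultimately obtain r \<nu> where r: "strict_mono (r :: nat \<Rightarrow> nat)" and \<nu>: "real_distribution \<nu>"
    and wc: "weak_conv_m (\<mu> \<circ> id \<circ> r) \<nu>"
    using tight_imp_convergent_subsubsequence[of \<mu> id] by blast
  interpret \<nu>: real_distribution \<nu> by fact
  have conv: "(\<lambda>N. \<integral>x. f x \<partial>\<mu> (r N)) \<longlonglongrightarrow> (\<integral>x. f x \<partial>\<nu>)"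
    if "\<And>x. isCont f x" "\<And>x. norm (f x) \<le> 1" for f :: "real \<Rightarrow> real"
    using weak_conv_imp_integral_bdd_continuous_conv[of "\<mu> \<circ> id \<circ> r" \<nu> f 1] rd \<nu> wc that by simp
  \<comment> \<open>\<open>g\<close> is positive exactly off [0,1], so its integral detects any mass
    that the weak limit might place outside.\<close>
  define g where "g x = min 1 (max 0 (- x) + max 0 (x - 1))" for x :: real
  have "(\<lambda>N. \<integral>x. g x \<partial>\<mu> (r N)) \<longlonglongrightarrow> (\<integral>x. g x \<partial>\<nu>)"
    by (rule conv) (auto simp: g_def intro!: continuous_intros)
  moreover have "(\<integral>x. g x \<partial>\<mu> (r N)) = 0" for N
  proof (rule integral_eq_zero_AE)
    show "AE x in \<mu> (r N). g x = 0" using prob_measuresD(3)[OF \<mu>[of "r N"]] by eventually_elim (auto simp: g_def)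
  qed
  ultimately have "(\<integral>x. g x \<partial>\<nu>) = 0" by (simp add: LIMSEQ_const_iff)
  moreover have "g \<in> borel_measurable borel" unfolding g_def by measurable
  then have "integrable \<nu> g" by (intro \<nu>.integrable_const_bound[where B=1]) (auto simp: g_def)
  ultimately have "AE x in \<nu>. g x = 0"
    by (subst (asm) integral_nonneg_eq_0_iff_AE) (auto simp: g_def)
  then have ae: "AE x in \<nu>. x \<in> {0..1}" by eventually_elim (auto simp: g_def split: if_splits)
  have mem: "\<nu> \<in> prob_measures {0..1}" using ae by (intro prob_measuresI) (auto intro: \<nu>.prob_space_axioms)
  have "moment j \<nu> = m j" if "j \<in> J" for j
  proof -
    define f where "f x = (min 1 (max 0 x)) ^ j" for x :: real
    have fm: "moment j \<eta> = (\<integral>x. f x \<partial>\<eta>)" if \<eta>: "\<eta> \<in> prob_measures {0..1}" for \<eta>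
      unfolding moment_def
    proof (rule integral_cong_AE)
      show "AE x in \<eta>. x ^ j = f x" using prob_measuresD(3)[OF \<eta>] by eventually_elim (auto simp: f_def)
      note [measurable_cong] = prob_measuresD(2)[OF \<eta>]
      show "f \<in> borel_measurable \<eta>" "(\<lambda>x. x ^ j) \<in> borel_measurable \<eta>" unfolding f_def by measurable
    qed
    have "(\<lambda>N. \<integral>x. f x \<partial>\<mu> (r N)) \<longlonglongrightarrow> (\<integral>x. f x \<partial>\<nu>)"
      by (rule conv) (auto simp: f_def power_le_one intro!: continuous_intros)
    then have "(\<lambda>N. moment j (\<mu> (r N))) \<longlonglongrightarrow> moment j \<nu>" using fm \<mu> mem by simp
    moreover have "(\<lambda>N. moment j (\<mu> (r N))) \<longlonglongrightarrow> m j"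
      using LIMSEQ_subseq_LIMSEQ[OF lim[OF that] r] by (simp add: o_def)
    ultimately show ?thesis using LIMSEQ_unique by blast
  qed
  then show ?thesis using mem by blast
qed

text \<open>Weak duality: \<open>dual\<close> says that the reciprocal weight has the same integral
  against every feasible measure. If f is the density of \<open>arcsine\<close> with respect to a
  competitor and r its density with respect to the candidate, then ln f - ln r >= 1 - r / f, whose
  \<open>arcsine\<close> integral is nonnegative; equality forces f = r.\<close>

lemma min_measure_eqI:
  assumes pos: "szego_pos c n" "c 0 = 1"
    and mem: "bernstein_szego c n \<in> constr_measures C {0..1}"
    and dual: "\<And>\<nu>. \<nu> \<in> constr_measures C {0..1} \<Longrightarrow> (\<integral>x. poly (weight_poly c n) x \<partial>\<nu>) = eps c n"
  shows "min_measure C = bernstein_szego c n"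
proof -
  \<comment> \<open>Density of \<open>arcsine\<close> with respect to the candidate, that is, the
    reciprocal of the weight in \<open>bernstein_szego\<close>.\<close>
  define r where "r x = poly (weight_poly c n) x / eps c n" for x
  let ?\<mu> = "bernstein_szego c n"
  have rm [measurable]: "r \<in> borel_measurable borel" unfolding r_def by measurable
  have E: "eps c n > 0" using szego_pos_eps[OF pos(1)] by simp
  have rpos: "0 < r x" if "x \<in> {0..1}" for x using weight_poly_pos[OF pos(1) that] E by (simp add: r_def)
  have AE0: "AE x in arcsine. 0 < r x"
    using prob_measuresD(3)[OF arcsine_prob_measure] by eventually_elim (rule rpos)
  have \<mu>: "?\<mu> = density arcsine (\<lambda>x. ennreal (1 / r x))" unfolding bernstein_szego_def r_def by simp
  have sets\<mu> [measurable_cong]: "sets ?\<mu> = sets borel" by (simp add: bernstein_szego_def)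
  have p\<mu>: "prob_space ?\<mu>" using prob_measuresD(1) bernstein_szego(1)[OF pos] by blast
  have dens: "density ?\<mu> (\<lambda>x. ennreal (r x)) = arcsine"
  proof -
    have "density ?\<mu> (\<lambda>x. ennreal (r x)) = density arcsine (\<lambda>x. ennreal (1 / r x) * ennreal (r x))"
      unfolding \<mu> by (rule density_density_eq) auto
    also have "\<dots> = density arcsine (\<lambda>_. 1)"
      by (rule density_cong) (use AE0 in \<open>auto elim!: eventually_mono simp flip: ennreal_mult''\<close>)
    finally show ?thesis by (simp add: density_1)
  qed
  have ac: "absolutely_continuous ?\<mu> arcsine"
    using absolutely_continuousI_density[of "\<lambda>x. ennreal (r x)" ?\<mu>] dens by simp
  have rn: "AE x in arcsine. ln (enn2real (RN_deriv ?\<mu> arcsine x)) = ln (r x)"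
  proof -
    interpret sigma_finite_measure ?\<mu> using p\<mu> by (rule prob_space_imp_sigma_finite)
    have "(\<lambda>x. ennreal (r x)) \<in> borel_measurable ?\<mu>" by measurable
    from RN_deriv_unique[OF this dens] have A: "AE x in ?\<mu>. ennreal (r x) = RN_deriv ?\<mu> arcsine x" .
    have "sets arcsine = sets ?\<mu>" using sets\<mu> by simp
    from absolutely_continuous_AE[OF this ac A]
    have "AE x in arcsine. ennreal (r x) = RN_deriv ?\<mu> arcsine x" .
    then show ?thesis using AE0 by eventually_elim (metis enn2real_ennreal less_imp_le)
  qed
  have ilnr: "integrable arcsine (\<lambda>x. ln (r x))"
  proof (rule integrable_arcsine)
    have "continuous_on {0..1} r" unfolding r_def using E by (intro continuous_intros) auto
    then show "continuous_on {0..1} (\<lambda>x. ln (r x))"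
      by (rule continuous_on_ln) (use rpos in \<open>metis less_irrefl\<close>)
  qed measurable
  define k where "k = (\<integral>x. ln (r x) \<partial>arcsine)"
  have K\<mu>: "rel_entropy arcsine ?\<mu> = ereal k"
  proof -
    have "integrable arcsine (\<lambda>x. ln (enn2real (RN_deriv ?\<mu> arcsine x)))"
      by (rule integrable_cong_AE_imp[OF ilnr]) (use rn in auto)
    moreover have "(\<integral>x. ln (enn2real (RN_deriv ?\<mu> arcsine x)) \<partial>arcsine) = k"
      unfolding k_def by (rule integral_cong_AE) (use rn in auto)
    ultimately show ?thesis using ac by (simp add: rel_entropy_def)
  qed
  have main: "ereal k \<le> rel_entropy arcsine \<nu> \<and> (rel_entropy arcsine \<nu> \<le> ereal k \<longrightarrow> \<nu> = ?\<mu>)"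
    if \<nu>C: "\<nu> \<in> constr_measures C {0..1}" for \<nu>
  proof (cases "absolutely_continuous \<nu> arcsine \<and> integrable arcsine (\<lambda>x. ln (enn2real (RN_deriv \<nu> arcsine x)))")
    case False
    then have "rel_entropy arcsine \<nu> = \<infinity>" by (auto simp: rel_entropy_def)
    then show ?thesis by simp
  next
    case True
    have \<nu>: "\<nu> \<in> prob_measures {0..1}" using \<nu>C by (simp add: constr_measures_def)
    have s\<nu> [measurable_cong]: "sets \<nu> = sets borel" using prob_measuresD(2)[OF \<nu>] .
    interpret \<nu>: prob_space \<nu> using prob_measuresD(1)[OF \<nu>] .
    define f where "f x = enn2real (RN_deriv \<nu> arcsine x)" for x
    have fm [measurable]: "f \<in> borel_measurable borel"
      using borel_measurable_RN_deriv[of \<nu> arcsine] unfolding f_def by (simp add: measurable_cong_sets[OF s\<nu> refl] borel_measurable_enn2real)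
    have f0: "0 \<le> f x" for x by (simp add: f_def)
    have "density \<nu> (RN_deriv \<nu> arcsine) = arcsine"
      by (rule \<nu>.density_RN_deriv) (use True s\<nu> in auto)
    moreover have "AE x in \<nu>. RN_deriv \<nu> arcsine x \<noteq> \<infinity>"
      by (rule \<nu>.RN_deriv_finite)
        (use True s\<nu> prob_measuresD(1)[OF arcsine_prob_measure] in \<open>auto intro: prob_space_imp_sigma_finite\<close>)
    then have "AE x in \<nu>. RN_deriv \<nu> arcsine x = ennreal (f x)"
      by eventually_elim (simp add: f_def top.not_eq_extremum)
    then have "density \<nu> (RN_deriv \<nu> arcsine) = density \<nu> (\<lambda>x. ennreal (f x))"
      by (intro density_cong) auto
    ultimately have d\<nu>: "arcsine = density \<nu> (\<lambda>x. ennreal (f x))" by simp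
    have fpos: "AE x in arcsine. 0 < f x"
      unfolding d\<nu> by (subst AE_density) auto
    have r\<nu>: "AE x in \<nu>. 0 < r x" using prob_measuresD(3)[OF \<nu>] by eventually_elim (rule rpos)
    have "(\<integral>\<^sup>+x. ennreal (r x / f x) \<partial>arcsine) = (\<integral>\<^sup>+x. ennreal (f x) * ennreal (r x / f x) \<partial>\<nu>)"
      unfolding d\<nu> by (rule nn_integral_density) auto
    \<comment> \<open>Only an inequality: where f = 0 the quotient r / f is 0 by convention, and
      \<nu> may charge that set.\<close>
    also have "\<dots> \<le> (\<integral>\<^sup>+x. ennreal (r x) \<partial>\<nu>)"
    proof (rule nn_integral_mono_AE)
      show "AE x in \<nu>. ennreal (f x) * ennreal (r x / f x) \<le> ennreal (r x)"
        using r\<nu> by eventually_elim (use f0 in \<open>simp flip: ennreal_mult'\<close>)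
    qed
    also have "\<dots> = ennreal (\<integral>x. r x \<partial>\<nu>)"
      using r\<nu> prob_measuresD(4)[OF \<nu>]
      by (intro nn_integral_eq_integral) (auto simp: r_def elim!: eventually_mono)
    also have "(\<integral>x. r x \<partial>\<nu>) = 1" using dual[OF \<nu>C] E by (simp add: r_def)
    finally have le1: "(\<integral>\<^sup>+x. ennreal (r x / f x) \<partial>arcsine) \<le> 1" by simp
    have rf0: "AE x in arcsine. 0 \<le> r x / f x" using AE0 fpos by eventually_elim simp
    have irf: "integrable arcsine (\<lambda>x. r x / f x)"
      using le1 rf0 by (intro integrableI_nonneg) (auto intro: le_less_trans)
    have le1': "(\<integral>x. r x / f x \<partial>arcsine) \<le> 1"
      using le1 rf0 irf by (subst (asm) nn_integral_eq_integral) auto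
    have ilnf: "integrable arcsine (\<lambda>x. ln (f x))" using True by (simp add: f_def)
    have K\<nu>: "rel_entropy arcsine \<nu> = ereal (\<integral>x. ln (f x) \<partial>arcsine)"
      using True by (simp add: rel_entropy_def f_def)
    let ?h = "\<lambda>x. ln (f x) - ln (r x) - 1 + r x / f x"
    have ih: "integrable arcsine ?h"
      using ilnf ilnr irf prob_measuresD(4)[OF arcsine_prob_measure, of 1] by simp
    have "prob_space arcsine" using prob_measuresD(1)[OF arcsine_prob_measure] .
    then have Ih: "(\<integral>x. ?h x \<partial>arcsine) = (\<integral>x. ln (f x) \<partial>arcsine) - k - 1 + (\<integral>x. r x / f x \<partial>arcsine)"
      using ilnf ilnr irf prob_measuresD(4)[OF arcsine_prob_measure, of 1]
      by (simp add: k_def prob_space.prob_space)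
    have h0: "AE x in arcsine. 0 \<le> ?h x"
      using AE0 fpos
    proof eventually_elim
      case (elim x)
      then have "ln (r x / f x) \<le> r x / f x - 1" by (intro ln_le_minus_one) simp
      then show ?case using elim by (simp add: ln_div)
    qed
    have "0 \<le> (\<integral>x. ?h x \<partial>arcsine)" using h0 by (rule integral_nonneg_AE)
    then have 1: "ereal k \<le> rel_entropy arcsine \<nu>" using le1' by (simp add: Ih K\<nu>)
    have 2: "\<nu> = ?\<mu>" if "rel_entropy arcsine \<nu> \<le> ereal k"
    proof -
      have "(\<integral>x. ?h x \<partial>arcsine) = 0"
        using that le1' \<open>0 \<le> (\<integral>x. ?h x \<partial>arcsine)\<close> by (simp add: Ih K\<nu>)
      then have "AE x in arcsine. ?h x = 0" using integral_nonneg_eq_0_iff_AE[OF ih h0] by simp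
      then have fr: "AE x in arcsine. f x = r x"
        using AE0 fpos
      proof eventually_elim
        case (elim x)
        then have "ln (r x / f x) = r x / f x - 1" by (simp add: ln_div)
        then have "r x / f x = 1" using elim by (intro ln_eq_minus_one) auto
        then show ?case using elim by simp
      qed
      \<comment> \<open>\<nu> may have a part singular to \<open>arcsine\<close>, so at first only
        domination is available. Applied to a set and to its complement, with both total masses
        equal to 1, it becomes equality.\<close>
      have le: "emeasure ?\<mu> A \<le> emeasure \<nu> A" if A[measurable]: "A \<in> sets borel" for A
      proof -
        have "emeasure ?\<mu> A = (\<integral>\<^sup>+x. ennreal (1 / r x) * indicator A x \<partial>arcsine)"
          unfolding \<mu> by (subst emeasure_density) auto
        also have "\<dots> = (\<integral>\<^sup>+x. ennreal (1 / f x) * indicator A x \<partial>arcsine)"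
          by (rule nn_integral_cong_AE) (use fr in \<open>auto elim!: eventually_mono\<close>)
        also have "\<dots> = (\<integral>\<^sup>+x. ennreal (f x) * (ennreal (1 / f x) * indicator A x) \<partial>\<nu>)"
          unfolding d\<nu> by (rule nn_integral_density) auto
        also have "\<dots> \<le> (\<integral>\<^sup>+x. indicator A x \<partial>\<nu>)"
        proof (rule nn_integral_mono)
          fix x
          have "ennreal (f x) * ennreal (1 / f x) \<le> 1" using f0[of x] by (simp flip: ennreal_mult')
          then show "ennreal (f x) * (ennreal (1 / f x) * indicator A x) \<le> indicator A x"
            by (simp split: split_indicator)
        qed
        also have "\<dots> = emeasure \<nu> A" using s\<nu> by simp
        finally show ?thesis .
      qed
      interpret \<mu>: prob_space ?\<mu> by fact
      show ?thesis
      proof (rule measure_eqI)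
        fix A assume "A \<in> sets \<nu>"
        then have A: "A \<in> sets borel" "- A \<in> sets borel" using s\<nu> by auto
        have "\<mu>.prob A \<le> \<nu>.prob A" "\<mu>.prob (- A) \<le> \<nu>.prob (- A)"
          using le[OF A(1)] le[OF A(2)] by (simp_all add: \<mu>.emeasure_eq_measure \<nu>.emeasure_eq_measure)
        moreover have "space \<nu> = UNIV" "space ?\<mu> = UNIV"
          using sets_eq_imp_space_eq[OF s\<nu>] sets_eq_imp_space_eq[OF sets\<mu>] by simp_all
        then have "\<mu>.prob (- A) = 1 - \<mu>.prob A" "\<nu>.prob (- A) = 1 - \<nu>.prob A"
          using \<mu>.prob_compl[of A] \<nu>.prob_compl[of A] A s\<nu> sets\<mu> by (simp_all add: Compl_eq_Diff_UNIV)
        ultimately have "\<nu>.prob A = \<mu>.prob A" by simp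
        then show "emeasure \<nu> A = emeasure ?\<mu> A" by (simp add: \<mu>.emeasure_eq_measure \<nu>.emeasure_eq_measure)
      qed (simp add: s\<nu> sets\<mu>)
    qed
    show ?thesis using 1 2 by blast
  qed
  show ?thesis
    unfolding min_measure_def
  proof (rule the_equality)
    show "?\<mu> \<in> constr_measures C {0..1} \<and> (\<forall>\<nu>\<in>constr_measures C {0..1}. rel_entropy arcsine ?\<mu> \<le> rel_entropy arcsine \<nu>)"
      unfolding K\<mu> using mem main by blast
    fix \<nu> assume "\<nu> \<in> constr_measures C {0..1} \<and> (\<forall>\<nu>'\<in>constr_measures C {0..1}. rel_entropy arcsine \<nu> \<le> rel_entropy arcsine \<nu>')"
    then have "\<nu> \<in> constr_measures C {0..1}" "rel_entropy arcsine \<nu> \<le> rel_entropy arcsine ?\<mu>"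
      using mem by auto
    then show "\<nu> = ?\<mu>" using main[of \<nu>] unfolding K\<mu> by simp
  qed
qed

section \<open>Moment spaces as limits of positive definite sequences\<close>

lemma sets_borel_of: "sets (borel_of X) = sigma_sets (topspace X) {U. openin X U}"
  unfolding borel_of_def by (rule sets_measure_of) (auto dest: openin_subset)

lemma space_borel_of: "space (borel_of X) = topspace X"
  unfolding borel_of_def by (rule space_measure_of) (auto dest: openin_subset)

lemma openin_borel_of: "openin X U \<Longrightarrow> U \<in> sets (borel_of X)"
  by (auto simp: sets_borel_of)

lemma continuous_map_borel_of:
  assumes "continuous_map X euclidean (f :: 'a \<Rightarrow> 'b::topological_space)"
  shows "f \<in> borel_measurable (borel_of X)"
proof (rule borel_measurableI)
  fix S :: "'b set" assume "open S"
  then have "openin X {x \<in> topspace X. f x \<in> S}"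
    using assms by (auto simp: continuous_map_def)
  moreover have "f -` S \<inter> space (borel_of X) = {x \<in> topspace X. f x \<in> S}"
    by (auto simp: space_borel_of)
  ultimately show "f -` S \<inter> space (borel_of X) \<in> sets (borel_of X)"
    by (simp add: openin_borel_of)
qed

text \<open>For the full countable product the identity is known; an open set over I is pulled back
  from there along extension by 0 outside I. The converse inclusion holds because coordinates are
  continuous.\<close>

lemma sets_borel_of_powertop:
  fixes I :: "'i::countable set"
  shows "sets (borel_of (powertop_real I)) = sets (PiM I (\<lambda>_. borel :: real measure))"
proof (rule antisym)
  let ?P = "PiM I (\<lambda>_. borel :: real measure)"
  have sp: "space ?P = topspace (powertop_real I)" by (simp add: space_PiM)
  show "sets (borel_of (powertop_real I)) \<subseteq> sets ?P"
    unfolding sets_borel_of sp[symmetric]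
  proof (rule sets.sigma_sets_subset)
    show "{U. openin (powertop_real I) U} \<subseteq> sets ?P"
    proof safe
      fix U assume U: "openin (powertop_real I) U"
      have "continuous_map euclidean (powertop_real I) (\<lambda>x::'i \<Rightarrow> real. restrict x I)"
        unfolding euclidean_product_topology[symmetric]
        by (subst continuous_map_componentwise)
          (auto intro!: continuous_map_product_projection)
      then have "open {x::'i \<Rightarrow> real. restrict x I \<in> U}"
        using U by (auto simp: continuous_map_def)
      then have "{x::'i \<Rightarrow> real. restrict x I \<in> U} \<in> sets (PiM UNIV (\<lambda>_::'i. borel :: real measure))"
        by (subst sets_PiM_equal_borel) (rule borel_open)
      moreover have "(\<lambda>x i. if i \<in> I then x i else 0) \<in> measurable ?P (PiM UNIV (\<lambda>_. borel))"
      proof (rule measurable_PiM_single')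
        fix i :: 'i
        show "(\<lambda>x. if i \<in> I then x i else 0) \<in> borel_measurable ?P" by (cases "i \<in> I") auto
      qed (auto simp: space_PiM)
      ultimately have "(\<lambda>x i. if i \<in> I then x i else 0) -` {x. restrict x I \<in> U} \<inter> space ?P \<in> sets ?P"
        by (rule measurable_sets[rotated])
      also have "(\<lambda>x i. if i \<in> I then x i else 0) -` {x. restrict x I \<in> U} \<inter> space ?P = U"
      proof -
        have "restrict (\<lambda>i. if i \<in> I then x i else 0) I = x" if "x \<in> PiE I (\<lambda>_. UNIV)" for x :: "'i \<Rightarrow> real"
          using that by (auto simp: PiE_def extensional_def restrict_def fun_eq_iff)
        moreover have "U \<subseteq> PiE I (\<lambda>_. UNIV)" using openin_subset[OF U] by simp
        ultimately show ?thesis by (auto simp: space_PiM)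
      qed
      finally show "U \<in> sets ?P" .
    qed
  qed
  have "(\<lambda>x. x) \<in> measurable (borel_of (powertop_real I)) ?P"
  proof (rule measurable_PiM_single')
    fix i assume "i \<in> I"
    then show "(\<lambda>x. x i) \<in> borel_measurable (borel_of (powertop_real I))"
      by (intro continuous_map_borel_of continuous_map_product_projection)
  qed (auto simp: space_borel_of)
  note id_meas = this
  show "sets ?P \<subseteq> sets (borel_of (powertop_real I))"
  proof (intro subsetI)
    fix A assume "A \<in> sets ?P"
    moreover from sets.sets_into_space[OF this] have "(\<lambda>x. x) -` A \<inter> space (borel_of (powertop_real I)) = A"
      unfolding sp space_borel_of by auto
    ultimately show "A \<in> sets (borel_of (powertop_real I))"
      using measurable_sets[OF \<open>(\<lambda>x. x) \<in> measurable (borel_of (powertop_real I)) ?P\<close>, of A] by simp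
  qed
qed

interpretation lborel_power: product_sigma_finite "\<lambda>_::nat. lborel :: real measure"
  by standard

abbreviation lborel_on :: "nat set \<Rightarrow> (nat \<Rightarrow> real) measure" where
  "lborel_on F \<equiv> PiM F (\<lambda>_. lborel)"

lemma measurable_coord [measurable]: "j \<in> F \<Longrightarrow> (\<lambda>y. y j) \<in> borel_measurable (lborel_on F)"
  using measurable_component_singleton[of j F "\<lambda>_. lborel :: real measure"] by simp

lemma measurable_szego:
  assumes "\<And>k. k \<le> n \<Longrightarrow> (\<lambda>y. c y k) \<in> borel_measurable M"
  shows "(\<lambda>y. phi (c y) n k) \<in> borel_measurable M" "(\<lambda>y. eps (c y) n) \<in> borel_measurable M"
proof -
  have "(\<forall>k. (\<lambda>y. phi (c y) n k) \<in> borel_measurable M) \<and> (\<lambda>y. eps (c y) n) \<in> borel_measurable M"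
    using assms
  proof (induction n)
    case 0 then show ?case by (simp add: phi_0 eps_0)
  next
    case (Suc n)
    then have [measurable]: "\<And>k. (\<lambda>y. phi (c y) n k) \<in> borel_measurable M" "(\<lambda>y. eps (c y) n) \<in> borel_measurable M"
      by auto
    have [measurable]: "\<And>j. j \<in> {..n} \<Longrightarrow> (\<lambda>y. c y (Suc j)) \<in> borel_measurable M" using Suc.prems by auto
    have [measurable]: "(\<lambda>y. alpha (c y) n) \<in> borel_measurable M" unfolding alpha_def by measurable
    show ?case unfolding phi_Suc eps_Suc by measurable
  qed
  then show "(\<lambda>y. phi (c y) n k) \<in> borel_measurable M" "(\<lambda>y. eps (c y) n) \<in> borel_measurable M" by auto
qed

lemma pred_szego_pos:
  assumes "\<And>k. k \<le> n \<Longrightarrow> (\<lambda>y. c y k) \<in> borel_measurable M"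
  shows "Measurable.pred M (\<lambda>y. szego_pos (c y) n)"
proof -
  have [measurable]: "j \<in> {..n} \<Longrightarrow> (\<lambda>y. eps (c y) j) \<in> borel_measurable M" for j
    using measurable_szego(2)[of j c M] assms by auto
  have "Measurable.pred M (\<lambda>y. \<forall>j\<in>{..n}. 0 < eps (c y) j)" by measurable
  then show ?thesis unfolding szego_pos_def by (simp add: Ball_def)
qed

section \<open>Dependence on the last moment\<close>

lemma trig_upd:
  shows "k \<le> n \<Longrightarrow> trig (m(Suc n := x)) k = trig m k"
    "trig (m(Suc n := x)) (Suc n) = coeff (cheb (Suc n)) (Suc n) * x + trig (m(Suc n := 0)) (Suc n)"
proof -
  show "k \<le> n \<Longrightarrow> trig (m(Suc n := x)) k = trig m k" by (rule trig_cong) auto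
  have s: "{1..Suc n} = insert (Suc n) {1..n}" by auto
  have "(\<Sum>j\<in>{1..n}. coeff (cheb (Suc n)) j * (m(Suc n := z)) j) = (\<Sum>j\<in>{1..n}. coeff (cheb (Suc n)) j * m j)" for z
    by (intro sum.cong) auto
  then show "trig (m(Suc n := x)) (Suc n) = coeff (cheb (Suc n)) (Suc n) * x + trig (m(Suc n := 0)) (Suc n)"
    unfolding trig_eq_dtrig dtrig_def s by (simp del: fun_upd_apply) simp
qed

lemma phi_trig_upd: "phi (trig (m(Suc n := x))) n = phi (trig m) n"
  and eps_trig_upd: "eps (trig (m(Suc n := x))) n = eps (trig m) n"
  and szego_pos_trig_upd: "szego_pos (trig (m(Suc n := x))) n = szego_pos (trig m) n"
  by (auto intro!: phi_cong eps_cong szego_pos_cong trig_upd(1))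

text \<open>The numerator of \<open>alpha\<close> when the next moment is 0. By
  \<open>alpha_trig_upd\<close>, \<open>alpha\<close> is affine in the next moment, and this is its
  intercept multiplied by \<open>eps\<close>.\<close>

definition next_shift :: "(nat \<Rightarrow> real) \<Rightarrow> nat \<Rightarrow> real" where
  "next_shift m n = trig (m(Suc n := 0)) (Suc n) + (\<Sum>j<n. phi (trig m) n j * trig m (Suc j))"

lemma alpha_trig_upd:
  "alpha (trig (m(Suc n := x))) n = (coeff (cheb (Suc n)) (Suc n) * x + next_shift m n) / eps (trig m) n"
proof -
  have "(\<Sum>j<n. phi (trig m) n j * trig (m(Suc n := x)) (Suc j)) = (\<Sum>j<n. phi (trig m) n j * trig m (Suc j))"
    by (intro sum.cong refl) (simp add: trig_upd(1))
  then show ?thesis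
    unfolding alpha_def phi_trig_upd eps_trig_upd next_shift_def
    by (simp add: lessThan_Suc_atMost[symmetric] phi_monic trig_upd(2)[of m n x] del: fun_upd_apply)
qed

text \<open>The boundary of the moment space is a null set because its fibres in the last coordinate are finite.\<close>

lemma singular_fibre_finite:
  "finite {x. toep_psd (trig (m(Suc n := x))) (Suc n) \<and> \<not> szego_pos (trig (m(Suc n := x))) (Suc n)}"
    (is "finite ?S")
proof (cases "szego_pos (trig m) n")
  case False
  have "x = y" if "x \<in> ?S" "y \<in> ?S" for x y
  proof -
    have "trig (m(Suc n := x)) (Suc n) = trig (m(Suc n := y)) (Suc n)"
      by (rule singular_extension_unique[of "trig (m(Suc n := x))" n "trig (m(Suc n := y))"]) (use that False in \<open>auto simp: trig_upd(1) szego_pos_trig_upd\<close>)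
    then show ?thesis using coeff_cheb_pos[of "Suc n"] unfolding trig_upd(2)[of m n x] trig_upd(2)[of m n y] by simp
  qed
  moreover have "finite S" if "\<And>x y. x \<in> S \<Longrightarrow> y \<in> S \<Longrightarrow> x = y" for S :: "real set"
  proof (cases "S = {}")
    case False
    then obtain x where "x \<in> S" by blast
    then have "S \<subseteq> {x}" using that by blast
    then show ?thesis by (rule finite_subset) simp
  qed simp
  ultimately show ?thesis by blast
next
  case True
  let ?k = "coeff (cheb (Suc n)) (Suc n)" and ?e = "eps (trig m) n"
  have k: "?k \<noteq> 0" and e: "?e > 0" using coeff_cheb_pos[of "Suc n"] szego_pos_eps[OF True] by auto
  have "?S \<subseteq> {(?e - next_shift m n) / ?k, (- ?e - next_shift m n) / ?k}"
  proof
    fix x assume x: "x \<in> ?S"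
    let ?c = "trig (m(Suc n := x))"
    have pos: "szego_pos ?c n" using True by (simp add: szego_pos_trig_upd)
    have "0 \<le> eps ?c (Suc n)"
      by (rule form_phi_psd_nonneg[of _ "Suc n"]) (use x szego_pos_eps[OF pos] in \<open>auto simp: less_Suc_eq_le, fastforce\<close>)
    moreover have "\<not> 0 < eps ?c (Suc n)" using x pos by (auto simp: szego_pos_Suc)
    ultimately have "?e * (1 - (alpha ?c n)\<^sup>2) = 0" by (simp add: eps_Suc eps_trig_upd)
    then have "(alpha ?c n)\<^sup>2 = 1" using e by simp
    then have "alpha ?c n = 1 \<or> alpha ?c n = - 1" by (simp add: power2_eq_1_iff)
    then have "?k * x + next_shift m n = ?e \<or> ?k * x + next_shift m n = - ?e"
      unfolding alpha_trig_upd using e by (simp add: divide_eq_eq)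
    then show "x \<in> {(?e - next_shift m n) / ?k, (- ?e - next_shift m n) / ?k}"
      using k by (auto simp: field_simps)
  qed
  then show ?thesis by (rule finite_subset) simp
qed

lemma toep_psd_cong: "(\<And>k. k \<le> n \<Longrightarrow> c k = d k) \<Longrightarrow> toep_psd c n = toep_psd d n"
  unfolding toep_psd_def using form_cong_seq[of n c d] by simp

lemma moment_space_psd: "m \<in> moment_space {0..1} n \<Longrightarrow> toep_psd (trig m) n"
proof -
  assume "m \<in> moment_space {0..1} n"
  then obtain \<mu> where \<mu>: "\<mu> \<in> prob_measures {0..1}" "m = moment_vec n \<mu>" by (auto simp: moment_space_def)
  show ?thesis using toep_psd_moments[OF \<mu>(1), of n] toep_psd_cong[of n "trig m"] trig_moment_vec[of _ n \<mu>] \<mu>(2) by metis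
qed

lemma szego_pos_moment_space:
  assumes "szego_pos (trig m) n" "m \<in> extensional {1..n}"
  shows "m \<in> moment_space {0..1} n"
proof -
  have "m = moment_vec n (bernstein_szego (trig m) n)"
    unfolding moment_vec_def using assms bernstein_szego_moment[OF assms(1)]
    by (auto simp: fun_eq_iff extensional_def)
  then show ?thesis unfolding moment_space_def using bernstein_szego(1)[OF assms(1) trig_0] by blast
qed

lemma trig_arcsine: "trig (\<lambda>j. moment j arcsine) k = (if k = 0 then 1 else 0)"
proof -
  have "((\<lambda>t. Re (cis t ^ k)) has_integral pi * Re (0 ^ k)) {pi..2*pi}"
    by (rule mean_value_half_circle) (auto intro!: holomorphic_intros)
  then have "((\<lambda>t. poly (cheb k) ((1 + cos t) / 2)) has_integral pi * Re (0 ^ k)) {pi..2*pi}"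
    unfolding cheb_cos Complex.DeMoivre by simp
  moreover have "continuous_on {0..1} (poly (cheb k))" by (intro continuous_on_poly continuous_on_id)
  ultimately show ?thesis
    unfolding trig_moment[OF arcsine_prob_measure]
    using integral_arcsine(2)[of "poly (cheb k)"] by (simp add: power_0_left)
qed

lemma szego_pos_arcsine: "szego_pos (trig (\<lambda>j. moment j arcsine)) n"
proof -
  have "eps (trig (\<lambda>j. moment j arcsine)) j = 1" for j
  proof (induction j)
    case (Suc j)
    then show ?case by (simp add: eps_Suc alpha_def trig_arcsine)
  qed (simp add: eps_0 trig_arcsine)
  then show ?thesis by (simp add: szego_pos_def)
qed

text \<open>Contraction towards the arcsine moments moves the whole moment space into its interior, so that
  the moment space becomes a countable intersection of measurable sets.\<close>

definition blend :: "nat \<Rightarrow> (nat \<Rightarrow> real) \<Rightarrow> nat \<Rightarrow> real" where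
  "blend N m j = (1 - 1 / real (N + 2)) * m j + 1 / real (N + 2) * moment j arcsine"

lemma trig_blend_arcsine:
  "trig (blend N m) = (\<lambda>k. (1 - 1 / real (N + 2)) * trig m k + 1 / real (N + 2) * trig (\<lambda>j. moment j arcsine) k)"
  unfolding blend_def by (rule trig_blend)

text \<open>Contraction turns semidefinite into definite. Conversely the Bernstein-Szego measures of
  the contracted points have moments converging to \<open>m\<close>, and
  \<open>moments_closed\<close> supplies a representing measure. The point is that the right-hand
  side is visibly a measurable condition on \<open>m\<close>.\<close>

lemma moment_space_iff_blend:
  assumes "m \<in> extensional {1..n}"
  shows "m \<in> moment_space {0..1} n \<longleftrightarrow> (\<forall>N. szego_pos (trig (blend N m)) n)"
proof
  assume "m \<in> moment_space {0..1} n"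
  then show "\<forall>N. szego_pos (trig (blend N m)) n"
    unfolding trig_blend_arcsine
    by (intro allI szego_pos_blend moment_space_psd szego_pos_arcsine) auto
next
  assume *: "\<forall>N. szego_pos (trig (blend N m)) n"
  have "\<exists>\<nu>\<in>prob_measures {0..1}. \<forall>j\<in>{1..n}. moment j \<nu> = m j"
  proof (rule moments_closed)
    show "bernstein_szego (trig (blend N m)) n \<in> prob_measures {0..1}" for N
      using * bernstein_szego(1)[of "trig (blend N m)" n] trig_0 by simp
    fix j assume j: "j \<in> {1..n}"
    have "(\<lambda>N. 1 / real (N + 2)) \<longlonglongrightarrow> 0"
      using LIMSEQ_ignore_initial_segment[OF lim_1_over_n, of 2] by simp
    then have "(\<lambda>N. (1 - 1 / real (N + 2)) * m j + 1 / real (N + 2) * moment j arcsine) \<longlonglongrightarrow> (1 - 0) * m j + 0 * moment j arcsine"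
      by (intro tendsto_intros)
    then show "(\<lambda>N. moment j (bernstein_szego (trig (blend N m)) n)) \<longlonglongrightarrow> m j"
      using bernstein_szego_moment[OF *[rule_format] j] by (simp add: blend_def)
  qed
  then obtain \<nu> where \<nu>: "\<nu> \<in> prob_measures {0..1}" "\<And>j. j \<in> {1..n} \<Longrightarrow> moment j \<nu> = m j" by blast
  then have "m = moment_vec n \<nu>"
    using assms by (auto simp: moment_vec_def fun_eq_iff extensional_def)
  then show "m \<in> moment_space {0..1} n" unfolding moment_space_def using \<nu>(1) by blast
qed

section \<open>The law of the first moments\<close>

lemma finite_free_indices [simp]: "finite (free_indices C n)"
  by (simp add: free_indices_def)

lemma fill_in_extensional: "fill_in C n y \<in> extensional {1..n}"
  by (simp add: fill_in_def)

lemma top_index_ge: "is_constraint C \<Longrightarrow> i \<in> dom C \<Longrightarrow> 1 \<le> i \<and> i \<le> top_index C"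
  unfolding is_constraint_def top_index_def by (auto intro!: Max_ge Suc_leI gr0I)

lemma free_indices_Suc:
  assumes "is_constraint C" "top_index C \<le> n"
  shows "free_indices C (Suc n) = insert (Suc n) (free_indices C n)" "Suc n \<notin> free_indices C n"
proof -
  have "Suc n \<notin> dom C" using top_index_ge[OF assms(1), of "Suc n"] assms(2) by force
  then show "free_indices C (Suc n) = insert (Suc n) (free_indices C n)" by (auto simp: free_indices_def)
qed (simp add: free_indices_def)

lemma fill_in_upd:
  assumes "is_constraint C" "top_index C \<le> n"
  shows "fill_in C (Suc n) (y(Suc n := x)) = (fill_in C n y)(Suc n := x)"
proof
  fix j
  have "C (Suc n) = None" using top_index_ge[OF assms(1), of "Suc n"] assms(2) by force
  then show "fill_in C (Suc n) (y(Suc n := x)) j = ((fill_in C n y)(Suc n := x)) j"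
    by (cases "j = Suc n") (auto simp: fill_in_def split: option.split)
qed

lemma free_moment_space_iff:
  assumes "is_constraint C" "top_index C \<le> n" "y \<in> extensional (free_indices C n)"
  shows "y \<in> free_moment_space C n \<longleftrightarrow> fill_in C n y \<in> moment_space {0..1} n"
proof
  assume "y \<in> free_moment_space C n"
  then obtain \<mu> where \<mu>: "\<mu> \<in> constr_measures C {0..1}" "y = restrict (moment_vec n \<mu>) (free_indices C n)"
    by (auto simp: free_moment_space_def constr_moment_space_def)
  have "fill_in C n y = moment_vec n \<mu>"
    using \<mu> by (auto simp: fill_in_def moment_vec_def constr_measures_def free_indices_def fun_eq_iff split: option.split)
  then show "fill_in C n y \<in> moment_space {0..1} n"
    using \<mu>(1) by (auto simp: moment_space_def constr_measures_def)
next
  assume "fill_in C n y \<in> moment_space {0..1} n"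
  then obtain \<mu> where \<mu>: "\<mu> \<in> prob_measures {0..1}" "fill_in C n y = moment_vec n \<mu>"
    by (auto simp: moment_space_def)
  have j: "moment j \<mu> = (case C j of Some c \<Rightarrow> c | None \<Rightarrow> y j)" if "j \<in> {1..n}" for j
    using fun_cong[OF \<mu>(2), of j] that by (simp add: fill_in_def moment_vec_def)
  have "\<mu> \<in> constr_measures C {0..1}"
    unfolding constr_measures_def using \<mu>(1) j top_index_ge[OF assms(1)] assms(2)
    by (force split: option.splits)
  moreover have "y = restrict (moment_vec n \<mu>) (free_indices C n)"
    using assms(3) j
    by (auto simp: fun_eq_iff extensional_def free_indices_def moment_vec_def domIff split: option.splits)
  ultimately show "y \<in> free_moment_space C n"
    unfolding free_moment_space_def constr_moment_space_def by blast
qed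

lemma free_moment_space_extensional: "y \<in> free_moment_space C n \<Longrightarrow> y \<in> extensional (free_indices C n)"
  by (auto simp: free_moment_space_def)

lemma measurable_fill_in [measurable]: "(\<lambda>y. fill_in C n y j) \<in> borel_measurable (lborel_on (free_indices C n))"
proof (cases "j \<in> {1..n} \<and> C j = None")
  case True
  then have "j \<in> free_indices C n" by (auto simp: free_indices_def)
  then show ?thesis using True by (simp add: fill_in_def measurable_coord)
next
  case False
  then have "(\<lambda>y. fill_in C n y j) = (\<lambda>y. fill_in C n (\<lambda>_. 0) j)"
    by (auto simp: fill_in_def split: option.split)
  then show ?thesis by simp
qed

lemma measurable_trig_fill [measurable]: "(\<lambda>y. trig (fill_in C n y) k) \<in> borel_measurable (lborel_on (free_indices C n))"
  unfolding trig_eq_dtrig dtrig_def by measurable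

lemma measurable_trig_blend [measurable]: "(\<lambda>y. trig (blend N (fill_in C n y)) k) \<in> borel_measurable (lborel_on (free_indices C n))"
  unfolding trig_blend_arcsine by measurable

lemma pred_szego_fill [measurable]: "Measurable.pred (lborel_on (free_indices C n)) (\<lambda>y. szego_pos (trig (fill_in C n y)) n)"
  by (rule pred_szego_pos) measurable

lemma eps_fill_measurable [measurable]: "(\<lambda>y. eps (trig (fill_in C n y)) n) \<in> borel_measurable (lborel_on (free_indices C n))"
  by (rule measurable_szego) measurable

lemma sets_free_moment_space:
  assumes "is_constraint C" "top_index C \<le> n"
  shows "free_moment_space C n \<in> sets (lborel_on (free_indices C n))"
proof -
  have [measurable]: "Measurable.pred (lborel_on (free_indices C n)) (\<lambda>y. szego_pos (trig (blend N (fill_in C n y))) n)" for N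
    by (rule pred_szego_pos) measurable
  have "free_moment_space C n = {y \<in> space (lborel_on (free_indices C n)). \<forall>N. szego_pos (trig (blend N (fill_in C n y))) n}"
    using free_moment_space_iff[OF assms] moment_space_iff_blend[OF fill_in_extensional, of C n] free_moment_space_extensional[of _ C n]
    by (auto simp: space_PiM PiE_def)
  also have "\<dots> \<in> sets (lborel_on (free_indices C n))" by measurable
  finally show ?thesis .
qed

text \<open>Up to normalization, \<open>slice_weight C l (n - l)\<close> is the density of the free coordinates among the
  first \<open>l\<close> moments under the uniform law of level \<open>n\<close>.\<close>

definition slice_weight :: "moment_constraint \<Rightarrow> nat \<Rightarrow> nat \<Rightarrow> (nat \<Rightarrow> real) \<Rightarrow> ennreal" where
  "slice_weight C n N y =
     (if szego_pos (trig (fill_in C n y)) n then ennreal (eps (trig (fill_in C n y)) n ^ N) else 0)"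

lemma measurable_slice_weight [measurable]:
  "slice_weight C n N \<in> borel_measurable (lborel_on (free_indices C n))"
  unfolding slice_weight_def by measurable

text \<open>A beta integral: what a fibre contributes in the variable a = \<open>alpha\<close>.
  Positivity and finiteness are recorded instead of its value, since it cancels in the
  normalization.\<close>

definition beta_mass :: "nat \<Rightarrow> ennreal" where
  "beta_mass N = (\<integral>\<^sup>+a. ennreal ((1 - a\<^sup>2) ^ N) * indicator {-1<..<1} a \<partial>lborel)"

lemma beta_mass_bounds: "0 < beta_mass N" "beta_mass N < \<infinity>"
proof -
  have "beta_mass N \<le> (\<integral>\<^sup>+a. indicator {-1<..<1::real} a \<partial>lborel)"
    unfolding beta_mass_def
  proof (intro nn_integral_mono)
    fix a :: real
    have "ennreal ((1 - a\<^sup>2) ^ N) \<le> 1" if "a \<in> {-1<..<1}"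
    proof -
      have "a\<^sup>2 \<le> 1" using that by (simp add: abs_square_le_1 abs_le_iff)
      then show ?thesis by (simp add: power_le_one)
    qed
    then show "ennreal ((1 - a\<^sup>2) ^ N) * indicator {-1<..<1} a \<le> indicator {-1<..<1} a"
      by (simp split: split_indicator)
  qed
  also have "\<dots> = 2" by simp
  finally show "beta_mass N < \<infinity>" by (rule le_less_trans) simp
  \<comment> \<open>On |a| <= 1/2, an interval of length 1, the integrand is at least
    (3/4)^N.\<close>
  have "ennreal ((3 / 4) ^ N) = (\<integral>\<^sup>+a. ennreal ((3 / 4) ^ N) * indicator {-(1/2)..1/2::real} a \<partial>lborel)"
    by (subst nn_integral_cmult) auto
  also have "\<dots> \<le> beta_mass N"
    unfolding beta_mass_def
  proof (intro nn_integral_mono)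
    fix a :: real
    have "ennreal ((3 / 4) ^ N) \<le> ennreal ((1 - a\<^sup>2) ^ N)" if "a \<in> {-(1/2)..1/2}"
    proof -
      have "\<bar>a\<bar> \<le> \<bar>1 / 2\<bar>" using that by auto
      then have "a\<^sup>2 \<le> (1 / 2)\<^sup>2" by (rule abs_le_square_iff[THEN iffD1])
      then have "3 / 4 \<le> 1 - a\<^sup>2" by (simp add: power2_eq_square)
      then show ?thesis by (intro ennreal_leI power_mono) auto
    qed
    then show "ennreal ((3 / 4) ^ N) * indicator {-(1/2)..1/2} a \<le> ennreal ((1 - a\<^sup>2) ^ N) * indicator {-1<..<1} a"
      by (auto split: split_indicator)
  qed
  finally show "0 < beta_mass N" by (rule less_le_trans[rotated]) simp
qed

text \<open>The next moment is affine in \<open>alpha\<close> with slope \<open>eps\<close> divided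
  by the leading Chebyshev coefficient, and the new error is \<open>eps\<close> (1 - a^2). The
  Jacobian contributes one more factor \<open>eps\<close>, which raises the exponent from N to N +
  1.\<close>

lemma fibre_integral:
  assumes "is_constraint C" "top_index C \<le> n"
  shows "(\<integral>\<^sup>+x. slice_weight C (Suc n) N (y(Suc n := x)) \<partial>lborel)
     = ennreal (1 / coeff (cheb (Suc n)) (Suc n)) * beta_mass N * slice_weight C n (Suc N) y"
proof -
  define m where "m = fill_in C n y"
  define k where "k = coeff (cheb (Suc n)) (Suc n)"
  define e where "e = eps (trig m) n"
  define s where "s = next_shift m n"
  have k: "k > 0" by (simp add: k_def coeff_cheb_pos)
  have W: "slice_weight C (Suc n) N (y(Suc n := x)) =
    (if szego_pos (trig m) n \<and> 0 < e * (1 - ((k * x + s) / e)\<^sup>2) then ennreal ((e * (1 - ((k * x + s) / e)\<^sup>2)) ^ N) else 0)" for x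
    unfolding slice_weight_def fill_in_upd[OF assms] szego_pos_Suc eps_Suc szego_pos_trig_upd alpha_trig_upd eps_trig_upd
      m_def[symmetric] k_def[symmetric] e_def[symmetric] s_def[symmetric] by simp
  show ?thesis
  proof (cases "szego_pos (trig m) n")
    case False
    then show ?thesis unfolding W by (simp add: slice_weight_def m_def)
  next
    case True
    then have e: "e > 0" by (simp add: e_def szego_pos_eps)
    let ?f = "\<lambda>x. if 0 < e * (1 - ((k * x + s) / e)\<^sup>2) then ennreal ((e * (1 - ((k * x + s) / e)\<^sup>2)) ^ N) else 0"
    have "(\<integral>\<^sup>+x. slice_weight C (Suc n) N (y(Suc n := x)) \<partial>lborel) = (\<integral>\<^sup>+x. ?f x \<partial>lborel)"
      unfolding W using True by simp
    \<comment> \<open>The affine substitution under which the new variable a is \<open>alpha\<close>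
      itself.\<close>
    also have "\<dots> = ennreal \<bar>e / k\<bar> * (\<integral>\<^sup>+a. ?f (- s / k + e / k * a) \<partial>lborel)"
      by (rule nn_integral_real_affine) (use e k in auto)
    also have "(\<lambda>a. ?f (- s / k + e / k * a)) = (\<lambda>a. ennreal (e ^ N) * (ennreal ((1 - a\<^sup>2) ^ N) * indicator {-1<..<1} a))"
    proof
      fix a
      have "(k * (- s / k + e / k * a) + s) / e = a" using e k by (simp add: field_simps)
      moreover have "0 < e * (1 - a\<^sup>2) \<longleftrightarrow> a \<in> {-1<..<1}"
        using e by (simp add: zero_less_mult_iff abs_square_less_1 abs_less_iff) auto
      ultimately show "?f (- s / k + e / k * a) = ennreal (e ^ N) * (ennreal ((1 - a\<^sup>2) ^ N) * indicator {-1<..<1} a)"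
        using e by (simp add: power_mult_distrib ennreal_mult' split: split_indicator)
    qed
    also have "(\<integral>\<^sup>+a. ennreal (e ^ N) * (ennreal ((1 - a\<^sup>2) ^ N) * indicator {-1<..<1} a) \<partial>lborel) = ennreal (e ^ N) * beta_mass N"
      unfolding beta_mass_def by (subst nn_integral_cmult) auto
    also have "ennreal \<bar>e / k\<bar> * (ennreal (e ^ N) * beta_mass N) = ennreal (1 / k) * beta_mass N * ennreal (e ^ Suc N)"
    proof -
      have "ennreal \<bar>e / k\<bar> = ennreal (1 / k) * ennreal e" using e k by (simp flip: ennreal_mult')
      moreover have "ennreal (e ^ Suc N) = ennreal e * ennreal (e ^ N)" using e by (simp add: ennreal_mult')
      ultimately show ?thesis by (simp add: mult_ac)
    qed
    finally have "(\<integral>\<^sup>+x. slice_weight C (Suc n) N (y(Suc n := x)) \<partial>lborel) = ennreal (1 / k) * beta_mass N * ennreal (e ^ Suc N)" .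
    moreover have "slice_weight C n (Suc N) y = ennreal (e ^ Suc N)"
      using True by (simp add: slice_weight_def m_def e_def)
    ultimately show ?thesis unfolding k_def by (simp only:)
  qed
qed

text \<open>Iteration of \<open>fibre_integral\<close> from the top coordinate down. Each step adds
  1 to the exponent, so the induction on d quantifies over N. The constant K is chosen before f;
  comparison with f = 1 therefore makes it cancel.\<close>

lemma slice_integral:
  assumes "is_constraint C" "top_index C \<le> l"
  shows "\<exists>K. 0 < K \<and> K < \<infinity> \<and> (\<forall>f. f \<in> borel_measurable (lborel_on (free_indices C l)) \<longrightarrow>
     (\<integral>\<^sup>+y. f (restrict y (free_indices C l)) * slice_weight C (l + d) N y \<partial>lborel_on (free_indices C (l + d)))
     = K * (\<integral>\<^sup>+y. f y * slice_weight C l (N + d) y \<partial>lborel_on (free_indices C l)))"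
proof (induction d arbitrary: N)
  case 0
  have base: "(\<integral>\<^sup>+y. f (restrict y (free_indices C l)) * slice_weight C l N y \<partial>lborel_on (free_indices C l))
     = (\<integral>\<^sup>+y. f y * slice_weight C l N y \<partial>lborel_on (free_indices C l))" for f
    by (intro nn_integral_cong) (simp add: space_PiM PiE_restrict)
  show ?case
  proof (intro exI[of _ 1] conjI allI impI)
    fix f :: "(nat \<Rightarrow> real) \<Rightarrow> ennreal"
    show "(\<integral>\<^sup>+y. f (restrict y (free_indices C l)) * slice_weight C (l + 0) N y \<partial>lborel_on (free_indices C (l + 0)))
       = 1 * (\<integral>\<^sup>+y. f y * slice_weight C l (N + 0) y \<partial>lborel_on (free_indices C l))"
      using base[of f] by (simp only: add_0_right mult_1)
  qed simp_all
next
  case (Suc d)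
  define n where "n = l + d"
  have n: "top_index C \<le> n" using assms by (simp add: n_def)
  obtain K where K: "0 < K" "K < \<infinity>" "\<And>f. f \<in> borel_measurable (lborel_on (free_indices C l)) \<Longrightarrow>
     (\<integral>\<^sup>+y. f (restrict y (free_indices C l)) * slice_weight C n (Suc N) y \<partial>lborel_on (free_indices C n))
     = K * (\<integral>\<^sup>+y. f y * slice_weight C l (Suc N + d) y \<partial>lborel_on (free_indices C l))"
    using Suc.IH[of "Suc N"] unfolding n_def by blast
  define B where "B = ennreal (1 / coeff (cheb (Suc n)) (Suc n)) * beta_mass N"
  have "0 < ennreal (1 / coeff (cheb (Suc n)) (Suc n))" using coeff_cheb_pos[of "Suc n"] by simp
  then have B: "0 < B" "B < \<infinity>"
    unfolding B_def using beta_mass_bounds[of N] by (auto simp: ennreal_zero_less_mult_iff ennreal_mult_less_top)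
  note F = free_indices_Suc[OF assms(1) n]
  have sub: "free_indices C l \<subseteq> free_indices C n" by (auto simp: free_indices_def n_def)
  have eq: "(\<integral>\<^sup>+y. f (restrict y (free_indices C l)) * slice_weight C (Suc n) N y \<partial>lborel_on (free_indices C (Suc n)))
     = (B * K) * (\<integral>\<^sup>+y. f y * slice_weight C l (N + Suc d) y \<partial>lborel_on (free_indices C l))"
    if f [measurable]: "f \<in> borel_measurable (lborel_on (free_indices C l))" for f
  proof -
    have r [measurable]: "(\<lambda>y. restrict y (free_indices C l)) \<in> measurable (lborel_on (free_indices C n)) (lborel_on (free_indices C l))"
      using sub by (rule measurable_restrict_subset)
    have r' [measurable]: "(\<lambda>y. restrict y (free_indices C l)) \<in> measurable (lborel_on (free_indices C (Suc n))) (lborel_on (free_indices C l))"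
      by (rule measurable_restrict_subset) (use sub F in auto)
    have "(\<integral>\<^sup>+y. f (restrict y (free_indices C l)) * slice_weight C (Suc n) N y \<partial>lborel_on (free_indices C (Suc n)))
      = (\<integral>\<^sup>+y. \<integral>\<^sup>+x. f (restrict (y(Suc n := x)) (free_indices C l)) * slice_weight C (Suc n) N (y(Suc n := x)) \<partial>lborel \<partial>lborel_on (free_indices C n))"
      unfolding F(1)
      by (rule lborel_power.product_nn_integral_insert[OF finite_free_indices F(2)]) (unfold F(1)[symmetric], measurable)
    also have "\<dots> = (\<integral>\<^sup>+y. f (restrict y (free_indices C l)) * (B * slice_weight C n (Suc N) y) \<partial>lborel_on (free_indices C n))"
    proof (intro nn_integral_cong)
      fix y assume y: "y \<in> space (lborel_on (free_indices C n))"
      have re: "restrict (y(Suc n := x)) (free_indices C l) = restrict y (free_indices C l)" for x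
        using sub F(2) by (auto simp: restrict_def fun_eq_iff)
      have [measurable]: "(\<lambda>x. y(Suc n := x)) \<in> measurable lborel (lborel_on (free_indices C (Suc n)))"
        unfolding F(1) using y by (intro measurable_fun_upd[where J="free_indices C n"]) auto
      show "(\<integral>\<^sup>+x. f (restrict (y(Suc n := x)) (free_indices C l)) * slice_weight C (Suc n) N (y(Suc n := x)) \<partial>lborel)
          = f (restrict y (free_indices C l)) * (B * slice_weight C n (Suc N) y)"
        unfolding re fibre_integral[OF assms(1) n, symmetric] B_def by (rule nn_integral_cmult) measurable
    qed
    also have "\<dots> = (\<integral>\<^sup>+y. B * (f (restrict y (free_indices C l)) * slice_weight C n (Suc N) y) \<partial>lborel_on (free_indices C n))"
      by (simp add: mult_ac)
    also have "\<dots> = B * (K * (\<integral>\<^sup>+y. f y * slice_weight C l (N + Suc d) y \<partial>lborel_on (free_indices C l)))"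
      by (subst nn_integral_cmult) (simp_all add: K(3)[OF f])
    finally show ?thesis by (simp add: mult.assoc)
  qed
  have "0 < B * K" "B * K < \<infinity>" using B K by (auto simp: ennreal_zero_less_mult_iff ennreal_mult_less_top)
  then show ?case
  proof (intro exI[of _ "B * K"] conjI allI impI)
    fix f :: "(nat \<Rightarrow> real) \<Rightarrow> ennreal"
    assume "f \<in> borel_measurable (lborel_on (free_indices C l))"
    from eq[OF this] show "(\<integral>\<^sup>+y. f (restrict y (free_indices C l)) * slice_weight C (l + Suc d) N y \<partial>lborel_on (free_indices C (l + Suc d)))
       = B * K * (\<integral>\<^sup>+y. f y * slice_weight C l (N + Suc d) y \<partial>lborel_on (free_indices C l))"
      by (simp only: n_def add_Suc_right)
  qed
qed

text \<open>Fubini in the last coordinate: over each base point the points of the moment space that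
  are not positive definite are finite in number by \<open>singular_fibre_finite\<close>. The level
  is \<open>Suc n\<close> with \<open>top_index C\<close> at most n, so that the last coordinate is
  free.\<close>

lemma AE_free_moment_space:
  assumes "is_constraint C" "top_index C \<le> n"
  shows "AE y in lborel_on (free_indices C (Suc n)).
    y \<in> free_moment_space C (Suc n) \<longleftrightarrow> szego_pos (trig (fill_in C (Suc n) y)) (Suc n)"
proof -
  let ?M = "lborel_on (free_indices C (Suc n))"
  have n': "top_index C \<le> Suc n" using assms by simp
  note F = free_indices_Suc[OF assms]
  have [measurable]: "free_moment_space C (Suc n) \<in> sets ?M" by (rule sets_free_moment_space[OF assms(1) n'])
  define D where "D = {y \<in> space ?M. y \<in> free_moment_space C (Suc n) \<and> \<not> szego_pos (trig (fill_in C (Suc n) y)) (Suc n)}"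
  have D [measurable]: "D \<in> sets ?M" unfolding D_def by measurable
  have "emeasure ?M D = (\<integral>\<^sup>+y. indicator D y \<partial>?M)" by simp
  also have "\<dots> = (\<integral>\<^sup>+y. \<integral>\<^sup>+x. indicator D (y(Suc n := x)) \<partial>lborel \<partial>lborel_on (free_indices C n))"
    unfolding F(1)
    by (rule lborel_power.product_nn_integral_insert[OF finite_free_indices F(2)]) (unfold F(1)[symmetric], measurable)
  also have "\<dots> = (\<integral>\<^sup>+y. 0 \<partial>lborel_on (free_indices C n))"
  proof (intro nn_integral_cong)
    fix y
    let ?m = "fill_in C n y"
    let ?S = "{x. toep_psd (trig (?m(Suc n := x))) (Suc n) \<and> \<not> szego_pos (trig (?m(Suc n := x))) (Suc n)}"
    have S: "finite ?S" by (rule singular_fibre_finite)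
    have "x \<in> ?S" if "y(Suc n := x) \<in> D" for x
    proof -
      have "toep_psd (trig (fill_in C (Suc n) (y(Suc n := x)))) (Suc n)"
        using that free_moment_space_iff[OF assms(1) n'] free_moment_space_extensional[of _ C "Suc n"]
        by (intro moment_space_psd) (auto simp: D_def)
      then show ?thesis using that by (simp add: D_def fill_in_upd[OF assms] del: fun_upd_apply)
    qed
    then have "(\<integral>\<^sup>+x. indicator D (y(Suc n := x)) \<partial>lborel) \<le> (\<integral>\<^sup>+x. indicator ?S x \<partial>lborel)"
      by (intro nn_integral_mono) (auto split: split_indicator)
    also have "\<dots> = 0" by (subst nn_integral_indicator) (use finite_imp_null_set_lborel[OF S] in auto)
    finally show "(\<integral>\<^sup>+x. indicator D (y(Suc n := x)) \<partial>lborel) = 0" by simp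
  qed
  finally have "D \<in> null_sets ?M" using D by (simp add: null_sets_def)
  then have "AE y in ?M. y \<notin> D" by (rule AE_not_in)
  moreover have "AE y in ?M. y \<in> space ?M" by (rule AE_space)
  ultimately show ?thesis
  proof eventually_elim
    case (elim y)
    then have ext: "y \<in> extensional (free_indices C (Suc n))" by (auto simp: space_PiM PiE_def)
    have "y \<in> free_moment_space C (Suc n)" if "szego_pos (trig (fill_in C (Suc n) y)) (Suc n)"
      using szego_pos_moment_space[OF that fill_in_extensional] free_moment_space_iff[OF assms(1) n' ext] by simp
    then show ?case using elim by (auto simp: D_def)
  qed
qed

definition scale_map :: "moment_constraint \<Rightarrow> nat \<Rightarrow> (nat \<Rightarrow> real) \<Rightarrow> real \<Rightarrow> (nat \<Rightarrow> real) \<Rightarrow> nat \<Rightarrow> real" where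
  "scale_map C l b s y = (\<lambda>j\<in>{1..l}. s * (fill_in C l y j - b j))"

lemma measurable_fill_in_map:
  "fill_in C n \<in> measurable (lborel_on (free_indices C n)) (borel_of (Rspace n))"
proof -
  have "fill_in C n \<in> measurable (lborel_on (free_indices C n)) (PiM {1..n} (\<lambda>_. borel))"
  proof (rule measurable_PiM_single')
    show "(\<lambda>y. fill_in C n y i) \<in> borel_measurable (lborel_on (free_indices C n))" for i by measurable
  qed (auto simp: fill_in_def)
  then show ?thesis using measurable_cong_sets[OF refl sets_borel_of_powertop] by blast
qed

lemma measurable_affine_map:
  assumes "l \<le> n"
  shows "(\<lambda>m. \<lambda>j\<in>{1..l}. s * (m j - b j)) \<in> measurable (borel_of (Rspace n)) (borel_of (Rspace l))"
proof -
  have "(\<lambda>m. \<lambda>j\<in>{1..l}. s * (m j - b j)) \<in> measurable (PiM {1..n} (\<lambda>_. borel)) (PiM {1..l} (\<lambda>_. borel))"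
  proof (rule measurable_PiM_single')
    fix j assume "j \<in> {1..l}"
    then have [measurable]: "(\<lambda>m. m j) \<in> borel_measurable (PiM {1..n} (\<lambda>_. borel :: real measure))"
      using assms by (intro measurable_component_singleton) auto
    have "(\<lambda>m. s * (m j - b j)) \<in> borel_measurable (PiM {1..n} (\<lambda>_. borel))" by measurable
    then show "(\<lambda>m. (\<lambda>j\<in>{1..l}. s * (m j - b j)) j) \<in> borel_measurable (PiM {1..n} (\<lambda>_. borel))"
      using \<open>j \<in> {1..l}\<close> by simp
  qed auto
  then show ?thesis using measurable_cong_sets[OF sets_borel_of_powertop sets_borel_of_powertop] by blast
qed

lemma measurable_scale_map: "scale_map C l b s \<in> measurable (lborel_on (free_indices C l)) (borel_of (Rspace l))"
proof -
  have "scale_map C l b s = (\<lambda>m. \<lambda>j\<in>{1..l}. s * (m j - b j)) \<circ> fill_in C l"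
    by (rule ext) (simp only: scale_map_def o_def)
  then show ?thesis
    using measurable_comp[OF measurable_fill_in_map measurable_affine_map[OF order_refl]] by (simp only:)
qed

text \<open>Up to a null set, \<open>slice_weight C n 0\<close> is the indicator of the moment space
  of level n. Integrating out n - l coordinates produces the exponent n - l and a factor K that
  occurs both in the integral and in the total volume. The strict inequality l < n provides a last
  free coordinate to which \<open>AE_free_moment_space\<close> applies.\<close>

lemma scaled_law_eq:
  assumes C: "is_constraint C" "top_index C \<le> l" and n: "l < n"
    and Z: "Z = (\<integral>\<^sup>+y. slice_weight C l (n - l) y \<partial>lborel_on (free_indices C l))" "0 < Z" "Z < \<infinity>"
  shows "scaled_law C l s n = distr (density (lborel_on (free_indices C l)) (\<lambda>y. slice_weight C l (n - l) y / Z))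
     (borel_of (Rspace l)) (scale_map C l (\<lambda>j. moment j (min_measure C)) (s n))"
proof -
  let ?b = "\<lambda>j. moment j (min_measure C)"
  let ?M = "lborel_on (free_indices C n)" and ?L = "lborel_on (free_indices C l)"
  let ?A = "free_moment_space C n"
  obtain n' where n': "n = Suc n'" "l \<le> n'" using n by (cases n) auto
  have tn: "top_index C \<le> n" "top_index C \<le> n'" using C n' by auto
  have A [measurable]: "?A \<in> sets ?M" by (rule sets_free_moment_space[OF C(1) tn(1)])
  obtain K where K: "0 < K" "K < \<infinity>" "\<And>f. f \<in> borel_measurable ?L \<Longrightarrow>
     (\<integral>\<^sup>+y. f (restrict y (free_indices C l)) * slice_weight C n 0 y \<partial>?M)
     = K * (\<integral>\<^sup>+y. f y * slice_weight C l (n - l) y \<partial>?L)"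
    using slice_integral[OF C, of "n - l" 0] n by auto
  have ind: "AE y in ?M. indicator ?A y = slice_weight C n 0 y"
    using AE_free_moment_space[OF C(1) tn(2)] unfolding n'(1)[symmetric]
    by eventually_elim (auto simp: slice_weight_def)
  have eA: "emeasure ?M ?A = K * Z"
  proof -
    have "emeasure ?M ?A = (\<integral>\<^sup>+y. indicator ?A y \<partial>?M)" by simp
    also have "\<dots> = (\<integral>\<^sup>+y. 1 * slice_weight C n 0 y \<partial>?M)"
      by (rule nn_integral_cong_AE) (use ind in auto)
    also have "\<dots> = K * Z" using K(3)[of "\<lambda>_. 1"] Z by simp
    finally show ?thesis .
  qed
  have fm: "fill_in C n \<in> measurable (uniform_measure ?M ?A) (borel_of (Rspace n))"
    using measurable_fill_in_map measurable_cong_sets[of "uniform_measure ?M ?A" ?M "borel_of (Rspace n)" "borel_of (Rspace n)"]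
    by simp
  have am: "(\<lambda>m. \<lambda>j\<in>{1..l}. s n * (m j - ?b j)) \<in> measurable (borel_of (Rspace n)) (borel_of (Rspace l))"
    using n by (intro measurable_affine_map) simp
  have S: "(\<lambda>j\<in>{1..l}. s n * (fill_in C n y j - ?b j)) = scale_map C l ?b (s n) (restrict y (free_indices C l))" for y
    using n by (auto simp: scale_map_def fill_in_def free_indices_def fun_eq_iff domIff split: option.split)
  show ?thesis
  proof (rule measure_eqI)
    fix B assume "B \<in> sets (scaled_law C l s n)"
    then have B: "B \<in> sets (borel_of (Rspace l))" by (simp add: scaled_law_def)
    define g where "g y = (indicator B (scale_map C l ?b (s n) y) :: ennreal)" for y
    have gm [measurable]: "g \<in> borel_measurable ?L"
      unfolding g_def using measurable_scale_map B by measurable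
    have "emeasure (scaled_law C l s n) B = (\<integral>\<^sup>+x. indicator B x \<partial>scaled_law C l s n)"
      using B by (simp add: scaled_law_def)
    also have "\<dots> = (\<integral>\<^sup>+m. indicator B (\<lambda>j\<in>{1..l}. s n * (m j - ?b j)) \<partial>uniform_moments C n)"
      unfolding scaled_law_def
    proof (rule nn_integral_distr)
      show "(\<lambda>m. \<lambda>j\<in>{1..l}. s n * (m j - ?b j)) \<in> measurable (uniform_moments C n) (borel_of (Rspace l))"
        using am unfolding uniform_moments_def measurable_distr_eq1 .
    qed (use B in simp)
    also have "\<dots> = (\<integral>\<^sup>+y. indicator B (\<lambda>j\<in>{1..l}. s n * (fill_in C n y j - ?b j)) \<partial>uniform_measure ?M ?A)"
      unfolding uniform_moments_def
      by (rule nn_integral_distr[OF fm])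
        (unfold measurable_distr_eq1, rule measurable_compose[OF am borel_measurable_indicator[OF B]])
    also have "\<dots> = (\<integral>\<^sup>+y. g (restrict y (free_indices C l)) \<partial>uniform_measure ?M ?A)"
      by (simp only: g_def S)
    also have "\<dots> = (\<integral>\<^sup>+y. g (restrict y (free_indices C l)) * indicator ?A y \<partial>?M) / emeasure ?M ?A"
    proof -
      have "(\<lambda>y. restrict y (free_indices C l)) \<in> measurable ?M ?L"
        by (rule measurable_restrict_subset) (use n in \<open>auto simp: free_indices_def\<close>)
      then have "(\<lambda>y. g (restrict y (free_indices C l))) \<in> borel_measurable ?M" by measurable
      then show ?thesis using A by (rule nn_integral_uniform_measure)
    qed
    also have "(\<integral>\<^sup>+y. g (restrict y (free_indices C l)) * indicator ?A y \<partial>?M)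
       = (\<integral>\<^sup>+y. g (restrict y (free_indices C l)) * slice_weight C n 0 y \<partial>?M)"
      by (rule nn_integral_cong_AE) (use ind in auto)
    also have "\<dots> = K * (\<integral>\<^sup>+y. g y * slice_weight C l (n - l) y \<partial>?L)" by (rule K(3)[OF gm])
    also have "\<dots> / emeasure ?M ?A = (\<integral>\<^sup>+y. g y * slice_weight C l (n - l) y \<partial>?L) / Z"
      unfolding eA using K(1,2) divide_mult_eq[of K _ Z] by (simp add: mult.commute[of K])
    also have "\<dots> = (\<integral>\<^sup>+y. slice_weight C l (n - l) y / Z * g y \<partial>?L)"
      by (subst nn_integral_divide[symmetric]) (auto simp: divide_ennreal_def mult_ac)
    also have "\<dots> = emeasure (distr (density ?L (\<lambda>y. slice_weight C l (n - l) y / Z)) (borel_of (Rspace l)) (scale_map C l ?b (s n))) B"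
    proof -
      have m: "scale_map C l ?b (s n) \<in> measurable (density ?L (\<lambda>y. slice_weight C l (n - l) y / Z)) (borel_of (Rspace l))"
        using measurable_scale_map by simp
      have pm: "scale_map C l ?b (s n) -` B \<inter> space ?L \<in> sets ?L"
        by (rule measurable_sets[OF measurable_scale_map B])
      show ?thesis
        unfolding emeasure_distr[OF m B] space_density
        by (subst emeasure_density[OF _ pm]) (auto intro!: nn_integral_cong simp: g_def split: split_indicator)
    qed
    finally show "emeasure (scaled_law C l s n) B =
       emeasure (distr (density ?L (\<lambda>y. slice_weight C l (n - l) y / Z)) (borel_of (Rspace l)) (scale_map C l ?b (s n))) B" .
  qed (simp add: scaled_law_def)
qed

section \<open>The optimal moment vector\<close>

definition on_free :: "moment_constraint \<Rightarrow> nat \<Rightarrow> (nat \<Rightarrow> real) \<Rightarrow> nat \<Rightarrow> real" where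
  "on_free C l h = (\<lambda>j. if j \<in> free_indices C l then h j else 0)"

lemma fill_in_add:
  "j \<in> {1..l} \<Longrightarrow> fill_in C l (\<lambda>i. y i + h i) j = fill_in C l y j + on_free C l h j"
  by (auto simp: fill_in_def on_free_def free_indices_def domIff split: option.split)

lemma trig_fill_add: "k \<le> l \<Longrightarrow> trig (fill_in C l (\<lambda>i. y i + h i)) k = trig (fill_in C l y) k + dtrig (on_free C l h) k"
  unfolding trig_add[symmetric] by (rule trig_cong) (simp add: fill_in_add)

lemma moment_bounds: "\<mu> \<in> prob_measures {0..1} \<Longrightarrow> 0 \<le> moment j \<mu> \<and> moment j \<mu> \<le> 1"
proof -
  assume \<mu>: "\<mu> \<in> prob_measures {0..1}"
  interpret prob_space \<mu> using prob_measuresD(1)[OF \<mu>] .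
  have i: "integrable \<mu> (\<lambda>x. x ^ j)" using \<mu> by (simp add: prob_measures_def)
  have "AE x in \<mu>. 0 \<le> x ^ j" "AE x in \<mu>. x ^ j \<le> 1"
    using prob_measuresD(3)[OF \<mu>] by (eventually_elim, simp add: power_le_one)+
  moreover from this have "(\<integral>x. x ^ j \<partial>\<mu>) \<le> (\<integral>x. 1 \<partial>\<mu>)"
    using i by (intro integral_mono_AE) auto
  ultimately show ?thesis unfolding moment_def
    using integral_nonneg_AE[where M=\<mu> and f="\<lambda>x. x ^ j"] by (simp add: prob_space)
qed

lemma szego_pos_bounds: "szego_pos (trig m) n \<Longrightarrow> j \<in> {1..n} \<Longrightarrow> 0 \<le> m j \<and> m j \<le> 1"
  using moment_bounds[OF bernstein_szego(1)[of "trig m" n], of j] bernstein_szego_moment[of m n j] trig_0 by simp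

text \<open>Each further moment is chosen so that \<open>alpha\<close> vanishes, which keeps the
  prediction error constant.\<close>

lemma szego_pos_extend:
  assumes "szego_pos (trig m) i" "i \<le> l"
  shows "\<exists>m'. szego_pos (trig m') l \<and> (\<forall>j\<le>i. m' j = m j)"
  using assms(2)
proof (induction l rule: dec_induct)
  case base then show ?case using assms by blast
next
  case (step n)
  then obtain m' where m': "szego_pos (trig m') n" "\<forall>j\<le>i. m' j = m j" by blast
  define x where "x = - next_shift m' n / coeff (cheb (Suc n)) (Suc n)"
  have "alpha (trig (m'(Suc n := x))) n = 0"
    unfolding alpha_trig_upd x_def using coeff_cheb_pos[of "Suc n"] by simp
  then have "szego_pos (trig (m'(Suc n := x))) (Suc n)"
    unfolding szego_pos_Suc eps_Suc szego_pos_trig_upd eps_trig_upd using m'(1) szego_pos_eps[OF m'(1), of n] by simp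
  moreover have "\<forall>j\<le>i. (m'(Suc n := x)) j = m j" using m'(2) step by auto
  ultimately show ?case by blast
qed

text \<open>An interior point can be pushed slightly away from the arcsine moments within the moment
  space; it is then a proper mixture of a semidefinite point and the definite arcsine point.\<close>

lemma interior_moment_space_szego_pos:
  assumes "m \<in> Rspace n interior_of moment_space {0..1} n"
  shows "szego_pos (trig m) n"
proof -
  obtain U where U: "openin (Rspace n) U" "m \<in> U" "U \<subseteq> moment_space {0..1} n"
    using assms by (auto simp: interior_of_def)
  have mext: "m \<in> extensional {1..n}" using openin_subset[OF U(1)] U(2) by (auto simp: PiE_def)
  let ?a = "\<lambda>j. moment j arcsine"
  let ?p = "\<lambda>t. \<lambda>j\<in>{1..n}. m j + t * (m j - ?a j)"
  have "continuous_map euclideanreal (Rspace n) ?p"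
    by (subst continuous_map_componentwise) (auto intro!: continuous_intros)
  then have "open {t. ?p t \<in> U}" using U(1) by (auto simp: continuous_map_def)
  moreover have "?p 0 = m" using mext by (auto simp: fun_eq_iff extensional_def)
  then have "0 \<in> {t. ?p t \<in> U}" using U(2) by simp
  ultimately obtain e where e: "e > 0" "ball 0 e \<subseteq> {t. ?p t \<in> U}" by (rule openE)
  define t where "t = e / 2"
  have t: "t > 0" using e by (simp add: t_def)
  have "t \<in> ball 0 e" using e by (simp add: t_def)
  then have "t \<in> {t. ?p t \<in> U}" using e(2) by (rule subsetD[rotated])
  then have pU: "?p t \<in> U" by (rule CollectD)
  then have psd: "toep_psd (trig (?p t)) n" using U(3) by (intro moment_space_psd) (rule subsetD)
  \<comment> \<open>The mixing weight that undoes the push: (1 - s)(1 + t) = 1, and the arcsine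
    terms cancel.\<close>
  define s where "s = t / (1 + t)"
  have s: "0 < s" "s \<le> 1" "(1 - s) * (1 + t) = 1" "s = (1 - s) * t" using t by (auto simp: s_def field_simps)
  have "szego_pos (\<lambda>k. (1 - s) * trig (?p t) k + s * trig ?a k) n"
    by (rule szego_pos_blend[OF psd szego_pos_arcsine s(1,2)])
  moreover have "(1 - s) * trig (?p t) k + s * trig ?a k = trig m k" if "k \<le> n" for k
  proof -
    have "(1 - s) * trig (?p t) k + s * trig ?a k = trig (\<lambda>j. (1 - s) * ?p t j + s * ?a j) k"
      by (simp only: trig_blend)
    also have "\<dots> = trig m k"
    proof (rule trig_cong)
      fix j assume "j \<in> {1..k}"
      then have "(1 - s) * ?p t j + s * ?a j = (1 - s) * (1 + t) * m j + (s - (1 - s) * t) * ?a j"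
        using that by (simp add: algebra_simps)
      then show "(1 - s) * ?p t j + s * ?a j = m j" using s by simp
    qed
    finally show ?thesis .
  qed
  ultimately show ?thesis using szego_pos_cong[of n "\<lambda>k. (1 - s) * trig (?p t) k + s * trig ?a k" "trig m"] by blast
qed

lemma admissible_szego_pos:
  assumes "is_constraint C" "admissible C {0..1}" "top_index C \<le> l"
  shows "\<exists>y. szego_pos (trig (fill_in C l y)) l"
proof -
  obtain m where m: "m \<in> constr_moment_space C {0..1} (top_index C)"
     "m \<in> Rspace (top_index C) interior_of moment_space {0..1} (top_index C)"
    using assms(2) by (auto simp: admissible_def)
  obtain m' where m': "szego_pos (trig m') l" "\<forall>j\<le>top_index C. m' j = m j"
    using szego_pos_extend[OF interior_moment_space_szego_pos[OF m(2)] assms(3)] by blast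
  obtain \<mu> where \<mu>: "\<mu> \<in> constr_measures C {0..1}" "m = moment_vec (top_index C) \<mu>"
    using m(1) by (auto simp: constr_moment_space_def)
  have "fill_in C l m' j = m' j" if "j \<in> {1..l}" for j
  proof (cases "C j")
    case (Some c)
    then have "1 \<le> j \<and> j \<le> top_index C" using top_index_ge[OF assms(1)] by blast
    then show ?thesis using Some \<mu> m'(2) that by (auto simp: fill_in_def moment_vec_def constr_measures_def)
  qed (use that in \<open>simp add: fill_in_def\<close>)
  then have "trig (fill_in C l m') k = trig m' k" if "k \<le> l" for k using that by (intro trig_cong) auto
  then show ?thesis using m'(1) szego_pos_cong[of l "trig (fill_in C l m')" "trig m'"] by blast
qed

lemma form_tendsto:
  assumes "\<And>k. k \<le> n \<Longrightarrow> (\<lambda>N. c N k) \<longlonglongrightarrow> d k"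
  shows "(\<lambda>N. form (c N) n u v) \<longlonglongrightarrow> form d n u v"
  unfolding form_sum by (intro tendsto_sum tendsto_mult tendsto_const assms) auto

text \<open>A maximizing sequence has a convergent subsequence, but its limit might lie on the
  boundary. It does not: on monic vectors of every degree j the forms are bounded below by the
  errors along the sequence, and this bound passes to the limit as the supremum s > 0.\<close>

lemma eps_maximizer:
  assumes "\<exists>y. szego_pos (trig (fill_in C l y)) l"
  shows "\<exists>y. szego_pos (trig (fill_in C l y)) l \<and>
    (\<forall>x. szego_pos (trig (fill_in C l x)) l \<longrightarrow> eps (trig (fill_in C l x)) l \<le> eps (trig (fill_in C l y)) l)"
proof -
  let ?P = "\<lambda>y. szego_pos (trig (fill_in C l y)) l" and ?e = "\<lambda>y. eps (trig (fill_in C l y)) l"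
  define S where "S = ?e ` {y. ?P y}"
  define s where "s = Sup S"
  have "?e y \<le> 1" if "?P y" for y using eps_antimono[OF that, of 0] by (simp add: eps_0 trig_0)
  then have bdd: "bdd_above S" unfolding S_def by (intro bdd_aboveI[of _ 1]) auto
  have ne: "S \<noteq> {}" using assms by (auto simp: S_def)
  have up: "?e y \<le> s" if "?P y" for y unfolding s_def using bdd that by (intro cSup_upper) (auto simp: S_def)
  have s0: "s > 0" using assms up szego_pos_eps[of _ l l] by (meson less_le_trans order_refl)
  have "\<exists>y. ?P y \<and> s - s / real (N + 2) < ?e y" for N
  proof -
    have "s - s / real (N + 2) < s" using s0 by simp
    then obtain z where "z \<in> S" "s - s / real (N + 2) < z" unfolding s_def using less_cSupD[OF ne] by blast
    then show ?thesis by (auto simp: S_def)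
  qed
  then obtain Y where Y: "\<And>N. ?P (Y N)" "\<And>N. s - s / real (N + 2) < ?e (Y N)" by metis
  \<comment> \<open>Setting all other coordinates to 0 places the sequence in the compact cube
    [0,1]^nat without changing \<open>fill_in\<close>.\<close>
  define X where "X N = on_free C l (Y N)" for N
  have VX: "fill_in C l (X N) = fill_in C l (Y N)" for N
    by (auto simp: fill_in_def X_def on_free_def free_indices_def fun_eq_iff domIff split: option.split)
  have Xb: "X N j \<in> {0..1}" for N j
  proof (cases "j \<in> free_indices C l")
    case True
    then have "fill_in C l (Y N) j = Y N j" by (auto simp: fill_in_def free_indices_def domIff split: option.split)
    then show ?thesis using szego_pos_bounds[OF Y(1)[of N], of j] True by (auto simp: X_def on_free_def free_indices_def)
  qed (simp add: X_def on_free_def)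
  have "compactin (product_topology (\<lambda>_::nat. euclideanreal) UNIV) (PiE UNIV (\<lambda>_. {0..1}))"
    by (subst compactin_PiE) (auto simp: compactin_euclidean_iff)
  then have "compact (PiE UNIV (\<lambda>_::nat. {0..1::real}))"
    by (simp add: euclidean_product_topology compactin_euclidean_iff)
  then have "seq_compact (PiE UNIV (\<lambda>_::nat. {0..1::real}))" by (rule compact_imp_seq_compact)
  moreover have "\<forall>N. X N \<in> PiE UNIV (\<lambda>_. {0..1})" using Xb by auto
  ultimately obtain x r where r: "strict_mono (r :: nat \<Rightarrow> nat)" and lim: "(X \<circ> r) \<longlonglongrightarrow> x"
    unfolding seq_compact_def by blast
  have limj: "(\<lambda>N. X (r N) j) \<longlonglongrightarrow> x j" for j
    using continuous_on_tendsto_compose[OF continuous_on_product_coordinates[of j] lim] by (simp add: o_def)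
  have limc: "(\<lambda>N. trig (fill_in C l (Y (r N))) k) \<longlonglongrightarrow> trig (fill_in C l x) k" for k
  proof -
    have "(\<lambda>N. fill_in C l (X (r N)) j) \<longlonglongrightarrow> fill_in C l x j" for j
      using limj by (cases "j \<in> {1..l}"; cases "C j") (auto simp: fill_in_def)
    then show ?thesis unfolding VX[symmetric] trig_eq_dtrig dtrig_def by (intro tendsto_intros)
  qed
  let ?c = "\<lambda>N. trig (fill_in C l (Y (r N)))"
  have elim: "(\<lambda>N. s - s / real (r N + 2)) \<longlonglongrightarrow> s"
  proof -
    have "(\<lambda>N. s * (1 / real (N + 2))) \<longlonglongrightarrow> s * 0"
      by (intro tendsto_mult tendsto_const) (use LIMSEQ_ignore_initial_segment[OF lim_1_over_n, of 2] in simp)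
    then have "(\<lambda>N. s - s / real (N + 2)) \<longlonglongrightarrow> s - 0" by (intro tendsto_diff) auto
    from LIMSEQ_subseq_LIMSEQ[OF this r] show ?thesis by (simp add: o_def)
  qed
  have ge: "s \<le> form (trig (fill_in C l x)) l v v" if v: "j \<le> l" "v j = 1" "\<And>i. i > j \<Longrightarrow> v i = 0" for j v
  proof (rule LIMSEQ_le[OF elim form_tendsto[OF limc]])
    have "s - s / real (r N + 2) \<le> form (?c N) l v v" for N
    proof -
      have "s - s / real (r N + 2) \<le> eps (?c N) l" using Y(2)[of "r N"] by simp
      also have "\<dots> \<le> eps (?c N) j" by (rule eps_antimono[OF Y(1) v(1)])
      also have "\<dots> \<le> form (?c N) j v v" using form_lower[OF szego_pos_mono[OF Y(1) v(1)], of v] v(2) by simp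
      also have "\<dots> = form (?c N) l v v" by (rule form_supp[symmetric]) (use v in auto)
      finally show ?thesis .
    qed
    then show "\<exists>N0. \<forall>N\<ge>N0. s - s / real (r N + 2) \<le> form (?c N) l v v" by blast
  qed
  have Px: "?P x" by (rule szego_posI) (use ge s0 less_le_trans in blast)
  have "?e x = form (trig (fill_in C l x)) l (phi (trig (fill_in C l x)) l) (phi (trig (fill_in C l x)) l)"
    by (rule form_phi_phi[symmetric]) (rule szego_pos_nonzero[OF Px])
  also have "\<dots> \<ge> s" by (rule ge[of l]) (auto simp: phi_monic phi_above)
  finally show ?thesis using Px up order_trans by blast
qed

lemma first_var_scale: "first_var c n (\<lambda>k. t * d k) = t * first_var c n d"
  unfolding first_var_def form_sum by (simp add: sum_distrib_left mult_ac)

lemma second_var_scale: "second_var c n (\<lambda>k. t * d k) = t\<^sup>2 * second_var c n d"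
proof -
  have "form (\<lambda>k. t * d k) n u v = t * form d n u v" for u v
    unfolding form_sum by (simp add: sum_distrib_left mult_ac)
  then show ?thesis unfolding second_var_def by (simp add: sum_distrib_left power_mult_distrib)
qed

lemma seq_norm_scale: "seq_norm (\<lambda>k. t * d k) n = \<bar>t\<bar> * seq_norm d n"
  unfolding seq_norm_def by (simp add: sum_distrib_left abs_mult)

lemma eps_fill_add:
  "eps (trig (fill_in C l (\<lambda>i. y i + h i))) l = eps (\<lambda>k. trig (fill_in C l y) k + dtrig (on_free C l h) k) l"
  "szego_pos (trig (fill_in C l (\<lambda>i. y i + h i))) l = szego_pos (\<lambda>k. trig (fill_in C l y) k + dtrig (on_free C l h) k) l"
  by (auto intro!: eps_cong szego_pos_cong trig_fill_add)

text \<open>A step of length r along the sign of the first variation a would gain r |a| and lose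
  only O(r^2) by \<open>eps_expansion\<close>, contradicting maximality for small r.\<close>

lemma critical_point:
  assumes P: "szego_pos (trig (fill_in C l y)) l"
    and max: "\<And>x. szego_pos (trig (fill_in C l x)) l \<Longrightarrow> eps (trig (fill_in C l x)) l \<le> eps (trig (fill_in C l y)) l"
  shows "first_var (trig (fill_in C l y)) l (dtrig (on_free C l h)) = 0"
proof (rule ccontr)
  let ?c = "trig (fill_in C l y)" and ?d = "dtrig (on_free C l h)"
  define a where "a = first_var ?c l ?d"
  define w where "w = second_var ?c l ?d"
  define S where "S = seq_norm ?d l"
  assume "first_var ?c l ?d \<noteq> 0"
  then have a: "\<bar>a\<bar> > 0" by (simp add: a_def)
  obtain \<delta> K where \<delta>: "\<delta> > 0" "K \<ge> 0" "\<And>e. seq_norm e l \<le> \<delta> \<Longrightarrow> szego_pos (\<lambda>k. ?c k + e k) l \<and>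
     \<bar>eps (\<lambda>k. ?c k + e k) l - (eps ?c l + first_var ?c l e - second_var ?c l e)\<bar> \<le> K * seq_norm e l ^ 3"
    using eps_expansion[OF P] by blast
  have S: "S \<ge> 0" and w: "w \<ge> 0" using seq_norm_nonneg second_var_nonneg[OF P] by (auto simp: S_def w_def)
  have bound: "\<bar>a\<bar> \<le> r * w + K * S ^ 3 * r\<^sup>2" if r: "0 < r" "r * S \<le> \<delta>" for r
  proof -
    define t where "t = r * sgn a"
    have t: "\<bar>t\<bar> = r" "t * a = r * \<bar>a\<bar>" "t\<^sup>2 = r\<^sup>2"
      using r a by (auto simp: t_def abs_mult abs_sgn_eq power_mult_distrib sgn_if abs_if)
    have n: "seq_norm (\<lambda>k. t * ?d k) l = r * S" by (simp add: seq_norm_scale S_def t)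
    have d: "dtrig (on_free C l (\<lambda>i. t * h i)) = (\<lambda>k. t * ?d k)"
    proof -
      have "on_free C l (\<lambda>i. t * h i) = (\<lambda>j. t * on_free C l h j + 0 * 0)" by (auto simp: on_free_def)
      then show ?thesis using dtrig_lin[of t "on_free C l h" 0 "\<lambda>_. 0"] by auto
    qed
    from \<delta>(3)[of "\<lambda>k. t * ?d k"] r n
    have pos: "szego_pos (\<lambda>k. ?c k + t * ?d k) l"
      and e: "\<bar>eps (\<lambda>k. ?c k + t * ?d k) l - (eps ?c l + t * a - t\<^sup>2 * w)\<bar> \<le> K * (r * S) ^ 3"
      by (auto simp: first_var_scale second_var_scale a_def w_def)
    have "eps (\<lambda>k. ?c k + t * ?d k) l \<le> eps ?c l"
      using max[of "\<lambda>i. y i + t * h i"] pos unfolding eps_fill_add d by simp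
    then have "r * \<bar>a\<bar> \<le> r\<^sup>2 * w + K * (r * S) ^ 3" using e t by auto
    also have "\<dots> = r * (r * w + K * S ^ 3 * r\<^sup>2)" by (simp add: power2_eq_square power3_eq_cube algebra_simps)
    finally show ?thesis using r by simp
  qed
  define D where "D = w + K * S ^ 3 + 1"
  have KS: "0 \<le> K * S ^ 3" using \<delta> S by simp
  have D: "D > 0" using w KS by (simp add: D_def)
  \<comment> \<open>Small enough for the expansion to apply (r S <= \<delta>), for r^2 <= r, and for
    the loss r D to be at most half of |a|.\<close>
  define r where "r = min (min 1 (\<delta> / (S + 1))) (\<bar>a\<bar> / (2 * D))"
  have r: "0 < r" "r \<le> 1" "r \<le> \<delta> / (S + 1)" "r \<le> \<bar>a\<bar> / (2 * D)" using \<delta> S a D by (auto simp: r_def)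
  have "r * S \<le> r * (S + 1)" using r by simp
  also have "\<dots> \<le> \<delta>" using r S by (simp add: pos_le_divide_eq)
  finally have "\<bar>a\<bar> \<le> r * w + K * S ^ 3 * r\<^sup>2" using bound r by blast
  also have "\<dots> \<le> r * w + K * S ^ 3 * r"
    using r KS by (intro add_left_mono mult_left_mono) (auto simp: power2_eq_square mult_left_le)
  also have "\<dots> \<le> r * D" using r by (simp add: D_def algebra_simps)
  also have "\<dots> \<le> \<bar>a\<bar> / 2" using r D by (simp add: field_simps)
  finally show False using a by simp
qed

text \<open>\<open>form_dtrig\<close> turns criticality in the direction of a free moment into the
  vanishing of that coefficient of \<open>weight_poly\<close>. Since its degree is at most l, every
  feasible measure gives it the same integral as the candidate, which is the hypothesis
  \<open>dual\<close> of \<open>min_measure_eqI\<close>.\<close>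

lemma min_measure_moments:
  assumes C: "is_constraint C" "top_index C \<le> l"
    and P: "szego_pos (trig (fill_in C l y)) l"
    and max: "\<And>x. szego_pos (trig (fill_in C l x)) l \<Longrightarrow> eps (trig (fill_in C l x)) l \<le> eps (trig (fill_in C l y)) l"
    and j: "j \<in> {1..l}"
  shows "moment j (min_measure C) = fill_in C l y j"
proof -
  let ?c = "trig (fill_in C l y)"
  let ?\<mu> = "bernstein_szego ?c l"
  have \<mu>: "?\<mu> \<in> prob_measures {0..1}" by (rule bernstein_szego(1)[OF P trig_0])
  have mom: "moment i ?\<mu> = fill_in C l y i" if "i \<in> {1..l}" for i by (rule bernstein_szego_moment[OF P that])
  have domC: "i \<in> {1..l}" if "C i = Some c" for i c using top_index_ge[OF C(1), of i] C(2) that by force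
  have zero: "coeff (weight_poly ?c l) i = 0" if i: "i \<in> free_indices C l" for i
  proof -
    let ?h = "\<lambda>k. if k = i then 1 else (0::real)"
    have "on_free C l ?h = ?h" using i by (auto simp: on_free_def)
    then have "0 = first_var ?c l (dtrig ?h)" using critical_point[OF P max, of ?h] by simp
    also have "\<dots> = (\<Sum>k\<in>{1..l}. coeff (weight_poly ?c l) k * ?h k)"
      unfolding first_var_def form_dtrig weight_poly_def ..
    also have "\<dots> = (\<Sum>k\<in>{1..l}. if k = i then coeff (weight_poly ?c l) k else 0)"
      by (intro sum.cong) auto
    also have "\<dots> = coeff (weight_poly ?c l) i" using i by (simp add: free_indices_def)
    finally show ?thesis by simp
  qed
  have deg: "degree (weight_poly ?c l) \<le> l" by (simp add: weight_poly_def degree_form_poly)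
  have "min_measure C = ?\<mu>"
  proof (rule min_measure_eqI[OF P trig_0])
    show mem: "?\<mu> \<in> constr_measures C {0..1}"
      using \<mu> mom domC by (auto simp: constr_measures_def fill_in_def)
    have base: "(\<integral>x. poly (weight_poly ?c l) x \<partial>?\<mu>) = eps ?c l"
    proof -
      have "(\<integral>x. poly (weight_poly ?c l) x \<partial>?\<mu>) = form (trig (\<lambda>j. moment j ?\<mu>)) l (phi ?c l) (phi ?c l)"
        unfolding form_integral[OF \<mu>] weight_poly_def poly_form_poly ..
      also have "\<dots> = form ?c l (phi ?c l) (phi ?c l)"
        by (rule form_cong_seq) (rule bernstein_szego(2)[OF P trig_0])
      also have "\<dots> = eps ?c l" by (rule form_phi_phi) (rule szego_pos_nonzero[OF P])
      finally show ?thesis .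
    qed
    fix \<nu> assume \<nu>: "\<nu> \<in> constr_measures C {0..1}"
    then have \<nu>': "\<nu> \<in> prob_measures {0..1}" by (simp add: constr_measures_def)
    have "coeff (weight_poly ?c l) i * moment i \<nu> = coeff (weight_poly ?c l) i * moment i ?\<mu>" if "i \<in> {1..l}" for i
      using zero[of i] that \<nu> mem by (cases "C i") (auto simp: free_indices_def constr_measures_def domIff)
    then have "(\<integral>x. poly (weight_poly ?c l) x \<partial>\<nu>) = (\<integral>x. poly (weight_poly ?c l) x \<partial>?\<mu>)"
      unfolding integral_poly_moments[OF \<nu>' deg] integral_poly_moments[OF \<mu> deg]
      by (intro arg_cong2[of _ _ _ _ "(+)"] refl sum.cong)
    then show "(\<integral>x. poly (weight_poly ?c l) x \<partial>\<nu>) = eps ?c l" using base by simp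
  qed
  then show ?thesis using mom[OF j] by simp
qed

text \<open>The Hessian of -ln \<open>eps\<close> in the free moments when y is critical: the first
  variation vanishes there, so it is the form 2 \<open>second_var\<close> / \<open>eps\<close>, a
  sum of squares of linear forms (see \<open>quad_hess\<close>).\<close>

definition hess :: "moment_constraint \<Rightarrow> nat \<Rightarrow> (nat \<Rightarrow> real) \<Rightarrow> nat \<Rightarrow> nat \<Rightarrow> real" where
  "hess C l y i k = (let c = trig (fill_in C l y) in 2 / eps c l *
     (\<Sum>j<l. coeff (form_poly l (phi c j) (phi c l)) i * coeff (form_poly l (phi c j) (phi c l)) k / eps c j))"

definition quad :: "nat set \<Rightarrow> (nat \<Rightarrow> nat \<Rightarrow> real) \<Rightarrow> (nat \<Rightarrow> real) \<Rightarrow> real" where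
  "quad F A h = (\<Sum>i\<in>F. \<Sum>k\<in>F. A i k * h i * h k)"

lemma hess_sym: "hess C l y i k = hess C l y k i"
  unfolding hess_def by (simp add: Let_def mult.commute)

lemma quad_hess:
  "quad (free_indices C l) (hess C l y) h
     = 2 / eps (trig (fill_in C l y)) l * second_var (trig (fill_in C l y)) l (dtrig (on_free C l h))"
proof -
  let ?c = "trig (fill_in C l y)" and ?F = "free_indices C l"
  define b where "b j i = coeff (form_poly l (phi ?c j) (phi ?c l)) i" for j i
  have f: "form (dtrig (on_free C l h)) l (phi ?c j) (phi ?c l) = (\<Sum>i\<in>?F. b j i * h i)" for j
    unfolding form_dtrig b_def
    by (rule sum.mono_neutral_cong_right) (auto simp: on_free_def free_indices_def)
  have "quad ?F (hess C l y) h = (\<Sum>i\<in>?F. \<Sum>k\<in>?F. \<Sum>j<l. 2 / eps ?c l * ((b j i * h i) * (b j k * h k) / eps ?c j))"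
    unfolding quad_def hess_def Let_def b_def[symmetric] by (simp add: sum_distrib_left sum_distrib_right mult_ac)
  also have "\<dots> = (\<Sum>i\<in>?F. \<Sum>j<l. \<Sum>k\<in>?F. 2 / eps ?c l * ((b j i * h i) * (b j k * h k) / eps ?c j))"
    by (rule sum.cong[OF refl sum.swap])
  also have "\<dots> = (\<Sum>j<l. \<Sum>i\<in>?F. \<Sum>k\<in>?F. 2 / eps ?c l * ((b j i * h i) * (b j k * h k) / eps ?c j))"
    by (rule sum.swap)
  also have "\<dots> = 2 / eps ?c l * second_var ?c l (dtrig (on_free C l h))"
    unfolding second_var_def f power2_eq_square sum_product
    by (simp add: sum_distrib_left sum_divide_distrib)
  finally show ?thesis .
qed

section \<open>Triangular coordinates\<close>

text \<open>The affine map v + B z with B lower triangular in the order of the indices.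
  Triangularity reduces the change of variables to one-dimensional substitutions.\<close>

definition tri :: "(nat \<Rightarrow> nat \<Rightarrow> real) \<Rightarrow> nat set \<Rightarrow> (nat \<Rightarrow> real) \<Rightarrow> (nat \<Rightarrow> real) \<Rightarrow> nat \<Rightarrow> real" where
  "tri B F v z = (\<lambda>k\<in>F. v k + (\<Sum>j\<in>{j\<in>F. j \<le> k}. B k j * z j))"

lemma measurable_tri [measurable]: "tri B F v \<in> measurable (lborel_on F) (lborel_on F)"
  unfolding tri_def by (rule measurable_restrict) measurable

lemma tri_insert_old:
  assumes "\<And>j. j \<in> F \<Longrightarrow> j < k" "i \<in> F"
  shows "tri B (insert k F) v z i = tri B F v z i"
proof -
  have "{j \<in> insert k F. j \<le> i} = {j \<in> F. j \<le> i}" using assms by fastforce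
  then show ?thesis using assms(2) by (simp add: tri_def)
qed

lemma tri_insert_new:
  assumes "finite F" "\<And>j. j \<in> F \<Longrightarrow> j < k"
  shows "tri B (insert k F) v z k = v k + (\<Sum>j\<in>F. B k j * z j) + B k k * z k"
proof -
  have "{j \<in> insert k F. j \<le> k} = insert k F" using assms by (auto simp: less_imp_le)
  moreover have "k \<notin> F" using assms(2) by blast
  ultimately show ?thesis using assms(1) by (simp add: tri_def)
qed

lemma tri_cong: "(\<And>j. j \<in> F \<Longrightarrow> z j = w j) \<Longrightarrow> tri B F v z = tri B F v w"
  unfolding tri_def by (intro restrict_ext arg_cong2[of _ _ _ _ "(+)"] refl sum.cong) auto

text \<open>Induction on the largest index k: Fubini splits it off, the induction hypothesis
  transforms the other coordinates, and with these fixed the last one undergoes an affine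
  substitution of slope \<open>B k k\<close>. No earlier coordinate involves it.\<close>

lemma nn_integral_triangular:
  assumes "finite F" "\<And>k. k \<in> F \<Longrightarrow> B k k \<noteq> 0" "f \<in> borel_measurable (lborel_on F)"
  shows "(\<integral>\<^sup>+x. f x \<partial>lborel_on F) = ennreal (\<Prod>k\<in>F. \<bar>B k k\<bar>) * (\<integral>\<^sup>+z. f (tri B F v z) \<partial>lborel_on F)"
  using assms
proof (induction F arbitrary: f rule: finite_linorder_max_induct)
  case empty
  have "tri B {} v z = z" if "z \<in> space (lborel_on {})" for z
    using that by (auto simp: tri_def space_PiM PiE_def extensional_def)
  then show ?case by (simp cong: nn_integral_cong)
next
  case (insert k F)
  have kF: "k \<notin> F" using insert.hyps by blast
  have lt: "\<And>j. j \<in> F \<Longrightarrow> j < k" using insert.hyps by blast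
  have B: "B k k \<noteq> 0" using insert.prems by simp
  have f [measurable]: "f \<in> borel_measurable (lborel_on (insert k F))" by fact
  have upd [measurable]: "(\<lambda>(x, y). x(k := y)) \<in> measurable (lborel_on F \<Otimes>\<^sub>M lborel) (lborel_on (insert k F))"
    using measurable_add_dim[of k F "\<lambda>_. lborel :: real measure"] by simp
  have g [measurable]: "(\<lambda>x. \<integral>\<^sup>+y. f (x(k := y)) \<partial>lborel) \<in> borel_measurable (lborel_on F)"
  proof (rule lborel.borel_measurable_nn_integral)
    show "(\<lambda>(x, y). f (x(k := y))) \<in> borel_measurable (lborel_on F \<Otimes>\<^sub>M lborel)"
      using measurable_compose[OF upd f] by (simp add: case_prod_beta')
  qed
  have g' : "(\<lambda>z. \<integral>\<^sup>+t. f (tri B (insert k F) v (z(k := t))) \<partial>lborel) \<in> borel_measurable (lborel_on F)"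
  proof (rule lborel.borel_measurable_nn_integral)
    show "(\<lambda>(z, t). f (tri B (insert k F) v (z(k := t)))) \<in> borel_measurable (lborel_on F \<Otimes>\<^sub>M lborel)"
      using measurable_compose[OF measurable_compose[OF upd measurable_tri] f] by (simp add: case_prod_beta')
  qed
  have "(\<integral>\<^sup>+x. f x \<partial>lborel_on (insert k F)) = (\<integral>\<^sup>+x. \<integral>\<^sup>+y. f (x(k := y)) \<partial>lborel \<partial>lborel_on F)"
    by (rule lborel_power.product_nn_integral_insert[OF insert.hyps(1) kF f])
  also have "\<dots> = ennreal (\<Prod>k\<in>F. \<bar>B k k\<bar>) * (\<integral>\<^sup>+z. \<integral>\<^sup>+y. f ((tri B F v z)(k := y)) \<partial>lborel \<partial>lborel_on F)"
    by (rule insert.IH[OF _ g]) (use insert.prems in auto)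
  also have "(\<integral>\<^sup>+z. \<integral>\<^sup>+y. f ((tri B F v z)(k := y)) \<partial>lborel \<partial>lborel_on F)
     = (\<integral>\<^sup>+z. ennreal \<bar>B k k\<bar> * (\<integral>\<^sup>+t. f (tri B (insert k F) v (z(k := t))) \<partial>lborel) \<partial>lborel_on F)"
  proof (intro nn_integral_cong)
    fix z assume z: "z \<in> space (lborel_on F)"
    let ?t0 = "v k + (\<Sum>j\<in>F. B k j * z j)"
    have [measurable]: "(\<lambda>y. (tri B F v z)(k := y)) \<in> measurable lborel (lborel_on (insert k F))"
      by (intro measurable_fun_upd[where J=F]) (use kF measurable_space[OF measurable_tri z] in auto)
    have "(\<integral>\<^sup>+y. f ((tri B F v z)(k := y)) \<partial>lborel) = ennreal \<bar>B k k\<bar> * (\<integral>\<^sup>+t. f ((tri B F v z)(k := ?t0 + B k k * t)) \<partial>lborel)"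
      by (rule nn_integral_real_affine[OF _ B]) measurable
    also have "(\<lambda>t. f ((tri B F v z)(k := ?t0 + B k k * t))) = (\<lambda>t. f (tri B (insert k F) v (z(k := t))))"
    proof
      fix t
      have "(tri B F v z)(k := ?t0 + B k k * t) = tri B (insert k F) v (z(k := t))"
      proof
        fix i
        have zz: "tri B F v (z(k := t)) = tri B F v z" using kF by (intro tri_cong) auto
        have s: "(\<Sum>j\<in>F. B k j * (z(k := t)) j) = (\<Sum>j\<in>F. B k j * z j)" using kF by (intro sum.cong) auto
        consider "i = k" | "i \<in> F" | "i \<notin> insert k F" by blast
        then show "((tri B F v z)(k := ?t0 + B k k * t)) i = tri B (insert k F) v (z(k := t)) i"
        proof cases
          case 1 then show ?thesis using tri_insert_new[OF insert.hyps(1) lt, of B v "z(k := t)"] s by simp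
        next
          case 2 then show ?thesis using tri_insert_old[OF lt 2, of B v "z(k := t)"] zz kF by auto
        next
          case 3 then show ?thesis by (auto simp: tri_def)
        qed
      qed
      then show "f ((tri B F v z)(k := ?t0 + B k k * t)) = f (tri B (insert k F) v (z(k := t)))" by simp
    qed
    finally show "(\<integral>\<^sup>+y. f ((tri B F v z)(k := y)) \<partial>lborel) = ennreal \<bar>B k k\<bar> * (\<integral>\<^sup>+t. f (tri B (insert k F) v (z(k := t))) \<partial>lborel)" .
  qed
  also have "\<dots> = ennreal \<bar>B k k\<bar> * (\<integral>\<^sup>+z. \<integral>\<^sup>+t. f (tri B (insert k F) v (z(k := t))) \<partial>lborel \<partial>lborel_on F)"
    by (rule nn_integral_cmult[OF g'])
  also have "(\<integral>\<^sup>+z. \<integral>\<^sup>+t. f (tri B (insert k F) v (z(k := t))) \<partial>lborel \<partial>lborel_on F) = (\<integral>\<^sup>+z. f (tri B (insert k F) v z) \<partial>lborel_on (insert k F))"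
    by (rule lborel_power.product_nn_integral_insert[OF insert.hyps(1) kF, symmetric]) measurable
  finally show ?case using kF insert.hyps(1)
    by (simp add: ennreal_mult' mult.assoc mult.left_commute prod_nonneg)
qed

section \<open>Quadratic forms and Cholesky coordinates\<close>

lemma quad_cong: "(\<And>i. i \<in> F \<Longrightarrow> h i = g i) \<Longrightarrow> quad F A h = quad F A g"
  unfolding quad_def by (intro sum.cong refl) auto

text \<open>Completion of the square in the variable k; the matrix that remains on F is the Schur
  complement.\<close>

lemma quad_insert:
  assumes "finite F" "k \<notin> F" "\<And>i j. A i j = A j i" "A k k \<noteq> 0"
  shows "quad (insert k F) A h = A k k * (h k + (\<Sum>j\<in>F. A k j * h j) / A k k)\<^sup>2
     + quad F (\<lambda>i j. A i j - A i k * A k j / A k k) h"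
proof -
  define s where "s = (\<Sum>j\<in>F. A k j * h j)"
  have s2: "(\<Sum>i\<in>F. A i k * h i * h k) = s * h k"
    unfolding s_def sum_distrib_right by (rule sum.cong[OF refl]) (subst assms(3), rule refl)
  have s3: "(\<Sum>j\<in>F. A k j * h k * h j) = s * h k"
    unfolding s_def sum_distrib_right by (rule sum.cong[OF refl]) (simp only: mult_ac)
  have "quad (insert k F) A h = A k k * h k * h k + 2 * (s * h k) + quad F A h"
    unfolding quad_def using assms(1,2) by (simp add: sum.distrib s2 s3)
  moreover have "quad F (\<lambda>i j. A i j - A i k * A k j / A k k) h = quad F A h - s * s / A k k"
  proof -
    have "s * s / A k k = (\<Sum>i\<in>F. \<Sum>j\<in>F. A i k * A k j / A k k * h i * h j)"
      unfolding s_def sum_product sum_divide_distrib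
    proof (intro sum.cong refl)
      fix i j
      have e: "A i k = A k i" by (rule assms(3))
      show "A k i * h i * (A k j * h j) / A k k = A i k * A k j / A k k * h i * h j"
        unfolding e by (simp add: divide_inverse mult_ac)
    qed
    then show ?thesis unfolding quad_def by (simp add: left_diff_distrib sum_subtractf)
  qed
  moreover have "A k k * (h k + s / A k k)\<^sup>2 = A k k * h k * h k + 2 * (s * h k) + s * s / A k k"
    using assms(4) by (simp add: power2_eq_square field_simps)
  ultimately show ?thesis unfolding s_def[symmetric] by simp
qed

text \<open>Produces B with B^T A B = I. The largest index is eliminated, and the Schur complement
  stays positive definite because the eliminated variable can be chosen to make its square
  vanish.\<close>

lemma cholesky:
  assumes "finite F" "\<And>i j. A i j = A j i" "\<And>h. (\<exists>i\<in>F. h i \<noteq> 0) \<Longrightarrow> 0 < quad F A h"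
  shows "\<exists>B. (\<forall>k\<in>F. 0 < B k k) \<and> (\<forall>z. quad F A (tri B F (\<lambda>_. 0) z) = (\<Sum>k\<in>F. (z k)\<^sup>2))"
  using assms
proof (induction F arbitrary: A rule: finite_linorder_max_induct)
  case empty show ?case by (simp add: quad_def)
next
  case (insert k F)
  have kF: "k \<notin> F" and lt: "\<And>j. j \<in> F \<Longrightarrow> j < k" using insert.hyps by blast+
  have "0 < quad (insert k F) A (\<lambda>i. if i = k then 1 else 0)" by (rule insert.prems) auto
  also have "quad (insert k F) A (\<lambda>i. if i = k then 1 else 0)
      = (\<Sum>i\<in>insert k F. \<Sum>j\<in>insert k F. if j = k then (if i = k then A k k else 0) else 0)"
    unfolding quad_def by (intro sum.cong refl) auto
  also have "\<dots> = A k k" using insert.hyps(1) by (simp only: sum.delta finite_insert insertI1 if_True)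
  finally have a: "0 < A k k" .
  define A' where "A' = (\<lambda>i j. A i j - A i k * A k j / A k k)"
  have a': "A k k \<noteq> 0" using a by linarith
  have qi: "quad (insert k F) A h = A k k * (h k + (\<Sum>j\<in>F. A k j * h j) / A k k)\<^sup>2 + quad F A' h" for h
    unfolding A'_def using quad_insert[where A=A and h=h, OF insert.hyps(1) kF _ a'] insert.prems(1) by blast
  have "\<exists>B. (\<forall>k\<in>F. 0 < B k k) \<and> (\<forall>z. quad F A' (tri B F (\<lambda>_. 0) z) = (\<Sum>k\<in>F. (z k)\<^sup>2))"
  proof (rule insert.IH)
    show "A' i j = A' j i" for i j unfolding A'_def using insert.prems(1) by (metis mult.commute)
    fix h :: "nat \<Rightarrow> real" assume h: "\<exists>i\<in>F. h i \<noteq> 0"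
    define h' where "h' = h(k := - (\<Sum>j\<in>F. A k j * h j) / A k k)"
    have "(\<Sum>j\<in>F. A k j * h' j) = (\<Sum>j\<in>F. A k j * h j)" using kF by (intro sum.cong) (auto simp: h'_def)
    then have "quad (insert k F) A h' = quad F A' h'" unfolding qi by (simp add: h'_def)
    also have "\<dots> = quad F A' h" using kF by (intro quad_cong) (auto simp: h'_def)
    finally have "quad (insert k F) A h' = quad F A' h" .
    moreover have "0 < quad (insert k F) A h'" using h kF by (intro insert.prems) (auto simp: h'_def)
    ultimately show "0 < quad F A' h" by simp
  qed
  then obtain B where B: "\<forall>k\<in>F. 0 < B k k" "\<And>z. quad F A' (tri B F (\<lambda>_. 0) z) = (\<Sum>k\<in>F. (z k)\<^sup>2)" by blast
  \<comment> \<open>The new row must realize x_k = z_k / sqrt(A_kk) - (sum of A_ki x_i) / A_kk,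
    which turns the completed square into z_k^2; its entries are this expression with the x_i
    rewritten in terms of z.\<close>
  define B' where "B' i j = (if i = k then (if j = k then 1 / sqrt (A k k) else - (\<Sum>i\<in>{i\<in>F. j \<le> i}. A k i * B i j) / A k k) else B i j)" for i j
  have old: "tri B' (insert k F) (\<lambda>_. 0) z i = tri B F (\<lambda>_. 0) z i" if "i \<in> F" for z i
  proof -
    have "i \<noteq> k" using that kF by blast
    then have "tri B' F (\<lambda>_. 0) z i = tri B F (\<lambda>_. 0) z i" by (simp add: tri_def B'_def)
    then show ?thesis using tri_insert_old[OF lt that, of B' "\<lambda>_. 0" z] by simp
  qed
  have new: "tri B' (insert k F) (\<lambda>_. 0) z k = z k / sqrt (A k k) - (\<Sum>i\<in>F. A k i * tri B F (\<lambda>_. 0) z i) / A k k" for z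
  proof -
    have "(\<Sum>j\<in>F. B' k j * z j) = (\<Sum>j\<in>F. (- 1 / A k k) * (\<Sum>i\<in>{i\<in>F. j \<le> i}. A k i * B i j * z j))"
      by (intro sum.cong refl) (use kF in \<open>auto simp: B'_def sum_distrib_right[symmetric]\<close>)
    also have "\<dots> = - (\<Sum>j\<in>F. \<Sum>i\<in>{i\<in>F. j \<le> i}. A k i * B i j * z j) / A k k"
      unfolding sum_distrib_left[symmetric] by simp
    also have "(\<Sum>j\<in>F. \<Sum>i\<in>{i\<in>F. j \<le> i}. A k i * B i j * z j) = (\<Sum>i\<in>F. \<Sum>j\<in>{j\<in>F. j \<le> i}. A k i * B i j * z j)"
      by (rule sum.swap_restrict) (use insert.hyps in auto)
    also have "\<dots> = (\<Sum>i\<in>F. A k i * tri B F (\<lambda>_. 0) z i)"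
      by (intro sum.cong refl) (simp add: tri_def sum_distrib_left mult.assoc)
    finally have "(\<Sum>j\<in>F. B' k j * z j) = - (\<Sum>i\<in>F. A k i * tri B F (\<lambda>_. 0) z i) / A k k" .
    moreover have "B' k k = 1 / sqrt (A k k)" by (simp add: B'_def)
    ultimately show ?thesis using tri_insert_new[OF insert.hyps(1) lt, of B' "\<lambda>_. 0" z] by simp
  qed
  have "quad (insert k F) A (tri B' (insert k F) (\<lambda>_. 0) z) = (\<Sum>k\<in>insert k F. (z k)\<^sup>2)" for z
  proof -
    let ?x = "tri B' (insert k F) (\<lambda>_. 0) z"
    have "(\<Sum>j\<in>F. A k j * ?x j) = (\<Sum>i\<in>F. A k i * tri B F (\<lambda>_. 0) z i)" by (intro sum.cong) (auto simp: old)
    then have "quad (insert k F) A ?x = A k k * (z k / sqrt (A k k))\<^sup>2 + quad F A' ?x"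
      unfolding qi new by simp
    also have "quad F A' ?x = quad F A' (tri B F (\<lambda>_. 0) z)" by (rule quad_cong) (rule old)
    also have "A k k * (z k / sqrt (A k k))\<^sup>2 = (z k)\<^sup>2" using a by (simp add: power_divide)
    finally show ?thesis using B(2) insert.hyps(1) kF by simp
  qed
  moreover have "\<forall>k\<in>insert k F. 0 < B' k k" using B(1) a kF by (auto simp: B'_def)
  ultimately show ?case by blast
qed

lemma tri_bound:
  assumes "finite F" "i \<in> F"
  shows "\<bar>tri B F (\<lambda>_. 0) z i\<bar> \<le> (\<Sum>j\<in>F. \<bar>B i j\<bar>) * sqrt (\<Sum>k\<in>F. (z k)\<^sup>2)"
proof -
  have z: "\<bar>z j\<bar> \<le> sqrt (\<Sum>k\<in>F. (z k)\<^sup>2)" if "j \<in> F" for j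
  proof -
    have "(z j)\<^sup>2 \<le> (\<Sum>k\<in>F. (z k)\<^sup>2)" by (rule member_le_sum[OF that]) (use assms in auto)
    then show ?thesis using real_sqrt_le_mono by fastforce
  qed
  have "\<bar>tri B F (\<lambda>_. 0) z i\<bar> = \<bar>\<Sum>j\<in>{j\<in>F. j \<le> i}. B i j * z j\<bar>" using assms(2) by (simp add: tri_def)
  also have "\<dots> \<le> (\<Sum>j\<in>{j\<in>F. j \<le> i}. \<bar>B i j * z j\<bar>)" by (rule sum_abs)
  also have "\<dots> \<le> (\<Sum>j\<in>F. \<bar>B i j * z j\<bar>)" by (rule sum_mono2) (use assms in auto)
  also have "\<dots> \<le> (\<Sum>j\<in>F. \<bar>B i j\<bar> * sqrt (\<Sum>k\<in>F. (z k)\<^sup>2))"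
    by (intro sum_mono) (use z in \<open>auto simp: abs_mult intro!: mult_left_mono\<close>)
  also have "\<dots> = (\<Sum>j\<in>F. \<bar>B i j\<bar>) * sqrt (\<Sum>k\<in>F. (z k)\<^sup>2)" by (rule sum_distrib_right[symmetric])
  finally show ?thesis .
qed

text \<open>What Laplace's method has to know about the normalized prediction error in the
  coordinates z. Concavity is stated along rays from the optimum, where the value is 1.
  \<open>depends\<close> appears because z is a total function whereas the measure lives on the
  coordinates in F.\<close>

locale laplace_ratio =
  fixes F :: "nat set" and R :: "(nat \<Rightarrow> real) \<Rightarrow> real" and \<delta> K D :: real
  assumes fin: "finite F"
    and meas [measurable]: "R \<in> borel_measurable (lborel_on F)"
    and depends: "\<And>z w. (\<And>k. k \<in> F \<Longrightarrow> z k = w k) \<Longrightarrow> R z = R w"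
    and R0: "\<And>z. 0 \<le> R z"
    and local: "\<And>z. (\<Sum>k\<in>F. (z k)\<^sup>2) \<le> \<delta>\<^sup>2 \<Longrightarrow>
       \<bar>R z - (1 - (\<Sum>k\<in>F. (z k)\<^sup>2) / 2)\<bar> \<le> K * sqrt (\<Sum>k\<in>F. (z k)\<^sup>2) ^ 3"
    and concave: "\<And>z t. 0 < R z \<Longrightarrow> 0 \<le> t \<Longrightarrow> t \<le> 1 \<Longrightarrow> (1 - t) + t * R z \<le> R (\<lambda>k. t * z k)"
    and bounded: "\<And>z. 0 < R z \<Longrightarrow> (\<Sum>k\<in>F. (z k)\<^sup>2) \<le> D\<^sup>2"
    and pos: "\<delta> > 0" "K \<ge> 0" "D > 0"

text \<open>Outside the interior of the moment space the ratio is set to 0, the value of the density there.\<close>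

definition eps_ratio :: "moment_constraint \<Rightarrow> nat \<Rightarrow> (nat \<Rightarrow> real) \<Rightarrow> (nat \<Rightarrow> nat \<Rightarrow> real) \<Rightarrow> (nat \<Rightarrow> real) \<Rightarrow> real" where
  "eps_ratio C l y B z = (let x = tri B (free_indices C l) y z in
     if szego_pos (trig (fill_in C l x)) l then eps (trig (fill_in C l x)) l / eps (trig (fill_in C l y)) l else 0)"

lemma fill_in_tri: "fill_in C l (tri B (free_indices C l) y z)
   = fill_in C l (\<lambda>i. y i + tri B (free_indices C l) (\<lambda>_. 0) z i)"
proof
  fix j show "fill_in C l (tri B (free_indices C l) y z) j
   = fill_in C l (\<lambda>i. y i + tri B (free_indices C l) (\<lambda>_. 0) z i) j"
    by (cases "j \<in> free_indices C l") (auto simp: fill_in_def free_indices_def tri_def domIff split: option.split)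
qed

lemma measurable_eps_ratio [measurable]: "eps_ratio C l y B \<in> borel_measurable (lborel_on (free_indices C l))"
proof -
  have "(\<lambda>x. if szego_pos (trig (fill_in C l x)) l then eps (trig (fill_in C l x)) l / eps (trig (fill_in C l y)) l else 0)
     \<in> borel_measurable (lborel_on (free_indices C l))"
    by measurable
  from measurable_compose[OF measurable_tri this] show ?thesis
    unfolding eps_ratio_def Let_def .
qed

text \<open>The interface between moment geometry and Laplace's method. The Hessian is positive
  definite by \<open>second_var_zero\<close>, which applies to every free direction because the
  first variation vanishes there.\<close>

lemma normal_form:
  assumes C: "is_constraint C" "admissible C {0..1}" "top_index C \<le> l"
  shows "\<exists>y A B \<delta> K D. szego_pos (trig (fill_in C l y)) l
    \<and> (\<forall>j\<in>{1..l}. moment j (min_measure C) = fill_in C l y j)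
    \<and> (\<forall>i j. A i j = A j i) \<and> (\<forall>k\<in>free_indices C l. 0 < B k k)
    \<and> (\<forall>z. quad (free_indices C l) A (tri B (free_indices C l) (\<lambda>_. 0) z) = (\<Sum>k\<in>free_indices C l. (z k)\<^sup>2))
    \<and> laplace_ratio (free_indices C l) (eps_ratio C l y B) \<delta> K D"
proof -
  let ?F = "free_indices C l"
  obtain y where P: "szego_pos (trig (fill_in C l y)) l"
    and max: "\<And>x. szego_pos (trig (fill_in C l x)) l \<Longrightarrow> eps (trig (fill_in C l x)) l \<le> eps (trig (fill_in C l y)) l"
    using eps_maximizer[OF admissible_szego_pos[OF C]] by blast
  let ?c = "trig (fill_in C l y)" and ?A = "hess C l y"
  define E where "E = eps ?c l"
  have E: "E > 0" using szego_pos_eps[OF P] by (simp add: E_def)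
  have crit: "first_var ?c l (dtrig (on_free C l h)) = 0" for h by (rule critical_point[OF P max])
  have pd: "0 < quad ?F ?A h" if h: "\<exists>i\<in>?F. h i \<noteq> 0" for h
  proof -
    have "second_var ?c l (dtrig (on_free C l h)) \<noteq> 0"
    proof
      assume "second_var ?c l (dtrig (on_free C l h)) = 0"
      then have "dtrig (on_free C l h) k = 0" if "k \<le> l" for k using second_var_zero[OF P _ crit that] by blast
      then have "on_free C l h i = 0" if "i \<in> {1..l}" for i using dtrig_zero_imp that by blast
      moreover obtain i where "i \<in> ?F" "h i \<noteq> 0" using h by blast
      moreover from this have "i \<in> {1..l}" "on_free C l h i = h i" by (simp_all add: free_indices_def on_free_def)
      ultimately show False by metis
    qed
    then show ?thesis unfolding quad_hess using second_var_nonneg[OF P] E by (simp add: E_def less_le)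
  qed
  obtain B where B: "\<forall>k\<in>?F. 0 < B k k" "\<forall>z. quad ?F ?A (tri B ?F (\<lambda>_. 0) z) = (\<Sum>k\<in>?F. (z k)\<^sup>2)"
    using cholesky[OF finite_free_indices hess_sym pd] by blast
  let ?T = "tri B ?F (\<lambda>_. 0)" and ?q = "\<lambda>z :: nat \<Rightarrow> real. \<Sum>k\<in>?F. (z k)\<^sup>2"
  obtain \<delta> K where \<delta>: "\<delta> > 0" "K \<ge> 0" "\<And>e. seq_norm e l \<le> \<delta> \<Longrightarrow> szego_pos (\<lambda>k. ?c k + e k) l \<and>
     \<bar>eps (\<lambda>k. ?c k + e k) l - (eps ?c l + first_var ?c l e - second_var ?c l e)\<bar> \<le> K * seq_norm e l ^ 3"
    using eps_expansion[OF P] by blast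
  \<comment> \<open>A norm bound for the linear map from z to the perturbation of the trigonometric
    moments; the 1 makes it positive, so that \<delta> / M is an admissible radius.\<close>
  define M where "M = 1 + (\<Sum>k\<le>l. \<Sum>j\<in>{1..k}. \<bar>coeff (cheb k) j\<bar> * (\<Sum>i\<in>?F. \<bar>B j i\<bar>))"
  have M: "M \<ge> 1" unfolding M_def by (simp add: sum_nonneg)
  have q0: "0 \<le> ?q z" for z by (intro sum_nonneg) auto
  have sn: "seq_norm (dtrig (on_free C l (?T z))) l \<le> M * sqrt (?q z)" for z
  proof -
    have "\<bar>on_free C l (?T z) j\<bar> \<le> (\<Sum>i\<in>?F. \<bar>B j i\<bar>) * sqrt (?q z)" for j
      using tri_bound[OF finite_free_indices, of j C l B z] q0[of z]
      by (cases "j \<in> ?F") (auto simp: on_free_def sum_nonneg)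
    then have "\<bar>dtrig (on_free C l (?T z)) k\<bar> \<le> (\<Sum>j\<in>{1..k}. \<bar>coeff (cheb k) j\<bar> * ((\<Sum>i\<in>?F. \<bar>B j i\<bar>) * sqrt (?q z)))" for k
      unfolding dtrig_def by (intro order_trans[OF sum_abs] sum_mono) (auto simp: abs_mult intro!: mult_left_mono)
    then have "seq_norm (dtrig (on_free C l (?T z))) l
       \<le> (\<Sum>k\<le>l. \<Sum>j\<in>{1..k}. \<bar>coeff (cheb k) j\<bar> * ((\<Sum>i\<in>?F. \<bar>B j i\<bar>) * sqrt (?q z)))"
      unfolding seq_norm_def by (intro sum_mono)
    also have "\<dots> = (M - 1) * sqrt (?q z)" unfolding M_def by (simp add: sum_distrib_right mult.assoc)
    also have "\<dots> \<le> M * sqrt (?q z)" using q0[of z] by (intro mult_right_mono) auto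
    finally show ?thesis .
  qed
  have R: "eps_ratio C l y B z = (if szego_pos (\<lambda>k. ?c k + dtrig (on_free C l (?T z)) k) l
      then eps (\<lambda>k. ?c k + dtrig (on_free C l (?T z)) k) l / E else 0)" for z
    unfolding eps_ratio_def Let_def fill_in_tri eps_fill_add E_def ..
  \<comment> \<open>Moments lie in [0,1], so displacements are at most 1 in each coordinate, and
    |z|^2, being the Hessian form of the displacement, is at most the sum of the absolute entries.
    The 1 ensures D <= D^2.\<close>
  define D where "D = 1 + (\<Sum>i\<in>?F. \<Sum>k\<in>?F. \<bar>?A i k\<bar>)"
  have D: "D \<ge> 1" unfolding D_def by (simp add: sum_nonneg)
  have "laplace_ratio ?F (eps_ratio C l y B) (\<delta> / M) (K * M ^ 3 / E) D"
  proof
    show "eps_ratio C l y B z = eps_ratio C l y B w" if "\<And>k. k \<in> ?F \<Longrightarrow> z k = w k" for z w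
    proof -
      have "tri B ?F y z = tri B ?F y w" by (rule tri_cong) (rule that)
      then show ?thesis by (simp only: eps_ratio_def)
    qed
    show "0 \<le> eps_ratio C l y B z" for z
      unfolding R using szego_pos_eps[of _ l l] E by (auto intro!: divide_nonneg_pos less_imp_le)
    show "\<bar>eps_ratio C l y B z - (1 - ?q z / 2)\<bar> \<le> K * M ^ 3 / E * sqrt (?q z) ^ 3" if z: "?q z \<le> (\<delta> / M)\<^sup>2" for z
    proof -
      let ?d = "dtrig (on_free C l (?T z))"
      have "sqrt (?q z) \<le> \<delta> / M" using z \<delta> M by (intro real_le_lsqrt) auto
      then have "M * sqrt (?q z) \<le> \<delta>" using M by (simp add: field_simps)
      then have le: "seq_norm ?d l \<le> \<delta>" using sn[of z] by simp
      have sv: "second_var ?c l ?d = E * (?q z / 2)"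
        using quad_hess[of C l y "?T z"] B(2) E by (simp add: E_def field_simps)
      have pos: "szego_pos (\<lambda>k. ?c k + ?d k) l" and e: "\<bar>eps (\<lambda>k. ?c k + ?d k) l - (E - E * (?q z / 2))\<bar> \<le> K * seq_norm ?d l ^ 3"
        using \<delta>(3)[OF le] crit[of "?T z"] sv by (auto simp: E_def)
      have "seq_norm ?d l ^ 3 \<le> (M * sqrt (?q z)) ^ 3" by (intro power_mono sn seq_norm_nonneg)
      then have "K * seq_norm ?d l ^ 3 \<le> K * (M * sqrt (?q z)) ^ 3" using \<delta> by (intro mult_left_mono)
      with e have e': "\<bar>eps (\<lambda>k. ?c k + ?d k) l - (E - E * (?q z / 2))\<bar> \<le> K * (M * sqrt (?q z)) ^ 3" by linarith
      have "eps_ratio C l y B z - (1 - ?q z / 2) = (eps (\<lambda>k. ?c k + ?d k) l - (E - E * (?q z / 2))) / E"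
        unfolding R using pos E by (simp add: diff_divide_distrib)
      then have "\<bar>eps_ratio C l y B z - (1 - ?q z / 2)\<bar> = \<bar>eps (\<lambda>k. ?c k + ?d k) l - (E - E * (?q z / 2))\<bar> / E"
        using E by (simp only: abs_divide abs_of_pos)
      also have "\<dots> \<le> K * (M * sqrt (?q z)) ^ 3 / E" using e' E by (intro divide_right_mono) auto
      also have "\<dots> = K * M ^ 3 / E * sqrt (?q z) ^ 3" by (simp only: power_mult_distrib) simp
      finally show ?thesis .
    qed
    show "(1 - t) + t * eps_ratio C l y B z \<le> eps_ratio C l y B (\<lambda>k. t * z k)"
      if z: "0 < eps_ratio C l y B z" and t: "0 \<le> t" "t \<le> 1" for z t
    proof -
      let ?d = "dtrig (on_free C l (?T z))"
      have pos: "szego_pos (\<lambda>k. ?c k + ?d k) l" using z unfolding R by (auto split: if_splits)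
      have "on_free C l (?T (\<lambda>k. t * z k)) = (\<lambda>j. t * on_free C l (?T z) j + 0 * 0)"
        by (auto simp: on_free_def tri_def sum_distrib_left mult.left_commute)
      then have "dtrig (on_free C l (?T (\<lambda>k. t * z k))) = (\<lambda>k. t * ?d k)"
        using dtrig_lin[of t "on_free C l (?T z)" 0 "\<lambda>_. 0"] by auto
      then have eq: "(\<lambda>k. ?c k + dtrig (on_free C l (?T (\<lambda>k. t * z k))) k) = (\<lambda>k. (1 - t) * ?c k + t * (?c k + ?d k))"
        by (auto simp: algebra_simps)
      have "((1 - t) * E + t * eps (\<lambda>k. ?c k + ?d k) l) / E \<le> eps (\<lambda>k. (1 - t) * ?c k + t * (?c k + ?d k)) l / E"
        using eps_concave(2)[OF P pos t] E by (intro divide_right_mono) (auto simp: E_def)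
      then show ?thesis unfolding R eq using eps_concave(1)[OF P pos t] pos E by (simp add: add_divide_distrib)
    qed
    show "?q z \<le> D\<^sup>2" if z: "0 < eps_ratio C l y B z" for z
    proof -
      have pos: "szego_pos (trig (fill_in C l (\<lambda>i. y i + ?T z i))) l"
        using z unfolding R eps_fill_add by (auto split: if_splits)
      have T1: "\<bar>?T z i\<bar> \<le> 1" if i: "i \<in> ?F" for i
      proof -
        have "i \<in> {1..l}" "C i = None" using i by (auto simp: free_indices_def)
        then show ?thesis using szego_pos_bounds[OF pos, of i] szego_pos_bounds[OF P, of i] by (auto simp: fill_in_def)
      qed
      have "?q z = quad ?F ?A (?T z)" using B(2) by simp
      also have "\<dots> \<le> (\<Sum>i\<in>?F. \<Sum>k\<in>?F. \<bar>?A i k\<bar>)"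
        unfolding quad_def
      proof (intro sum_mono)
        fix i k assume ik: "i \<in> ?F" "k \<in> ?F"
        have "?A i k * ?T z i * ?T z k \<le> \<bar>?A i k\<bar> * (\<bar>?T z i\<bar> * \<bar>?T z k\<bar>)"
          by (metis abs_ge_self abs_mult mult.assoc)
        also have "\<dots> \<le> \<bar>?A i k\<bar> * 1" using T1[OF ik(1)] T1[OF ik(2)] by (intro mult_left_mono mult_le_one) auto
        finally show "?A i k * ?T z i * ?T z k \<le> \<bar>?A i k\<bar>" by simp
      qed
      also have "\<dots> \<le> D" by (simp add: D_def)
      also have "\<dots> \<le> D\<^sup>2" using D by (simp add: power2_eq_square)
      finally show ?thesis .
    qed
  qed (use \<delta> M E D in auto)
  then show ?thesis using P min_measure_moments[OF C(1,3) P max] hess_sym B by blast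
qed

section \<open>Laplace asymptotics\<close>

lemma nn_integral_gauss_finite:
  assumes "finite F" "0 < c"
  shows "(\<integral>\<^sup>+u. ennreal (exp (- c * (\<Sum>k\<in>F. (u k)\<^sup>2))) \<partial>lborel_on F) < \<infinity>"
proof -
  have one: "(\<integral>\<^sup>+x. ennreal (exp (- c * x\<^sup>2)) \<partial>lborel) < \<infinity>"
  proof -
    define \<sigma> where "\<sigma> = sqrt (1 / (2 * c))"
    have \<sigma>: "\<sigma> > 0" "2 * \<sigma>\<^sup>2 = 1 / c" using assms(2) by (auto simp: \<sigma>_def)
    have "integrable lborel (\<lambda>x. sqrt (2 * pi * \<sigma>\<^sup>2) * normal_density 0 \<sigma> x)"
      using integrable_normal_density[OF \<sigma>(1)] by simp
    moreover have "(\<lambda>x. sqrt (2 * pi * \<sigma>\<^sup>2) * normal_density 0 \<sigma> x) = (\<lambda>x. exp (- c * x\<^sup>2))"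
      using \<sigma> by (simp add: normal_density_def fun_eq_iff)
    ultimately have "integrable lborel (\<lambda>x. exp (- c * x\<^sup>2))" by simp
    then show ?thesis by (subst (asm) integrable_iff_bounded) auto
  qed
  have "(\<integral>\<^sup>+u. ennreal (exp (- c * (\<Sum>k\<in>F. (u k)\<^sup>2))) \<partial>lborel_on F)
     = (\<integral>\<^sup>+u. (\<Prod>k\<in>F. ennreal (exp (- c * (u k)\<^sup>2))) \<partial>lborel_on F)"
    using assms(1) by (intro nn_integral_cong) (simp add: exp_sum[symmetric] sum_distrib_left prod_ennreal sum_negf)
  also have "\<dots> = (\<Prod>k\<in>F. \<integral>\<^sup>+x. ennreal (exp (- c * x\<^sup>2)) \<partial>lborel)"
  proof (rule lborel_power.product_nn_integral_prod[OF assms(1), where f="\<lambda>_ x. ennreal (exp (- c * x\<^sup>2))"])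
    have "(\<lambda>x. exp (- c * x\<^sup>2)) \<in> borel_measurable borel"
      by (intro borel_measurable_continuous_onI continuous_intros)
    then show "(\<lambda>x. ennreal (exp (- c * x\<^sup>2))) \<in> borel_measurable lborel" by simp
  qed
  also have "\<dots> < \<infinity>" using one by (simp add: power_less_top_ennreal)
  finally show ?thesis .
qed

lemma integrable_gauss:
  assumes "finite F" "0 < c"
  shows "integrable (lborel_on F) (\<lambda>u. exp (- c * (\<Sum>k\<in>F. (u k)\<^sup>2)))"
  using nn_integral_gauss_finite[OF assms] by (intro integrableI_nonneg) auto

context laplace_ratio
begin

abbreviation q :: "(nat \<Rightarrow> real) \<Rightarrow> real" where "q z \<equiv> \<Sum>k\<in>F. (z k)\<^sup>2"

lemma q_nonneg: "0 \<le> q z" by (intro sum_nonneg) auto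

lemma q_scale: "q (\<lambda>k. t * z k) = t\<^sup>2 * q z"
  by (simp add: power_mult_distrib sum_distrib_left)

lemma q_divide: "q (\<lambda>k. z k / t) = q z / t\<^sup>2"
  by (simp add: power_divide sum_divide_distrib)

lemma measurable_R_scaled [measurable]: "(\<lambda>u. R (\<lambda>k. u k / s)) \<in> borel_measurable (lborel_on F)"
proof -
  have "(\<lambda>u. \<lambda>k\<in>F. u k / s) \<in> measurable (lborel_on F) (lborel_on F)"
    by (rule measurable_restrict) measurable
  from measurable_compose[OF this meas]
  have "(\<lambda>u. R (\<lambda>k\<in>F. u k / s)) \<in> borel_measurable (lborel_on F)" .
  moreover have "R (\<lambda>k\<in>F. u k / s) = R (\<lambda>k. u k / s)" for u by (rule depends) simp
  ultimately show ?thesis by simp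
qed

lemma two_sided:
  assumes "0 < e" "e \<le> 1"
  shows "\<exists>r>0. \<forall>z. q z \<le> r\<^sup>2 \<longrightarrow> exp (- ((1 + e) / 2 * q z)) \<le> R z \<and> R z \<le> exp (- ((1 - e) / 2 * q z))"
proof -
  \<comment> \<open>With x = q / 2, the bound e / (4 (K + 1)) makes the cubic error at most (e / 2)
    x, and sqrt (e / 9) makes x at most e / 18, so that the quadratic loss in ln (1 - v) >= - v - 2
    v^2 is again at most (e / 2) x.\<close>
  define r where "r = min (min \<delta> (e / (4 * (K + 1)))) (sqrt (e / 9))"
  have r: "0 < r" "r \<le> \<delta>" "r \<le> e / (4 * (K + 1))" "r \<le> sqrt (e / 9)" using pos assms by (auto simp: r_def)
  have "exp (- ((1 + e) / 2 * q z)) \<le> R z \<and> R z \<le> exp (- ((1 - e) / 2 * q z))" if z: "q z \<le> r\<^sup>2" for z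
  proof -
    define x where "x = q z / 2"
    define w where "w = sqrt (q z)"
    have x0: "0 \<le> x" using q_nonneg[of z] by (simp add: x_def)
    have w: "0 \<le> w" "w \<le> r" "w\<^sup>2 = q z" using z r q_nonneg[of z] by (auto simp: w_def intro!: real_le_lsqrt)
    have "r\<^sup>2 \<le> \<delta>\<^sup>2" using r by (intro power_mono) auto
    then have loc: "\<bar>R z - (1 - x)\<bar> \<le> K * w ^ 3" using local[of z] z by (simp add: x_def w_def)
    have "(4 * (K + 1)) * w \<le> (4 * (K + 1)) * (e / (4 * (K + 1)))" using w r pos by (intro mult_left_mono) auto
    then have "4 * (K + 1) * w \<le> e" using pos by simp
    then have Kw: "K * w \<le> e / 4" using w by (simp add: algebra_simps)
    have "K * w ^ 3 = (K * w) * w\<^sup>2" by (simp add: power2_eq_square power3_eq_cube)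
    also have "\<dots> \<le> e / 4 * w\<^sup>2" using Kw by (intro mult_right_mono) auto
    also have "\<dots> = e / 2 * x" by (simp add: w x_def)
    finally have K3: "K * w ^ 3 \<le> e / 2 * x" .
    have "r\<^sup>2 \<le> (sqrt (e / 9))\<^sup>2" using r by (intro power_mono) auto
    then have x9: "x \<le> e / 18" using z assms by (simp add: x_def)
    have up: "R z \<le> exp (- ((1 - e) * x))"
    proof -
      have "R z \<le> 1 - x + e / 2 * x" using loc K3 by linarith
      also have "\<dots> \<le> 1 + (- ((1 - e) * x))" using x0 assms by (simp add: algebra_simps)
      also have "\<dots> \<le> exp (- ((1 - e) * x))" by (rule exp_ge_add_one_self)
      finally show ?thesis .
    qed
    define v where "v = (1 + e / 2) * x"
    have v: "0 \<le> v" using x0 assms by (simp add: v_def)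
    have v2: "v \<le> 3 / 2 * x" using x0 assms unfolding v_def by (intro mult_right_mono) auto
    then have v3: "v \<le> e / 12" using x9 by simp
    have vv: "v + 2 * v\<^sup>2 \<le> (1 + e) * x"
    proof -
      have "2 * v\<^sup>2 = 2 * v * v" by (simp add: power2_eq_square)
      also have "\<dots> \<le> 2 * (e / 12) * (3 / 2 * x)" using v v2 v3 assms by (intro mult_mono) auto
      also have "\<dots> \<le> e / 2 * x" using x0 assms by simp
      finally show ?thesis by (simp add: v_def algebra_simps)
    qed
    have lo: "exp (- ((1 + e) * x)) \<le> R z"
    proof -
      have "v \<le> 1 / 2" using v3 assms by simp
      then have "- v - 2 * v\<^sup>2 \<le> ln (1 - v)" using v by (intro ln_one_minus_pos_lower_bound)
      then have "- ((1 + e) * x) \<le> ln (1 - v)" using vv by linarith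
      then have "exp (- ((1 + e) * x)) \<le> exp (ln (1 - v))" by simp
      also have "\<dots> = 1 - v" using \<open>v \<le> 1 / 2\<close> by simp
      also have "\<dots> \<le> R z" using loc K3 by (simp add: v_def algebra_simps abs_le_iff)
      finally show ?thesis .
    qed
    show ?thesis using up lo by (simp add: x_def)
  qed
  then show ?thesis using r(1) by blast
qed

text \<open>Near the origin this is \<open>two_sided\<close>. Farther out, concavity on the ray
  compares z with the point at radius r1, where R is at most 1 - \<eta>, and gives R z <= 1 -
  \<eta>. As R vanishes beyond radius D, a Gaussian with rate at most \<eta> / D^2 lies above
  it.\<close>

lemma gauss_bound: "\<exists>\<beta>>0. \<forall>z. R z \<le> exp (- (\<beta> * q z))"
proof -
  obtain r where r: "r > 0" "\<And>z. q z \<le> r\<^sup>2 \<Longrightarrow> R z \<le> exp (- ((1 - 1 / 2) / 2 * q z))"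
    using two_sided[of "1 / 2"] by auto
  define r1 where "r1 = min r 1"
  have r1: "0 < r1" "r1 \<le> 1" "r1 \<le> r" using r by (auto simp: r1_def)
  have near: "R z \<le> exp (- (q z / 4))" if "q z \<le> r1\<^sup>2" for z
  proof -
    have "r1\<^sup>2 \<le> r\<^sup>2" using r1 by (intro power_mono) auto
    then show ?thesis using r(2)[of z] that by simp
  qed
  define \<eta> where "\<eta> = 1 - exp (- (r1\<^sup>2 / 4))"
  have \<eta>: "\<eta> > 0" using r1 by (simp add: \<eta>_def)
  define \<beta> where "\<beta> = min (1 / 4) (\<eta> / (D\<^sup>2))"
  have b1: "\<beta> > 0" using \<eta> pos by (simp add: \<beta>_def)
  have b2: "\<beta> \<le> 1 / 4" unfolding \<beta>_def by (rule min.cobounded1)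
  have b3: "\<beta> \<le> \<eta> / D\<^sup>2" unfolding \<beta>_def by (rule min.cobounded2)
  note \<beta> = b1 b2 b3
  have "R z \<le> exp (- (\<beta> * q z))" for z
  proof (cases "q z \<le> r1\<^sup>2")
    case True
    have "\<beta> * q z \<le> 1 / 4 * q z" using \<beta> q_nonneg[of z] by (intro mult_right_mono) auto
    then show ?thesis using near[OF True] by (simp add: order_trans[OF near[OF True]])
  next
    case False
    show ?thesis
    proof (cases "R z = 0")
      case True then show ?thesis by simp
    next
      case nz: False
      then have Rz: "0 < R z" using R0[of z] by simp
      define t where "t = r1 / sqrt (q z)"
      have w: "r1 < sqrt (q z)" using False r1 by (intro real_less_rsqrt) auto
      then have w0: "0 < sqrt (q z)" using r1 by linarith
      have t: "0 < t" "t \<le> 1"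
        unfolding t_def using divide_pos_pos[OF r1(1) w0] w w0 by (simp_all only: pos_divide_le_eq mult_1 less_imp_le)
      have qz: "0 < q z" using w0 by (simp only: real_sqrt_gt_0_iff)
      have qt: "q (\<lambda>k. t * z k) = r1\<^sup>2"
        unfolding q_scale t_def power_divide real_sqrt_pow2[OF q_nonneg] using qz by (simp only: nonzero_eq_divide_eq times_divide_eq_left) simp
      have "(1 - t) + t * R z \<le> exp (- (r1\<^sup>2 / 4))"
        using concave[OF Rz, of t] near[of "\<lambda>k. t * z k"] t qt by simp
      then have "t * R z \<le> t - \<eta>" by (simp add: \<eta>_def)
      also have "\<dots> \<le> t - t * \<eta>" using t \<eta> by (simp add: mult_left_le_one_le)
      finally have "t * R z \<le> t * (1 - \<eta>)" by (simp add: algebra_simps)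
      then have "R z \<le> 1 - \<eta>" using t by simp
      also have "\<dots> \<le> 1 + (- (\<beta> * q z))"
      proof -
        have "\<beta> * q z \<le> (\<eta> / D\<^sup>2) * D\<^sup>2" using \<beta> bounded[OF Rz] q_nonneg[of z] \<eta> pos by (intro mult_mono) auto
        then show ?thesis using pos by simp
      qed
      also have "\<dots> \<le> exp (- (\<beta> * q z))" by (rule exp_ge_add_one_self)
      finally show ?thesis .
    qed
  qed
  then show ?thesis using \<beta> by blast
qed

lemma power_le_exp: "R z \<le> exp (- x) \<Longrightarrow> R z ^ N \<le> exp (- (real N * x))"
  using power_mono[of "R z" "exp (- x)" N] R0[of z] by (simp add: exp_of_nat_mult[symmetric])

lemma power_ge_exp: "exp (- x) \<le> R z \<Longrightarrow> exp (- (real N * x)) \<le> R z ^ N"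
  using power_mono[of "exp (- x)" "R z" N] by (simp add: exp_of_nat_mult[symmetric])

lemma ratio_tendsto: "(\<lambda>n. real (n - l) / real n) \<longlonglongrightarrow> 1"
proof -
  have "(\<lambda>n. 1 - real l * (1 / real n)) \<longlonglongrightarrow> 1 - real l * 0"
    by (intro tendsto_intros lim_1_over_n)
  then have "(\<lambda>n. 1 - real l / real n) \<longlonglongrightarrow> 1" by simp
  moreover have "\<forall>\<^sub>F n in sequentially. 1 - real l / real n = real (n - l) / real n"
    using eventually_ge_at_top[of "Suc l"] by eventually_elim (simp add: of_nat_diff diff_divide_distrib)
  ultimately show ?thesis by (rule Lim_transform_eventually)
qed

lemma ratio_le: "real (n - l) / real n \<le> 1"
  by (cases "n = 0") auto

text \<open>The exponent n - l and the scaling by n differ by a factor tending to 1, which costs one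
  more factor 1 - e in the upper bound; then e tends to 0 from the right.\<close>

lemma pointwise_limit:
  "(\<lambda>n. R (\<lambda>k. u k / sqrt (real n)) ^ (n - l)) \<longlonglongrightarrow> exp (- (q u / 2))"
proof -
  define x where "x = q u / 2"
  have x: "0 \<le> x" using q_nonneg[of u] by (simp add: x_def)
  have bounds: "\<forall>\<^sub>F n in sequentially. exp (- ((1 + e) * x)) \<le> R (\<lambda>k. u k / sqrt (real n)) ^ (n - l)
      \<and> R (\<lambda>k. u k / sqrt (real n)) ^ (n - l) \<le> exp (- ((1 - e) * (1 - e) * x))" if e: "0 < e" "e \<le> 1" for e
  proof -
    obtain r where r: "r > 0" "\<And>z. q z \<le> r\<^sup>2 \<Longrightarrow> exp (- ((1 + e) / 2 * q z)) \<le> R z \<and> R z \<le> exp (- ((1 - e) / 2 * q z))"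
      using two_sided[OF e] by blast
    have "filterlim (\<lambda>n. real n) at_top sequentially" by (rule filterlim_real_sequentially)
    then have "\<forall>\<^sub>F n in sequentially. q u / r\<^sup>2 \<le> real n" by (simp add: filterlim_at_top)
    moreover have "\<forall>\<^sub>F n in sequentially. 1 - e < real (n - l) / real n"
      using order_tendstoD(1)[OF ratio_tendsto[of l], of "1 - e"] e by simp
    ultimately show ?thesis using eventually_gt_at_top[of 0]
    proof eventually_elim
      case (elim n)
      let ?z = "\<lambda>k. u k / sqrt (real n)"
      have qz: "q ?z = q u / real n" unfolding q_divide by simp
      have "q ?z \<le> r\<^sup>2" unfolding qz using elim r by (simp add: field_simps)
      note rz = r(2)[OF this]
      have "real (n - l) * ((1 + e) / 2 * q ?z) = real (n - l) / real n * ((1 + e) * x)"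
        unfolding qz by (simp add: x_def)
      also have "\<dots> \<le> 1 * ((1 + e) * x)" using ratio_le e x by (intro mult_right_mono) auto
      finally have lo: "exp (- ((1 + e) * x)) \<le> exp (- (real (n - l) * ((1 + e) / 2 * q ?z)))" by simp
      have "(1 - e) * (1 - e) * x \<le> real (n - l) / real n * ((1 - e) * x)"
        using elim e x by (subst mult.assoc, intro mult_right_mono) auto
      also have "\<dots> = real (n - l) * ((1 - e) / 2 * q ?z)" unfolding qz by (simp add: x_def)
      finally have hi: "exp (- (real (n - l) * ((1 - e) / 2 * q ?z))) \<le> exp (- ((1 - e) * (1 - e) * x))" by simp
      show ?case
        using order_trans[OF lo power_ge_exp] order_trans[OF power_le_exp hi] rz by blast
    qed
  qed
  have e1: "\<forall>\<^sub>F e in at_right 0. 0 < e \<and> e \<le> (1::real)"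
    by (rule eventually_at_rightI[of 0 1]) auto
  have "(\<lambda>n. R (\<lambda>k. u k / sqrt (real n)) ^ (n - l)) \<longlonglongrightarrow> exp (- x)"
  proof (rule order_tendstoI)
    fix y assume y: "y < exp (- x)"
    have "((\<lambda>e. exp (- ((1 + e) * x))) \<longlongrightarrow> exp (- ((1 + 0) * x))) (at_right 0)" by (intro tendsto_intros)
    then have "\<forall>\<^sub>F e in at_right 0. y < exp (- ((1 + e) * x))" using y by (intro order_tendstoD(1)) auto
    then have "\<exists>e. y < exp (- ((1 + e) * x)) \<and> 0 < e \<and> e \<le> 1"
      using eventually_happens[OF eventually_conj[OF _ e1]] by (simp add: trivial_limit_at_right_real)
    then obtain e where e: "y < exp (- ((1 + e) * x))" "0 < e" "e \<le> 1" by blast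
    show "\<forall>\<^sub>F n in sequentially. y < R (\<lambda>k. u k / sqrt (real n)) ^ (n - l)"
      using bounds[OF e(2,3)] by eventually_elim (use e in linarith)
  next
    fix y assume y: "exp (- x) < y"
    have "((\<lambda>e. exp (- ((1 - e) * (1 - e) * x))) \<longlongrightarrow> exp (- ((1 - 0) * (1 - 0) * x))) (at_right 0)" by (intro tendsto_intros)
    then have "\<forall>\<^sub>F e in at_right 0. exp (- ((1 - e) * (1 - e) * x)) < y" using y by (intro order_tendstoD(2)) auto
    then have "\<exists>e. exp (- ((1 - e) * (1 - e) * x)) < y \<and> 0 < e \<and> e \<le> 1"
      using eventually_happens[OF eventually_conj[OF _ e1]] by (simp add: trivial_limit_at_right_real)
    then obtain e where e: "exp (- ((1 - e) * (1 - e) * x)) < y" "0 < e" "e \<le> 1" by blast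
    show "\<forall>\<^sub>F n in sequentially. R (\<lambda>k. u k / sqrt (real n)) ^ (n - l) < y"
      using bounds[OF e(2,3)] by eventually_elim (use e in linarith)
  qed
  then show ?thesis by (simp add: x_def)
qed

lemma laplace_clt:
  assumes f [measurable]: "f \<in> borel_measurable (lborel_on F)" and fb: "\<And>u. \<bar>f u\<bar> \<le> (M :: real)"
  shows "(\<lambda>n. \<integral>u. f u * R (\<lambda>k. u k / sqrt (real n)) ^ (n - l) \<partial>lborel_on F)
     \<longlonglongrightarrow> (\<integral>u. f u * exp (- (q u / 2)) \<partial>lborel_on F)"
    "\<forall>\<^sub>F n in sequentially. integrable (lborel_on F) (\<lambda>u. f u * R (\<lambda>k. u k / sqrt (real n)) ^ (n - l))"
proof -
  obtain \<beta> where \<beta>: "\<beta> > 0" "\<And>z. R z \<le> exp (- (\<beta> * q z))" using gauss_bound by blast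
  have "\<forall>\<^sub>F n in sequentially. 1 / 2 < real (n - l) / real n"
    by (rule order_tendstoD(1)[OF ratio_tendsto]) simp
  then obtain n0 where n0: "\<And>n. n \<ge> n0 \<Longrightarrow> 1 / 2 < real (n - l) / real n"
    unfolding eventually_sequentially by blast
  \<comment> \<open>From \<open>n0\<close> on at least half of the exponent survives the passage
    from n to n - l, so one Gaussian with rate \<beta> / 2 dominates the whole tail of the
    sequence.\<close>
  let ?w = "\<lambda>u. M * exp (- (\<beta> / 2) * q u)"
  have "integrable (lborel_on F) (\<lambda>u. exp (- (\<beta> / 2) * q u))"
    by (rule integrable_gauss[OF fin]) (use \<beta> in simp)
  then have w: "integrable (lborel_on F) ?w" by (rule integrable_mult_right)
  have bd: "\<bar>f u * R (\<lambda>k. u k / sqrt (real n)) ^ (n - l)\<bar> \<le> ?w u" if n: "n \<ge> n0 + 1" for n u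
  proof -
    let ?z = "\<lambda>k. u k / sqrt (real n)"
    have "real (n - l) * (\<beta> * q ?z) = real (n - l) / real n * (\<beta> * q u)" unfolding q_divide by simp
    also have "\<dots> \<ge> 1 / 2 * (\<beta> * q u)" using n0[of n] n \<beta> q_nonneg[of u] by (intro mult_right_mono) auto
    finally have h: "1 / 2 * (\<beta> * q u) \<le> real (n - l) * (\<beta> * q ?z)" .
    have e: "- (\<beta> / 2) * q u = - (1 / 2 * (\<beta> * q u))" by simp
    have "exp (- (real (n - l) * (\<beta> * q ?z))) \<le> exp (- (\<beta> / 2) * q u)"
      unfolding e using h by (simp only: exp_le_cancel_iff neg_le_iff_le)
    then have "R ?z ^ (n - l) \<le> exp (- (\<beta> / 2) * q u)" by (rule order_trans[OF power_le_exp[OF \<beta>(2)]])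
    moreover have "0 \<le> R ?z ^ (n - l)" using R0[of ?z] by (rule zero_le_power)
    moreover have "0 \<le> M" using fb[of u] abs_ge_zero order_trans by blast
    ultimately show ?thesis using fb[of u] unfolding abs_mult
      by (intro mult_mono) (simp_all only: abs_of_nonneg abs_ge_zero)
  qed
  show "\<forall>\<^sub>F n in sequentially. integrable (lborel_on F) (\<lambda>u. f u * R (\<lambda>k. u k / sqrt (real n)) ^ (n - l))"
    using eventually_ge_at_top[of "n0 + 1"]
  proof eventually_elim
    case (elim n)
    show ?case
    proof (rule Bochner_Integration.integrable_bound[OF w])
      show "AE u in lborel_on F. norm (f u * R (\<lambda>k. u k / sqrt (real n)) ^ (n - l)) \<le> norm (?w u)"
        using order_trans[OF bd[OF elim] abs_ge_self] by (intro AE_I2) (simp only: real_norm_def)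
    qed measurable
  qed
  have "(\<lambda>n. \<integral>u. f u * R (\<lambda>k. u k / sqrt (real (n + (n0 + 1)))) ^ (n + (n0 + 1) - l) \<partial>lborel_on F)
     \<longlonglongrightarrow> (\<integral>u. f u * exp (- (q u / 2)) \<partial>lborel_on F)"
  proof (rule integral_dominated_convergence[OF _ _ w])
    show "AE u in lborel_on F. (\<lambda>n. f u * R (\<lambda>k. u k / sqrt (real (n + (n0 + 1)))) ^ (n + (n0 + 1) - l)) \<longlonglongrightarrow> f u * exp (- (q u / 2))"
      by (intro AE_I2 tendsto_mult tendsto_const LIMSEQ_ignore_initial_segment[OF pointwise_limit])
    show "AE u in lborel_on F. norm (f u * R (\<lambda>k. u k / sqrt (real (n + (n0 + 1)))) ^ (n + (n0 + 1) - l)) \<le> ?w u" for n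
      by (intro AE_I2) (simp only: real_norm_def, rule bd, simp)
  qed measurable
  then show "(\<lambda>n. \<integral>u. f u * R (\<lambda>k. u k / sqrt (real n)) ^ (n - l) \<partial>lborel_on F)
     \<longlonglongrightarrow> (\<integral>u. f u * exp (- (q u / 2)) \<partial>lborel_on F)" by (rule LIMSEQ_offset)
qed

end

section \<open>Moderate deviations of the Laplace integrals\<close>

lemma speed_at_top:
  assumes "filterlim a at_top sequentially" "a \<in> o(\<lambda>n. sqrt (real n))"
  shows "filterlim (\<lambda>n. real n / (a n)\<^sup>2) at_top sequentially"
proof -
  have "\<forall>\<^sub>F n in sequentially. 1 \<le> a n" using assms(1) unfolding filterlim_at_top by blast
  then have a0: "\<forall>\<^sub>F n in sequentially. a n \<noteq> 0" by eventually_elim auto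
  have "(\<lambda>n. a n / sqrt (real n)) \<longlonglongrightarrow> 0"
    using assms(2) by (rule smalloD_tendsto)
  then have "(\<lambda>n. (a n / sqrt (real n))\<^sup>2) \<longlonglongrightarrow> 0\<^sup>2" by (rule tendsto_power)
  then have "(\<lambda>n. (a n)\<^sup>2 / real n) \<longlonglongrightarrow> 0" by (simp add: power_divide)
  moreover have "\<forall>\<^sub>F n in sequentially. 0 < (a n)\<^sup>2 / real n"
    using a0 eventually_gt_at_top[of 0] by eventually_elim simp
  ultimately have "filterlim (\<lambda>n. inverse ((a n)\<^sup>2 / real n)) at_top sequentially"
    by (intro filterlim_inverse_at_top)
  then show ?thesis by (simp add: field_simps)
qed

context laplace_ratio
begin

lemma total_mass_finite:
  assumes "s > 0" "N > 0"
  shows "(\<integral>\<^sup>+u. ennreal (R (\<lambda>k. u k / s) ^ N) \<partial>lborel_on F) < \<infinity>"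
proof -
  obtain \<beta> where \<beta>: "\<beta> > 0" "\<And>z. R z \<le> exp (- (\<beta> * q z))" using gauss_bound by blast
  define c where "c = real N * \<beta> / s\<^sup>2"
  have "(\<integral>\<^sup>+u. ennreal (R (\<lambda>k. u k / s) ^ N) \<partial>lborel_on F) \<le> (\<integral>\<^sup>+u. ennreal (exp (- c * q u)) \<partial>lborel_on F)"
  proof (intro nn_integral_mono ennreal_leI)
    fix u
    have "R (\<lambda>k. u k / s) ^ N \<le> exp (- (real N * (\<beta> * q (\<lambda>k. u k / s))))" by (rule power_le_exp[OF \<beta>(2)])
    also have "- (real N * (\<beta> * q (\<lambda>k. u k / s))) = - c * q u" unfolding q_divide by (simp add: c_def)
    finally show "R (\<lambda>k. u k / s) ^ N \<le> exp (- c * q u)" .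
  qed
  also have "\<dots> < \<infinity>" by (rule nn_integral_gauss_finite[OF fin]) (use \<beta> assms in \<open>simp add: c_def\<close>)
  finally show ?thesis .
qed

lemma box_mass:
  assumes "r > 0"
  shows "{u \<in> space (lborel_on F). \<forall>k\<in>F. \<bar>u k - v k\<bar> < r} \<in> sets (lborel_on F)"
    "emeasure (lborel_on F) {u \<in> space (lborel_on F). \<forall>k\<in>F. \<bar>u k - v k\<bar> < r} = ennreal ((2 * r) ^ card F)"
proof -
  have eq: "{u \<in> space (lborel_on F). \<forall>k\<in>F. \<bar>u k - v k\<bar> < r} = PiE F (\<lambda>k. {v k - r<..<v k + r})"
    by (auto simp: space_PiM PiE_def Pi_def abs_less_iff)
  show "{u \<in> space (lborel_on F). \<forall>k\<in>F. \<bar>u k - v k\<bar> < r} \<in> sets (lborel_on F)"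
    unfolding eq by (intro sets_PiM_I_finite fin) auto
  have "emeasure (lborel_on F) (PiE F (\<lambda>k. {v k - r<..<v k + r})) = (\<Prod>k\<in>F. emeasure lborel {v k - r<..<v k + r})"
    by (rule lborel_power.emeasure_PiM[OF fin]) auto
  also have "\<dots> = (\<Prod>k\<in>F. ennreal (2 * r))" using assms by (intro prod.cong) auto
  also have "\<dots> = ennreal ((2 * r) ^ card F)" using assms by (simp add: ennreal_power)
  finally show "emeasure (lborel_on F) {u \<in> space (lborel_on F). \<forall>k\<in>F. \<bar>u k - v k\<bar> < r} = ennreal ((2 * r) ^ card F)"
    unfolding eq .
qed

lemma q_box:
  assumes "\<eta> > 0" "r > 0"
  shows "\<exists>r'>0. r' \<le> r \<and> (\<forall>u. (\<forall>k\<in>F. \<bar>u k - v k\<bar> < r') \<longrightarrow> q u \<le> q v + \<eta>)"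
proof -
  define M where "M = (\<Sum>k\<in>F. 2 * \<bar>v k\<bar> + 1)"
  have M: "M \<ge> 0" unfolding M_def by (intro sum_nonneg) auto
  define r' where "r' = min (min r 1) (\<eta> / (M + 1))"
  have r': "0 < r'" "r' \<le> r" "r' \<le> 1" "r' \<le> \<eta> / (M + 1)" using assms M by (auto simp: r'_def)
  have "q u \<le> q v + \<eta>" if u: "\<forall>k\<in>F. \<bar>u k - v k\<bar> < r'" for u
  proof -
    have "q u \<le> (\<Sum>k\<in>F. (v k)\<^sup>2 + r' * (2 * \<bar>v k\<bar> + 1))"
    proof (rule sum_mono)
      fix k assume k: "k \<in> F"
      define d where "d = u k - v k"
      have d: "\<bar>d\<bar> < r'" using u k by (simp add: d_def)
      have "(u k)\<^sup>2 = (v k)\<^sup>2 + 2 * v k * d + d * d" by (simp add: d_def power2_eq_square algebra_simps)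
      moreover have "v k * d \<le> \<bar>v k\<bar> * r'"
      proof -
        have "v k * d \<le> \<bar>v k\<bar> * \<bar>d\<bar>" by (simp flip: abs_mult)
        also have "\<dots> \<le> \<bar>v k\<bar> * r'" using d by (intro mult_left_mono) auto
        finally show ?thesis .
      qed
      moreover have "d * d \<le> r' * 1"
      proof -
        have "d * d \<le> \<bar>d\<bar> * \<bar>d\<bar>" by simp
        also have "\<dots> \<le> r' * 1" using d r' by (intro mult_mono) auto
        finally show ?thesis .
      qed
      ultimately show "(u k)\<^sup>2 \<le> (v k)\<^sup>2 + r' * (2 * \<bar>v k\<bar> + 1)" by (simp add: algebra_simps)
    qed
    also have "\<dots> = q v + r' * M" unfolding M_def sum_distrib_left by (rule sum.distrib)
    also have "r' * M \<le> r' * (M + 1)" using r' by simp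
    also have "r' * (M + 1) \<le> \<eta>" using r' M by (simp add: pos_le_divide_eq)
    finally show ?thesis by simp
  qed
  then show ?thesis using r' by blast
qed

lemma total_mass_pos:
  assumes "s > 0"
  shows "0 < (\<integral>\<^sup>+u. ennreal (R (\<lambda>k. u k / s) ^ N) \<partial>lborel_on F)"
proof -
  obtain r where r: "r > 0" "\<And>z. q z \<le> r\<^sup>2 \<Longrightarrow> exp (- ((1 + 1) / 2 * q z)) \<le> R z"
    using two_sided[of 1] by auto
  obtain r' where r': "r' > 0" "\<And>u. (\<forall>k\<in>F. \<bar>u k - 0\<bar> < r') \<Longrightarrow> q u \<le> (\<Sum>k\<in>F. 0\<^sup>2) + (s * r)\<^sup>2"
    using q_box[of "(s * r)\<^sup>2" 1 "\<lambda>_. 0"] assms r by auto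
  let ?W = "{u \<in> space (lborel_on F). \<forall>k\<in>F. \<bar>u k - 0\<bar> < r'}"
  have W: "?W \<in> sets (lborel_on F)" "emeasure (lborel_on F) ?W = ennreal ((2 * r') ^ card F)"
    using box_mass[OF r'(1), of "\<lambda>_. 0"] by auto
  define c where "c = exp (- (real N * r\<^sup>2))"
  have "0 < ennreal c * ennreal ((2 * r') ^ card F)" using r' by (simp add: c_def ennreal_zero_less_mult_iff)
  also have "\<dots> = (\<integral>\<^sup>+u. ennreal c * indicator ?W u \<partial>lborel_on F)"
    using W by (subst nn_integral_cmult_indicator) auto
  also have "\<dots> \<le> (\<integral>\<^sup>+u. ennreal (R (\<lambda>k. u k / s) ^ N) \<partial>lborel_on F)"
  proof (rule nn_integral_mono)
    fix u
    have "c \<le> R (\<lambda>k. u k / s) ^ N" if "u \<in> ?W"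
    proof -
      have qu: "q u \<le> (s * r)\<^sup>2" using r'(2)[of u] that by simp
      have "q (\<lambda>k. u k / s) \<le> r\<^sup>2"
        unfolding q_divide using qu assms by (simp add: pos_divide_le_eq power_mult_distrib mult.commute)
      moreover from this have "exp (- (r\<^sup>2)) \<le> R (\<lambda>k. u k / s)" by (intro order_trans[OF _ r(2)]) auto
      ultimately show ?thesis unfolding c_def by (intro power_ge_exp)
    qed
    then show "ennreal c * indicator ?W u \<le> ennreal (R (\<lambda>k. u k / s) ^ N)"
      by (auto split: split_indicator intro!: ennreal_leI)
  qed
  finally show ?thesis .
qed

lemma scaled_exponent:
  assumes "0 < n" "0 < s"
  shows "real (n - l) * (c * q (\<lambda>k. u k / s)) = real (n - l) / real n * (real n / s\<^sup>2 * (c * q u))"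
  unfolding q_divide using assms by simp

text \<open>A fixed small box about v suffices. Division by a_n brings it into the range of
  \<open>two_sided\<close>, where the integrand is at least exp (- b (q v / 2 + 3 \<eta> / 4)) with
  b the speed, and the remaining \<eta> / 4 absorbs the volume of the box once b is large.\<close>

lemma laplace_lower:
  assumes a: "filterlim a at_top sequentially"
    and b: "filterlim (\<lambda>n. real n / (a n)\<^sup>2) at_top sequentially"
    and r: "r > 0" and \<eta>: "\<eta> > 0"
  shows "\<forall>\<^sub>F n in sequentially. ennreal (exp (- (real n / (a n)\<^sup>2 * (q v / 2 + \<eta>))))
     \<le> (\<integral>\<^sup>+u. ennreal (R (\<lambda>k. u k / a n) ^ (n - l)) * indicator {u \<in> space (lborel_on F). \<forall>k\<in>F. \<bar>u k - v k\<bar> < r} u \<partial>lborel_on F)"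
proof -
  define Q where "Q = q v + \<eta>"
  have Q: "Q > 0" using \<eta> q_nonneg[of v] by (simp add: Q_def)
  \<comment> \<open>Makes e Q at most \<eta> / 2, so that (1 + e) Q / 2 exceeds q v / 2 by at most 3
    \<eta> / 4.\<close>
  define e where "e = min 1 (\<eta> / (2 * Q))"
  have e: "0 < e" "e \<le> 1" "e \<le> \<eta> / (2 * Q)" using \<eta> Q by (auto simp: e_def)
  have eQ: "(1 + e) / 2 * Q \<le> q v / 2 + 3 / 4 * \<eta>"
  proof -
    have "e * Q \<le> \<eta> / 2" using e Q by (simp add: field_simps)
    moreover have "(1 + e) / 2 * Q = Q / 2 + e * Q / 2" by (simp add: field_simps)
    moreover have "Q = q v + \<eta>" by (simp only: Q_def)
    ultimately show ?thesis by linarith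
  qed
  obtain \<rho> where \<rho>: "\<rho> > 0" "\<And>z. q z \<le> \<rho>\<^sup>2 \<Longrightarrow> exp (- ((1 + e) / 2 * q z)) \<le> R z"
    using two_sided[OF e(1,2)] by blast
  obtain r' where r': "r' > 0" "r' \<le> r" "\<And>u. (\<forall>k\<in>F. \<bar>u k - v k\<bar> < r') \<Longrightarrow> q u \<le> Q"
    using q_box[OF \<eta> r, of v] unfolding Q_def by blast
  let ?W = "{u \<in> space (lborel_on F). \<forall>k\<in>F. \<bar>u k - v k\<bar> < r'}"
  define V where "V = (2 * r') ^ card F"
  have V: "V > 0" using r' by (simp add: V_def)
  have W: "?W \<in> sets (lborel_on F)" "emeasure (lborel_on F) ?W = ennreal V"
    using box_mass[OF r'(1), of v] by (auto simp: V_def)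
  have "\<forall>\<^sub>F n in sequentially. max 1 (sqrt Q / \<rho>) \<le> a n" using a unfolding filterlim_at_top by blast
  moreover have "\<forall>\<^sub>F n in sequentially. max 0 (- (ln V * 4 / \<eta>)) \<le> real n / (a n)\<^sup>2" using b unfolding filterlim_at_top by blast
  ultimately show ?thesis using eventually_gt_at_top[of 0]
  proof eventually_elim
    case (elim n)
    let ?b = "real n / (a n)\<^sup>2"
    have an: "0 < a n" "sqrt Q / \<rho> \<le> a n" using elim by auto
    have "sqrt Q \<le> a n * \<rho>" using an \<rho> by (simp add: pos_divide_le_eq)
    then have "(sqrt Q)\<^sup>2 \<le> (a n * \<rho>)\<^sup>2" using Q by (intro power_mono) auto
    then have Qa: "Q / (a n)\<^sup>2 \<le> \<rho>\<^sup>2" using Q an by (simp add: pos_divide_le_eq power_mult_distrib mult.commute)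
    have b0: "0 \<le> ?b" by simp
    have "- (ln V * 4 / \<eta>) \<le> ?b" using elim by simp
    then have "- (ln V * 4 / \<eta>) * (\<eta> / 4) \<le> ?b * (\<eta> / 4)" using \<eta> by (intro mult_right_mono) auto
    then have "- (?b * (\<eta> / 4)) \<le> ln V" using \<eta> by simp
    then have "exp (- (?b * (\<eta> / 4))) \<le> exp (ln V)" by (simp only: exp_le_cancel_iff)
    then have VV: "exp (- (?b * (\<eta> / 4))) \<le> V" using V by (simp only: exp_ln)
    define c where "c = exp (- (?b * (q v / 2 + 3 / 4 * \<eta>)))"
    have "exp (- (?b * (q v / 2 + \<eta>))) = c * exp (- (?b * (\<eta> / 4)))"
      unfolding c_def exp_add[symmetric] by (simp add: algebra_simps)
    also have "\<dots> \<le> c * V" using VV by (intro mult_left_mono) (auto simp: c_def)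
    finally have "ennreal (exp (- (?b * (q v / 2 + \<eta>)))) \<le> ennreal (c * V)" by (rule ennreal_leI)
    also have "\<dots> = ennreal c * ennreal V" using V by (simp add: ennreal_mult' c_def)
    also have "\<dots> = (\<integral>\<^sup>+u. ennreal c * indicator ?W u \<partial>lborel_on F)"
      using W by (subst nn_integral_cmult_indicator) auto
    also have "\<dots> \<le> (\<integral>\<^sup>+u. ennreal (R (\<lambda>k. u k / a n) ^ (n - l)) * indicator {u \<in> space (lborel_on F). \<forall>k\<in>F. \<bar>u k - v k\<bar> < r} u \<partial>lborel_on F)"
    proof (rule nn_integral_mono)
      fix u
      show "ennreal c * indicator ?W u \<le> ennreal (R (\<lambda>k. u k / a n) ^ (n - l)) * indicator {u \<in> space (lborel_on F). \<forall>k\<in>F. \<bar>u k - v k\<bar> < r} u"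
      proof (cases "u \<in> ?W")
        case True
        then have qu: "q u \<le> Q" using r'(3)[of u] by blast
        have "q (\<lambda>k. u k / a n) \<le> Q / (a n)\<^sup>2" unfolding q_divide using qu by (intro divide_right_mono) auto
        also have "\<dots> \<le> \<rho>\<^sup>2" by (rule Qa)
        finally have "exp (- (real (n - l) * ((1 + e) / 2 * q (\<lambda>k. u k / a n)))) \<le> R (\<lambda>k. u k / a n) ^ (n - l)"
          by (intro power_ge_exp \<rho>(2))
        moreover have "real (n - l) * ((1 + e) / 2 * q (\<lambda>k. u k / a n)) \<le> ?b * (q v / 2 + 3 / 4 * \<eta>)"
        proof -
          have "real (n - l) * ((1 + e) / 2 * q (\<lambda>k. u k / a n)) = real (n - l) / real n * (?b * ((1 + e) / 2 * q u))"
            by (rule scaled_exponent) (use elim an in auto)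
          also have "\<dots> \<le> 1 * (?b * ((1 + e) / 2 * q u))"
            using ratio_le[of n l] e q_nonneg[of u] b0 by (intro mult_right_mono mult_nonneg_nonneg) auto
          also have "\<dots> \<le> ?b * ((1 + e) / 2 * Q)" using qu e b0 by (simp only: mult_1) (intro mult_left_mono, auto)
          also have "\<dots> \<le> ?b * (q v / 2 + 3 / 4 * \<eta>)" using eQ b0 by (intro mult_left_mono)
          finally show ?thesis .
        qed
        then have "c \<le> exp (- (real (n - l) * ((1 + e) / 2 * q (\<lambda>k. u k / a n))))"
          unfolding c_def by (simp only: exp_le_cancel_iff neg_le_iff_le)
        ultimately have "c \<le> R (\<lambda>k. u k / a n) ^ (n - l)" by (rule order_trans[rotated])
        then have "ennreal c \<le> ennreal (R (\<lambda>k. u k / a n) ^ (n - l))" by (rule ennreal_leI)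
        moreover have "u \<in> {u \<in> space (lborel_on F). \<forall>k\<in>F. \<bar>u k - v k\<bar> < r}" using True r'(2) by fastforce
        ultimately show ?thesis using True by (simp only: indicator_simps mult_1_right)
      qed simp
    qed
    finally show ?case .
  qed
qed

text \<open>A small multiple c of q is split off the exponent to keep the integral finite; what
  remains is at least (1 - 3 e) b \<kappa> on G. Within radius \<rho> a_n this follows from
  \<open>two_sided\<close>; beyond it \<open>gauss_bound\<close> suffices, because q is there at
  least \<rho>^2 a_n^2 and outgrows \<kappa>.\<close>

lemma laplace_upper:
  assumes a: "filterlim a at_top sequentially"
    and b: "filterlim (\<lambda>n. real n / (a n)\<^sup>2) at_top sequentially"
    and G: "G \<in> sets (lborel_on F)" and \<kappa>: "0 \<le> \<kappa>" "\<And>u. u \<in> G \<Longrightarrow> \<kappa> \<le> q u / 2" and \<eta>: "\<eta> > 0"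
  shows "\<forall>\<^sub>F n in sequentially.
     (\<integral>\<^sup>+u. ennreal (R (\<lambda>k. u k / a n) ^ (n - l)) * indicator G u \<partial>lborel_on F)
     \<le> ennreal (exp (- (real n / (a n)\<^sup>2 * (\<kappa> - \<eta>))))"
proof -
  \<comment> \<open>The exponent loses 3 e \<kappa>, and e b pays for the Gaussian integral J, so e
    (3 \<kappa> + 1) <= \<eta> is what is required; e <= 1/3 keeps 1 - 3 e nonnegative.\<close>
  define e where "e = min (1 / 3) (\<eta> / (3 * \<kappa> + 1))"
  have e1: "0 < e" using \<eta> \<kappa> by (simp add: e_def)
  have e2: "e \<le> 1 / 3" unfolding e_def by (rule min.cobounded1)
  have e3: "e \<le> \<eta> / (3 * \<kappa> + 1)" unfolding e_def by (rule min.cobounded2)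
  note e = e1 e2 e3
  have ek: "e * (3 * \<kappa> + 1) \<le> \<eta>" using e \<kappa> by (simp add: pos_le_divide_eq)
  obtain \<beta> where \<beta>: "\<beta> > 0" "\<And>z. R z \<le> exp (- (\<beta> * q z))" using gauss_bound by blast
  obtain \<rho> where \<rho>: "\<rho> > 0" "\<And>z. q z \<le> \<rho>\<^sup>2 \<Longrightarrow> R z \<le> exp (- ((1 - e) / 2 * q z))"
    using two_sided[of e] e by auto
  \<comment> \<open>In the near region e / 2 is the margin between 1 - 3 e and 1 - 2 e; in the far
    region one \<beta> / 4 goes here and another one pays for \<kappa>.\<close>
  define c where "c = min (e / 2) (\<beta> / 4)"
  have c: "0 < c" using e \<beta> by (simp add: c_def)
  have c1: "c \<le> e / 2" unfolding c_def by (rule min.cobounded1)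
  have c2: "c \<le> \<beta> / 4" unfolding c_def by (rule min.cobounded2)
  define J where "J = (\<integral>\<^sup>+u. ennreal (exp (- c * q u)) \<partial>lborel_on F)"
  have J: "J < \<infinity>" unfolding J_def by (rule nn_integral_gauss_finite[OF fin c])
  obtain j where j: "J = ennreal j" "0 \<le> j" using J by (cases J) auto
  have "\<forall>\<^sub>F n in sequentially. max 1 (4 * \<kappa> / (\<beta> * \<rho>\<^sup>2)) \<le> a n" using a unfolding filterlim_at_top by blast
  moreover have "\<forall>\<^sub>F n in sequentially. max 1 (ln (j + 1) / e) \<le> real n / (a n)\<^sup>2" using b unfolding filterlim_at_top by blast
  moreover have "\<forall>\<^sub>F n in sequentially. 1 - e < real (n - l) / real n"
    by (rule order_tendstoD(1)[OF ratio_tendsto]) (use e in simp)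
  ultimately show ?thesis using eventually_gt_at_top[of 0]
  proof eventually_elim
    case (elim n)
    define b where "b = real n / (a n)\<^sup>2"
    define t where "t = real (n - l) / real n"
    have an: "1 \<le> a n" "4 * \<kappa> / (\<beta> * \<rho>\<^sup>2) \<le> a n" and b1: "1 \<le> b" "ln (j + 1) / e \<le> b" using elim by (auto simp: b_def)
    have t: "1 - e \<le> t" using elim by (simp add: t_def)
    have "a n * 1 \<le> a n * a n" using an by (intro mult_left_mono) auto
    then have "4 * \<kappa> / (\<beta> * \<rho>\<^sup>2) \<le> (a n)\<^sup>2" using an(2) by (simp add: power2_eq_square)
    then have "4 * \<kappa> \<le> (a n)\<^sup>2 * (\<beta> * \<rho>\<^sup>2)" using \<beta> \<rho> by (simp add: pos_divide_le_eq)
    then have k4: "\<kappa> \<le> \<beta> / 4 * ((a n)\<^sup>2 * \<rho>\<^sup>2)" by (simp add: algebra_simps)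
    have jb: "j \<le> exp (e * b)"
    proof -
      have "ln (j + 1) \<le> e * b" using b1(2) e by (simp add: pos_divide_le_eq mult.commute)
      then have "exp (ln (j + 1)) \<le> exp (e * b)" by (simp only: exp_le_cancel_iff)
      then show ?thesis using j by simp
    qed
    define d where "d = exp (- ((1 - 3 * e) * b * \<kappa>))"
    have pt: "R (\<lambda>k. u k / a n) ^ (n - l) \<le> d * exp (- c * q u)" if u: "u \<in> G" for u
    proof -
      have ku: "\<kappa> \<le> q u / 2" by (rule \<kappa>(2)[OF u])
      have qu: "0 \<le> q u" by (rule q_nonneg)
      have bq: "1 * (c * q u) \<le> b * (c * q u)" by (rule mult_right_mono[OF b1(1)]) (use c qu in simp)
      have ex: "\<exists>x. R (\<lambda>k. u k / a n) ^ (n - l) \<le> exp (- x) \<and> (1 - 3 * e) * b * \<kappa> + c * q u \<le> x"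
      proof (cases "q (\<lambda>k. u k / a n) \<le> \<rho>\<^sup>2")
        case True
        let ?x = "real (n - l) * ((1 - e) / 2 * q (\<lambda>k. u k / a n))"
        have "R (\<lambda>k. u k / a n) ^ (n - l) \<le> exp (- ?x)" by (rule power_le_exp[OF \<rho>(2)[OF True]])
        moreover have "(1 - 3 * e) * b * \<kappa> + c * q u \<le> ?x"
        proof -
          have "(1 - 3 * e) * \<kappa> + c * q u \<le> (1 - 3 * e) * (q u / 2) + e / 2 * q u"
            using ku e c1 qu by (intro add_mono mult_left_mono mult_right_mono) auto
          also have "\<dots> = (1 - 2 * e) * (q u / 2)" by (simp add: field_simps)
          also have "\<dots> \<le> ((1 - e) * (1 - e)) * (q u / 2)"
            using qu by (intro mult_right_mono) (auto simp: algebra_simps)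
          also have "\<dots> \<le> (t * (1 - e)) * (q u / 2)" by (intro mult_right_mono t) (use e qu in simp_all)
          finally have "b * ((1 - 3 * e) * \<kappa> + c * q u) \<le> b * ((t * (1 - e)) * (q u / 2))"
            using b1 by (intro mult_left_mono) auto
          also have "\<dots> = t * (b * ((1 - e) / 2 * q u))" by simp
          also have "\<dots> = ?x" unfolding t_def b_def by (rule scaled_exponent[symmetric]) (use elim an in auto)
          finally have "b * ((1 - 3 * e) * \<kappa> + c * q u) \<le> ?x" .
          moreover have "b * ((1 - 3 * e) * \<kappa> + c * q u) = (1 - 3 * e) * b * \<kappa> + b * (c * q u)"
            by (simp add: algebra_simps)
          ultimately show ?thesis using bq by linarith
        qed
        ultimately show ?thesis by blast
      next
        case False
        let ?x = "real (n - l) * (\<beta> * q (\<lambda>k. u k / a n))"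
        have "\<rho>\<^sup>2 \<le> q u / (a n)\<^sup>2" using False unfolding q_divide by simp
        then have far: "(a n)\<^sup>2 * \<rho>\<^sup>2 \<le> q u" using an by (simp add: pos_le_divide_eq mult.commute)
        have "R (\<lambda>k. u k / a n) ^ (n - l) \<le> exp (- ?x)" by (rule power_le_exp[OF \<beta>(2)])
        moreover have "(1 - 3 * e) * b * \<kappa> + c * q u \<le> ?x"
        proof -
          have "(1 - 3 * e) * \<kappa> \<le> 1 * \<kappa>" using e \<kappa> by (intro mult_right_mono) auto
          also have "1 * \<kappa> \<le> \<beta> / 4 * ((a n)\<^sup>2 * \<rho>\<^sup>2)" using k4 by simp
          also have "\<dots> \<le> \<beta> / 4 * q u" using far \<beta> by (intro mult_left_mono) auto
          finally have "(1 - 3 * e) * \<kappa> + c * q u \<le> \<beta> / 4 * q u + \<beta> / 4 * q u"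
            using c2 qu by (intro add_mono mult_right_mono) auto
          also have "\<dots> = 1 / 2 * (\<beta> * q u)" by simp
          also have "\<dots> \<le> t * (\<beta> * q u)"
          proof (rule mult_right_mono)
            show "1 / 2 \<le> t" using t e by linarith
          qed (use \<beta> qu in simp)
          finally have "b * ((1 - 3 * e) * \<kappa> + c * q u) \<le> b * (t * (\<beta> * q u))"
            using b1 by (intro mult_left_mono) auto
          also have "\<dots> = t * (b * (\<beta> * q u))" by simp
          also have "\<dots> = ?x" unfolding t_def b_def by (rule scaled_exponent[symmetric]) (use elim an in auto)
          finally have "b * ((1 - 3 * e) * \<kappa> + c * q u) \<le> ?x" .
          moreover have "b * ((1 - 3 * e) * \<kappa> + c * q u) = (1 - 3 * e) * b * \<kappa> + b * (c * q u)"
            by (simp add: algebra_simps)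
          ultimately show ?thesis using bq by linarith
        qed
        ultimately show ?thesis by blast
      qed
      then obtain x where x: "R (\<lambda>k. u k / a n) ^ (n - l) \<le> exp (- x)" "(1 - 3 * e) * b * \<kappa> + c * q u \<le> x" by blast
      have "exp (- x) \<le> exp (- ((1 - 3 * e) * b * \<kappa> + c * q u))" using x(2) by (simp only: exp_le_cancel_iff neg_le_iff_le)
      also have "\<dots> = d * exp (- c * q u)" unfolding d_def exp_add[symmetric] by simp
      finally show ?thesis using x(1) by linarith
    qed
    have "(\<integral>\<^sup>+u. ennreal (R (\<lambda>k. u k / a n) ^ (n - l)) * indicator G u \<partial>lborel_on F)
       \<le> (\<integral>\<^sup>+u. ennreal d * ennreal (exp (- c * q u)) \<partial>lborel_on F)"
    proof (rule nn_integral_mono)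
      fix u
      have "ennreal (R (\<lambda>k. u k / a n) ^ (n - l)) \<le> ennreal d * ennreal (exp (- c * q u))" if "u \<in> G"
        using ennreal_leI[OF pt[OF that]] by (simp only: ennreal_mult' exp_ge_zero d_def)
      then show "ennreal (R (\<lambda>k. u k / a n) ^ (n - l)) * indicator G u \<le> ennreal d * ennreal (exp (- c * q u))"
        by (cases "u \<in> G") simp_all
    qed
    also have "\<dots> = ennreal d * J" unfolding J_def by (rule nn_integral_cmult) measurable
    also have "\<dots> = ennreal (d * j)" using j by (simp add: ennreal_mult' d_def)
    also have "\<dots> \<le> ennreal (exp (- (b * (\<kappa> - \<eta>))))"
    proof (rule ennreal_leI)
      have "d * j \<le> d * exp (e * b)" using jb by (intro mult_left_mono) (auto simp: d_def)
      also have "\<dots> = exp (- (b * (\<kappa> - e * (3 * \<kappa> + 1))))"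
        unfolding d_def exp_add[symmetric] by (simp add: algebra_simps)
      also have "\<dots> \<le> exp (- (b * (\<kappa> - \<eta>)))"
      proof -
        have "b * (\<kappa> - \<eta>) \<le> b * (\<kappa> - e * (3 * \<kappa> + 1))" using ek b1 by (intro mult_left_mono) auto
        then show ?thesis by (simp only: exp_le_cancel_iff neg_le_iff_le)
      qed
      finally show "d * j \<le> exp (- (b * (\<kappa> - \<eta>)))" .
    qed
    finally show ?case unfolding b_def .
  qed
qed

end

section \<open>The covariance matrix and its pseudo-inverse\<close>

definition low :: "(nat \<Rightarrow> nat \<Rightarrow> real) \<Rightarrow> nat set \<Rightarrow> nat \<Rightarrow> nat \<Rightarrow> real" where
  "low B F i k = (if i \<in> F \<and> k \<in> F \<and> k \<le> i then B i k else 0)"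

text \<open>The linear map z -> B z into R^l with zeros at the constrained indices; its image is the
  subspace on which the rate is finite.\<close>

definition embed :: "(nat \<Rightarrow> nat \<Rightarrow> real) \<Rightarrow> nat set \<Rightarrow> nat \<Rightarrow> (nat \<Rightarrow> real) \<Rightarrow> nat \<Rightarrow> real" where
  "embed B F l z = (\<lambda>j\<in>{1..l}. \<Sum>k\<in>F. low B F j k * z k)"

lemma tri_low:
  assumes "finite F" "i \<in> F" shows "tri B F (\<lambda>_. 0) z i = (\<Sum>k\<in>F. low B F i k * z k)"
proof -
  have "tri B F (\<lambda>_. 0) z i = (\<Sum>j\<in>{j\<in>F. j \<le> i}. B i j * z j)" using assms(2) by (simp add: tri_def)
  also have "\<dots> = (\<Sum>k\<in>F. low B F i k * z k)"
    using assms by (intro sum.mono_neutral_cong_left) (auto simp: low_def)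
  finally show ?thesis .
qed

lemma low_outside: "i \<notin> F \<Longrightarrow> low B F i k = 0" by (simp add: low_def)

lemma tri_surj:
  assumes "finite F" "\<And>k. k \<in> F \<Longrightarrow> B k k \<noteq> 0"
  shows "\<exists>z. z \<in> extensional F \<and> (\<forall>i\<in>F. tri B F (\<lambda>_. 0) z i = x i)"
  using assms
proof (induction F rule: finite_linorder_max_induct)
  case empty show ?case by (intro exI[of _ "\<lambda>_. undefined"]) auto
next
  case (insert k F)
  have lt: "\<And>j. j \<in> F \<Longrightarrow> j < k" and kF: "k \<notin> F" using insert.hyps by blast+
  obtain z where z: "z \<in> extensional F" "\<forall>i\<in>F. tri B F (\<lambda>_. 0) z i = x i"
    using insert.IH insert.prems by auto
  define z' where "z' = z(k := (x k - (\<Sum>j\<in>F. B k j * z j)) / B k k)"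
  have "tri B (insert k F) (\<lambda>_. 0) z' i = x i" if i: "i \<in> insert k F" for i
  proof (cases "i = k")
    case True
    have "(\<Sum>j\<in>F. B k j * z' j) = (\<Sum>j\<in>F. B k j * z j)" using kF by (intro sum.cong) (auto simp: z'_def)
    then show ?thesis using True tri_insert_new[OF insert.hyps(1) lt, of B "\<lambda>_. 0" z'] insert.prems[of k]
      by (simp add: z'_def)
  next
    case False
    then have iF: "i \<in> F" using i by simp
    have "tri B F (\<lambda>_. 0) z' = tri B F (\<lambda>_. 0) z" using kF by (intro tri_cong) (auto simp: z'_def)
    then show ?thesis using tri_insert_old[OF lt iF, of B "\<lambda>_. 0" z'] z iF by simp
  qed
  moreover have "z' \<in> extensional (insert k F)" using z(1) by (auto simp: z'_def extensional_def)
  ultimately show ?case by blast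
qed

definition cov_entry :: "(nat \<Rightarrow> nat \<Rightarrow> real) \<Rightarrow> nat set \<Rightarrow> nat \<Rightarrow> nat \<Rightarrow> real" where
  "cov_entry B F i j = (\<Sum>k\<in>F. low B F i k * low B F j k)"

definition cov_mat :: "(nat \<Rightarrow> nat \<Rightarrow> real) \<Rightarrow> nat set \<Rightarrow> nat \<Rightarrow> real mat" where
  "cov_mat B F l = mat l l (\<lambda>(i, j). cov_entry B F (Suc i) (Suc j))"

definition pad_mat :: "(nat \<Rightarrow> nat \<Rightarrow> real) \<Rightarrow> nat set \<Rightarrow> nat \<Rightarrow> real mat" where
  "pad_mat A F l = mat l l (\<lambda>(i, j). if Suc i \<in> F \<and> Suc j \<in> F then A (Suc i) (Suc j) else 0)"

text \<open>Polarization of \<open>Q\<close>; in matrix terms, B^T A B = I.\<close>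

lemma bilinear_polar:
  assumes F: "finite F" and sym: "\<And>i j. A i j = A j i"
    and Q: "\<And>z. quad F A (tri B F (\<lambda>_. 0) z) = (\<Sum>k\<in>F. (z k)\<^sup>2)"
  shows "(\<Sum>i\<in>F. \<Sum>k\<in>F. A i k * tri B F (\<lambda>_. 0) w i * tri B F (\<lambda>_. 0) z k) = (\<Sum>k\<in>F. w k * z k)"
proof -
  let ?T = "tri B F (\<lambda>_. 0)"
  define b where "b x y = (\<Sum>i\<in>F. \<Sum>k\<in>F. A i k * x i * y k)" for x y :: "nat \<Rightarrow> real"
  have bs: "b x y = b y x" for x y
  proof -
    have "b x y = (\<Sum>i\<in>F. \<Sum>k\<in>F. A k i * x k * y i)" unfolding b_def by (rule sum.swap)
    also have "\<dots> = b y x" unfolding b_def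
    proof (intro sum.cong refl)
      fix i k have "A k i = A i k" by (rule sym)
      then show "A k i * x k * y i = A i k * y i * x k" by simp
    qed
    finally show ?thesis .
  qed
  have badd: "b (\<lambda>i. x i + y i) (\<lambda>i. x i + y i) = b x x + b x y + b y x + b y y" for x y
    unfolding b_def by (simp add: algebra_simps sum.distrib)
  have T: "?T (\<lambda>k. w k + z k) i = ?T w i + ?T z i" if "i \<in> F" for i
    unfolding tri_low[OF F that] by (simp add: algebra_simps sum.distrib)
  have qb: "quad F A x = b x x" for x by (simp add: quad_def b_def)
  have "(\<Sum>k\<in>F. (w k + z k)\<^sup>2) = quad F A (?T (\<lambda>k. w k + z k))" by (rule Q[symmetric])
  also have "\<dots> = quad F A (\<lambda>i. ?T w i + ?T z i)" by (rule quad_cong) (rule T)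
  also have "\<dots> = quad F A (?T w) + 2 * b (?T w) (?T z) + quad F A (?T z)"
    unfolding qb badd using bs[of "?T z" "?T w"] by simp
  also have "\<dots> = (\<Sum>k\<in>F. (w k)\<^sup>2) + 2 * b (?T w) (?T z) + (\<Sum>k\<in>F. (z k)\<^sup>2)" unfolding Q ..
  finally have "(\<Sum>k\<in>F. (w k)\<^sup>2) + 2 * b (?T w) (?T z) + (\<Sum>k\<in>F. (z k)\<^sup>2) = (\<Sum>k\<in>F. (w k + z k)\<^sup>2)" ..
  also have "\<dots> = (\<Sum>k\<in>F. (w k)\<^sup>2) + 2 * (\<Sum>k\<in>F. w k * z k) + (\<Sum>k\<in>F. (z k)\<^sup>2)"
    by (simp add: power2_sum sum.distrib sum_distrib_left mult.assoc)
  finally show ?thesis unfolding b_def by simp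
qed

text \<open>Choose z with B z = e_j. Polarization gives B^T A e_j = z, hence B B^T A e_j = B z =
  e_j, without forming the inverse of B.\<close>

lemma cov_inverse:
  assumes F: "finite F" and sym: "\<And>i j. A i j = A j i" and B: "\<And>k. k \<in> F \<Longrightarrow> B k k \<noteq> 0"
    and Q: "\<And>z. quad F A (tri B F (\<lambda>_. 0) z) = (\<Sum>k\<in>F. (z k)\<^sup>2)"
    and ij: "i \<in> F" "j \<in> F"
  shows "(\<Sum>m\<in>F. cov_entry B F i m * A m j) = (if i = j then 1 else 0)"
proof -
  let ?T = "tri B F (\<lambda>_. 0)"
  obtain z where z: "\<forall>i\<in>F. ?T z i = (if i = j then 1 else 0)"
    using tri_surj[of F B "\<lambda>i. if i = j then 1 else 0"] F B by blast
  have inner: "(\<Sum>m\<in>F. low B F m k * A m j) = z k" if k: "k \<in> F" for k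
  proof -
    let ?e = "\<lambda>i. if i = k then 1 else (0::real)"
    have Te: "?T ?e m = low B F m k" if "m \<in> F" for m
      unfolding tri_low[OF F that] using k F by (simp add: if_distrib cong: if_cong)
    have "(\<Sum>m\<in>F. low B F m k * A m j) = (\<Sum>m\<in>F. \<Sum>p\<in>F. A m p * ?T ?e m * ?T z p)"
    proof (intro sum.cong refl)
      fix m assume m: "m \<in> F"
      have "(\<Sum>p\<in>F. A m p * ?T ?e m * ?T z p) = (\<Sum>p\<in>F. if p = j then A m p * low B F m k else 0)"
        using z Te[OF m] by (intro sum.cong) auto
      then show "low B F m k * A m j = (\<Sum>p\<in>F. A m p * ?T ?e m * ?T z p)" using ij F by simp
    qed
    also have "\<dots> = (\<Sum>m\<in>F. ?e m * z m)" by (rule bilinear_polar[OF F sym Q])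
    also have "\<dots> = (\<Sum>m\<in>F. if m = k then z m else 0)" by (intro sum.cong) auto
    also have "\<dots> = z k" using k F by simp
    finally show ?thesis .
  qed
  have "(\<Sum>m\<in>F. cov_entry B F i m * A m j) = (\<Sum>m\<in>F. \<Sum>k\<in>F. low B F i k * (low B F m k * A m j))"
    unfolding cov_entry_def by (simp add: sum_distrib_right mult.assoc)
  also have "\<dots> = (\<Sum>k\<in>F. \<Sum>m\<in>F. low B F i k * (low B F m k * A m j))" by (rule sum.swap)
  also have "\<dots> = (\<Sum>k\<in>F. low B F i k * z k)" by (simp add: sum_distrib_left[symmetric] inner)
  also have "\<dots> = ?T z i" by (rule tri_low[OF F ij(1), symmetric])
  also have "\<dots> = (if i = j then 1 else 0)" using z ij by blast
  finally show ?thesis .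
qed

text \<open>Bridge between matrix indices starting at 0 and moments numbered from 1.\<close>

lemma sum_Suc_free:
  assumes "F \<subseteq> {1..l}" "\<And>j. j \<in> {1..l} - F \<Longrightarrow> g j = (0::real)"
  shows "(\<Sum>m = 0..<l. g (Suc m)) = (\<Sum>j\<in>F. g j)"
proof -
  have "(\<Sum>m = 0..<l. g (Suc m)) = (\<Sum>j\<in>{Suc 0..l}. g j)"
    unfolding sum.atLeast1_atMost_eq by (simp add: atLeast0LessThan)
  also have "\<dots> = (\<Sum>j\<in>F. g j)" by (rule sum.mono_neutral_right) (use assms in auto)
  finally show ?thesis .
qed

lemma cov_mat_carrier [simp]: "cov_mat B F l \<in> carrier_mat l l" by (simp add: cov_mat_def)
lemma pad_mat_carrier [simp]: "pad_mat A F l \<in> carrier_mat l l" by (simp add: pad_mat_def)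

lemma cov_entry_sym: "cov_entry B F i j = cov_entry B F j i"
  unfolding cov_entry_def by (simp add: mult.commute)

lemma transpose_cov_mat: "transpose_mat (cov_mat B F l) = cov_mat B F l"
  by (rule eq_matI) (auto simp: cov_mat_def cov_entry_sym)

lemma transpose_pad_mat: "(\<And>i j. A i j = A j i) \<Longrightarrow> transpose_mat (pad_mat A F l) = pad_mat A F l"
  by (rule eq_matI) (auto simp: pad_mat_def)

lemma cov_pad:
  assumes F: "finite F" "F \<subseteq> {1..l}" and sym: "\<And>i j. A i j = A j i" and B: "\<And>k. k \<in> F \<Longrightarrow> B k k \<noteq> 0"
    and Q: "\<And>z. quad F A (tri B F (\<lambda>_. 0) z) = (\<Sum>k\<in>F. (z k)\<^sup>2)"
  shows "cov_mat B F l * pad_mat A F l = pad_mat (\<lambda>i j. if i = j then 1 else 0) F l"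
proof (rule eq_matI)
  fix i j assume "i < dim_row (pad_mat (\<lambda>i j. if i = j then 1 else 0) F l)" "j < dim_col (pad_mat (\<lambda>i j. if i = j then 1 else 0) F l)"
  then have ij: "i < l" "j < l" by (auto simp: pad_mat_def)
  have "(cov_mat B F l * pad_mat A F l) $$ (i, j)
     = (\<Sum>m = 0..<l. cov_entry B F (Suc i) (Suc m) * (if Suc m \<in> F \<and> Suc j \<in> F then A (Suc m) (Suc j) else 0))"
    using ij by (simp add: cov_mat_def pad_mat_def scalar_prod_def)
  also have "\<dots> = (\<Sum>m\<in>F. cov_entry B F (Suc i) m * (if m \<in> F \<and> Suc j \<in> F then A m (Suc j) else 0))"
    by (rule sum_Suc_free[OF F(2)]) auto
  also have "\<dots> = (if Suc i \<in> F \<and> Suc j \<in> F then (if i = j then 1 else 0) else 0)"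
  proof (cases "Suc i \<in> F \<and> Suc j \<in> F")
    case True
    then show ?thesis using cov_inverse[OF F(1) sym B Q, of "Suc i" "Suc j"] by (simp cong: sum.cong)
  next
    case False
    then show ?thesis by (auto simp: cov_entry_def low_def intro!: sum.neutral)
  qed
  finally show "(cov_mat B F l * pad_mat A F l) $$ (i, j) = pad_mat (\<lambda>i j. if i = j then 1 else 0) F l $$ (i, j)"
    using ij by (simp add: pad_mat_def)
qed (auto simp: cov_mat_def pad_mat_def)

lemma pad_id_mult:
  assumes F: "F \<subseteq> {1..l}" and X: "X \<in> carrier_mat l l" and z: "\<And>i j. i < l \<Longrightarrow> j < l \<Longrightarrow> Suc i \<notin> F \<Longrightarrow> X $$ (i, j) = 0"
  shows "pad_mat (\<lambda>i j. if i = j then 1 else 0) F l * X = X"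
proof (rule eq_matI)
  fix i j assume "i < dim_row X" "j < dim_col X"
  then have ij: "i < l" "j < l" using X by auto
  have "(pad_mat (\<lambda>i j. if i = j then 1 else 0) F l * X) $$ (i, j)
     = (\<Sum>m = 0..<l. (if Suc i \<in> F \<and> Suc m \<in> F then (if Suc i = Suc m then 1 else 0) else 0) * X $$ (m, j))"
    using ij X by (simp add: pad_mat_def scalar_prod_def)
  also have "\<dots> = (\<Sum>m = 0..<l. if m = i then (if Suc i \<in> F then X $$ (i, j) else 0) else 0)"
    by (intro sum.cong refl) auto
  also have "\<dots> = X $$ (i, j)" using ij z[OF ij] by simp
  finally show "(pad_mat (\<lambda>i j. if i = j then 1 else 0) F l * X) $$ (i, j) = X $$ (i, j)" .
qed (use X in \<open>auto simp: pad_mat_def\<close>)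

text \<open>Uniqueness of the pseudo-inverse: symmetry of the projections gives A X = A Y and X A =
  Y A, whence Y = Y A Y = X A X = X.\<close>

lemma moore_penrose_eqI:
  assumes A: "A \<in> carrier_mat n n" and X: "X \<in> carrier_mat n n"
    and X1: "A * X * A = A" "X * A * X = X" "transpose_mat (A * X) = A * X" "transpose_mat (X * A) = X * A"
  shows "moore_penrose A = X"
  unfolding moore_penrose_def
proof (rule the_equality)
  show "X \<in> carrier_mat (dim_col A) (dim_row A) \<and> A * X * A = A \<and> X * A * X = X \<and>
     transpose_mat (A * X) = A * X \<and> transpose_mat (X * A) = X * A"
    using assms by auto
  fix Y assume "Y \<in> carrier_mat (dim_col A) (dim_row A) \<and> A * Y * A = A \<and> Y * A * Y = Y \<and>
     transpose_mat (A * Y) = A * Y \<and> transpose_mat (Y * A) = Y * A"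
  then have Y: "Y \<in> carrier_mat n n" and Y1: "A * Y * A = A" "Y * A * Y = Y" "transpose_mat (A * Y) = A * Y"
      "transpose_mat (Y * A) = Y * A" using A by auto
  note AX = mult_carrier_mat[OF A X] and AY = mult_carrier_mat[OF A Y]
    and XA = mult_carrier_mat[OF X A] and YA = mult_carrier_mat[OF Y A]
  have "A * X = (A * Y * A) * X" by (simp only: Y1)
  also have "\<dots> = (A * Y) * (A * X)" by (rule assoc_mult_mat[OF AY A X])
  also have "\<dots> = transpose_mat (A * Y) * transpose_mat (A * X)" by (simp only: X1 Y1)
  also have "\<dots> = transpose_mat ((A * X) * (A * Y))" by (rule transpose_mult[OF AX AY, symmetric])
  also have "(A * X) * (A * Y) = (A * X * A) * Y" by (rule assoc_mult_mat[OF AX A Y, symmetric])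
  also have "\<dots> = A * Y" by (simp only: X1)
  finally have e1: "A * X = A * Y" by (simp only: Y1)
  have "X * A = X * (A * Y * A)" by (simp only: Y1)
  also have "A * Y * A = A * (Y * A)" by (rule assoc_mult_mat[OF A Y A])
  also have "X * (A * (Y * A)) = (X * A) * (Y * A)" by (rule assoc_mult_mat[OF X A YA, symmetric])
  also have "\<dots> = transpose_mat (X * A) * transpose_mat (Y * A)" by (simp only: X1 Y1)
  also have "\<dots> = transpose_mat ((Y * A) * (X * A))" by (rule transpose_mult[OF YA XA, symmetric])
  also have "(Y * A) * (X * A) = Y * (A * (X * A))" by (rule assoc_mult_mat[OF Y A XA])
  also have "A * (X * A) = A * X * A" by (rule assoc_mult_mat[OF A X A, symmetric])
  also have "Y * (A * X * A) = Y * A" by (simp only: X1)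
  finally have e2: "X * A = Y * A" by (simp only: Y1)
  have "Y = Y * A * Y" by (simp only: Y1)
  also have "\<dots> = X * A * Y" by (simp only: e2)
  also have "\<dots> = X * (A * Y)" by (rule assoc_mult_mat[OF X A Y])
  also have "\<dots> = X * (A * X)" by (simp only: e1)
  also have "\<dots> = X * A * X" by (rule assoc_mult_mat[OF X A X, symmetric])
  also have "\<dots> = X" by (rule X1(2))
  finally show "Y = X" .
qed

text \<open>On the free coordinates the two matrices are inverse to each other, so both products
  equal the coordinate projection P. It is symmetric and fixes both matrices, which gives the four
  Penrose equations.\<close>

lemma moore_penrose_cov:
  assumes F: "finite F" "F \<subseteq> {1..l}" and sym: "\<And>i j. A i j = A j i" and B: "\<And>k. k \<in> F \<Longrightarrow> B k k \<noteq> 0"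
    and Q: "\<And>z. quad F A (tri B F (\<lambda>_. 0) z) = (\<Sum>k\<in>F. (z k)\<^sup>2)"
  shows "moore_penrose (cov_mat B F l) = pad_mat A F l"
proof -
  let ?S = "cov_mat B F l" and ?A = "pad_mat A F l" and ?P = "pad_mat (\<lambda>i j. if i = j then 1 else 0) F l"
  have SA: "?S * ?A = ?P" by (rule cov_pad[OF F sym B Q])
  have tP: "transpose_mat ?P = ?P" by (rule transpose_pad_mat) auto
  have "?A * ?S = transpose_mat ?A * transpose_mat ?S"
    unfolding transpose_cov_mat transpose_pad_mat[where A=A, OF sym] ..
  also have "\<dots> = transpose_mat (?S * ?A)" by (rule transpose_mult[OF cov_mat_carrier pad_mat_carrier, symmetric])
  also have "\<dots> = ?P" unfolding SA by (rule tP)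
  finally have AS: "?A * ?S = ?P" .
  have PS: "?P * ?S = ?S"
    by (rule pad_id_mult[OF F(2)]) (auto simp: cov_mat_def cov_entry_def low_def)
  have PA: "?P * ?A = ?A"
    by (rule pad_id_mult[OF F(2)]) (auto simp: pad_mat_def)
  show ?thesis
    by (rule moore_penrose_eqI[of _ l]) (simp_all only: SA AS PS PA tP cov_mat_carrier pad_mat_carrier)
qed

lemma scalar_prod_mult_vec:
  fixes A :: "real mat"
  assumes "A \<in> carrier_mat l l" "v \<in> carrier_vec l"
  shows "scalar_prod v (A *\<^sub>v v) = (\<Sum>i = 0..<l. \<Sum>j = 0..<l. A $$ (i, j) * v $ i * v $ j)"
proof -
  have "scalar_prod v (A *\<^sub>v v) = (\<Sum>i = 0..<l. \<Sum>j = 0..<l. v $ i * (A $$ (i, j) * v $ j))"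
    using assms by (simp add: scalar_prod_def sum_distrib_left)
  also have "\<dots> = (\<Sum>i = 0..<l. \<Sum>j = 0..<l. A $$ (i, j) * v $ i * v $ j)"
    by (intro sum.cong refl) (simp only: mult_ac)
  finally show ?thesis .
qed

lemma pad_quad:
  assumes "F \<subseteq> {1..l}"
  shows "scalar_prod (to_vec l x) (pad_mat A F l *\<^sub>v to_vec l x) = quad F A x"
proof -
  have "scalar_prod (to_vec l x) (pad_mat A F l *\<^sub>v to_vec l x)
    = (\<Sum>i = 0..<l. \<Sum>j = 0..<l. (if Suc i \<in> F \<and> Suc j \<in> F then A (Suc i) (Suc j) else 0) * x (Suc i) * x (Suc j))"
    by (subst scalar_prod_mult_vec[where l=l]) (auto simp: to_vec_def pad_mat_def intro!: sum.cong)
  also have "\<dots> = (\<Sum>i = 0..<l. \<Sum>j\<in>F. (if Suc i \<in> F \<and> j \<in> F then A (Suc i) j else 0) * x (Suc i) * x j)"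
    by (intro sum.cong refl sum_Suc_free[OF assms]) auto
  also have "\<dots> = (\<Sum>i\<in>F. \<Sum>j\<in>F. (if i \<in> F \<and> j \<in> F then A i j else 0) * x i * x j)"
    by (rule sum_Suc_free[OF assms]) auto
  also have "\<dots> = quad F A x" unfolding quad_def by (intro sum.cong refl) auto
  finally show ?thesis .
qed

section \<open>Linear functionals of the embedded vector and their variances\<close>

definition coeffs_of :: "(nat \<Rightarrow> nat \<Rightarrow> real) \<Rightarrow> nat set \<Rightarrow> nat \<Rightarrow> real vec \<Rightarrow> nat \<Rightarrow> real" where
  "coeffs_of B F l t k = (\<Sum>i = 0..<l. t $ i * low B F (Suc i) k)"

lemma functional_embed:
  "t \<in> carrier_vec l \<Longrightarrow> scalar_prod t (to_vec l (embed B F l z)) = (\<Sum>k\<in>F. coeffs_of B F l t k * z k)"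
proof -
  assume "t \<in> carrier_vec l"
  then have "scalar_prod t (to_vec l (embed B F l z)) = (\<Sum>i = 0..<l. \<Sum>k\<in>F. t $ i * low B F (Suc i) k * z k)"
    by (simp add: scalar_prod_def to_vec_def embed_def sum_distrib_left mult.assoc)
  also have "\<dots> = (\<Sum>k\<in>F. \<Sum>i = 0..<l. t $ i * low B F (Suc i) k * z k)" by (rule sum.swap)
  also have "\<dots> = (\<Sum>k\<in>F. coeffs_of B F l t k * z k)" unfolding coeffs_of_def by (simp add: sum_distrib_right)
  finally show ?thesis .
qed

lemma cov_quad:
  assumes t: "t \<in> carrier_vec l"
  shows "scalar_prod t (cov_mat B F l *\<^sub>v t) = (\<Sum>k\<in>F. (coeffs_of B F l t k)\<^sup>2)"
proof -
  have "scalar_prod t (cov_mat B F l *\<^sub>v t)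
     = (\<Sum>i = 0..<l. \<Sum>j = 0..<l. \<Sum>k\<in>F. (t $ i * low B F (Suc i) k) * (t $ j * low B F (Suc j) k))"
    by (subst scalar_prod_mult_vec[OF cov_mat_carrier t])
      (simp add: cov_mat_def cov_entry_def sum_distrib_left sum_distrib_right mult_ac)
  also have "\<dots> = (\<Sum>i = 0..<l. \<Sum>k\<in>F. \<Sum>j = 0..<l. (t $ i * low B F (Suc i) k) * (t $ j * low B F (Suc j) k))"
    by (rule sum.cong[OF refl sum.swap])
  also have "\<dots> = (\<Sum>k\<in>F. \<Sum>i = 0..<l. \<Sum>j = 0..<l. (t $ i * low B F (Suc i) k) * (t $ j * low B F (Suc j) k))"
    by (rule sum.swap)
  also have "\<dots> = (\<Sum>k\<in>F. (coeffs_of B F l t k)\<^sup>2)"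
    unfolding coeffs_of_def power2_eq_square sum_product ..
  finally show ?thesis .
qed

lemma cov_matrix_cov: "cov_matrix l (cov_mat B F l)"
  unfolding cov_matrix_def using cov_quad[of _ l B F] transpose_cov_mat[of B F l]
  by (auto intro!: sum_nonneg)

section \<open>The central limit theorem\<close>

abbreviation gauss_on :: "nat set \<Rightarrow> (nat \<Rightarrow> real) measure" where
  "gauss_on F \<equiv> PiM F (\<lambda>_. std_normal_distribution)"

lemma prob_space_std_normal: "prob_space std_normal_distribution"
  by (rule prob_space_normal_density) simp

lemma gauss_on_density:
  assumes F: "finite F"
  shows "gauss_on F = density (lborel_on F)
     (\<lambda>u. ennreal ((1 / sqrt (2 * pi)) ^ card F * exp (- ((\<Sum>k\<in>F. (u k)\<^sup>2) / 2))))"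
proof -
  interpret G: product_sigma_finite "\<lambda>_::nat. std_normal_distribution"
    by (intro product_sigma_finite.intro prob_space_imp_sigma_finite prob_space_std_normal)
  define w where "w u = (\<Prod>k\<in>F. ennreal (std_normal_density (u k)))" for u
  have wm [measurable]: "w \<in> borel_measurable (lborel_on F)"
    unfolding w_def by (intro borel_measurable_prod_ennreal) (rule measurable_compose[OF measurable_coord], auto)
  have "density (lborel_on F) w = gauss_on F"
  proof (rule G.PiM_eqI[OF F])
    show "sets (density (lborel_on F) w) = sets (gauss_on F)"
      by (simp cong: sets_PiM_cong)
    fix A assume A: "\<And>i. i \<in> F \<Longrightarrow> A i \<in> sets std_normal_distribution"
    then have A': "\<And>i. i \<in> F \<Longrightarrow> A i \<in> sets borel" by simp
    have S: "PiE F A \<in> sets (lborel_on F)" by (rule sets_PiM_I_finite[OF F]) (use A' in simp)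
    have "emeasure (density (lborel_on F) w) (PiE F A) = (\<integral>\<^sup>+u. w u * indicator (PiE F A) u \<partial>lborel_on F)"
      by (rule emeasure_density[OF wm S])
    also have "\<dots> = (\<integral>\<^sup>+u. (\<Prod>k\<in>F. ennreal (std_normal_density (u k)) * indicator (A k) (u k)) \<partial>lborel_on F)"
    proof (intro nn_integral_cong)
      fix u assume "u \<in> space (lborel_on F)"
      then have "indicator (PiE F A) u = (\<Prod>k\<in>F. indicator (A k) (u k) :: ennreal)"
        using F by (auto simp: indicator_def space_PiM PiE_def Pi_def)
      then show "w u * indicator (PiE F A) u = (\<Prod>k\<in>F. ennreal (std_normal_density (u k)) * indicator (A k) (u k))"
        by (simp add: w_def prod.distrib)
    qed
    also have "\<dots> = (\<Prod>k\<in>F. \<integral>\<^sup>+x. ennreal (std_normal_density x) * indicator (A k) x \<partial>lborel)"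
      by (rule lborel_power.product_nn_integral_prod[OF F, where f="\<lambda>k x. ennreal (std_normal_density x) * indicator (A k) x"])
        (use A' in auto)
    also have "\<dots> = (\<Prod>k\<in>F. emeasure std_normal_distribution (A k))"
      by (intro prod.cong refl emeasure_density[symmetric]) (use A' in auto)
    finally show "emeasure (density (lborel_on F) w) (PiE F A) = (\<Prod>i\<in>F. emeasure std_normal_distribution (A i))" .
  qed
  moreover have "w u = ennreal ((1 / sqrt (2 * pi)) ^ card F * exp (- ((\<Sum>k\<in>F. (u k)\<^sup>2) / 2)))" for u
  proof -
    have "w u = ennreal (\<Prod>k\<in>F. std_normal_density (u k))" unfolding w_def by (rule prod_ennreal) simp
    also have "(\<Prod>k\<in>F. std_normal_density (u k)) = (1 / sqrt (2 * pi)) ^ card F * (\<Prod>k\<in>F. exp (- (u k)\<^sup>2 / 2))"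
      unfolding std_normal_density_def prod.distrib by simp
    also have "(\<Prod>k\<in>F. exp (- (u k)\<^sup>2 / 2)) = exp (- ((\<Sum>k\<in>F. (u k)\<^sup>2) / 2))"
    proof -
      have "- ((\<Sum>k\<in>F. (u k)\<^sup>2) / 2) = (\<Sum>k\<in>F. - (u k)\<^sup>2 / 2)"
        unfolding sum_divide_distrib sum_negf[symmetric] by (intro sum.cong refl) simp
      then show ?thesis by (simp only: exp_sum[OF F])
    qed
    finally show ?thesis .
  qed
  then have "w = (\<lambda>u. ennreal ((1 / sqrt (2 * pi)) ^ card F * exp (- ((\<Sum>k\<in>F. (u k)\<^sup>2) / 2))))" by (rule ext)
  ultimately show ?thesis by simp
qed

lemma gauss_component:
  assumes "k \<in> F"
  shows "distr (gauss_on F) std_normal_distribution (\<lambda>u. u k) = std_normal_distribution"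
proof -
  interpret product_prob_space "\<lambda>_::nat. std_normal_distribution" F
    by (intro product_prob_spaceI prob_space_std_normal)
  show ?thesis using PiM_component[OF assms] by simp
qed

lemma prob_space_gauss: "prob_space (gauss_on F)"
  by (intro prob_space_PiM prob_space_std_normal)

text \<open>A sum of independent normal variables. Zero coefficients are dropped first, since each
  summand must have positive standard deviation; if none is left the law is the point mass of
  \<open>centered_normal 0\<close>.\<close>

lemma gauss_functional:
  assumes F: "finite F"
  shows "distr (gauss_on F) borel (\<lambda>u. \<Sum>k\<in>F. c k * u k) = centered_normal (\<Sum>k\<in>F. (c k)\<^sup>2)"
proof -
  interpret Q: prob_space "gauss_on F" by (rule prob_space_gauss)
  define I where "I = {k \<in> F. c k \<noteq> 0}"
  have I: "finite I" "I \<subseteq> F" using F by (auto simp: I_def)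
  have S: "(\<Sum>k\<in>F. c k * u k) = (\<Sum>k\<in>I. c k * u k)" for u
    by (rule sum.mono_neutral_right) (use F in \<open>auto simp: I_def\<close>)
  have V: "(\<Sum>k\<in>F. (c k)\<^sup>2) = (\<Sum>k\<in>I. (c k)\<^sup>2)"
    by (rule sum.mono_neutral_right) (use F in \<open>auto simp: I_def\<close>)
  have coord: "(\<lambda>u. u k) \<in> borel_measurable (gauss_on F)" if "k \<in> F" for k
    using measurable_component_singleton[OF that, of "\<lambda>_. std_normal_distribution"] by simp
  have dc: "distr (gauss_on F) borel (\<lambda>u. u k) = std_normal_distribution" if "k \<in> F" for k
  proof -
    have "distr (gauss_on F) borel (\<lambda>u. u k) = distr (gauss_on F) std_normal_distribution (\<lambda>u. u k)"
      by (rule distr_cong) auto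
    then show ?thesis using gauss_component[OF that] by simp
  qed
  show ?thesis
  proof (cases "I = {}")
    case True
    then show ?thesis unfolding S V by (simp add: centered_normal_def)
  next
    case False
    then have Fne: "F \<noteq> {}" using I by auto
    have "Q.indep_vars (\<lambda>_. borel) (\<lambda>k u. u k) F"
    proof (subst Q.indep_vars_iff_distr_eq_PiM'[OF Fne coord])
      have "distr (gauss_on F) (PiM F (\<lambda>_. borel)) (\<lambda>u. \<lambda>k\<in>F. u k) = distr (gauss_on F) (gauss_on F) (\<lambda>u. u)"
        by (rule distr_cong) (auto simp: space_PiM intro!: sets_PiM_cong)
      also have "\<dots> = gauss_on F" by simp
      also have "\<dots> = PiM F (\<lambda>k. distr (gauss_on F) borel (\<lambda>u. u k))"
        by (rule PiM_cong) (auto simp: dc)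
      finally show "distr (gauss_on F) (PiM F (\<lambda>_. borel)) (\<lambda>u. \<lambda>k\<in>F. u k) = PiM F (\<lambda>k. distr (gauss_on F) borel (\<lambda>u. u k))" .
    qed
    then have "Q.indep_vars (\<lambda>_. borel) (\<lambda>k u. u k) I" by (rule Q.indep_vars_subset[OF _ I(2)])
    then have ind: "Q.indep_vars (\<lambda>_. borel) (\<lambda>k u. c k * u k) I"
      by (rule Q.indep_vars_compose2[where Y="\<lambda>k x. c k * x"]) auto
    have nd: "distributed (gauss_on F) lborel (\<lambda>u. c k * u k) (normal_density 0 \<bar>c k\<bar>)" if "k \<in> I" for k
    proof -
      have kF: "k \<in> F" "c k \<noteq> 0" using that by (auto simp: I_def)
      have "distr (gauss_on F) lborel (\<lambda>u. u k) = distr (gauss_on F) borel (\<lambda>u. u k)" by (rule distr_cong) auto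
      then have "distributed (gauss_on F) lborel (\<lambda>u. u k) (normal_density 0 1)"
        unfolding distributed_def using dc[OF kF(1)] coord[OF kF(1)] by simp
      from Q.normal_density_affine[OF this _ kF(2), of 0] show ?thesis by simp
    qed
    have "distributed (gauss_on F) lborel (\<lambda>u. \<Sum>k\<in>I. c k * u k) (normal_density (\<Sum>k\<in>I. 0) (sqrt (\<Sum>k\<in>I. \<bar>c k\<bar>\<^sup>2)))"
      by (rule Q.sum_indep_normal[OF I(1) False ind _ nd]) (auto simp: I_def)
    then have "distr (gauss_on F) lborel (\<lambda>u. \<Sum>k\<in>I. c k * u k) = density lborel (normal_density 0 (sqrt (\<Sum>k\<in>I. (c k)\<^sup>2)))"
      by (simp add: distributed_def)
    moreover have "distr (gauss_on F) lborel (\<lambda>u. \<Sum>k\<in>I. c k * u k) = distr (gauss_on F) borel (\<lambda>u. \<Sum>k\<in>I. c k * u k)"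
      by (rule distr_cong) auto
    moreover have "0 < (\<Sum>k\<in>I. (c k)\<^sup>2)"
      by (rule sum_pos[OF I(1) False]) (auto simp: I_def)
    ultimately show ?thesis unfolding S V by (simp add: centered_normal_def)
  qed
qed

text \<open>The value is strictly decreasing in v, so this integral recovers the variance. The law
  is realized as a multiple of a standard normal coordinate, which treats v = 0 along with the
  rest.\<close>

lemma integral_cos_centered_normal:
  assumes "0 \<le> v" shows "(\<integral>x. cos x \<partial>centered_normal v) = exp (- v / 2)"
proof -
  have v: "v = (\<Sum>k\<in>{0::nat}. (sqrt v)\<^sup>2)" using assms by simp
  have m: "(\<lambda>u. u (0::nat)) \<in> measurable (gauss_on {0}) std_normal_distribution"
    by (rule measurable_component_singleton) simp
  have m': "(\<lambda>u. \<Sum>k\<in>{0::nat}. sqrt v * u k) \<in> borel_measurable (gauss_on {0})"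
    using m by simp
  have "(\<integral>x. cos x \<partial>centered_normal v) = (\<integral>x. cos x \<partial>distr (gauss_on {0}) borel (\<lambda>u. \<Sum>k\<in>{0::nat}. sqrt v * u k))"
    by (subst v, subst gauss_functional) auto
  also have "\<dots> = (\<integral>u. cos (sqrt v * u 0) \<partial>gauss_on {0})"
    by (subst integral_distr[OF m']) auto
  also have "\<dots> = (\<integral>x. cos (sqrt v * x) \<partial>distr (gauss_on {0}) std_normal_distribution (\<lambda>u. u 0))"
    by (subst integral_distr[OF m]) auto
  also have "\<dots> = (\<integral>x. cos (sqrt v * x) \<partial>std_normal_distribution)" using gauss_component[of 0 "{0}"] by simp
  also have "\<dots> = Re (char std_normal_distribution (sqrt v))"
  proof -
    interpret S: prob_space std_normal_distribution by (rule prob_space_std_normal)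
    have "integrable std_normal_distribution (\<lambda>x. iexp (sqrt v * x))"
      by (rule S.integrable_iexp) auto
    then have "Re (char std_normal_distribution (sqrt v)) = (\<integral>x. Re (iexp (sqrt v * x)) \<partial>std_normal_distribution)"
      unfolding char_def by (rule integral_Re[symmetric])
    then show ?thesis by (simp add: Re_exp mult.commute)
  qed
  also have "\<dots> = exp (- v / 2)" unfolding char_std_normal_distribution using assms by simp
  finally show ?thesis .
qed

lemma embed_extensional: "embed B F l z \<in> extensional {1..l}" by (simp add: embed_def)

lemma measurable_embed:
  assumes "finite F" shows "embed B F l \<in> measurable (lborel_on F) (borel_of (Rspace l))"
proof -
  have "embed B F l \<in> measurable (lborel_on F) (PiM {1..l} (\<lambda>_. borel))"
  proof (rule measurable_PiM_single')
    fix j assume "j \<in> {1..l}"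
    have "(\<lambda>z. \<Sum>k\<in>F. low B F j k * z k) \<in> borel_measurable (lborel_on F)"
      by (intro borel_measurable_sum borel_measurable_times borel_measurable_const measurable_coord)
    then show "(\<lambda>z. embed B F l z j) \<in> borel_measurable (lborel_on F)"
      using \<open>j \<in> {1..l}\<close> by (simp add: embed_def)
  qed (auto simp: embed_def)
  then show ?thesis using measurable_cong_sets[OF refl sets_borel_of_powertop] by blast
qed

lemma emeasure_distr_density:
  assumes w: "w \<in> borel_measurable M" and g: "g \<in> measurable M N" and A: "A \<in> sets N"
  shows "emeasure (distr (density M w) N g) A = (\<integral>\<^sup>+x. w x * indicator A (g x) \<partial>M)"
proof -
  have g': "g \<in> measurable (density M w) N" using g by simp
  have S: "g -` A \<inter> space M \<in> sets M" by (rule measurable_sets[OF g A])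
  show ?thesis
    unfolding emeasure_distr[OF g' A] space_density
    by (subst emeasure_density[OF w S]) (auto intro!: nn_integral_cong split: split_indicator)
qed

lemma tri_scale: "tri (\<lambda>i j. B i j / s) F v u = tri B F v (\<lambda>k. u k / s)"
  by (simp add: tri_def)

locale mdp_setup = laplace_ratio "free_indices C l" "eps_ratio C l y B" \<delta> K D
  for C :: moment_constraint and l :: nat and y :: "nat \<Rightarrow> real" and B :: "nat \<Rightarrow> nat \<Rightarrow> real"
    and \<delta> K D :: real +
  fixes A :: "nat \<Rightarrow> nat \<Rightarrow> real"
  assumes C: "is_constraint C" "top_index C \<le> l"
    and optimum_pos: "szego_pos (trig (fill_in C l y)) l"
    and optimum: "\<And>j. j \<in> {1..l} \<Longrightarrow> moment j (min_measure C) = fill_in C l y j"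
    and A_sym: "\<And>i j. A i j = A j i"
    and B_pos: "\<And>k. k \<in> free_indices C l \<Longrightarrow> 0 < B k k"
    and quad_tri: "\<And>z. quad (free_indices C l) A (tri B (free_indices C l) (\<lambda>_. 0) z) = (\<Sum>k\<in>free_indices C l. (z k)\<^sup>2)"
begin

abbreviation "F \<equiv> free_indices C l"
abbreviation "R \<equiv> eps_ratio C l y B"
abbreviation "iota \<equiv> embed B F l"

section \<open>The law of the rescaled moments in triangular coordinates\<close>

lemma F_sub: "F \<subseteq> {1..l}" by (auto simp: free_indices_def)

lemma B_ne: "k \<in> F \<Longrightarrow> B k k \<noteq> 0" using B_pos[of k] by simp

text \<open>N > 0 matters: outside the positive definite points the ratio is 0, and 0 ^ N has to
  vanish there.\<close>

lemma slice_weight_tri: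
  assumes "N > 0"
  shows "slice_weight C l N (tri B F y z) = ennreal (eps (trig (fill_in C l y)) l ^ N) * ennreal (R z ^ N)"
proof -
  have E: "eps (trig (fill_in C l y)) l > 0" using szego_pos_eps[OF optimum_pos] by simp
  show ?thesis
    using E assms by (simp add: slice_weight_def eps_ratio_def Let_def power_divide flip: ennreal_mult')
qed

text \<open>By \<open>optimum\<close> the centring vector is the base point of the coordinates, so
  after z = u / s the factor s cancels and a linear image of u remains.\<close>

lemma scale_map_tri:
  assumes "s > 0"
  shows "scale_map C l (\<lambda>j. moment j (min_measure C)) s (tri B F y (\<lambda>k. u k / s)) = iota u"
proof
  fix j
  show "scale_map C l (\<lambda>j. moment j (min_measure C)) s (tri B F y (\<lambda>k. u k / s)) j = iota u j"
  proof (cases "j \<in> {1..l}")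
    case j: True
    have "scale_map C l (\<lambda>j. moment j (min_measure C)) s (tri B F y (\<lambda>k. u k / s)) j
       = s * on_free C l (tri B F (\<lambda>_. 0) (\<lambda>k. u k / s)) j"
      unfolding scale_map_def fill_in_tri using j optimum[OF j] fill_in_add[OF j, of C y] by simp
    also have "\<dots> = (\<Sum>k\<in>F. low B F j k * u k)"
    proof (cases "j \<in> F")
      case True
      have "s * on_free C l (tri B F (\<lambda>_. 0) (\<lambda>k. u k / s)) j = s * (\<Sum>k\<in>F. low B F j k * (u k / s))"
        using True tri_low[OF finite_free_indices True, of B "\<lambda>k. u k / s"] by (simp add: on_free_def)
      then show ?thesis using assms by (simp add: sum_distrib_left)
    next
      case False then show ?thesis by (simp add: on_free_def low_outside)
    qed
    finally show ?thesis using j by (simp add: embed_def)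
  next
    case False then show ?thesis by (auto simp: scale_map_def embed_def)
  qed
qed

definition mass :: "real \<Rightarrow> nat \<Rightarrow> ennreal" where
  "mass s N = (\<integral>\<^sup>+u. ennreal (R (\<lambda>k. u k / s) ^ N) \<partial>lborel_on F)"

lemma mass_bounds: "s > 0 \<Longrightarrow> N > 0 \<Longrightarrow> 0 < mass s N \<and> mass s N < \<infinity>"
  unfolding mass_def using total_mass_pos total_mass_finite by blast

text \<open>The substitution x = y + B u / s in \<open>scaled_law_eq\<close>. The Jacobian P and the
  power e of the maximal error occur in the numerator and in the normalizer alike.\<close>

lemma emeasure_scaled_law:
  assumes n: "l < n" and s: "s n > 0" and G: "\<Gamma> \<in> sets (borel_of (Rspace l))"
  shows "emeasure (scaled_law C l s n) \<Gamma> =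
    (\<integral>\<^sup>+u. ennreal (R (\<lambda>k. u k / s n) ^ (n - l)) / mass (s n) (n - l) * indicator \<Gamma> (iota u) \<partial>lborel_on F)"
proof -
  let ?N = "n - l" and ?b = "\<lambda>j. moment j (min_measure C)"
  let ?B = "\<lambda>i j. B i j / s n"
  define P where "P = ennreal (\<Prod>k\<in>F. \<bar>?B k k\<bar>)"
  define e where "e = ennreal (eps (trig (fill_in C l y)) l ^ ?N)"
  define Zn where "Zn = mass (s n) ?N"
  have N: "?N > 0" using n by simp
  have ne: "?B k k \<noteq> 0" if "k \<in> F" for k using B_ne[OF that] s by simp
  have P: "0 < P" "P < \<infinity>" using B_ne s by (auto simp: P_def intro!: prod_pos)
  have e: "0 < e" "e < \<infinity>" using szego_pos_eps[OF optimum_pos] by (auto simp: e_def)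
  have Z: "0 < Zn" "Zn < \<infinity>" using mass_bounds[OF s N] by (auto simp: Zn_def)
  have W: "slice_weight C l ?N (tri ?B F y u) = e * ennreal (R (\<lambda>k. u k / s n) ^ ?N)" for u
    unfolding tri_scale e_def by (rule slice_weight_tri[OF N])
  have chg: "(\<integral>\<^sup>+x. f x \<partial>lborel_on F) = P * (\<integral>\<^sup>+u. f (tri ?B F y u) \<partial>lborel_on F)"
    if "f \<in> borel_measurable (lborel_on F)" for f
    unfolding P_def by (rule nn_integral_triangular[OF finite_free_indices ne that])
  define Z0 where "Z0 = (\<integral>\<^sup>+x. slice_weight C l ?N x \<partial>lborel_on F)"
  have Z0: "Z0 = P * e * Zn"
    unfolding Z0_def chg[OF measurable_slice_weight] W Zn_def mass_def
    by (subst nn_integral_cmult) (auto simp: mult.assoc intro!: measurable_compose[OF measurable_R_scaled])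
  have Pe: "P * e \<noteq> 0" "P * e \<noteq> \<infinity>" using P e by (auto simp: ennreal_mult_eq_top_iff)
  have Z0b: "0 < Z0" "Z0 < \<infinity>" unfolding Z0 using P e Z by (auto simp: ennreal_zero_less_mult_iff ennreal_mult_less_top)
  have m: "(\<lambda>x. slice_weight C l ?N x / Z0 * indicator \<Gamma> (scale_map C l ?b (s n) x)) \<in> borel_measurable (lborel_on F)"
  proof -
    have "(\<lambda>x. indicator \<Gamma> (scale_map C l ?b (s n) x) :: ennreal) \<in> borel_measurable (lborel_on F)"
      by (rule measurable_compose[OF measurable_scale_map borel_measurable_indicator[OF G]])
    then show ?thesis by (intro borel_measurable_times_ennreal borel_measurable_divide_ennreal) auto
  qed
  have "emeasure (scaled_law C l s n) \<Gamma> = (\<integral>\<^sup>+x. slice_weight C l ?N x / Z0 * indicator \<Gamma> (scale_map C l ?b (s n) x) \<partial>lborel_on F)"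
    unfolding scaled_law_eq[OF C n Z0_def Z0b]
    by (rule emeasure_distr_density[OF _ measurable_scale_map G]) auto
  also have "\<dots> = P * (\<integral>\<^sup>+u. e * ennreal (R (\<lambda>k. u k / s n) ^ ?N) / Z0 * indicator \<Gamma> (iota u) \<partial>lborel_on F)"
    unfolding chg[OF m] W unfolding tri_scale scale_map_tri[OF s] ..
  also have "\<dots> = (\<integral>\<^sup>+u. P * (e * ennreal (R (\<lambda>k. u k / s n) ^ ?N) / Z0 * indicator \<Gamma> (iota u)) \<partial>lborel_on F)"
  proof (rule nn_integral_cmult[symmetric])
    have "(\<lambda>u. indicator \<Gamma> (iota u) :: ennreal) \<in> borel_measurable (lborel_on F)"
      by (rule measurable_compose[OF measurable_embed[OF finite_free_indices] borel_measurable_indicator[OF G]])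
    moreover have "(\<lambda>u. ennreal (R (\<lambda>k. u k / s n) ^ ?N)) \<in> borel_measurable (lborel_on F)"
      by (intro measurable_compose[OF measurable_R_scaled]) auto
    ultimately show "(\<lambda>u. e * ennreal (R (\<lambda>k. u k / s n) ^ ?N) / Z0 * indicator \<Gamma> (iota u)) \<in> borel_measurable (lborel_on F)"
      by (intro borel_measurable_times_ennreal borel_measurable_divide_ennreal) auto
  qed
  also have "\<dots> = (\<integral>\<^sup>+u. ennreal (R (\<lambda>k. u k / s n) ^ ?N) / Zn * indicator \<Gamma> (iota u) \<partial>lborel_on F)"
  proof (intro nn_integral_cong)
    fix u
    let ?r = "ennreal (R (\<lambda>k. u k / s n) ^ ?N)"
    have "P * (e * ?r / Z0 * indicator \<Gamma> (iota u)) = (?r * (P * e)) / (Zn * (P * e)) * indicator \<Gamma> (iota u)"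
      unfolding Z0 by (simp add: divide_ennreal_def mult_ac)
    also have "(?r * (P * e)) / (Zn * (P * e)) = ?r / Zn" by (rule divide_mult_eq[OF Pe])
    finally show "P * (e * ?r / Z0 * indicator \<Gamma> (iota u)) = ?r / Zn * indicator \<Gamma> (iota u)" .
  qed
  finally show ?thesis unfolding Zn_def .
qed

lemma scaled_law_density:
  assumes n: "l < n" and s: "s n > 0"
  shows "scaled_law C l s n = distr (density (lborel_on F) (\<lambda>u. ennreal (R (\<lambda>k. u k / s n) ^ (n - l)) / mass (s n) (n - l)))
     (borel_of (Rspace l)) iota"
proof (rule measure_eqI)
  fix \<Gamma> assume "\<Gamma> \<in> sets (scaled_law C l s n)"
  then have G: "\<Gamma> \<in> sets (borel_of (Rspace l))" by (simp add: scaled_law_def)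
  have w: "(\<lambda>u. ennreal (R (\<lambda>k. u k / s n) ^ (n - l)) / mass (s n) (n - l)) \<in> borel_measurable (lborel_on F)"
    by (intro borel_measurable_divide_ennreal measurable_compose[OF measurable_R_scaled]) auto
  show "emeasure (scaled_law C l s n) \<Gamma> = emeasure (distr (density (lborel_on F) (\<lambda>u. ennreal (R (\<lambda>k. u k / s n) ^ (n - l)) / mass (s n) (n - l)))
     (borel_of (Rspace l)) iota) \<Gamma>"
    unfolding emeasure_scaled_law[where s=s, OF n s G] emeasure_distr_density[OF w measurable_embed[OF finite_free_indices] G] ..
qed (simp add: scaled_law_def)

lemma prob_space_scaled_law:
  assumes n: "l < n" and s: "s n > 0" shows "prob_space (scaled_law C l s n)"
proof (rule prob_spaceI)
  have sp: "space (scaled_law C l s n) = topspace (Rspace l)" by (simp add: scaled_law_def space_borel_of)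
  have "topspace (Rspace l) \<in> sets (borel_of (Rspace l))" by (rule openin_borel_of[OF openin_topspace])
  then have "emeasure (scaled_law C l s n) (topspace (Rspace l)) =
    (\<integral>\<^sup>+u. ennreal (R (\<lambda>k. u k / s n) ^ (n - l)) / mass (s n) (n - l) * indicator (topspace (Rspace l)) (iota u) \<partial>lborel_on F)"
    by (rule emeasure_scaled_law[where s=s, OF n s])
  also have "\<dots> = (\<integral>\<^sup>+u. ennreal (R (\<lambda>k. u k / s n) ^ (n - l)) / mass (s n) (n - l) \<partial>lborel_on F)"
    by (intro nn_integral_cong) (simp add: embed_def)
  also have "\<dots> = mass (s n) (n - l) / mass (s n) (n - l)"
    unfolding mass_def by (rule nn_integral_divide) (intro measurable_compose[OF measurable_R_scaled], auto)
  also have "\<dots> = 1" using mass_bounds[of "s n" "n - l"] s n by (intro ennreal_divide_self) auto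
  finally show "emeasure (scaled_law C l s n) (space (scaled_law C l s n)) = 1" unfolding sp .
qed

definition limit_law :: "(nat \<Rightarrow> real) measure" where
  "limit_law = distr (gauss_on F) (borel_of (Rspace l)) iota"

lemma measurable_iota_gauss: "iota \<in> measurable (gauss_on F) (borel_of (Rspace l))"
proof -
  have "sets (gauss_on F) = sets (lborel_on F)" by (intro sets_PiM_cong) auto
  then show ?thesis using measurable_embed[OF finite_free_indices] measurable_cong_sets by blast
qed

lemma measurable_functional: "(\<lambda>x. scalar_prod t (to_vec l x)) \<in> borel_measurable (borel_of (Rspace l))"
proof -
  have "(\<lambda>x. \<Sum>i = 0..<l. t $ i * x (Suc i)) \<in> borel_measurable (borel_of (Rspace l))"
    by (intro borel_measurable_sum borel_measurable_times borel_measurable_const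
        continuous_map_borel_of continuous_map_product_projection) auto
  then show ?thesis by (simp add: scalar_prod_def to_vec_def)
qed

lemma limit_law_normal: "is_normal_law l (cov_mat B F l) limit_law"
  unfolding is_normal_law_def
proof (intro conjI ballI cov_matrix_cov)
  show "prob_space limit_law" unfolding limit_law_def
    by (intro prob_space.prob_space_distr prob_space_PiM prob_space_std_normal measurable_iota_gauss)
  show "sets limit_law = sets (borel_of (Rspace l))" by (simp add: limit_law_def)
  fix t :: "real vec" assume t: "t \<in> carrier_vec l"
  have "distr limit_law borel (\<lambda>x. scalar_prod t (to_vec l x)) = distr (gauss_on F) borel (\<lambda>u. scalar_prod t (to_vec l (iota u)))"
    unfolding limit_law_def by (subst distr_distr[OF measurable_functional measurable_iota_gauss]) (simp add: o_def)
  also have "\<dots> = centered_normal (scalar_prod t (cov_mat B F l *\<^sub>v t))"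
    unfolding functional_embed[OF t] cov_quad[OF t] by (rule gauss_functional) simp
  finally show "distr limit_law borel (\<lambda>x. scalar_prod t (to_vec l x)) = centered_normal (scalar_prod t (cov_mat B F l *\<^sub>v t))" .
qed

text \<open>Both the numerator and the normalizer converge by \<open>laplace_clt\<close>, and in the
  quotient of the limits the Gaussian constant cancels.\<close>

lemma clt: "weakly_converges (Rspace l) (scaled_law C l (\<lambda>n. sqrt (real n))) limit_law"
  unfolding weakly_converges_def
proof (intro allI impI)
  fix f assume f: "continuous_map (Rspace l) euclideanreal f \<and> bounded (f ` topspace (Rspace l))"
  have fm: "f \<in> borel_measurable (borel_of (Rspace l))" using f by (intro continuous_map_borel_of) blast
  define g where "g u = f (iota u)" for u
  have gm: "g \<in> borel_measurable (lborel_on F)"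
    unfolding g_def by (rule measurable_compose[OF measurable_embed[OF finite_free_indices] fm])
  have it: "iota u \<in> topspace (Rspace l)" for u by (auto simp: embed_def)
  obtain M where M: "\<And>x. x \<in> topspace (Rspace l) \<Longrightarrow> \<bar>f x\<bar> \<le> M" using f by (auto simp: bounded_iff)
  have gb: "\<bar>g u\<bar> \<le> M" for u unfolding g_def by (rule M[OF it])
  let ?r = "\<lambda>n u. R (\<lambda>k. u k / sqrt (real n)) ^ (n - l)"
  let ?e = "\<lambda>u. exp (- ((\<Sum>k\<in>F. (u k)\<^sup>2) / 2))"
  have c1: "(\<lambda>n. \<integral>u. g u * ?r n u \<partial>lborel_on F) \<longlonglongrightarrow> (\<integral>u. g u * ?e u \<partial>lborel_on F)"
    by (rule laplace_clt(1)[OF gm gb])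
  have c2: "(\<lambda>n. \<integral>u. 1 * ?r n u \<partial>lborel_on F) \<longlonglongrightarrow> (\<integral>u. 1 * ?e u \<partial>lborel_on F)"
    by (rule laplace_clt(1)[where M=1]) auto
  have i2: "\<forall>\<^sub>F n in sequentially. integrable (lborel_on F) (\<lambda>u. 1 * ?r n u)"
    by (rule laplace_clt(2)[where M=1]) auto
  define c where "c = (1 / sqrt (2 * pi)) ^ card F"
  have c0: "c > 0" by (simp add: c_def)
  have ie: "(\<integral>u. h u \<partial>gauss_on F) = c * (\<integral>u. h u * ?e u \<partial>lborel_on F)" if h: "h \<in> borel_measurable (lborel_on F)" for h :: "_ \<Rightarrow> real"
  proof -
    have "(\<integral>u. h u \<partial>gauss_on F) = (\<integral>u. (c * ?e u) *\<^sub>R h u \<partial>lborel_on F)"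
      unfolding gauss_on_density[OF finite_free_indices] c_def[symmetric]
      by (rule integral_density[OF h]) (use c0 in auto)
    also have "\<dots> = (\<integral>u. c * (h u * ?e u) \<partial>lborel_on F)" by (intro Bochner_Integration.integral_cong refl) simp
    finally show ?thesis by simp
  qed
  interpret G: prob_space "gauss_on F" by (intro prob_space_PiM prob_space_std_normal)
  have ce: "c * (\<integral>u. 1 * ?e u \<partial>lborel_on F) = 1"
    using ie[of "\<lambda>_. 1"] G.prob_space by simp
  then have ne: "(\<integral>u. 1 * ?e u \<partial>lborel_on F) \<noteq> 0" by (metis mult_zero_right zero_neq_one)
  have lim: "(\<lambda>n. (\<integral>u. g u * ?r n u \<partial>lborel_on F) / (\<integral>u. 1 * ?r n u \<partial>lborel_on F))
     \<longlonglongrightarrow> (\<integral>u. g u * ?e u \<partial>lborel_on F) / (\<integral>u. 1 * ?e u \<partial>lborel_on F)"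
    by (rule tendsto_divide[OF c1 c2 ne])
  have "(\<integral>x. f x \<partial>limit_law) = (\<integral>u. g u \<partial>gauss_on F)"
    unfolding limit_law_def g_def by (rule integral_distr[OF measurable_iota_gauss fm])
  also have "\<dots> = (\<integral>u. g u * ?e u \<partial>lborel_on F) / (\<integral>u. 1 * ?e u \<partial>lborel_on F)"
    unfolding ie[OF gm] using ce ne by (simp add: nonzero_eq_divide_eq mult_ac)
  finally have L: "(\<integral>x. f x \<partial>limit_law) = (\<integral>u. g u * ?e u \<partial>lborel_on F) / (\<integral>u. 1 * ?e u \<partial>lborel_on F)" .
  have "\<forall>\<^sub>F n in sequentially. (\<integral>u. g u * ?r n u \<partial>lborel_on F) / (\<integral>u. 1 * ?r n u \<partial>lborel_on F)
     = (\<integral>x. f x \<partial>scaled_law C l (\<lambda>n. sqrt (real n)) n)"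
    using i2 eventually_gt_at_top[of l]
  proof eventually_elim
    case (elim n)
    have s: "sqrt (real n) > 0" "n - l > 0" using elim by auto
    have r0: "0 \<le> ?r n u" for u using R0 by (rule zero_le_power)
    have rm: "(\<lambda>u. ?r n u) \<in> borel_measurable (lborel_on F)" by (intro borel_measurable_power measurable_R_scaled)
    define Z where "Z = (\<integral>u. ?r n u \<partial>lborel_on F)"
    have mZ: "mass (sqrt (real n)) (n - l) = ennreal Z"
      unfolding mass_def Z_def by (rule nn_integral_eq_integral) (use elim r0 in auto)
    have Z: "Z > 0" using mass_bounds[OF s] unfolding mZ by simp
    have w: "ennreal (?r n u) / mass (sqrt (real n)) (n - l) = ennreal (?r n u / Z)" for u
      unfolding mZ using r0 Z by (simp add: divide_ennreal)
    have "(\<integral>x. f x \<partial>scaled_law C l (\<lambda>n. sqrt (real n)) n)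
       = (\<integral>u. g u \<partial>density (lborel_on F) (\<lambda>u. ennreal (?r n u / Z)))"
      unfolding scaled_law_density[OF elim(2), of "\<lambda>n. sqrt (real n)", OF s(1)] w g_def
      by (rule integral_distr[OF _ fm]) (use measurable_embed[OF finite_free_indices] in simp)
    also have "\<dots> = (\<integral>u. (?r n u / Z) *\<^sub>R g u \<partial>lborel_on F)"
      by (rule integral_density[OF gm]) (use rm r0 Z in \<open>auto intro!: borel_measurable_divide\<close>)
    also have "\<dots> = (\<integral>u. g u * ?r n u / Z \<partial>lborel_on F)"
      by (intro Bochner_Integration.integral_cong refl) simp
    also have "\<dots> = (\<integral>u. g u * ?r n u \<partial>lborel_on F) / Z" by simp
    finally show ?case by (simp add: Z_def)
  qed
  with lim show "(\<lambda>n. \<integral>x. f x \<partial>scaled_law C l (\<lambda>n. sqrt (real n)) n) \<longlonglongrightarrow> (\<integral>x. f x \<partial>limit_law)"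
    unfolding L by (rule Lim_transform_eventually)
qed

lemma normal_law_integral_cos:
  assumes "is_normal_law l S Q" "t \<in> carrier_vec l"
  shows "(\<integral>x. cos (scalar_prod t (to_vec l x)) \<partial>Q) = exp (- scalar_prod t (S *\<^sub>v t) / 2)"
proof -
  have sQ: "sets Q = sets (borel_of (Rspace l))" using assms(1) by (simp add: is_normal_law_def)
  have m: "(\<lambda>x. scalar_prod t (to_vec l x)) \<in> borel_measurable Q"
    using measurable_functional measurable_cong_sets[OF sQ refl] by blast
  have "(\<integral>x. cos (scalar_prod t (to_vec l x)) \<partial>Q) = (\<integral>z. cos z \<partial>distr Q borel (\<lambda>x. scalar_prod t (to_vec l x)))"
    by (rule integral_distr[OF m, symmetric]) simp
  also have "\<dots> = (\<integral>z. cos z \<partial>centered_normal (scalar_prod t (S *\<^sub>v t)))"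
    using assms by (simp add: is_normal_law_def)
  also have "\<dots> = exp (- scalar_prod t (S *\<^sub>v t) / 2)"
    by (rule integral_cos_centered_normal) (use assms in \<open>simp add: is_normal_law_def cov_matrix_def\<close>)
  finally show ?thesis .
qed

lemma continuous_functional: "continuous_map (Rspace l) euclideanreal (\<lambda>x. cos (scalar_prod t (to_vec l x)))"
proof -
  have "continuous_map (Rspace l) euclideanreal (\<lambda>x. \<Sum>i = 0..<l. t $ i * x (Suc i))"
    by (intro continuous_map_sum continuous_map_real_mult continuous_map_canonical_const continuous_map_product_projection) auto
  then have "continuous_map (Rspace l) euclideanreal (\<lambda>x. scalar_prod t (to_vec l x))"
    by (simp add: scalar_prod_def to_vec_def)
  then have "continuous_map (Rspace l) euclideanreal (cos \<circ> (\<lambda>x. scalar_prod t (to_vec l x)))"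
    by (rule continuous_map_compose) (simp add: continuous_on_cos continuous_on_id)
  then show ?thesis by (simp add: o_def)
qed

end

text \<open>Evaluation at e_i + e_j: the case i = j gives the diagonal, and symmetry then isolates
  the remaining entries.\<close>

lemma sym_mat_eqI:
  fixes S T :: "real mat"
  assumes S: "S \<in> carrier_mat l l" "transpose_mat S = S" and T: "T \<in> carrier_mat l l" "transpose_mat T = T"
    and eq: "\<And>t. t \<in> carrier_vec l \<Longrightarrow> scalar_prod t (S *\<^sub>v t) = scalar_prod t (T *\<^sub>v t)"
  shows "S = T"
proof -
  have form: "scalar_prod (vec l (\<lambda>k. (if k = i then 1 else 0) + (if k = j then 1 else 0)))
      (M *\<^sub>v vec l (\<lambda>k. (if k = i then 1 else 0) + (if k = j then 1 else 0)))
      = M $$ (i, i) + M $$ (i, j) + M $$ (j, i) + M $$ (j, j)"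
    if M: "M \<in> carrier_mat l l" and ij: "i < l" "j < l" for M :: "real mat" and i j
  proof -
    let ?d = "\<lambda>i k. if k = i then 1 else (0::real)"
    have d: "(\<Sum>a = 0..<l. \<Sum>b = 0..<l. M $$ (a, b) * ?d p a * ?d q b) = M $$ (p, q)" if "p < l" "q < l" for p q
    proof -
      have "(\<Sum>a = 0..<l. \<Sum>b = 0..<l. M $$ (a, b) * ?d p a * ?d q b)
        = (\<Sum>a = 0..<l. \<Sum>b = 0..<l. if b = q then (if a = p then M $$ (p, q) else 0) else 0)"
        by (intro sum.cong refl) auto
      also have "\<dots> = M $$ (p, q)" using that by simp
      finally show ?thesis .
    qed
    have "scalar_prod (vec l (\<lambda>k. ?d i k + ?d j k)) (M *\<^sub>v vec l (\<lambda>k. ?d i k + ?d j k))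
       = (\<Sum>a = 0..<l. \<Sum>b = 0..<l. M $$ (a, b) * (?d i a + ?d j a) * (?d i b + ?d j b))"
      by (subst scalar_prod_mult_vec[OF M]) simp_all
    also have "\<dots> = (\<Sum>a = 0..<l. \<Sum>b = 0..<l. M $$ (a, b) * ?d i a * ?d i b + M $$ (a, b) * ?d i a * ?d j b
       + M $$ (a, b) * ?d j a * ?d i b + M $$ (a, b) * ?d j a * ?d j b)"
      by (intro sum.cong refl) (simp add: algebra_simps)
    also have "\<dots> = M $$ (i, i) + M $$ (i, j) + M $$ (j, i) + M $$ (j, j)"
      unfolding sum.distrib d[OF ij(1) ij(1)] d[OF ij(1) ij(2)] d[OF ij(2) ij(1)] d[OF ij(2) ij(2)] ..
    finally show ?thesis .
  qed
  have e: "S $$ (i, i) + S $$ (i, j) + S $$ (j, i) + S $$ (j, j) = T $$ (i, i) + T $$ (i, j) + T $$ (j, i) + T $$ (j, j)"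
    if "i < l" "j < l" for i j
    using eq[of "vec l (\<lambda>k. (if k = i then 1 else 0) + (if k = j then 1 else 0))"] form[OF S(1) that] form[OF T(1) that] by simp
  have symm: "M $$ (j, i) = M $$ (i, j)" if "M \<in> carrier_mat l l" "transpose_mat M = M" "i < l" "j < l" for M :: "real mat" and i j
    using index_transpose_mat(1)[of i M j] that by simp
  show ?thesis
  proof (rule eq_matI)
    fix i j assume "i < dim_row T" "j < dim_col T"
    then have ij: "i < l" "j < l" using T by auto
    have "S $$ (i, i) = T $$ (i, i)" "S $$ (j, j) = T $$ (j, j)" using e[OF ij(1) ij(1)] e[OF ij(2) ij(2)] by simp_all
    then show "S $$ (i, j) = T $$ (i, j)" using e[OF ij] symm[OF S ij] symm[OF T ij] by simp
  qed (use S T in auto)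
qed

context mdp_setup
begin

text \<open>Uniqueness: two weak limits agree on the bounded continuous functions cos(t . x), whose
  integrals determine t^T S t by \<open>normal_law_integral_cos\<close>; a symmetric matrix is
  determined by its quadratic form.\<close>

lemma limit_cov_eq: "limit_cov C l = cov_mat B F l"
  unfolding limit_cov_def
proof (rule the_equality)
  show "\<exists>Q. is_normal_law l (cov_mat B F l) Q \<and> weakly_converges (Rspace l) (scaled_law C l (\<lambda>n. sqrt (real n))) Q"
    using limit_law_normal clt by blast
  fix S assume "\<exists>Q. is_normal_law l S Q \<and> weakly_converges (Rspace l) (scaled_law C l (\<lambda>n. sqrt (real n))) Q"
  then obtain Q where Q: "is_normal_law l S Q" "weakly_converges (Rspace l) (scaled_law C l (\<lambda>n. sqrt (real n))) Q" by blast
  have "scalar_prod t (S *\<^sub>v t) = scalar_prod t (cov_mat B F l *\<^sub>v t)" if t: "t \<in> carrier_vec l" for t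
  proof -
    let ?f = "\<lambda>x. cos (scalar_prod t (to_vec l x))"
    have f: "continuous_map (Rspace l) euclideanreal ?f \<and> bounded (?f ` topspace (Rspace l))"
      using continuous_functional[of t] unfolding bounded_iff by (intro conjI exI[of _ 1]) auto
    have "(\<integral>x. ?f x \<partial>Q) = (\<integral>x. ?f x \<partial>limit_law)"
      using Q(2)[unfolded weakly_converges_def, rule_format, OF f] clt[unfolded weakly_converges_def, rule_format, OF f]
      by (rule LIMSEQ_unique)
    then show ?thesis
      unfolding normal_law_integral_cos[OF Q(1) t] normal_law_integral_cos[OF limit_law_normal t] by simp
  qed
  moreover have "cov_matrix l S" "cov_matrix l (cov_mat B F l)"
    using Q(1) limit_law_normal unfolding is_normal_law_def by blast+
  ultimately show "S = cov_mat B F l" unfolding cov_matrix_def by (elim conjE) (rule sym_mat_eqI)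
qed

end

section \<open>The large deviations principle\<close>

lemma ln_ext_le:
  assumes "b > 0" "0 \<le> p" "p \<le> exp (- (b * c))"
  shows "ereal (1 / b) * ln_ext p \<le> ereal (- c)"
proof (cases "p = 0")
  case True then show ?thesis using assms by (simp add: ln_ext_def)
next
  case False
  then have "ln p \<le> - (b * c)" using assms by (metis exp_gt_zero exp_le_cancel_iff exp_ln order_le_less)
  then have "1 / b * ln p \<le> - c" using assms by (simp add: field_simps)
  then show ?thesis using False by (simp add: ln_ext_def)
qed

lemma ln_ext_ge:
  assumes "b > 0" "exp (- (b * c)) \<le> p"
  shows "ereal (- c) \<le> ereal (1 / b) * ln_ext p"
proof -
  have p: "p > 0" using assms(2) exp_gt_zero[of "- (b * c)"] by linarith
  then have "- (b * c) \<le> ln p" using assms by (simp add: ln_ge_iff)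
  then have "- c \<le> 1 / b * ln p" using assms by (simp add: field_simps)
  then show ?thesis using p by (simp add: ln_ext_def)
qed

lemma exp_shift: "exp (- (b * (\<kappa> - \<eta> / 2))) * exp (b * (\<eta> / 2)) = exp (- (b * (\<kappa> - \<eta>)))" for b \<kappa> \<eta> :: real
  unfolding exp_add[symmetric] by (rule arg_cong[where f=exp]) (simp add: field_simps)

lemma exp_shift': "exp (- (b * (c + \<eta> / 2))) * exp (- (b * (\<eta> / 2))) = exp (- (b * (c + \<eta>)))" for b c \<eta> :: real
  unfolding exp_add[symmetric] by (rule arg_cong[where f=exp]) (simp add: field_simps)

lemma box_in_openin_powertop:
  assumes F: "finite F" and U: "openin (powertop_real F) U" "v \<in> U"
  obtains r where "r > 0" "{u \<in> extensional F. \<forall>k\<in>F. \<bar>u k - v k\<bar> < r} \<subseteq> U"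
proof -
  obtain W where W: "\<forall>k\<in>F. openin euclideanreal (W k)" "v \<in> PiE F W" "PiE F W \<subseteq> U"
    using U unfolding openin_product_topology_alt by blast
  have "\<exists>r>0. \<forall>x. \<bar>x - v k\<bar> < r \<longrightarrow> x \<in> W k" if "k \<in> F" for k
  proof -
    have "open (W k)" "v k \<in> W k" using W that by auto
    then obtain r where "r > 0" "ball (v k) r \<subseteq> W k" using open_contains_ball by blast
    then show ?thesis by (intro exI[of _ r]) (auto simp: ball_def dist_real_def abs_minus_commute subset_iff)
  qed
  then obtain \<rho> where \<rho>: "\<And>k. k \<in> F \<Longrightarrow> \<rho> k > 0 \<and> (\<forall>x. \<bar>x - v k\<bar> < \<rho> k \<longrightarrow> x \<in> W k)" by metis
  define r where "r = Min (insert 1 (\<rho> ` F))"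
  have r: "r \<le> \<rho> k" if "k \<in> F" for k unfolding r_def by (rule Min_le) (use F that in auto)
  have r0: "r > 0" unfolding r_def using F \<rho> by (subst Min_gr_iff) auto
  have "{u \<in> extensional F. \<forall>k\<in>F. \<bar>u k - v k\<bar> < r} \<subseteq> PiE F W"
  proof
    fix u assume u: "u \<in> {u \<in> extensional F. \<forall>k\<in>F. \<bar>u k - v k\<bar> < r}"
    have "u k \<in> W k" if "k \<in> F" for k
    proof -
      have "\<bar>u k - v k\<bar> < r" using u that by blast
      then have "\<bar>u k - v k\<bar> < \<rho> k" using r[OF that] by (rule less_le_trans)
      then show ?thesis using \<rho>[OF that] by blast
    qed
    then show "u \<in> PiE F W" using u by (auto simp: PiE_def)
  qed
  then have "{u \<in> extensional F. \<forall>k\<in>F. \<bar>u k - v k\<bar> < r} \<subseteq> U" using W(3) by (rule order_trans)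
  with r0 show ?thesis by (rule that)
qed

context mdp_setup
begin

section \<open>The rate function and its level sets\<close>

lemma dom_bounds: "i \<in> dom C \<Longrightarrow> i \<in> {1..l} \<and> i \<notin> F"
proof -
  assume i: "i \<in> dom C"
  have "i \<noteq> 0" using C i by (auto simp: is_constraint_def)
  moreover have "i \<le> top_index C" unfolding top_index_def
    by (rule Max_ge) (use C i in \<open>auto simp: is_constraint_def\<close>)
  ultimately show ?thesis using C(2) i by (auto simp: free_indices_def)
qed

lemma iota_topspace: "iota z \<in> topspace (Rspace l)" by (auto simp: embed_def)

text \<open>The pseudo-inverse acts on the image of \<open>iota\<close> as the Hessian, whose
  quadratic form is |z|^2 in the coordinates z.\<close>

lemma rate_iota: "mdp_rate C l (iota z) = ereal (q z / 2)"
proof -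
  have "iota z i = 0" if "i \<in> dom C" for i
    using dom_bounds[OF that] by (simp add: embed_def low_outside)
  moreover have "quad F A (iota z) = quad F A (tri B F (\<lambda>_. 0) z)"
  proof (rule quad_cong)
    fix i assume i: "i \<in> F"
    then have "i \<in> {1..l}" using F_sub by blast
    then show "iota z i = tri B F (\<lambda>_. 0) z i" unfolding tri_low[OF finite_free_indices i] by (simp add: embed_def)
  qed
  moreover have "moore_penrose (limit_cov C l) = pad_mat A F l"
    unfolding limit_cov_eq by (rule moore_penrose_cov[OF finite_free_indices F_sub A_sym B_ne quad_tri])
  ultimately show ?thesis unfolding mdp_rate_def by (simp add: pad_quad[OF F_sub] quad_tri)
qed

text \<open>A vector vanishing at the constrained indices lies in the image of \<open>iota\<close>,
  because a triangular system with nonzero diagonal is solvable. The solution is taken extensional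
  so that it is a point of the coordinate space.\<close>

lemma rate_cases:
  assumes "x \<in> topspace (Rspace l)"
  obtains (finite) z where "z \<in> extensional F" "x = iota z" "mdp_rate C l x = ereal (q z / 2)"
    | (infinite) "mdp_rate C l x = \<infinity>"
proof (cases "\<forall>i\<in>dom C. x i = 0")
  case True
  obtain z where z: "z \<in> extensional F" "\<forall>i\<in>F. tri B F (\<lambda>_. 0) z i = x i"
    using tri_surj[where B=B and x=x, OF finite_free_indices B_ne] by blast
  have "x j = iota z j" for j
  proof (cases "j \<in> {1..l}")
    case j: True
    show ?thesis
    proof (cases "j \<in> F")
      case True
      then show ?thesis using z(2) j tri_low[OF finite_free_indices True, of B z] by (simp add: embed_def)
    next
      case False
      then have "j \<in> dom C" using j by (auto simp: free_indices_def)
      then show ?thesis using True False j by (simp add: embed_def low_outside)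
    qed
  next
    case False
    then show ?thesis using assms by (auto simp: embed_def PiE_def extensional_def)
  qed
  then have "x = iota z" by (rule ext)
  then show ?thesis using finite z(1) rate_iota by blast
next
  case False
  then have "mdp_rate C l x = \<infinity>" unfolding mdp_rate_def by (rule if_not_P)
  then show ?thesis by (rule infinite)
qed

lemma rate_nonneg: "x \<in> topspace (Rspace l) \<Longrightarrow> 0 \<le> mdp_rate C l x"
  by (erule rate_cases) (auto intro: sum_nonneg)

lemma continuous_iota: "continuous_map (powertop_real F) (Rspace l) iota"
  unfolding continuous_map_componentwise
proof (intro conjI ballI)
  show "iota ` topspace (powertop_real F) \<subseteq> extensional {1..l}" using embed_extensional by blast
  fix j assume j: "j \<in> {1..l}"
  have "continuous_map (powertop_real F) euclideanreal (\<lambda>z. \<Sum>k\<in>F. low B F j k * z k)"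
    by (intro continuous_map_sum continuous_map_real_mult continuous_map_canonical_const continuous_map_product_projection) auto
  then show "continuous_map (powertop_real F) euclideanreal (\<lambda>z. iota z j)" using j by (simp add: embed_def)
qed

text \<open>By \<open>rate_iota\<close> the level set is the continuous image of a closed ball,
  which is compact inside a cube.\<close>

lemma compactin_level: "compactin (Rspace l) {x \<in> topspace (Rspace l). mdp_rate C l x \<le> ereal \<alpha>}"
proof -
  let ?T = "powertop_real F"
  let ?S = "{z \<in> topspace ?T. q z \<in> {..2 * \<alpha>}}" and ?K = "PiE F (\<lambda>_. {- sqrt (2 * \<alpha>)..sqrt (2 * \<alpha>)})"
  have "continuous_map ?T euclideanreal (\<lambda>z. \<Sum>k\<in>F. z k * z k)"
    by (intro continuous_map_sum continuous_map_real_mult continuous_map_product_projection) auto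
  then have "continuous_map ?T euclideanreal q" by (simp add: power2_eq_square)
  then have "closedin ?T ?S" by (rule closedin_continuous_map_preimage) simp
  moreover have "?S \<subseteq> ?K"
  proof
    fix z assume z: "z \<in> ?S"
    have "\<bar>z k\<bar> \<le> sqrt (2 * \<alpha>)" if "k \<in> F" for k
    proof -
      have "(z k)\<^sup>2 \<le> q z" using that by (intro member_le_sum) auto
      then have "(z k)\<^sup>2 \<le> 2 * \<alpha>" using z by simp
      then have "sqrt ((z k)\<^sup>2) \<le> sqrt (2 * \<alpha>)" by (rule real_sqrt_le_mono)
      then show ?thesis by simp
    qed
    then show "z \<in> ?K" using z by (auto simp: PiE_def abs_le_iff) (metis abs_le_iff minus_le_iff)
  qed
  moreover have "compactin ?T ?K" by (simp add: compactin_PiE)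
  ultimately have "compactin ?T ?S" using closed_compactin by blast
  then have "compactin (Rspace l) (iota ` ?S)" using continuous_iota by (rule image_compactin)
  also have "iota ` ?S = {x \<in> topspace (Rspace l). mdp_rate C l x \<le> ereal \<alpha>}"
  proof (intro equalityI subsetI)
    fix x assume "x \<in> iota ` ?S"
    then obtain z where "z \<in> ?S" "x = iota z" by blast
    then show "x \<in> {x \<in> topspace (Rspace l). mdp_rate C l x \<le> ereal \<alpha>}"
      using iota_topspace[of z] by (simp add: rate_iota del: topspace_product_topology)
  next
    fix x assume x: "x \<in> {x \<in> topspace (Rspace l). mdp_rate C l x \<le> ereal \<alpha>}"
    then have "x \<in> topspace (Rspace l)" by blast
    then show "x \<in> iota ` ?S"
    proof (cases rule: rate_cases)
      case (finite z)
      then have "z \<in> ?S" using x by (simp add: PiE_def)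
      then show ?thesis using finite(2) by blast
    next
      case infinite then show ?thesis using x by simp
    qed
  qed
  finally show ?thesis .
qed

lemma closedin_level: "closedin (Rspace l) {x \<in> topspace (Rspace l). mdp_rate C l x \<le> ereal \<alpha>}"
  by (rule compactin_imp_closedin[OF _ compactin_level]) (simp add: Hausdorff_space_product_topology)

text \<open>Clearing the denominator M avoids quotients of extended reals: a probability times M is
  an integral to which the two Laplace bounds apply.\<close>

lemma law_mass:
  assumes n: "l < n" and s: "a n > 0" and \<Gamma>: "\<Gamma> \<in> sets (borel_of (Rspace l))"
  obtains M where "M > 0" "mass (a n) (n - l) = ennreal M"
    "(\<integral>\<^sup>+u. ennreal (R (\<lambda>k. u k / a n) ^ (n - l)) * indicator {u \<in> space (lborel_on F). iota u \<in> \<Gamma>} u \<partial>lborel_on F)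
       = ennreal (measure (scaled_law C l a n) \<Gamma> * M)"
proof -
  interpret P: prob_space "scaled_law C l a n" by (rule prob_space_scaled_law[where s=a, OF n s])
  have mb: "0 < mass (a n) (n - l)" "mass (a n) (n - l) < \<infinity>" using mass_bounds[of "a n" "n - l"] n s by auto
  then obtain M where M: "mass (a n) (n - l) = ennreal M" "0 \<le> M" by (cases "mass (a n) (n - l)") auto
  have M0: "M > 0" using mb M by simp
  let ?r = "\<lambda>u. ennreal (R (\<lambda>k. u k / a n) ^ (n - l))"
  have im: "(\<lambda>u. indicator \<Gamma> (iota u) :: ennreal) \<in> borel_measurable (lborel_on F)"
    by (rule measurable_compose[OF measurable_embed[OF finite_free_indices] borel_measurable_indicator[OF \<Gamma>]])
  have rm: "?r \<in> borel_measurable (lborel_on F)"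
    by (intro measurable_compose[OF measurable_R_scaled]) auto
  have "emeasure (scaled_law C l a n) \<Gamma> = (\<integral>\<^sup>+u. ?r u * indicator \<Gamma> (iota u) / ennreal M \<partial>lborel_on F)"
    unfolding emeasure_scaled_law[where s=a, OF n s \<Gamma>] M(1)
    by (intro nn_integral_cong) (simp add: divide_ennreal_def mult_ac)
  also have "\<dots> = (\<integral>\<^sup>+u. ?r u * indicator \<Gamma> (iota u) \<partial>lborel_on F) / ennreal M"
    by (rule nn_integral_divide) (intro borel_measurable_times_ennreal rm im)
  also have "(\<integral>\<^sup>+u. ?r u * indicator \<Gamma> (iota u) \<partial>lborel_on F)
     = (\<integral>\<^sup>+u. ?r u * indicator {u \<in> space (lborel_on F). iota u \<in> \<Gamma>} u \<partial>lborel_on F)" (is "_ = ?N")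
    by (intro nn_integral_cong) (simp add: indicator_def)
  finally have e: "ennreal (measure (scaled_law C l a n) \<Gamma>) = ?N / ennreal M" by (simp add: P.emeasure_eq_measure)
  have "?N = ?N * ennreal M / ennreal M" by (rule mult_divide_eq_ennreal[symmetric]) (use M0 in auto)
  also have "\<dots> = ?N / ennreal M * ennreal M" by (simp add: divide_ennreal_def mult_ac)
  also have "\<dots> = ennreal (measure (scaled_law C l a n) \<Gamma> * M)" using M0 by (simp add: e[symmetric] ennreal_mult'')
  finally show ?thesis using that M0 M(1) by blast
qed

section \<open>Logarithmic asymptotics of probabilities\<close>

context
  fixes a :: "nat \<Rightarrow> real"
  assumes a: "filterlim a at_top sequentially"
    and b: "filterlim (\<lambda>n. real n / (a n)\<^sup>2) at_top sequentially"
begin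

lemma eventually_speed: "\<forall>\<^sub>F n in sequentially. l < n \<and> a n > 0 \<and> real n / (a n)\<^sup>2 > 0"
proof -
  have "\<forall>\<^sub>F n in sequentially. 1 \<le> a n" using a unfolding filterlim_at_top by blast
  then show ?thesis using eventually_gt_at_top[of l] by eventually_elim auto
qed

text \<open>Half of \<eta> is spent on the upper bound for the numerator, half on the lower bound
  for the total mass, taken from the box of radius 1 about v = 0.\<close>

lemma log_prob_le:
  assumes \<Gamma>: "\<Gamma> \<in> sets (borel_of (Rspace l))" and \<kappa>: "0 \<le> \<kappa>" "\<And>x. x \<in> \<Gamma> \<Longrightarrow> ereal \<kappa> \<le> mdp_rate C l x" and \<eta>: "\<eta> > 0"
  shows "\<forall>\<^sub>F n in sequentially. ereal (1 / (real n / (a n)\<^sup>2)) * ln_ext (measure (scaled_law C l a n) \<Gamma>) \<le> ereal (- (\<kappa> - \<eta>))"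
proof -
  let ?G = "{u \<in> space (lborel_on F). iota u \<in> \<Gamma>}"
  have G: "?G \<in> sets (lborel_on F)"
  proof -
    have "iota -` \<Gamma> \<inter> space (lborel_on F) \<in> sets (lborel_on F)"
      by (rule measurable_sets[OF measurable_embed[OF finite_free_indices] \<Gamma>])
    moreover have "iota -` \<Gamma> \<inter> space (lborel_on F) = ?G" by blast
    ultimately show ?thesis by simp
  qed
  have one: "(0::real) < 1" by simp
  have k: "\<kappa> \<le> q u / 2" if "u \<in> ?G" for u
    using \<kappa>(2)[of "iota u"] that unfolding rate_iota by simp
  have \<eta>2: "\<eta> / 2 > 0" using \<eta> by simp
  have up: "\<forall>\<^sub>F n in sequentially. (\<integral>\<^sup>+u. ennreal (R (\<lambda>k. u k / a n) ^ (n - l)) * indicator ?G u \<partial>lborel_on F)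
     \<le> ennreal (exp (- (real n / (a n)\<^sup>2 * (\<kappa> - \<eta> / 2))))"
    by (rule laplace_upper[OF a b G \<kappa>(1) _ \<eta>2]) (rule k)
  show ?thesis
    using up laplace_lower[where l=l and v="\<lambda>_. 0", OF a b one \<eta>2] eventually_speed
  proof eventually_elim
    case (elim n)
    let ?p = "measure (scaled_law C l a n) \<Gamma>" and ?b = "real n / (a n)\<^sup>2"
    obtain M where M: "M > 0" "mass (a n) (n - l) = ennreal M"
      "(\<integral>\<^sup>+u. ennreal (R (\<lambda>k. u k / a n) ^ (n - l)) * indicator ?G u \<partial>lborel_on F) = ennreal (?p * M)"
      using law_mass[OF _ _ \<Gamma>, of n a] elim(3) by blast
    have up: "?p * M \<le> exp (- (?b * (\<kappa> - \<eta> / 2)))" using elim(1) unfolding M(3) by simp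
    note elim(2)
    also have "(\<integral>\<^sup>+u. ennreal (R (\<lambda>k. u k / a n) ^ (n - l)) * indicator {u \<in> space (lborel_on F). \<forall>k\<in>F. \<bar>u k - 0\<bar> < 1} u \<partial>lborel_on F)
      \<le> ennreal M" unfolding M(2)[symmetric] mass_def by (intro nn_integral_mono) (simp add: indicator_def)
    finally have lo: "exp (- (?b * (\<eta> / 2))) \<le> M" using M(1) by simp
    have "?p * exp (- (?b * (\<eta> / 2))) \<le> exp (- (?b * (\<kappa> - \<eta> / 2)))"
      by (rule order_trans[OF mult_left_mono[OF lo measure_nonneg] up])
    then have "?p * exp (- (?b * (\<eta> / 2))) * exp (?b * (\<eta> / 2)) \<le> exp (- (?b * (\<kappa> - \<eta> / 2))) * exp (?b * (\<eta> / 2))"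
      by (rule mult_right_mono) simp
    moreover have "?p * exp (- (?b * (\<eta> / 2))) * exp (?b * (\<eta> / 2)) = ?p"
      unfolding mult.assoc exp_add[symmetric] by simp
    moreover have "exp (- (?b * (\<kappa> - \<eta> / 2))) * exp (?b * (\<eta> / 2)) = exp (- (?b * (\<kappa> - \<eta>)))"
      by (rule exp_shift)
    ultimately have "?p \<le> exp (- (?b * (\<kappa> - \<eta>)))" by linarith
    then show ?case using elim(3) by (intro ln_ext_le) auto
  qed
qed

text \<open>The preimage of the interior contains a box about v, to which
  \<open>laplace_lower\<close> applies; the total mass is bounded above by
  \<open>laplace_upper\<close> on the whole space with \<kappa> = 0.\<close>

lemma log_prob_ge:
  assumes \<Gamma>: "\<Gamma> \<in> sets (borel_of (Rspace l))" and v: "v \<in> extensional F" "iota v \<in> Rspace l interior_of \<Gamma>" and \<eta>: "\<eta> > 0"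
  shows "\<forall>\<^sub>F n in sequentially. ereal (- (q v / 2 + \<eta>)) \<le> ereal (1 / (real n / (a n)\<^sup>2)) * ln_ext (measure (scaled_law C l a n) \<Gamma>)"
proof -
  let ?U = "{u \<in> topspace (powertop_real F). iota u \<in> Rspace l interior_of \<Gamma>}"
  have "openin (powertop_real F) ?U"
    by (rule openin_continuous_map_preimage[OF continuous_iota openin_interior_of])
  moreover have "v \<in> ?U" using v by (simp add: PiE_def)
  ultimately obtain r where r: "r > 0" "{u \<in> extensional F. \<forall>k\<in>F. \<bar>u k - v k\<bar> < r} \<subseteq> ?U"
    by (rule box_in_openin_powertop[OF finite_free_indices])
  let ?G = "{u \<in> space (lborel_on F). iota u \<in> \<Gamma>}"
  have sp: "space (lborel_on F) = extensional F" by (simp add: space_PiM PiE_def)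
  have box: "{u \<in> space (lborel_on F). \<forall>k\<in>F. \<bar>u k - v k\<bar> < r} \<subseteq> ?G"
    using r(2) interior_of_subset[of "Rspace l" \<Gamma>] unfolding sp by blast
  have \<eta>2: "\<eta> / 2 > 0" using \<eta> by simp
  have up: "\<forall>\<^sub>F n in sequentially. (\<integral>\<^sup>+u. ennreal (R (\<lambda>k. u k / a n) ^ (n - l)) * indicator (space (lborel_on F)) u \<partial>lborel_on F)
     \<le> ennreal (exp (- (real n / (a n)\<^sup>2 * (0 - \<eta> / 2))))"
    by (rule laplace_upper[OF a b sets.top order_refl _ \<eta>2]) (simp add: sum_nonneg)
  show ?thesis
    using laplace_lower[where l=l and v=v, OF a b r(1) \<eta>2] up eventually_speed
  proof eventually_elim
    case (elim n)
    let ?p = "measure (scaled_law C l a n) \<Gamma>" and ?b = "real n / (a n)\<^sup>2"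
    obtain M where M: "M > 0" "mass (a n) (n - l) = ennreal M"
      "(\<integral>\<^sup>+u. ennreal (R (\<lambda>k. u k / a n) ^ (n - l)) * indicator ?G u \<partial>lborel_on F) = ennreal (?p * M)"
      using law_mass[OF _ _ \<Gamma>, of n a] elim(3) by blast
    note elim(1)
    also have "(\<integral>\<^sup>+u. ennreal (R (\<lambda>k. u k / a n) ^ (n - l)) * indicator {u \<in> space (lborel_on F). \<forall>k\<in>F. \<bar>u k - v k\<bar> < r} u \<partial>lborel_on F)
      \<le> ennreal (?p * M)" unfolding M(3)[symmetric]
      by (intro nn_integral_mono) (use box in \<open>auto simp: indicator_def\<close>)
    finally have lo: "exp (- (?b * (q v / 2 + \<eta> / 2))) \<le> ?p * M" using M(1) by (simp add: ennreal_le_iff)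
    have "(\<integral>\<^sup>+u. ennreal (R (\<lambda>k. u k / a n) ^ (n - l)) * indicator (space (lborel_on F)) u \<partial>lborel_on F) = ennreal M"
      unfolding M(2)[symmetric] mass_def by (intro nn_integral_cong) (simp add: indicator_def)
    then have up: "M \<le> exp (- (?b * (0 - \<eta> / 2)))" using elim(2) by simp
    have "exp (- (?b * (q v / 2 + \<eta> / 2))) \<le> ?p * exp (- (?b * (0 - \<eta> / 2)))"
      by (rule order_trans[OF lo mult_left_mono[OF up measure_nonneg]])
    then have "exp (- (?b * (q v / 2 + \<eta> / 2))) * exp (- (?b * (\<eta> / 2))) \<le> ?p * exp (- (?b * (0 - \<eta> / 2))) * exp (- (?b * (\<eta> / 2)))"
      by (rule mult_right_mono) simp
    moreover have "?p * exp (- (?b * (0 - \<eta> / 2))) * exp (- (?b * (\<eta> / 2))) = ?p"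
      unfolding mult.assoc exp_add[symmetric] by simp
    moreover have "exp (- (?b * (q v / 2 + \<eta> / 2))) * exp (- (?b * (\<eta> / 2))) = exp (- (?b * (q v / 2 + \<eta>)))"
      by (rule exp_shift')
    ultimately have "exp (- (?b * (q v / 2 + \<eta>))) \<le> ?p" by linarith
    then show ?case using elim(3) by (intro ln_ext_ge) auto
  qed
qed

lemma limsup_bound:
  assumes \<Gamma>: "\<Gamma> \<in> sets (borel_of (Rspace l))"
  shows "limsup (\<lambda>n. ereal (1 / (real n / (a n)\<^sup>2)) * ln_ext (measure (scaled_law C l a n) \<Gamma>))
     \<le> - (INF x\<in>Rspace l closure_of \<Gamma>. mdp_rate C l x)" (is "?L \<le> - ?J")
proof -
  have \<Gamma>X: "\<Gamma> \<subseteq> topspace (Rspace l)" using sets.sets_into_space[OF \<Gamma>] by (simp add: space_borel_of)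
  have low: "?J \<le> mdp_rate C l x" if "x \<in> \<Gamma>" for x
    by (rule INF_lower) (use closure_of_subset[OF \<Gamma>X] that in blast)
  have "?J \<le> - ?L"
  \<comment> \<open>Approximation from below by reals also covers an infinite infimum, for which
    \<open>log_prob_le\<close> cannot be applied directly.\<close>
  proof (rule dense_le)
    fix w assume "w < ?J"
    then obtain r where r: "w < ereal r" "ereal r < ?J" using ereal_dense2 by blast
    then obtain r' where r': "ereal r < ereal r'" "ereal r' < ?J" using ereal_dense2 by blast
    \<comment> \<open>\<open>log_prob_le\<close> requires \<kappa> >= 0, and raising r' to 0 is
      harmless because the rate is nonnegative. The gap \<kappa> - r then serves as \<eta>.\<close>
    define \<kappa> where "\<kappa> = max r' 0"
    have \<kappa>: "0 \<le> \<kappa>" "\<kappa> - r > 0" using r' by (auto simp: \<kappa>_def)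
    have "0 \<le> ?J"
      by (rule INF_greatest) (use closure_of_subset_topspace[of "Rspace l" \<Gamma>] rate_nonneg in blast)
    then have "ereal \<kappa> \<le> ?J" using r'(2) by (auto simp: \<kappa>_def max_def zero_ereal_def[symmetric])
    then have "ereal \<kappa> \<le> mdp_rate C l x" if "x \<in> \<Gamma>" for x using low[OF that] by (rule order_trans)
    from log_prob_le[OF \<Gamma> \<kappa>(1) this \<kappa>(2)] have "?L \<le> ereal (- (\<kappa> - (\<kappa> - r)))" by (rule Limsup_bounded)
    then have "?L \<le> - ereal r" by simp
    then have "ereal r \<le> - ?L" using ereal_minus_le_minus[of "- ereal r" ?L] by (simp only: ereal_uminus_uminus)
    then show "w \<le> - ?L" using r(1) by (rule order_trans[OF less_imp_le, rotated])
  qed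
  then show ?thesis using ereal_minus_le_minus[of "- ?L" ?J] by (simp only: ereal_uminus_uminus)
qed

text \<open>Points of infinite rate impose no condition; the others are of the form
  \<open>iota z\<close>, where \<open>log_prob_ge\<close> applies with arbitrarily small
  slack.\<close>

lemma liminf_bound:
  assumes \<Gamma>: "\<Gamma> \<in> sets (borel_of (Rspace l))"
  shows "- (INF x\<in>Rspace l interior_of \<Gamma>. mdp_rate C l x)
     \<le> liminf (\<lambda>n. ereal (1 / (real n / (a n)\<^sup>2)) * ln_ext (measure (scaled_law C l a n) \<Gamma>))" (is "- ?J \<le> ?L")
proof -
  have "- ?L \<le> ?J"
  proof (rule INF_greatest)
    fix x assume x: "x \<in> Rspace l interior_of \<Gamma>"
    then have "x \<in> topspace (Rspace l)" by (rule subsetD[OF interior_of_subset_topspace])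
    then show "- ?L \<le> mdp_rate C l x"
    proof (cases rule: rate_cases)
      case (finite z)
      show ?thesis
      proof (rule ereal_le_epsilon2)
        fix e :: real assume e: "0 < e"
        have "iota z \<in> Rspace l interior_of \<Gamma>" using x finite(2) by simp
        from log_prob_ge[OF \<Gamma> finite(1) this e] have "ereal (- (q z / 2 + e)) \<le> ?L" by (rule Liminf_bounded)
        then have "- ereal (q z / 2 + e) \<le> ?L" by simp
        then have "- ?L \<le> ereal (q z / 2 + e)" by (simp only: ereal_uminus_le_reorder)
        then show "- ?L \<le> mdp_rate C l x + ereal e" unfolding finite(3) by simp
      qed
    qed simp
  qed
  then show ?thesis by (simp only: ereal_uminus_le_reorder)
qed

lemma ldp: "satisfies_LDP (Rspace l) (scaled_law C l a) (\<lambda>n. real n / (a n)\<^sup>2) (mdp_rate C l)"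
  unfolding satisfies_LDP_def
proof (intro conjI allI ballI)
  show "sets (scaled_law C l a n) = sets (borel_of (Rspace l))" for n by (simp add: scaled_law_def)
  show "\<forall>\<^sub>F n in sequentially. prob_space (scaled_law C l a n)"
    using eventually_speed by eventually_elim (intro prob_space_scaled_law[where s=a], simp_all)
qed (rule b rate_nonneg closedin_level liminf_bound limsup_bound, assumption?)+

end

end

theorem theorem2p6:
  fixes C :: moment_constraint and l :: nat and a :: "nat \<Rightarrow> real"
  assumes "is_constraint C" and "admissible C {0..1}"
    and "top_index C \<le> l" and "1 \<le> l"
    and "filterlim a at_top sequentially"
    and "a \<in> o(\<lambda>n. sqrt (real n))"
  shows "satisfies_LDP (Rspace l) (scaled_law C l a) (\<lambda>n. real n / (a n)\<^sup>2) (mdp_rate C l)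
       \<and> good_rate_function (Rspace l) (mdp_rate C l)"
proof -
  obtain y A B \<delta> K D where nf: "szego_pos (trig (fill_in C l y)) l"
    "\<forall>j\<in>{1..l}. moment j (min_measure C) = fill_in C l y j" "\<forall>i j. A i j = A j i"
    "\<forall>k\<in>free_indices C l. 0 < B k k"
    "\<forall>z. quad (free_indices C l) A (tri B (free_indices C l) (\<lambda>_. 0) z) = (\<Sum>k\<in>free_indices C l. (z k)\<^sup>2)"
    "laplace_ratio (free_indices C l) (eps_ratio C l y B) \<delta> K D"
    using normal_form[OF assms(1-3)] by (elim exE conjE) (rule that)
  interpret L: laplace_ratio "free_indices C l" "eps_ratio C l y B" \<delta> K D by (rule nf(6))
  interpret mdp_setup C l y B \<delta> K D A
    by unfold_locales (rule assms(1) assms(3) nf(1) nf(2)[rule_format] nf(3)[rule_format] nf(4)[rule_format] nf(5)[rule_format], assumption?)+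
  show ?thesis
    unfolding good_rate_function_def
    by (intro conjI allI impI ldp[OF assms(5) speed_at_top[OF assms(5,6)]] compactin_level)
qed

end
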